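(* Let $\alpha\in(0,2)$, let $\omega$ be an open and nonempty subset of $(0,1)$, let $T>0$ and let $E\subset(0,T)$ be a measurable set of positive measure. For every $y^0\in L^2(0,1)$ there exists $f\in L^2(\omega\times E)$ such that the solution $y=y(x,t)$ of $$\begin{cases}\partial_ty-\partial_x(x^\alpha\partial_xy)=1_{\omega\times E}f&\text{in }(0,1)\times(0,T),\\ \mathrm{BC}_\alpha(y)=0&\text{on }(0,T),\\ y|_{x=1}=0&\text{on }(0,T),\\ y|_{t=0}=y^0&\text{in }(0,1),\end{cases}$$ satisfies $y(\cdot,T)=0$.
   Context: $1_{\omega\times E}$ is the characteristic function of $\omega\times E$ ($1_{\omega\times E}f$ is $f$ extended by $0$). $\mathrm{BC}_\alpha(\vartheta)=\vartheta|_{x=0}$ if $\alpha\in(0,1)$ and $\mathrm{BC}_\alpha(\vartheta)=(x^\alpha\vartheta')|_{x=0}$ if $\alpha\in[1,2)$. Let $H^1_\alpha(0,1)$ be the set of $\vartheta\in L^2(0,1)$ that are (locally) absolutely continuous in $(0,1)$ with $\int_0^1x^\alpha|\vartheta'|^2dx<\infty$ and $\vartheta(1)=0$. The operator $\mathcal{P}\vartheta=-(x^\alpha\vartheta')'$ with domain $D(\mathcal{P})=\{\vartheta\in H^1_\alpha(0,1):\ \mathcal{P}\vartheta\in L^2(0,1),\ \mathrm{BC}_\alpha(\vartheta)=0\}$ is self-adjoint, positive, with compact resolvent on $L^2(0,1)$. The solution of the system is understood as the solution in $C([0,T];L^2(0,1))$ of $y'+\mathcal{P}y=1_{\omega\times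 E}f$, $y(0)=y^0$, given by the semigroup $e^{-t\mathcal{P}}$ and Duhamel's formula. *)

theory Defs
  imports "HOL-Analysis.Analysis"
begin

section \<open>The Hilbert space \<open>L\<^sup>2(0,1)\<close>\<close>

abbreviation unit_leb :: "real measure" where
  "unit_leb \<equiv> lebesgue_on {0<..<1}"

definition L2_fun :: "(real \<Rightarrow> real) \<Rightarrow> bool" where
  "L2_fun f \<longleftrightarrow> f \<in> borel_measurable unit_leb \<and> integrable unit_leb (\<lambda>x. (f x)\<^sup>2)"

definition L2_rel :: "(real \<Rightarrow> real) \<Rightarrow> (real \<Rightarrow> real) \<Rightarrow> bool" where
  "L2_rel f g \<longleftrightarrow> L2_fun f \<and> L2_fun g \<and> (AE x in unit_leb. f x = g x)"

lemma L2_fun_measurable: "L2_fun f \<Longrightarrow> f \<in> borel_measurable unit_leb"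
  and L2_fun_integrable_sq: "L2_fun f \<Longrightarrow> integrable unit_leb (\<lambda>x. (f x)\<^sup>2)"
  by (auto simp: L2_fun_def)

lemma finite_measure_unit_leb: "finite_measure unit_leb"
  by (rule finite_measureI) (simp add: emeasure_restrict_space)

lemma measure_unit_leb: "measure unit_leb {0<..<1} = 1"
  by (simp add: measure_restrict_space)

lemma L2_fun_integrable_mult:
  assumes "L2_fun f" "L2_fun g"
  shows "integrable unit_leb (\<lambda>x. f x * g x)"
proof (rule Bochner_Integration.integrable_bound)
  show "integrable unit_leb (\<lambda>x. (f x)\<^sup>2 + (g x)\<^sup>2)"
    using assms by (simp add: L2_fun_def)
  show "(\<lambda>x. f x * g x) \<in> borel_measurable unit_leb"
    using assms by (intro borel_measurable_times) (auto simp: L2_fun_def)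
  have "\<bar>a * b\<bar> \<le> a\<^sup>2 + b\<^sup>2" for a b :: real
  proof -
    have "2 * (\<bar>a\<bar> * \<bar>b\<bar>) \<le> a\<^sup>2 + b\<^sup>2"
      using sum_squares_bound[of "\<bar>a\<bar>" "\<bar>b\<bar>"] by simp
    moreover have "0 \<le> \<bar>a\<bar> * \<bar>b\<bar>" by simp
    ultimately show ?thesis unfolding abs_mult by linarith
  qed
  then show "AE x in unit_leb. norm (f x * g x) \<le> norm ((f x)\<^sup>2 + (g x)\<^sup>2)"
    by simp
qed

lemma L2_fun_zero: "L2_fun (\<lambda>x. 0)"
  by (simp add: L2_fun_def)

lemma L2_fun_scale: "L2_fun f \<Longrightarrow> L2_fun (\<lambda>x. c * f x)"
  by (auto simp: L2_fun_def power_mult_distrib intro!: borel_measurable_times)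

lemma L2_fun_uminus: "L2_fun f \<Longrightarrow> L2_fun (\<lambda>x. - f x)"
  by (simp add: L2_fun_def)

lemma L2_fun_add:
  assumes "L2_fun f" "L2_fun g"
  shows "L2_fun (\<lambda>x. f x + g x)"
  using assms L2_fun_integrable_mult[OF assms]
  by (auto simp: L2_fun_def power2_sum mult.assoc intro!: borel_measurable_add)

lemma L2_fun_diff:
  assumes "L2_fun f" "L2_fun g"
  shows "L2_fun (\<lambda>x. f x - g x)"
  using L2_fun_add[OF assms(1) L2_fun_uminus[OF assms(2)]] by simp

lemma L2_fun_indicator: "A \<in> sets lebesgue \<Longrightarrow> L2_fun (indicat_real A)"
proof -
  assume A: "A \<in> sets lebesgue"
  interpret finite_measure unit_leb by (rule finite_measure_unit_leb)
  have m: "indicat_real A \<in> borel_measurable unit_leb"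
    using A by (intro measurable_restrict_space1) auto
  have "(\<lambda>x. (indicat_real A x)\<^sup>2) = indicat_real A"
    by (auto simp: indicator_def)
  moreover have "integrable unit_leb (indicat_real A)"
    by (rule integrable_const_bound[where B = 1, OF _ m]) (simp add: indicator_def)
  ultimately have "integrable unit_leb (\<lambda>x. (indicat_real A x)\<^sup>2)" by simp
  with m show ?thesis by (simp add: L2_fun_def)
qed

lemma L2_rel_part_equivp: "part_equivp L2_rel"
proof (rule part_equivpI)
  show "\<exists>x. L2_rel x x"
    by (rule exI[of _ "\<lambda>_. 0"]) (simp add: L2_rel_def L2_fun_zero)
  show "symp L2_rel"
    by (rule sympI) (auto simp: L2_rel_def eq_commute)
  show "transp L2_rel"
  proof (rule transpI)
    fix f g h assume a: "L2_rel f g" "L2_rel g h"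
    then have "AE x in unit_leb. f x = g x" "AE x in unit_leb. g x = h x"
      by (auto simp: L2_rel_def)
    then have "AE x in unit_leb. f x = h x" by eventually_elim simp
    with a show "L2_rel f h" by (simp add: L2_rel_def)
  qed
qed

quotient_type L2 = "real \<Rightarrow> real" / partial: L2_rel
  by (rule L2_rel_part_equivp)

text \<open>The class of a function; functions outside \<open>L\<^sup>2\<close> are sent to \<open>0\<close>.\<close>

definition L2_class :: "(real \<Rightarrow> real) \<Rightarrow> L2" where
  "L2_class f = abs_L2 (if L2_fun f then f else (\<lambda>_. 0))"

lemma L2_rel_refl: "L2_fun f \<Longrightarrow> L2_rel f f"
  by (simp add: L2_rel_def)

lemma L2_class_cases: obtains f where "L2_fun f" "u = L2_class f"
proof -
  have "L2_rel (rep_L2 u) (rep_L2 u)"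
    using Quotient3_rep_reflp[OF Quotient3_L2] .
  then have "L2_fun (rep_L2 u)" by (simp add: L2_rel_def)
  moreover have "u = L2_class (rep_L2 u)"
    using calculation Quotient3_abs_rep[OF Quotient3_L2] by (simp add: L2_class_def)
  ultimately show thesis by (rule that)
qed

lemma L2_class_eq_iff:
  assumes "L2_fun f" "L2_fun g"
  shows "L2_class f = L2_class g \<longleftrightarrow> (AE x in unit_leb. f x = g x)"
  using Quotient3_rel[OF Quotient3_L2, of f g] assms
  by (auto simp: L2_class_def L2_rel_def)

instantiation L2 :: real_inner
begin

lift_definition zero_L2 :: L2 is "\<lambda>_. 0"
  by (simp add: L2_rel_def L2_fun_zero)

lift_definition plus_L2 :: "L2 \<Rightarrow> L2 \<Rightarrow> L2" is "\<lambda>f g x. f x + g x"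
  by (auto simp: L2_rel_def L2_fun_add)

lift_definition uminus_L2 :: "L2 \<Rightarrow> L2" is "\<lambda>f x. - f x"
  by (auto simp: L2_rel_def L2_fun_uminus)

lift_definition minus_L2 :: "L2 \<Rightarrow> L2 \<Rightarrow> L2" is "\<lambda>f g x. f x - g x"
  by (auto simp: L2_rel_def L2_fun_diff)

lift_definition scaleR_L2 :: "real \<Rightarrow> L2 \<Rightarrow> L2" is "\<lambda>c f x. c * f x"
  by (auto simp: L2_rel_def L2_fun_scale)

lift_definition inner_L2 :: "L2 \<Rightarrow> L2 \<Rightarrow> real" is "\<lambda>f g. \<integral>x. f x * g x \<partial>unit_leb"
proof -
  fix f f' g g' :: "real \<Rightarrow> real"
  assume a: "L2_rel f f'" "L2_rel g g'"
  show "(\<integral>x. f x * g x \<partial>unit_leb) = (\<integral>x. f' x * g' x \<partial>unit_leb)"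
  proof (rule integral_cong_AE)
    show "(\<lambda>x. f x * g x) \<in> borel_measurable unit_leb"
      "(\<lambda>x. f' x * g' x) \<in> borel_measurable unit_leb"
      using a by (auto simp: L2_rel_def L2_fun_def)
    show "AE x in unit_leb. f x * g x = f' x * g' x"
      using a by (auto simp: L2_rel_def)
  qed
qed

definition norm_L2 :: "L2 \<Rightarrow> real" where "norm_L2 u = sqrt (inner u u)"
definition dist_L2 :: "L2 \<Rightarrow> L2 \<Rightarrow> real" where "dist_L2 u v = norm (u - v)"
definition sgn_L2 :: "L2 \<Rightarrow> L2" where "sgn_L2 u = inverse (norm u) *\<^sub>R u"
definition uniformity_L2 :: "(L2 \<times> L2) filter" where
  "uniformity_L2 = (INF e\<in>{0 <..}. principal {(x, y). dist x y < e})"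
definition open_L2 :: "L2 set \<Rightarrow> bool" where
  "open_L2 U \<longleftrightarrow> (\<forall>x\<in>U. eventually (\<lambda>(x', y). x' = x \<longrightarrow> y \<in> U) uniformity)"

instance
proof
  fix u v w :: L2 and r s :: real and U :: "L2 set"
  show "u + v + w = u + (v + w)"
    by transfer (auto simp: L2_rel_def L2_fun_add algebra_simps)
  show "u + v = v + u"
    by transfer (auto simp: L2_rel_def L2_fun_add algebra_simps)
  show "0 + u = u"
    by transfer (auto simp: L2_rel_def)
  show "- u + u = 0"
    by transfer (auto simp: L2_rel_def L2_fun_zero)
  show "u - v = u + - v"
    by transfer (auto simp: L2_rel_def L2_fun_diff)
  show "r *\<^sub>R (u + v) = r *\<^sub>R u + r *\<^sub>R v"
  proof transfer
    fix r and f g assume "L2_rel f f" "L2_rel g g"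
    then show "L2_rel (\<lambda>x. r * (f x + g x)) (\<lambda>x. r * f x + r * g x)"
      using L2_fun_scale[OF L2_fun_add, of f g r]
      by (auto simp: L2_rel_def algebra_simps)
  qed
  show "(r + s) *\<^sub>R u = r *\<^sub>R u + s *\<^sub>R u"
  proof transfer
    fix r s :: real and f assume "L2_rel f f"
    then show "L2_rel (\<lambda>x. (r + s) * f x) (\<lambda>x. r * f x + s * f x)"
      using L2_fun_scale[of f "r + s"]
      by (auto simp: L2_rel_def algebra_simps)
  qed
  show "r *\<^sub>R s *\<^sub>R u = (r * s) *\<^sub>R u"
  proof transfer
    fix r s :: real and f assume "L2_rel f f"
    then show "L2_rel (\<lambda>x. r * (s * f x)) (\<lambda>x. r * s * f x)"
      using L2_fun_scale[of f "r * s"]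
      by (auto simp: L2_rel_def algebra_simps)
  qed
  show "1 *\<^sub>R u = u"
    by transfer (auto simp: L2_rel_def)
  show "inner u v = inner v u"
    by transfer (simp add: mult.commute)
  show "inner (u + v) w = inner u w + inner v w"
    by transfer (simp add: L2_rel_def distrib_right L2_fun_integrable_mult)
  show "inner (r *\<^sub>R u) v = r * inner u v"
    by transfer (simp add: mult.assoc)
  show "0 \<le> inner u u"
    by transfer simp
  show "inner u u = 0 \<longleftrightarrow> u = 0"
  proof transfer
    fix f assume "L2_rel f f"
    then have f: "L2_fun f" by (simp add: L2_rel_def)
    have "(\<integral>x. f x * f x \<partial>unit_leb) = 0 \<longleftrightarrow> (AE x in unit_leb. f x * f x = 0)"
      using L2_fun_integrable_mult[OF f f] by (intro integral_nonneg_eq_0_iff_AE) auto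
    then show "(\<integral>x. f x * f x \<partial>unit_leb) = 0 \<longleftrightarrow> L2_rel f (\<lambda>_. 0)"
      using f by (simp add: L2_rel_def L2_fun_zero)
  qed
qed (simp_all only: norm_L2_def dist_L2_def sgn_L2_def uniformity_L2_def open_L2_def)

end

lemma L2_class_zero: "L2_class (\<lambda>_. 0) = 0"
  by (simp add: L2_class_def zero_L2_def)

lemma L2_class_arith:
  assumes f: "L2_fun f" and g: "L2_fun g"
  shows L2_class_add: "L2_class f + L2_class g = L2_class (\<lambda>x. f x + g x)"
    and L2_class_diff: "L2_class f - L2_class g = L2_class (\<lambda>x. f x - g x)"
    and L2_class_scaleR: "c *\<^sub>R L2_class f = L2_class (\<lambda>x. c * f x)"
    and L2_class_inner: "inner (L2_class f) (L2_class g) = (\<integral>x. f x * g x \<partial>unit_leb)"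
  using L2_rel_refl[OF f] L2_rel_refl[OF g] L2_fun_add[OF f g] L2_fun_diff[OF f g]
    L2_fun_scale[OF f, of c] f g
  by (simp_all add: L2_class_def plus_L2.abs_eq minus_L2.abs_eq scaleR_L2.abs_eq
      inner_L2.abs_eq)

lemma L2_class_norm: "L2_fun f \<Longrightarrow> norm (L2_class f) = sqrt (\<integral>x. (f x)\<^sup>2 \<partial>unit_leb)"
  by (simp add: norm_L2_def L2_class_inner power2_eq_square)

lemma L2_fun_integrable:
  assumes f: "L2_fun f" shows "integrable unit_leb f"
proof -
  have "L2_fun (\<lambda>_. 1)"
    using L2_fun_indicator[of UNIV] by (simp add: L2_fun_def)
  from L2_fun_integrable_mult[OF f this] show ?thesis by simp
qed

lemma L2_fun_integral_abs_le:
  assumes f: "L2_fun f"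
  shows "(\<integral>x. \<bar>f x\<bar> \<partial>unit_leb) \<le> norm (L2_class f)"
proof -
  have one: "L2_fun (\<lambda>_. 1)"
    using L2_fun_indicator[of UNIV] by (simp add: L2_fun_def)
  have a: "L2_fun (\<lambda>x. \<bar>f x\<bar>)"
    using f by (auto simp: L2_fun_def intro!: borel_measurable_abs)
  have "(\<integral>x. \<bar>f x\<bar> \<partial>unit_leb) = inner (L2_class (\<lambda>x. \<bar>f x\<bar>)) (L2_class (\<lambda>_. 1))"
    by (simp add: L2_class_inner[OF a one])
  also have "\<dots> \<le> norm (L2_class (\<lambda>x. \<bar>f x\<bar>)) * norm (L2_class (\<lambda>_. 1))"
    by (rule norm_cauchy_schwarz)
  also have "\<dots> = norm (L2_class f)"
    using measure_unit_leb by (simp add: L2_class_norm a one f)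
  finally show ?thesis .
qed

lemma L2_Cauchy_convergent_subseq:
  fixes X :: "nat \<Rightarrow> L2"
  assumes X: "\<And>n. norm (X (Suc n) - X n) \<le> (1/2)^n"
  shows "convergent X"
proof -
  have "\<exists>f. L2_fun f \<and> X n = L2_class f" for n
    by (rule L2_class_cases[of "X n"]) blast
  then obtain f where f: "\<And>n. L2_fun (f n)" and Xf: "\<And>n. X n = L2_class (f n)"
    by metis
  have fm[measurable]: "\<And>n. f n \<in> borel_measurable unit_leb"
    using f by (simp add: L2_fun_def)
  define d where "d n x = \<bar>f (Suc n) x - f n x\<bar>" for n x
  have dm[measurable]: "\<And>n. d n \<in> borel_measurable unit_leb"
    unfolding d_def by measurable
  have di: "integrable unit_leb (d n)" for n
    unfolding d_def by (intro integrable_abs L2_fun_integrable L2_fun_diff f)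
  have d_eq: "d n = (\<lambda>x. \<bar>f (Suc n) x - f n x\<bar>)" for n
    by (simp add: fun_eq_iff d_def)
  have "(\<integral>x. d n x \<partial>unit_leb) \<le> (1/2)^n" for n
    using L2_fun_integral_abs_le[OF L2_fun_diff[OF f f], of "Suc n" n] X[of n]
    unfolding d_eq by (simp add: Xf L2_class_diff f)
  then have dn: "(\<integral>\<^sup>+x. ennreal (d n x) \<partial>unit_leb) \<le> ennreal ((1/2)^n)" for n
  proof -
    have "(\<integral>\<^sup>+x. ennreal (d n x) \<partial>unit_leb) = ennreal (\<integral>x. d n x \<partial>unit_leb)"
      by (rule nn_integral_eq_integral[OF di]) (simp add: d_def)
    also have "\<dots> \<le> ennreal ((1/2)^n)" by (rule ennreal_leI) fact
    finally show ?thesis .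
  qed
  have "(\<integral>\<^sup>+x. (\<Sum>n. ennreal (d n x)) \<partial>unit_leb) = (\<Sum>n. \<integral>\<^sup>+x. ennreal (d n x) \<partial>unit_leb)"
    by (rule nn_integral_suminf) measurable
  also have "\<dots> \<le> (\<Sum>n. ennreal ((1/2)^n))"
    by (intro suminf_le dn) auto
  also have "\<dots> = ennreal (\<Sum>n. (1/2)^n)"
    by (intro suminf_ennreal2) (auto intro: summable_geometric)
  also have "\<dots> < \<infinity>" by simp
  finally have "AE x in unit_leb. (\<Sum>n. ennreal (d n x)) \<noteq> \<infinity>"
    by (intro nn_integral_PInf_AE) auto
  then have conv: "AE x in unit_leb. convergent (\<lambda>n. f n x)"
  proof eventually_elim
    case (elim x)
    then have "summable (\<lambda>n. d n x)"
      by (intro summable_suminf_not_top) (auto simp: d_def)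
    then have "summable (\<lambda>n. f (Suc n) x - f n x)"
      unfolding d_def by (rule summable_rabs_cancel)
    then have "convergent (\<lambda>n. \<Sum>i<n. f (Suc i) x - f i x)"
      by (simp only: summable_iff_convergent)
    then have "convergent (\<lambda>n. f n x - f 0 x)"
      by (simp only: sum_lessThan_telescope[of "\<lambda>n. f n x"])
    from convergent_add[OF this convergent_const[of "f 0 x"]] show ?case
      by (simp only: diff_add_cancel)
  qed
  define g where "g x = lim (\<lambda>n. f n x)" for x
  have gm[measurable]: "g \<in> borel_measurable unit_leb"
    unfolding g_def by measurable
  have cauchy: "norm (X n - X m) \<le> 2 * (1/2)^m" if "m \<le> n" for m n
  proof -
    have "norm (X n - X m) \<le> 2 * (1/2)^m - 2 * (1/2)^n"
      using that
    proof (induction n rule: dec_induct)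
      case base then show ?case by simp
    next
      case (step n)
      have "norm (X (Suc n) - X m) \<le> norm (X (Suc n) - X n) + norm (X n - X m)"
        using norm_triangle_ineq[of "X (Suc n) - X n" "X n - X m"] by simp
      with step.IH X[of n] show ?case by simp
    qed
    then show ?thesis
      by (rule order_trans) simp
  qed
  have key: "(\<integral>\<^sup>+x. ennreal ((g x - f m x)\<^sup>2) \<partial>unit_leb) \<le> ennreal ((2 * (1/2)^m)\<^sup>2)" for m
  proof -
    have "AE x in unit_leb. ennreal ((g x - f m x)\<^sup>2) = liminf (\<lambda>n. ennreal ((f n x - f m x)\<^sup>2))"
      using conv
    proof eventually_elim
      case (elim x)
      then have "(\<lambda>n. f n x) \<longlonglongrightarrow> g x"
        unfolding g_def by (simp add: convergent_LIMSEQ_iff)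
      then have "(\<lambda>n. ennreal ((f n x - f m x)\<^sup>2)) \<longlonglongrightarrow> ennreal ((g x - f m x)\<^sup>2)"
        by (intro tendsto_ennrealI tendsto_intros)
      from lim_imp_Liminf[OF _ this] show ?case by simp
    qed
    then have "(\<integral>\<^sup>+x. ennreal ((g x - f m x)\<^sup>2) \<partial>unit_leb) =
        (\<integral>\<^sup>+x. liminf (\<lambda>n. ennreal ((f n x - f m x)\<^sup>2)) \<partial>unit_leb)"
      by (rule nn_integral_cong_AE)
    also have "\<dots> \<le> liminf (\<lambda>n. \<integral>\<^sup>+x. ennreal ((f n x - f m x)\<^sup>2) \<partial>unit_leb)"
      by (rule nn_integral_liminf) measurable
    also have "\<dots> \<le> liminf (\<lambda>n::nat. ennreal ((2 * (1/2)^m)\<^sup>2))"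
    proof (rule Liminf_mono, rule eventually_sequentiallyI)
      fix n assume "m \<le> n"
      have l: "L2_fun (\<lambda>x. f n x - f m x)" by (intro L2_fun_diff f)
      have "(\<integral>\<^sup>+x. ennreal ((f n x - f m x)\<^sup>2) \<partial>unit_leb) =
          ennreal (\<integral>x. (f n x - f m x)\<^sup>2 \<partial>unit_leb)"
        by (rule nn_integral_eq_integral) (use l in \<open>auto simp: L2_fun_def\<close>)
      also have "(\<integral>x. (f n x - f m x)\<^sup>2 \<partial>unit_leb) = (norm (X n - X m))\<^sup>2"
        by (simp add: Xf L2_class_diff f L2_class_norm l)
      also have "ennreal \<dots> \<le> ennreal ((2 * (1/2)^m)\<^sup>2)"
        by (intro ennreal_leI power_mono cauchy \<open>m \<le> n\<close>) simp
      finally show "(\<integral>\<^sup>+x. ennreal ((f n x - f m x)\<^sup>2) \<partial>unit_leb) \<le> ennreal ((2 * (1/2)^m)\<^sup>2)" .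
    qed
    also have "\<dots> = ennreal ((2 * (1/2)^m)\<^sup>2)" by (rule Liminf_const) simp
    finally show ?thesis .
  qed
  have gf: "L2_fun (\<lambda>x. g x - f m x)" for m
    unfolding L2_fun_def
  proof
    show "(\<lambda>x. g x - f m x) \<in> borel_measurable unit_leb" by measurable
    show "integrable unit_leb (\<lambda>x. (g x - f m x)\<^sup>2)"
    proof (rule integrableI_bounded)
      show "(\<lambda>x. (g x - f m x)\<^sup>2) \<in> borel_measurable unit_leb" by measurable
      have "(\<integral>\<^sup>+x. ennreal ((g x - f m x)\<^sup>2) \<partial>unit_leb) < \<infinity>"
        using key[of m] by (rule le_less_trans) (simp only: ennreal_less_top infinity_ennreal_def)
      then show "(\<integral>\<^sup>+x. ennreal (norm ((g x - f m x)\<^sup>2)) \<partial>unit_leb) < \<infinity>"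
        by (simp only: real_norm_def abs_power2)
    qed
  qed
  have g: "L2_fun g"
    using L2_fun_add[OF gf f, of 0 0] by simp
  have "norm (X m - L2_class g) \<le> 2 * (1/2)^m" for m
  proof -
    have "ennreal (\<integral>x. (g x - f m x)\<^sup>2 \<partial>unit_leb) \<le> ennreal ((2 * (1/2)^m)\<^sup>2)"
      using key[of m] gf[of m] by (subst (asm) nn_integral_eq_integral) (auto simp: L2_fun_def)
    then have "(\<integral>x. (g x - f m x)\<^sup>2 \<partial>unit_leb) \<le> (2 * (1/2)^m)\<^sup>2"
      by (simp add: ennreal_le_iff)
    then have "norm (L2_class g - X m) \<le> 2 * (1/2)^m"
      by (simp add: Xf L2_class_diff f g L2_class_norm gf real_le_lsqrt)
    then show ?thesis by (simp add: norm_minus_commute)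
  qed
  moreover have "(\<lambda>m. 2 * (1/2::real)^m) \<longlonglongrightarrow> 0"
    by (intro tendsto_mult_right_zero LIMSEQ_power_zero) simp
  ultimately have "(\<lambda>m. X m - L2_class g) \<longlonglongrightarrow> 0"
    by (rule Lim_null_comparison[OF always_eventually[OF allI]])
  then show ?thesis
    by (rule convergentI[OF LIM_zero_cancel])
qed

instance L2 :: complete_space
proof
  fix X :: "nat \<Rightarrow> L2" assume C: "Cauchy X"
  have "\<exists>N. \<forall>m\<ge>N. \<forall>n\<ge>N. norm (X m - X n) < (1/2)^k" for k :: nat
    using C by (intro CauchyD) auto
  then obtain N where N: "\<And>k m n. m \<ge> N k \<Longrightarrow> n \<ge> N k \<Longrightarrow> norm (X m - X n) < (1/2)^k"
    by metis
  define r where "r k = k + (\<Sum>i\<le>k. N i)" for k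
  have rmono: "strict_mono r"
    by (rule strict_monoI_Suc) (simp add: r_def)
  have rN: "N k \<le> r k" for k
    unfolding r_def by (simp add: member_le_sum trans_le_add2)
  have "convergent (X \<circ> r)"
  proof (rule L2_Cauchy_convergent_subseq)
    fix n
    have "N n \<le> r (Suc n)"
      using rN[of n] strict_monoD[OF rmono, of n "Suc n"] by simp
    from N[OF this rN] show "norm ((X \<circ> r) (Suc n) - (X \<circ> r) n) \<le> (1/2)^n"
      by (simp add: less_imp_le)
  qed
  then obtain L where "(X \<circ> r) \<longlonglongrightarrow> L" by (auto simp: convergent_def)
  from Cauchy_converges_subseq[OF C rmono this] show "convergent X"
    by (auto simp: convergent_def)
qed

instance L2 :: banach ..

lemma L2_dominated_convergence:
  assumes h: "L2_fun h" and fm: "\<And>n. f n \<in> borel_measurable unit_leb"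
    and gm: "g \<in> borel_measurable unit_leb"
    and lim: "AE x in unit_leb. (\<lambda>n. f n x) \<longlonglongrightarrow> g x"
    and bd: "\<And>n. AE x in unit_leb. \<bar>f n x\<bar> \<le> h x"
  shows "\<And>n. L2_fun (f n)" and "L2_fun g" and "(\<lambda>n. L2_class (f n)) \<longlonglongrightarrow> L2_class g"
proof -
  have h2: "integrable unit_leb (\<lambda>x. (h x)\<^sup>2)"
    using h by (simp add: L2_fun_def)
  have *: "L2_fun k" if k: "k \<in> borel_measurable unit_leb" and b: "AE x in unit_leb. \<bar>k x\<bar> \<le> h x" for k
  proof -
    have "integrable unit_leb (\<lambda>x. (k x)\<^sup>2)"
    proof (rule Bochner_Integration.integrable_bound[OF h2])
      show "(\<lambda>x. (k x)\<^sup>2) \<in> borel_measurable unit_leb"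
        using k by (rule borel_measurable_power)
      show "AE x in unit_leb. norm ((k x)\<^sup>2) \<le> norm ((h x)\<^sup>2)"
        using b by eventually_elim (auto simp: abs_le_square_iff[symmetric])
    qed
    with k show ?thesis by (simp add: L2_fun_def)
  qed
  show f: "L2_fun (f n)" for n by (rule *[OF fm bd])
  have "AE x in unit_leb. \<forall>n. \<bar>f n x\<bar> \<le> h x"
    using bd by (simp add: AE_all_countable)
  with lim have bg: "AE x in unit_leb. \<bar>g x\<bar> \<le> h x"
  proof eventually_elim
    case (elim x)
    then have "(\<lambda>n. \<bar>f n x\<bar>) \<longlonglongrightarrow> \<bar>g x\<bar>" by (intro tendsto_rabs)
    then show ?case using elim by (intro LIMSEQ_le_const2) auto
  qed
  show g: "L2_fun g" by (rule *[OF gm bg])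
  have "(\<lambda>n. \<integral>x. (f n x - g x)\<^sup>2 \<partial>unit_leb) \<longlonglongrightarrow> (\<integral>x. 0 \<partial>unit_leb)"
  proof (rule integral_dominated_convergence[where w = "\<lambda>x. 4 * (h x)\<^sup>2"])
    show "(\<lambda>x. (f n x - g x)\<^sup>2) \<in> borel_measurable unit_leb" for n
      using fm gm by (intro borel_measurable_power borel_measurable_diff)
    show "AE x in unit_leb. (\<lambda>n. (f n x - g x)\<^sup>2) \<longlonglongrightarrow> 0"
      using lim
    proof eventually_elim
      case (elim x)
      then have "(\<lambda>n. (f n x - g x)\<^sup>2) \<longlonglongrightarrow> (g x - g x)\<^sup>2" by (intro tendsto_intros)
      then show ?case by simp
    qed
    show "AE x in unit_leb. norm ((f n x - g x)\<^sup>2) \<le> 4 * (h x)\<^sup>2" for n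
      using bd[of n] bg
    proof eventually_elim
      case (elim x)
      then have "\<bar>f n x - g x\<bar> \<le> \<bar>2 * h x\<bar>" by linarith
      then show ?case by (simp add: abs_le_square_iff power_mult_distrib)
    qed
  qed (use h2 in auto)
  then have "(\<lambda>n. sqrt (\<integral>x. (f n x - g x)\<^sup>2 \<partial>unit_leb)) \<longlonglongrightarrow> sqrt 0"
    by (intro tendsto_real_sqrt) simp
  then have "(\<lambda>n. norm (L2_class (f n) - L2_class g)) \<longlonglongrightarrow> 0"
    by (simp add: L2_class_diff f g L2_class_norm L2_fun_diff)
  then show "(\<lambda>n. L2_class (f n)) \<longlonglongrightarrow> L2_class g"
    by (rule LIM_zero_cancel[OF tendsto_norm_zero_cancel])
qed

text \<open>Separability: rational combinations of indicators of rational intervals are dense.\<close>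

definition L2_rat_steps :: "L2 set" where
  "L2_rat_steps = range (\<lambda>l :: (rat \<times> rat \<times> rat) list.
     \<Sum>(c, a, b)\<leftarrow>l. of_rat c *\<^sub>R L2_class (indicat_real {of_rat a..of_rat b}))"

lemma countable_L2_rat_steps: "countable L2_rat_steps"
  unfolding L2_rat_steps_def by (intro countable_image) simp

lemma L2_rat_steps_zero: "0 \<in> L2_rat_steps"
  unfolding L2_rat_steps_def by (rule range_eqI[of _ _ "[]"]) simp

lemma L2_rat_steps_add:
  assumes "u \<in> L2_rat_steps" "v \<in> L2_rat_steps" shows "u + v \<in> L2_rat_steps"
proof -
  let ?F = "\<lambda>l :: (rat \<times> rat \<times> rat) list.
     \<Sum>(c, a, b)\<leftarrow>l. of_rat c *\<^sub>R L2_class (indicat_real {of_rat a..of_rat b})"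
  from assms obtain l m where "u = ?F l" "v = ?F m" unfolding L2_rat_steps_def by blast
  then have "u + v = ?F (l @ m)" by simp
  then show ?thesis unfolding L2_rat_steps_def by blast
qed

lemma L2_rat_steps_scale:
  assumes "u \<in> L2_rat_steps" shows "of_rat r *\<^sub>R u \<in> L2_rat_steps"
proof -
  let ?F = "\<lambda>l :: (rat \<times> rat \<times> rat) list.
     \<Sum>(c, a, b)\<leftarrow>l. of_rat c *\<^sub>R L2_class (indicat_real {of_rat a..of_rat b})"
  from assms obtain l where l: "u = ?F l" unfolding L2_rat_steps_def by blast
  have "of_rat r *\<^sub>R ?F l = ?F (map (\<lambda>(c, a, b). (r * c, a, b)) l)"
    by (induction l) (auto simp: scaleR_add_right of_rat_mult)
  with l show ?thesis unfolding L2_rat_steps_def by blast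
qed

lemma L2_closure_add:
  assumes "u \<in> closure L2_rat_steps" "v \<in> closure L2_rat_steps"
  shows "u + v \<in> closure L2_rat_steps"
proof -
  from assms obtain x y where "\<And>n::nat. x n \<in> L2_rat_steps" "x \<longlonglongrightarrow> u"
    "\<And>n::nat. y n \<in> L2_rat_steps" "y \<longlonglongrightarrow> v"
    unfolding closure_sequential by blast
  then have "\<forall>n. x n + y n \<in> L2_rat_steps" "(\<lambda>n. x n + y n) \<longlonglongrightarrow> u + v"
    by (auto intro: L2_rat_steps_add tendsto_add)
  then show ?thesis unfolding closure_sequential by (intro exI conjI)
qed

lemma L2_closure_scale:
  assumes "u \<in> closure L2_rat_steps"
  shows "c *\<^sub>R u \<in> closure L2_rat_steps"
proof -
  from assms obtain x where x: "\<And>n::nat. x n \<in> L2_rat_steps" "x \<longlonglongrightarrow> u"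
    unfolding closure_sequential by blast
  have "\<exists>q::rat. c - 1 / real (Suc n) < of_rat q \<and> of_rat q < c" for n
    by (rule of_rat_dense) simp
  then obtain q :: "nat \<Rightarrow> rat" where q: "\<And>n. c - 1 / real (Suc n) < of_rat (q n)" "\<And>n. of_rat (q n) < c"
    by metis
  have "(\<lambda>n. real_of_rat (q n)) \<longlonglongrightarrow> c"
  proof (rule tendsto_sandwich)
    show "(\<lambda>n. c - 1 / real (Suc n)) \<longlonglongrightarrow> c"
      using tendsto_diff[OF tendsto_const LIMSEQ_inverse_real_of_nat, of c]
      by (simp add: inverse_eq_divide)
    show "(\<lambda>n::nat. c) \<longlonglongrightarrow> c" by simp
  qed (use q in \<open>auto intro!: always_eventually less_imp_le\<close>)
  then have "(\<lambda>n. of_rat (q n) *\<^sub>R x n) \<longlonglongrightarrow> c *\<^sub>R u"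
    using x by (intro tendsto_scaleR)
  moreover have "\<forall>n. of_rat (q n) *\<^sub>R x n \<in> L2_rat_steps"
    using x L2_rat_steps_scale by blast
  ultimately show ?thesis unfolding closure_sequential by (intro exI conjI)
qed

lemma L2_closure_lim:
  assumes "\<And>n::nat. x n \<in> closure L2_rat_steps" "x \<longlonglongrightarrow> u"
  shows "u \<in> closure L2_rat_steps"
  using closed_sequentially[OF closed_closure] assms by blast

lemma L2_fun_const: "L2_fun (\<lambda>_. c)"
  using L2_fun_scale[OF L2_fun_indicator[of UNIV], of c] by simp

lemma measurable_indicator_unit_leb:
  "A \<in> sets lebesgue \<Longrightarrow> indicat_real A \<in> borel_measurable unit_leb"
  using L2_fun_indicator by (simp add: L2_fun_def)

lemma L2_closure_interval: "L2_class (indicat_real {a..b}) \<in> closure L2_rat_steps"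
proof -
  have "\<exists>q::rat. a - 1 / real (Suc n) < of_rat q \<and> of_rat q < a" for n
    by (rule of_rat_dense) simp
  then obtain p :: "nat \<Rightarrow> rat" where p: "\<And>n. a - 1 / real (Suc n) < of_rat (p n)" "\<And>n. of_rat (p n) < a"
    by metis
  have "\<exists>q::rat. b < of_rat q \<and> of_rat q < b + 1 / real (Suc n)" for n
    by (rule of_rat_dense) simp
  then obtain q :: "nat \<Rightarrow> rat" where q: "\<And>n. b < of_rat (q n)" "\<And>n. of_rat (q n) < b + 1 / real (Suc n)"
    by metis
  let ?f = "\<lambda>n. indicat_real {real_of_rat (p n)..of_rat (q n)}"
  have "(\<lambda>n. L2_class (?f n)) \<longlonglongrightarrow> L2_class (indicat_real {a..b})"
  proof (rule L2_dominated_convergence(3)[where h = "\<lambda>_. 1"])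
    show "L2_fun (\<lambda>_. 1)" by (rule L2_fun_const)
    show "AE x in unit_leb. (\<lambda>n. ?f n x) \<longlonglongrightarrow> indicat_real {a..b} x"
    proof (rule AE_I2)
      fix x :: real
      have r: "(\<lambda>n. 1 / real (Suc n)) \<longlonglongrightarrow> 0"
        using LIMSEQ_inverse_real_of_nat by (simp add: inverse_eq_divide)
      have "\<forall>\<^sub>F n in sequentially. ?f n x = indicat_real {a..b} x"
      proof (cases "x \<in> {a..b}")
        case True
        then have "?f n x = indicat_real {a..b} x" for n
          using p(2)[of n] q(1)[of n] by (auto simp: indicator_def)
        then show ?thesis by simp
      next
        case False
        then consider "x < a" | "b < x" by fastforce
        then show ?thesis
        proof cases
          case 1
          then have "\<forall>\<^sub>F n in sequentially. 1 / real (Suc n) < a - x"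
            using order_tendstoD(2)[OF r, of "a - x"] by simp
          then show ?thesis
          proof eventually_elim
            case (elim n)
            with p(1)[of n] 1 show ?case by (auto simp: indicator_def)
          qed
        next
          case 2
          then have "\<forall>\<^sub>F n in sequentially. 1 / real (Suc n) < x - b"
            using order_tendstoD(2)[OF r, of "x - b"] by simp
          then show ?thesis
          proof eventually_elim
            case (elim n)
            with q(2)[of n] 2 show ?case by (auto simp: indicator_def)
          qed
        qed
      qed
      then show "(\<lambda>n. ?f n x) \<longlonglongrightarrow> indicat_real {a..b} x"
        by (rule tendsto_eventually)
    qed
    show "AE x in unit_leb. \<bar>?f n x\<bar> \<le> 1" for n
      by (simp add: indicator_def)
  qed (auto intro!: measurable_indicator_unit_leb)
  moreover have "L2_class (?f n) \<in> closure L2_rat_steps" for n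
  proof -
    have "L2_class (?f n) \<in> L2_rat_steps"
      unfolding L2_rat_steps_def by (rule range_eqI[of _ _ "[(1, p n, q n)]"]) simp
    then show ?thesis using closure_subset by blast
  qed
  ultimately show ?thesis by (rule L2_closure_lim[rotated])
qed

lemma L2_class_cong_AE:
  assumes "L2_fun f" "L2_fun g" "AE x in unit_leb. f x = g x"
  shows "L2_class f = L2_class g"
  using assms by (simp add: L2_class_eq_iff)

lemma L2_closure_borel:
  "A \<in> sets borel \<Longrightarrow> L2_class (indicat_real A) \<in> closure L2_rat_steps"
proof (induction A rule: borel_set_induct)
  case empty
  then show ?case
    using L2_rat_steps_zero closure_subset L2_class_zero by auto
next
  case (interval a b)
  show ?case by (rule L2_closure_interval)
next
  case (compl A)
  have A: "A \<in> sets lebesgue" using compl by simp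
  have 1: "L2_fun (indicat_real {0..1})" by (intro L2_fun_indicator) simp
  have 2: "L2_fun (\<lambda>x. (-1) * indicat_real A x)" by (intro L2_fun_scale L2_fun_indicator A)
  have 3: "L2_fun (indicat_real (-A))" using A by (intro L2_fun_indicator) (simp add: Compl_in_sets_lebesgue)
  have "L2_class (indicat_real (-A)) = L2_class (\<lambda>x. indicat_real {0..1} x + (-1) * indicat_real A x)"
  proof (rule L2_class_cong_AE)
    show "AE x in unit_leb. indicat_real (-A) x = indicat_real {0..1} x + (-1) * indicat_real A x"
      by (rule AE_I2) (auto simp: indicator_def)
  qed (rule 3 L2_fun_add[OF 1 2])+
  also have "\<dots> = L2_class (indicat_real {0..1}) + (-1) *\<^sub>R L2_class (indicat_real A)"
    unfolding L2_class_scaleR[OF L2_fun_indicator[OF A] L2_fun_zero]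
    by (rule L2_class_add[OF 1 2, symmetric])
  also have "\<dots> \<in> closure L2_rat_steps"
    by (intro L2_closure_add L2_closure_scale L2_closure_interval compl.IH)
  finally show ?case .
next
  case (union f)
  have disj: "disjoint_family f" by fact
  have fb: "f i \<in> sets borel" for i by fact
  then have f: "f i \<in> sets lebesgue" for i by simp
  have IH: "L2_class (indicat_real (f i)) \<in> closure L2_rat_steps" for i by fact
  have fin: "L2_class (indicat_real (\<Union>i<n. f i)) \<in> closure L2_rat_steps" for n
  proof (induction n)
    case 0
    then show ?case
      using L2_rat_steps_zero closure_subset L2_class_zero by auto
  next
    case (Suc n)
    have dis: "(\<Union>i<n. f i) \<inter> f n = {}"
    proof -
      have "f i \<inter> f n = {}" if "i < n" for i
        using disjoint_family_onD[OF disj, of i n] that by simp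
      then show ?thesis by blast
    qed
    have U: "(\<Union>i<n. f i) \<in> sets lebesgue" by (rule sets.finite_UN) (auto intro: f)
    have "indicat_real (\<Union>i<Suc n. f i) = (\<lambda>x. indicat_real (\<Union>i<n. f i) x + indicat_real (f n) x)"
    proof
      fix x
      have "(\<Union>i<Suc n. f i) = (\<Union>i<n. f i) \<union> f n" by (auto simp: lessThan_Suc)
      then show "indicat_real (\<Union>i<Suc n. f i) x = indicat_real (\<Union>i<n. f i) x + indicat_real (f n) x"
        using dis by (simp add: indicator_add)
    qed
    then have "L2_class (indicat_real (\<Union>i<Suc n. f i)) =
        L2_class (indicat_real (\<Union>i<n. f i)) + L2_class (indicat_real (f n))"
      by (simp add: L2_class_add[OF L2_fun_indicator[OF U] L2_fun_indicator[OF f]])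
    then show ?case using L2_closure_add[OF Suc.IH IH] by simp
  qed
  have "(\<lambda>n. L2_class (indicat_real (\<Union>i<n. f i))) \<longlonglongrightarrow> L2_class (indicat_real (\<Union>i. f i))"
  proof (rule L2_dominated_convergence(3)[where h = "\<lambda>_. 1"])
    show "AE x in unit_leb. (\<lambda>n. indicat_real (\<Union>i<n. f i) x) \<longlonglongrightarrow> indicat_real (\<Union>i. f i) x"
      by (rule AE_I2) (rule LIMSEQ_indicator_UN)
    show "AE x in unit_leb. \<bar>indicat_real (\<Union>i<n. f i) x\<bar> \<le> 1" for n
      by (simp add: indicator_def)
  qed (use f in \<open>auto intro!: L2_fun_const measurable_indicator_unit_leb\<close>)
  from L2_closure_lim[OF fin this] show ?case .
qed

lemma L2_closure_lebesgue:
  assumes A: "A \<in> sets lebesgue"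
  shows "L2_class (indicat_real A) \<in> closure L2_rat_steps"
proof -
  from A obtain S N N' where 1: "A = S \<union> N" "N \<subseteq> N'" "N' \<in> null_sets lborel" "S \<in> sets lborel"
    by (rule sets_completionE)
  then have S: "S \<in> sets borel" by simp
  have "N' \<in> null_sets lebesgue" using 1 by (simp add: null_sets_completionI)
  then have "AE x in lebesgue. x \<notin> N'" by (rule AE_not_in)
  then have "AE x in unit_leb. x \<notin> N'"
    by (subst AE_restrict_space_iff) auto
  then have "AE x in unit_leb. indicat_real A x = indicat_real S x"
    by eventually_elim (use 1 in \<open>auto simp: indicator_def\<close>)
  then have "L2_class (indicat_real A) = L2_class (indicat_real S)"
    using A S by (intro L2_class_cong_AE L2_fun_indicator) auto
  with L2_closure_borel[OF S] show ?thesis by simp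
qed

lemma L2_closure_simple:
  assumes s: "simple_function unit_leb s"
  shows "L2_fun s \<and> L2_class s \<in> closure L2_rat_steps"
proof -
  define A where "A y = s -` {y} \<inter> {0<..<1}" for y
  let ?R = "s ` {0<..<1}"
  have A: "A y \<in> sets lebesgue" for y
  proof -
    have "A y \<in> sets unit_leb"
      using simple_functionD(2)[OF s, of "{y}"] by (simp add: A_def)
    then show ?thesis by (simp add: A_def sets_restrict_space_iff)
  qed
  have fin: "finite ?R" using simple_functionD(1)[OF s] by simp
  have *: "L2_fun (\<lambda>x. \<Sum>y\<in>B. y * indicat_real (A y) x) \<and>
      L2_class (\<lambda>x. \<Sum>y\<in>B. y * indicat_real (A y) x) \<in> closure L2_rat_steps"
    if "finite B" for B
    using that
  proof induction
    case empty
    then show ?case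
      using L2_rat_steps_zero closure_subset L2_class_zero L2_fun_zero by auto
  next
    case (insert z B)
    have z: "L2_fun (\<lambda>x. z * indicat_real (A z) x)"
      by (intro L2_fun_scale L2_fun_indicator A)
    have "L2_class (\<lambda>x. z * indicat_real (A z) x) = z *\<^sub>R L2_class (indicat_real (A z))"
      by (rule L2_class_scaleR[symmetric, OF L2_fun_indicator[OF A] L2_fun_zero])
    then have zc: "L2_class (\<lambda>x. z * indicat_real (A z) x) \<in> closure L2_rat_steps"
      by (simp add: L2_closure_scale L2_closure_lebesgue A)
    note B = conjunct1[OF insert.IH] conjunct2[OF insert.IH]
    show ?case
      unfolding sum.insert[OF insert.hyps]
      using L2_fun_add[OF z B(1)] L2_closure_add[OF zc B(2), unfolded L2_class_add[OF z B(1)]]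
      by (rule conjI)
  qed
  let ?g = "\<lambda>x. \<Sum>y\<in>?R. y * indicat_real (A y) x"
  have eq: "s x = ?g x" if "x \<in> {0<..<1}" for x
  proof -
    have "?g x = (\<Sum>y\<in>?R. if y = s x then y else 0)"
      using that by (intro sum.cong) (auto simp: A_def indicator_def)
    also have "\<dots> = s x" using fin that by simp
    finally show ?thesis by simp
  qed
  have g: "L2_fun ?g" "L2_class ?g \<in> closure L2_rat_steps" using *[OF fin] by blast+
  have sf: "L2_fun s"
    unfolding L2_fun_def
  proof
    show "s \<in> borel_measurable unit_leb" by (rule borel_measurable_simple_function[OF s])
    have "integrable unit_leb (\<lambda>x. (s x)\<^sup>2) \<longleftrightarrow> integrable unit_leb (\<lambda>x. (?g x)\<^sup>2)"
    proof (rule Bochner_Integration.integrable_cong[OF refl])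
      fix x assume "x \<in> space unit_leb"
      then show "(s x)\<^sup>2 = (?g x)\<^sup>2" using eq[of x] by simp
    qed
    then show "integrable unit_leb (\<lambda>x. (s x)\<^sup>2)"
      using L2_fun_integrable_sq[OF g(1)] by blast
  qed
  have "L2_class s = L2_class ?g"
    by (rule L2_class_cong_AE[OF sf g(1)], rule AE_I2) (rule eq, simp)
  with sf g show ?thesis by simp
qed

lemma L2_rat_steps_dense: "closure L2_rat_steps = UNIV"
proof -
  have "u \<in> closure L2_rat_steps" for u
  proof (rule L2_class_cases[of u])
    fix f assume f: "L2_fun f" and u: "u = L2_class f"
    obtain s where s: "\<And>i. simple_function unit_leb (s i)"
      and lim: "\<And>x. x \<in> space unit_leb \<Longrightarrow> (\<lambda>i. s i x) \<longlonglongrightarrow> f x"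
      and bd: "\<And>i x. x \<in> space unit_leb \<Longrightarrow> dist (s i x) 0 \<le> 2 * dist (f x) 0"
      using borel_measurable_implies_sequence_metric[OF L2_fun_measurable[OF f], of 0] by blast
    have "(\<lambda>i. L2_class (s i)) \<longlonglongrightarrow> L2_class f"
    proof (rule L2_dominated_convergence(3)[where h = "\<lambda>x. 2 * \<bar>f x\<bar>"])
      show "L2_fun (\<lambda>x. 2 * \<bar>f x\<bar>)"
        using f by (intro L2_fun_scale) (auto simp: L2_fun_def intro!: borel_measurable_abs)
      show "AE x in unit_leb. (\<lambda>i. s i x) \<longlonglongrightarrow> f x"
        by (rule AE_I2) (rule lim)
      show "AE x in unit_leb. \<bar>s i x\<bar> \<le> 2 * \<bar>f x\<bar>" for i
        by (rule AE_I2) (use bd[of _ i] in simp)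
    qed (use f s in \<open>auto intro: borel_measurable_simple_function L2_fun_measurable\<close>)
    from L2_closure_lim[OF _ this] show "u \<in> closure L2_rat_steps"
      using L2_closure_simple[OF s] u by blast
  qed
  then show ?thesis by blast
qed

instance L2 :: second_countable_topology
proof
  let ?B = "(\<lambda>(q, r). ball q (of_rat r)) ` (L2_rat_steps \<times> (UNIV :: rat set))"
  have "countable ?B"
    by (intro countable_image countable_SIGMA countable_L2_rat_steps) simp
  moreover have "topological_basis ?B"
  proof (rule topological_basisI)
    fix U and u :: L2 assume "open U" "u \<in> U"
    then obtain e where e: "e > 0" "ball u e \<subseteq> U" by (rule openE)
    obtain r :: rat where r: "0 < real_of_rat r" "real_of_rat r < e / 2"
      using of_rat_dense[of 0 "e / 2"] e by auto
    have "u \<in> closure L2_rat_steps" by (simp add: L2_rat_steps_dense)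
    then obtain q where q: "q \<in> L2_rat_steps" "dist q u < of_rat r"
      using r unfolding closure_approachable by blast
    have "ball q (of_rat r) \<subseteq> ball u e"
    proof
      fix v assume "v \<in> ball q (of_rat r)"
      then have "dist u v < of_rat r + of_rat r"
        using q dist_triangle[of u v q] by (simp add: dist_commute)
      then show "v \<in> ball u e" using r by simp
    qed
    with e q show "\<exists>V\<in>?B. u \<in> V \<and> V \<subseteq> U"
      by (intro bexI[of _ "ball q (of_rat r)"]) auto
  qed auto
  ultimately show "\<exists>B :: L2 set set. countable B \<and> open = generate_topology B"
    using topological_basis_imp_subbasis by blast
qed

section \<open>The degenerate operator\<close>

text \<open>Absolute continuity on a compact interval, in the \<open>\<epsilon>\<close>-\<open>\<delta>\<close> form with finitely many
  non-overlapping subintervals.\<close>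

definition abs_continuous_on :: "real \<Rightarrow> real \<Rightarrow> (real \<Rightarrow> real) \<Rightarrow> bool" where
  "abs_continuous_on a b g \<longleftrightarrow>
     (\<forall>\<epsilon>>0. \<exists>\<delta>>0. \<forall>(n::nat) l r.
        (\<forall>i<n. a \<le> l i \<and> l i \<le> r i \<and> r i \<le> b) \<longrightarrow>
        (\<forall>i<n. \<forall>j<n. i \<noteq> j \<longrightarrow> {l i<..<r i} \<inter> {l j<..<r j} = {}) \<longrightarrow>
        (\<Sum>i<n. r i - l i) < \<delta> \<longrightarrow> (\<Sum>i<n. \<bar>g (r i) - g (l i)\<bar>) < \<epsilon>)"

definition loc_abs_continuous :: "(real \<Rightarrow> real) \<Rightarrow> bool" where
  "loc_abs_continuous g \<longleftrightarrow> (\<forall>a b. 0 < a \<longrightarrow> a \<le> b \<longrightarrow> b < 1 \<longrightarrow> abs_continuous_on a b g)"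

text \<open>\<open>H\<^sup>1\<^sub>\<alpha>(0,1)\<close>. Only the values on \<open>(0,1)\<close> matter, so \<open>\<theta>(1) = 0\<close> is the limit from the left;
  \<open>deriv \<theta>\<close> is the derivative almost everywhere.\<close>

definition H1_alpha :: "real \<Rightarrow> (real \<Rightarrow> real) \<Rightarrow> bool" where
  "H1_alpha \<alpha> \<theta> \<longleftrightarrow> L2_fun \<theta> \<and> loc_abs_continuous \<theta> \<and>
     integrable unit_leb (\<lambda>x. x powr \<alpha> * (deriv \<theta> x)\<^sup>2) \<and> (\<theta> \<longlongrightarrow> 0) (at_left 1)"

text \<open>\<open>w\<close> is the locally absolutely continuous representative of \<open>x\<^sup>\<alpha> \<theta>'\<close>. It exists whenever
  \<open>(x\<^sup>\<alpha> \<theta>')'\<close>, in the sense of distributions, is in \<open>L\<^sup>2(0,1)\<close>; \<open>deriv w\<close> is then that distribution,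
  and the trace of \<open>x\<^sup>\<alpha> \<theta>'\<close> at \<open>0\<close> is the limit of \<open>w\<close>.\<close>

definition flux :: "real \<Rightarrow> (real \<Rightarrow> real) \<Rightarrow> (real \<Rightarrow> real) \<Rightarrow> bool" where
  "flux \<alpha> \<theta> w \<longleftrightarrow> loc_abs_continuous w \<and> (AE x in unit_leb. w x = x powr \<alpha> * deriv \<theta> x)"

definition BC :: "real \<Rightarrow> (real \<Rightarrow> real) \<Rightarrow> (real \<Rightarrow> real) \<Rightarrow> bool" where
  "BC \<alpha> \<theta> w \<longleftrightarrow> (if \<alpha> < 1 then (\<theta> \<longlongrightarrow> 0) (at_right 0) else (w \<longlongrightarrow> 0) (at_right 0))"

text \<open>The graph of \<open>\<P>\<close>: the pairs \<open>(u, \<P> u)\<close> with \<open>u \<in> D(\<P>)\<close>.\<close>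

definition P_graph :: "real \<Rightarrow> (L2 \<times> L2) set" where
  "P_graph \<alpha> = {(L2_class \<theta>, L2_class (\<lambda>x. - deriv w x)) | \<theta> w.
     H1_alpha \<alpha> \<theta> \<and> flux \<alpha> \<theta> w \<and> L2_fun (\<lambda>x. - deriv w x) \<and> BC \<alpha> \<theta> w}"

section \<open>Semigroups and solutions\<close>

definition C0_semigroup :: "(real \<Rightarrow> 'a::real_normed_vector \<Rightarrow> 'a) \<Rightarrow> bool" where
  "C0_semigroup S \<longleftrightarrow>
     (\<forall>t\<ge>0. bounded_linear (S t)) \<and> (\<forall>u. S 0 u = u) \<and>
     (\<forall>s\<ge>0. \<forall>t\<ge>0. \<forall>u. S (s + t) u = S s (S t u)) \<and>
     (\<forall>u. ((\<lambda>t. S t u) \<longlongrightarrow> u) (at_right 0))"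

definition generator :: "(real \<Rightarrow> 'a::real_normed_vector \<Rightarrow> 'a) \<Rightarrow> ('a \<times> 'a) set" where
  "generator S = {(u, v). ((\<lambda>h. (S h u - u) /\<^sub>R h) \<longlongrightarrow> v) (at_right 0)}"

text \<open>\<open>S t = e\<^sup>-\<^sup>t\<^sup>\<P>\<close> for \<open>t \<ge> 0\<close>; a semigroup is determined on \<open>[0, \<infinity>)\<close> by its generator.\<close>

definition P_semigroup :: "real \<Rightarrow> (real \<Rightarrow> L2 \<Rightarrow> L2) \<Rightarrow> bool" where
  "P_semigroup \<alpha> S \<longleftrightarrow> C0_semigroup S \<and> generator S = {(u, - v) | u v. (u, v) \<in> P_graph \<alpha>}"

definition L2_on :: "(real \<times> real) set \<Rightarrow> (real \<times> real \<Rightarrow> real) \<Rightarrow> bool" where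
  "L2_on A f \<longleftrightarrow> f \<in> borel_measurable (lebesgue_on A) \<and> integrable (lebesgue_on A) (\<lambda>p. (f p)\<^sup>2)"

text \<open>The \<open>L\<^sup>2(0,1)\<close>-valued function \<open>s \<mapsto> (1\<^bsub>\<omega>\<times>E\<^esub> f)(\<cdot>, s)\<close>.\<close>

definition control :: "real set \<Rightarrow> real set \<Rightarrow> (real \<times> real \<Rightarrow> real) \<Rightarrow> real \<Rightarrow> L2" where
  "control \<omega> E f s = L2_class (\<lambda>x. indicat_real (\<omega> \<times> E) (x, s) * f (x, s))"

text \<open>The mild solution: Duhamel's formula, with a Bochner integral in \<open>L\<^sup>2(0,1)\<close>.\<close>

definition solution ::
  "real \<Rightarrow> real set \<Rightarrow> real set \<Rightarrow> real \<Rightarrow> L2 \<Rightarrow> (real \<times> real \<Rightarrow> real) \<Rightarrow> (real \<Rightarrow> L2) \<Rightarrow> bool" where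
  "solution \<alpha> \<omega> E T y0 f y \<longleftrightarrow>
     continuous_on {0..T} y \<and>
     (\<exists>S. P_semigroup \<alpha> S \<and>
       (\<forall>t\<in>{0..T}.
          set_integrable lebesgue {0..t} (\<lambda>s. S (t - s) (control \<omega> E f s)) \<and>
          y t = S t y0 + (LINT s:{0..t}|lebesgue. S (t - s) (control \<omega> E f s))))"

end

(* The method is that of Lebeau and Robbiano, in the form adapted to measurable sets of times.
   P is the inverse of a compact self-adjoint integral operator whose kernel is the Green function of
   -(x^alpha u')', so there is an orthonormal basis of eigenfunctions e_k with eigenvalues lam_k, and
   e_k is a multiple of the Frobenius (Bessel) solution x^beta F(-lam_k x^(2-alpha)), where F is an
   entire function whose coefficients are of size 1/n!^2.

   Spectral inequality: a combination u of the e_k with lam_k <= L satisfies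
   ||u|| <= exp(D sqrt L) ||u||_{L^2(omega)}.  Up to the weight x^beta, u is a function of
   t = x^(2-alpha), and the Taylor polynomial of degree m ~ sqrt L of that function has an
   exponentially small error.  In each of m subintervals of omega there is a point where |u| is at
   most its mean, and Lagrange interpolation at these points bounds the polynomial on all of [0,1].

   Let Ts be a density point of E and t_m = Ts - delta/2^m.  On (t_m, t_{m+1}] a control of size
   exp(D sqrt L_m), acting at times of E in the first half, removes the frequencies below
   L_m ~ 9^m; in the second half the remaining ones decay by exp(-L_m (t_{m+1} - t_m)/2).  Since
   9^m/2^m dominates 3^m, the states at the times t_m tend to 0 and the controls remain bounded. *)
theory Submission
  imports Defs "HOL-Library.Diagonal_Subsequence" "HOL-Computational_Algebra.Polynomial"
begin

section \<open>Absolutely continuous functions on the line\<close>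

text \<open>The exponent 1/2 of L in the spectral inequality comes from the factor 1/n!^2:
  \<open>F\<close> has order 1/2 as an entire function, so a degree of about sqrt L suffices for
  arguments up to L, and the Remez bound costs a factor exponential in the degree only. The
  normalising factors of the e_k must not spoil this; they grow at most polynomially in L, by
  Bessel's inequality for the Green function at one point close to 0. Three obstacles lie elsewhere.
  The domain of P consists of absolutely continuous functions with derivatives almost everywhere, so
  that identifying its graph with that of the integral operator takes the fundamental theorem of
  calculus for such functions. A solution may use any C0-semigroup with the right generator, so this
  semigroup has to be shown equal to the diagonal one; on eigenvectors this needs local boundedness,
  hence Baire's theorem. Finally, the control is constructed as a function of time with values in
  L^2 and has to become a measurable function of two variables.\<close>

lemma lebesgue_differentiation:
  fixes f :: "real \<Rightarrow> real"
  assumes f: "\<And>a b. f integrable_on {a..b}"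
  shows "AE x in lebesgue. \<forall>a<x. ((\<lambda>y. integral {a..y} f) has_real_derivative f x) (at x)"
proof -
  obtain N where N: "negligible N" "\<And>x e. \<lbrakk>x \<notin> N; 0 < e\<rbrakk> \<Longrightarrow>
      \<exists>d>0. \<forall>h. 0 < h \<and> h < d \<longrightarrow> norm (integral (cbox x (x + h *\<^sub>R One)) f /\<^sub>R h ^ DIM(real) - f x) < e"
    by (rule integrable_ccontinuous_explicit[where f = f]) (use f in \<open>simp, blast\<close>)
  \<comment> \<open>Off \<open>N\<close> the averages over intervals that start at \<open>x\<close>
    converge to \<open>f x\<close>. The reflected function gives the intervals that end at
    \<open>x\<close>, off the reflection of its null set. The exceptional set does not depend on
    \<open>a\<close>, because only increments near \<open>x\<close> enter.\<close>
  have fm: "(\<lambda>s. f (- s)) integrable_on {a..b}" for a b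
    using f[of "-b" "-a"] Henstock_Kurzweil_Integration.integrable_reflect_real[where f = f and a = "-b" and b = "-a"] by simp
  obtain M where M: "negligible M" "\<And>x e. \<lbrakk>x \<notin> M; 0 < e\<rbrakk> \<Longrightarrow>
      \<exists>d>0. \<forall>h. 0 < h \<and> h < d \<longrightarrow> norm (integral (cbox x (x + h *\<^sub>R One)) (\<lambda>s. f (- s)) /\<^sub>R h ^ DIM(real) - f (- x)) < e"
    by (rule integrable_ccontinuous_explicit[where f = "\<lambda>s. f (- s)"]) (use fm in \<open>simp, blast\<close>)
  have M': "negligible (uminus ` M)"
    by (rule negligible_differentiable_image_negligible[OF _ M(1)]) (auto intro: derivative_intros simp: differentiable_on_def)
  have "negligible (N \<union> uminus ` M)" using N(1) M' by (rule negligible_Un)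
  then have "AE x in lebesgue. x \<notin> N \<union> uminus ` M"
    by (intro AE_not_in) (simp add: negligible_iff_null_sets)
  then show ?thesis
  proof eventually_elim
    case (elim x)
    have xN: "x \<notin> N" and xM: "- x \<notin> M" using elim by force+
    show ?case
    proof (intro allI impI)
      fix a assume a: "a < x"
      show "((\<lambda>y. integral {a..y} f) has_real_derivative f x) (at x)"
        unfolding DERIV_def
      proof (rule LIM_I)
        fix e :: real assume e: "e > 0"
        from N(2)[OF xN e] obtain d1 where d1: "d1 > 0"
          "\<And>h::real. 0 < h \<Longrightarrow> h < d1 \<Longrightarrow> \<bar>integral {x..x+h} f / h - f x\<bar> < e"
          by (auto simp: divide_inverse_commute)
        from M(2)[OF xM e] obtain d2 where d2: "d2 > 0"
          "\<And>h::real. 0 < h \<Longrightarrow> h < d2 \<Longrightarrow> \<bar>integral {-x..-x+h} (\<lambda>s. f (-s)) / h - f x\<bar> < e"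
          by (auto simp: divide_inverse_commute)
        show "\<exists>s>0. \<forall>h::real. h \<noteq> 0 \<and> norm (h - 0) < s \<longrightarrow>
            norm ((integral {a..x + h} f - integral {a..x} f) / h - f x) < e"
        proof (intro exI[of _ "Min {d1, d2, x - a}"] conjI allI impI)
          show "0 < Min {d1, d2, x - a}" using d1 d2 a by simp
          fix h :: real assume h: "h \<noteq> 0 \<and> norm (h - 0) < Min {d1, d2, x - a}"
          show "norm ((integral {a..x + h} f - integral {a..x} f) / h - f x) < e"
          proof (cases "h > 0")
            case True
            have "integral {a..x} f + integral {x..x+h} f = integral {a..x+h} f"
              using a True by (intro Henstock_Kurzweil_Integration.integral_combine f) auto
            then have "integral {a..x + h} f - integral {a..x} f = integral {x..x+h} f" by simp
            then show ?thesis using d1(2)[of h] h True by simp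
          next
            case False
            then have hn: "h < 0" using h by auto
            have "integral {a..x+h} f + integral {x+h..x} f = integral {a..x} f"
              using a hn h by (intro Henstock_Kurzweil_Integration.integral_combine f) auto
            moreover have "integral {-x..-(x+h)} (\<lambda>s. f (-s)) = integral {x+h..x} f"
              by (rule Henstock_Kurzweil_Integration.integral_reflect_real)
            moreover have "-(x+h) = -x + (-h)" by simp
            ultimately have "integral {a..x + h} f - integral {a..x} f = - integral {-x..-x+(-h)} (\<lambda>s. f (-s))"
              by simp
            then have "(integral {a..x + h} f - integral {a..x} f) / h = integral {-x..-x+(-h)} (\<lambda>s. f (-s)) / (-h)"
              by simp
            then show ?thesis using d2(2)[of "-h"] h hn by simp
          qed
        qed
      qed
    qed
  qed
qed

text \<open>The index set is an arbitrary finite set, so that a refinement of a family can be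
  indexed by pairs without renumbering.\<close>

definition nonoverlapping :: "'i set \<Rightarrow> ('i \<Rightarrow> real) \<Rightarrow> ('i \<Rightarrow> real) \<Rightarrow> real \<Rightarrow> real \<Rightarrow> bool" where
  "nonoverlapping I l r a b \<longleftrightarrow> finite I \<and> (\<forall>i\<in>I. a \<le> l i \<and> l i \<le> r i \<and> r i \<le> b) \<and>
     (\<forall>i\<in>I. \<forall>j\<in>I. i \<noteq> j \<longrightarrow> {l i<..<r i} \<inter> {l j<..<r j} = {})"

lemma abs_continuous_on_nonoverlapping:
  assumes "abs_continuous_on a b g" "\<epsilon> > 0"
  obtains \<delta> where "\<delta> > 0" "\<And>(I::'i set) l r. nonoverlapping I l r a b \<Longrightarrow> (\<Sum>i\<in>I. r i - l i) < \<delta> \<Longrightarrow>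
           (\<Sum>i\<in>I. \<bar>g (r i) - g (l i)\<bar>) < \<epsilon>"
proof -
  from assms obtain \<delta> where \<delta>: "\<delta> > 0" "\<forall>(n::nat) l r.
        (\<forall>i<n. a \<le> l i \<and> l i \<le> r i \<and> r i \<le> b) \<longrightarrow>
        (\<forall>i<n. \<forall>j<n. i \<noteq> j \<longrightarrow> {l i<..<r i} \<inter> {l j<..<r j} = {}) \<longrightarrow>
        (\<Sum>i<n. r i - l i) < \<delta> \<longrightarrow> (\<Sum>i<n. \<bar>g (r i) - g (l i)\<bar>) < \<epsilon>"
    unfolding abs_continuous_on_def by (elim allE[of _ \<epsilon>] impE exE conjE)
  show thesis
  proof (rule that[OF \<delta>(1)])
    fix I :: "'i set" and l r
    assume n: "nonoverlapping I l r a b" and s: "(\<Sum>i\<in>I. r i - l i) < \<delta>"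
    then obtain h where h: "bij_betw h {..<card I} I"
      using ex_bij_betw_nat_finite[of I] by (auto simp: nonoverlapping_def lessThan_atLeast0)
    have hI: "h i \<in> I" if "i < card I" for i using h that by (auto simp: bij_betw_def)
    have hj: "h i \<noteq> h j" if "i < card I" "j < card I" "i \<noteq> j" for i j
      using h that by (auto simp: bij_betw_def inj_on_def)
    have "(\<Sum>i<card I. \<bar>g (r (h i)) - g (l (h i))\<bar>) < \<epsilon>"
    proof (rule \<delta>(2)[rule_format])
      show "(\<Sum>i<card I. r (h i) - l (h i)) < \<delta>"
        using s sum.reindex_bij_betw[OF h, of "\<lambda>i. r i - l i"] by simp
    qed (use n hI hj in \<open>auto simp: nonoverlapping_def\<close>)
    then show "(\<Sum>i\<in>I. \<bar>g (r i) - g (l i)\<bar>) < \<epsilon>"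
      using sum.reindex_bij_betw[OF h, of "\<lambda>i. \<bar>g (r i) - g (l i)\<bar>"] by simp
  qed
qed

lemma nonoverlapping_sum_length:
  assumes n: "nonoverlapping I l r a b" and ab: "a \<le> b"
  shows "(\<Sum>i\<in>I. r i - l i) \<le> b - a"
proof -
  have fin: "finite I" using n by (simp add: nonoverlapping_def)
  have "(\<Sum>i\<in>I. r i - l i) = (\<Sum>i\<in>I. measure lborel {l i<..<r i})"
    using n by (intro sum.cong) (auto simp: nonoverlapping_def)
  also have "\<dots> = measure lborel (\<Union>i\<in>I. {l i<..<r i})"
    using n fin by (intro measure_finite_Union[symmetric])
      (auto simp: nonoverlapping_def disjoint_family_on_def)
  also have "\<dots> \<le> measure lborel {a..b}"
  proof (rule measure_mono_fmeasurable)
    show "(\<Union>i\<in>I. {l i<..<r i}) \<subseteq> {a..b}" using n by (fastforce simp: nonoverlapping_def)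
    show "(\<Union>i\<in>I. {l i<..<r i}) \<in> sets lborel" using fin by (intro sets.finite_UN) auto
    show "{a..b} \<in> fmeasurable lborel" by (rule fmeasurableI) (auto simp: emeasure_lborel_Icc_eq)
  qed
  finally show ?thesis using ab by simp
qed

text \<open>Clamping the endpoints at \<open>m\<close> turns an interval into a degenerate one on
  the side that it does not meet. Degenerate intervals contribute 0, so both families keep the index
  set \<open>I\<close>.\<close>

lemma nonoverlapping_split:
  fixes g :: "real \<Rightarrow> real"
  assumes n: "nonoverlapping I l r a b" and m: "a \<le> m" "m \<le> b"
  shows "nonoverlapping I (\<lambda>i. min (l i) m) (\<lambda>i. min (r i) m) a m"
    and "nonoverlapping I (\<lambda>i. max (l i) m) (\<lambda>i. max (r i) m) m b"
    and "(\<Sum>i\<in>I. \<bar>g (r i) - g (l i)\<bar>) \<le> (\<Sum>i\<in>I. \<bar>g (min (r i) m) - g (min (l i) m)\<bar>)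
           + (\<Sum>i\<in>I. \<bar>g (max (r i) m) - g (max (l i) m)\<bar>)"
proof -
  have s: "{min (l i) m<..<min (r i) m} \<subseteq> {l i<..<r i}" "{max (l i) m<..<max (r i) m} \<subseteq> {l i<..<r i}" for i
    by auto
  show "nonoverlapping I (\<lambda>i. min (l i) m) (\<lambda>i. min (r i) m) a m"
    unfolding nonoverlapping_def
  proof (intro conjI ballI impI)
    fix i j assume "i \<in> I" "j \<in> I" "i \<noteq> j"
    then have "{l i<..<r i} \<inter> {l j<..<r j} = {}" using n by (simp add: nonoverlapping_def)
    then show "{min (l i) m<..<min (r i) m} \<inter> {min (l j) m<..<min (r j) m} = {}"
      using s(1)[of i] s(1)[of j] by blast
  qed (use n m in \<open>auto simp: nonoverlapping_def min_def\<close>)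
  show "nonoverlapping I (\<lambda>i. max (l i) m) (\<lambda>i. max (r i) m) m b"
    unfolding nonoverlapping_def
  proof (intro conjI ballI impI)
    fix i j assume "i \<in> I" "j \<in> I" "i \<noteq> j"
    then have "{l i<..<r i} \<inter> {l j<..<r j} = {}" using n by (simp add: nonoverlapping_def)
    then show "{max (l i) m<..<max (r i) m} \<inter> {max (l j) m<..<max (r j) m} = {}"
      using s(2)[of i] s(2)[of j] by blast
  qed (use n m in \<open>auto simp: nonoverlapping_def max_def\<close>)
  show "(\<Sum>i\<in>I. \<bar>g (r i) - g (l i)\<bar>) \<le> (\<Sum>i\<in>I. \<bar>g (min (r i) m) - g (min (l i) m)\<bar>)
           + (\<Sum>i\<in>I. \<bar>g (max (r i) m) - g (max (l i) m)\<bar>)"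
    unfolding sum.distrib[symmetric]
  proof (rule sum_mono)
    fix i assume "i \<in> I"
    then have "l i \<le> r i" using n by (simp add: nonoverlapping_def)
    then show "\<bar>g (r i) - g (l i)\<bar> \<le> \<bar>g (min (r i) m) - g (min (l i) m)\<bar> + \<bar>g (max (r i) m) - g (max (l i) m)\<bar>"
      by (cases "r i \<le> m"; cases "l i \<le> m") (simp_all add: min_def max_def)
  qed
qed

section \<open>Total variation of an absolutely continuous function\<close>

definition variation_sums :: "(real \<Rightarrow> real) \<Rightarrow> real \<Rightarrow> real \<Rightarrow> real set" where
  "variation_sums g a b = {\<Sum>i\<in>I. \<bar>g (r i) - g (l i)\<bar> | (I :: nat set) l r. nonoverlapping I l r a b}"

definition variation :: "(real \<Rightarrow> real) \<Rightarrow> real \<Rightarrow> real \<Rightarrow> real" where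
  "variation g a b = Sup (variation_sums g a b)"

lemma variation_sums_nonempty: "variation_sums g a b \<noteq> {}"
proof -
  have "nonoverlapping ({} :: nat set) (\<lambda>_. 0) (\<lambda>_. 0) a b" by (simp add: nonoverlapping_def)
  then show ?thesis unfolding variation_sums_def by blast
qed

text \<open>Take the \<delta> that belongs to \<epsilon> = 1. Cutting the interval into pieces of
  length at most \<delta>/2, each piece contributes less than 1 to any sum; the half makes the
  strict inequality for the total length available.\<close>

lemma variation_sums_bdd:
  assumes ac: "abs_continuous_on a b g" and ab: "a \<le> x" "x \<le> y" "y \<le> b"
  shows "bdd_above (variation_sums g x y)"
proof -
  obtain \<delta> where \<delta>: "\<delta> > 0" "\<And>(I::nat set) l r. nonoverlapping I l r a b \<Longrightarrow> (\<Sum>i\<in>I. r i - l i) < \<delta> \<Longrightarrow>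
           (\<Sum>i\<in>I. \<bar>g (r i) - g (l i)\<bar>) < 1"
    using abs_continuous_on_nonoverlapping[OF ac zero_less_one, where 'i = nat] by blast
  have *: "\<lbrakk>nonoverlapping I l r u v; a \<le> u; u \<le> v; v \<le> b; v \<le> u + real k * (\<delta> / 2)\<rbrakk> \<Longrightarrow>
      (\<Sum>i\<in>I. \<bar>g (r i) - g (l i)\<bar>) \<le> real k" for k and I :: "nat set" and l r u v
  proof (induction k arbitrary: I l r u)
    case 0
    then have "r i = l i" if "i \<in> I" for i using that by (force simp: nonoverlapping_def)
    then show ?case by simp
  next
    case (Suc k)
    define m where "m = min v (u + \<delta> / 2)"
    have m: "u \<le> m" "m \<le> v" "m \<le> u + \<delta> / 2" using Suc.prems \<delta>(1) by (auto simp: m_def)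
    note sp = nonoverlapping_split[OF Suc.prems(1) m(1,2)]
    have "nonoverlapping I (\<lambda>i. min (l i) m) (\<lambda>i. min (r i) m) a b"
      using sp(1) Suc.prems(2,4) m unfolding nonoverlapping_def by fastforce
    moreover have "(\<Sum>i\<in>I. min (r i) m - min (l i) m) < \<delta>"
      using nonoverlapping_sum_length[OF sp(1) m(1)] m(3) \<delta>(1) by linarith
    ultimately have 1: "(\<Sum>i\<in>I. \<bar>g (min (r i) m) - g (min (l i) m)\<bar>) < 1" by (rule \<delta>(2))
    have "v \<le> m + real k * (\<delta> / 2)" using Suc.prems(5) \<delta>(1) by (auto simp: m_def min_def field_simps)
    then have 2: "(\<Sum>i\<in>I. \<bar>g (max (r i) m) - g (max (l i) m)\<bar>) \<le> real k"
      using Suc.prems m by (intro Suc.IH[OF sp(2)]) auto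
    show ?case using sp(3)[of g] 1 2 by simp
  qed
  obtain k :: nat where "(y - x) / (\<delta> / 2) < real k" using reals_Archimedean2 by blast
  then have k: "y \<le> x + real k * (\<delta> / 2)" using \<delta>(1) by (simp add: field_simps)
  show ?thesis
    unfolding bdd_above_def variation_sums_def using *[OF _ ab k] by blast
qed

lemma variation_ge:
  assumes "bdd_above (variation_sums g a b)" "nonoverlapping (I :: 'i set) l r a b"
  shows "(\<Sum>i\<in>I. \<bar>g (r i) - g (l i)\<bar>) \<le> variation g a b"
proof -
  obtain h where h: "bij_betw h {..<card I} I"
    using ex_bij_betw_nat_finite[of I] assms(2) by (auto simp: nonoverlapping_def lessThan_atLeast0)
  have hI: "h i \<in> I" if "i < card I" for i using h that by (auto simp: bij_betw_def)
  have hj: "h i \<noteq> h j" if "i < card I" "j < card I" "i \<noteq> j" for i j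
    using h that by (auto simp: bij_betw_def inj_on_def)
  have "nonoverlapping {..<card I} (l \<circ> h) (r \<circ> h) a b"
    using assms(2) hI hj by (auto simp: nonoverlapping_def)
  then have "(\<Sum>i<card I. \<bar>g ((r \<circ> h) i) - g ((l \<circ> h) i)\<bar>) \<in> variation_sums g a b"
    unfolding variation_sums_def by blast
  then have "(\<Sum>i<card I. \<bar>g ((r \<circ> h) i) - g ((l \<circ> h) i)\<bar>) \<le> variation g a b"
    unfolding variation_def by (rule cSup_upper[OF _ assms(1)])
  then show ?thesis
    using sum.reindex_bij_betw[OF h, of "\<lambda>i. \<bar>g (r i) - g (l i)\<bar>"] by simp
qed

lemma variation_approx:
  assumes "c < variation g a b"
  obtains I :: "nat set" and l r where "nonoverlapping I l r a b" "c < (\<Sum>i\<in>I. \<bar>g (r i) - g (l i)\<bar>)"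
  using less_cSupD[OF variation_sums_nonempty assms[unfolded variation_def]]
  unfolding variation_sums_def by blast

lemma nonoverlapping_Sigma:
  assumes I: "nonoverlapping I l r a b"
    and J: "\<And>i. i \<in> I \<Longrightarrow> nonoverlapping (J i) (u i) (v i) (l i) (r i)"
  shows "nonoverlapping (Sigma I J) (\<lambda>(i, j). u i j) (\<lambda>(i, j). v i j) a b"
  unfolding nonoverlapping_def
proof (intro conjI ballI impI)
  show "finite (Sigma I J)" using I J by (intro finite_SigmaI) (auto simp: nonoverlapping_def)
  fix p assume p: "p \<in> Sigma I J"
  then obtain i j where p': "p = (i, j)" "i \<in> I" "j \<in> J i" by blast
  have 1: "l i \<le> u i j" "u i j \<le> v i j" "v i j \<le> r i" "a \<le> l i" "r i \<le> b"
    using J[OF p'(2)] p'(2,3) I by (auto simp: nonoverlapping_def)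
  show "a \<le> (case p of (i, j) \<Rightarrow> u i j)" "(case p of (i, j) \<Rightarrow> u i j) \<le> (case p of (i, j) \<Rightarrow> v i j)"
    "(case p of (i, j) \<Rightarrow> v i j) \<le> b" using 1 p' by auto
  fix q assume q: "q \<in> Sigma I J" "p \<noteq> q"
  then obtain i' j' where q': "q = (i', j')" "i' \<in> I" "j' \<in> J i'" by blast
  have 2: "l i' \<le> u i' j'" "v i' j' \<le> r i'"
    using J[OF q'(2)] q'(2,3) by (auto simp: nonoverlapping_def)
  have "{u i j<..<v i j} \<inter> {u i' j'<..<v i' j'} = {}"
  proof (cases "i = i'")
    case True
    then show ?thesis using J[OF p'(2)] p' q' q(2) by (auto simp: nonoverlapping_def)
  next
    case False
    then have "{l i<..<r i} \<inter> {l i'<..<r i'} = {}" using I p' q' by (simp add: nonoverlapping_def)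
    moreover have "{u i j<..<v i j} \<subseteq> {l i<..<r i}" "{u i' j'<..<v i' j'} \<subseteq> {l i'<..<r i'}"
      using 1 2 by auto
    ultimately show ?thesis by blast
  qed
  then show "{case p of (i, j) \<Rightarrow> u i j<..<case p of (i, j) \<Rightarrow> v i j} \<inter>
      {case q of (i, j) \<Rightarrow> u i j<..<case q of (i, j) \<Rightarrow> v i j} = {}" using p' q' by simp
qed

lemma variation_subadditive:
  assumes bd: "bdd_above (variation_sums g a m)" "bdd_above (variation_sums g m b)" and m: "a \<le> m" "m \<le> b"
  shows "variation g a b \<le> variation g a m + variation g m b"
  unfolding variation_def[of g a b]
proof (rule cSup_least[OF variation_sums_nonempty])
  fix s assume "s \<in> variation_sums g a b"
  then obtain I :: "nat set" and l r where n: "nonoverlapping I l r a b" "s = (\<Sum>i\<in>I. \<bar>g (r i) - g (l i)\<bar>)"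
    unfolding variation_sums_def by blast
  show "s \<le> variation g a m + variation g m b"
    using nonoverlapping_split(3)[OF n(1) m, of g] variation_ge[OF bd(1) nonoverlapping_split(1)[OF n(1) m]]
      variation_ge[OF bd(2) nonoverlapping_split(2)[OF n(1) m]] n(2)
    by linarith
qed

text \<open>Almost optimal families inside the single intervals join into one family indexed by
  pairs, whose total length has not grown, so the assumed bound applies to it. Each interval may
  lose \<open>c\<close>; the + 1 in \<open>c\<close> covers an empty \<open>I\<close>. Both
  superadditivity and absolute continuity of the variation follow from this.\<close>

lemma sum_variation_le:
  fixes I :: "nat set"
  assumes I: "nonoverlapping I l r a b"
    and bound: "\<And>J :: (nat \<times> nat) set. \<And>u v. nonoverlapping J u v a b \<Longrightarrow> (\<Sum>j\<in>J. v j - u j) \<le> (\<Sum>i\<in>I. r i - l i) \<Longrightarrow>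
      (\<Sum>j\<in>J. \<bar>g (v j) - g (u j)\<bar>) \<le> B"
  shows "(\<Sum>i\<in>I. variation g (l i) (r i)) \<le> B"
proof (rule field_le_epsilon)
  fix e :: real assume e: "e > 0"
  define c where "c = e / (real (card I) + 1)"
  have c: "c > 0" using e by (simp add: c_def)
  have "\<exists>J u v. nonoverlapping (J :: nat set) u v (l i) (r i) \<and>
      variation g (l i) (r i) - c < (\<Sum>j\<in>J. \<bar>g (v j) - g (u j)\<bar>)" for i
  proof -
    have "variation g (l i) (r i) - c < variation g (l i) (r i)" using c by simp
    from variation_approx[OF this] show ?thesis by blast
  qed
  then have "\<forall>i. \<exists>J u v. nonoverlapping (J :: nat set) u v (l i) (r i) \<and>
      variation g (l i) (r i) - c < (\<Sum>j\<in>J. \<bar>g (v j) - g (u j)\<bar>)" by (rule allI)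
  from this[unfolded choice_iff] obtain J u v where J: "\<And>i. nonoverlapping (J i :: nat set) (u i) (v i) (l i) (r i)"
    "\<And>i. variation g (l i) (r i) - c < (\<Sum>j\<in>J i. \<bar>g (v i j) - g (u i j)\<bar>)" by blast
  have fin: "finite I" "\<forall>i\<in>I. finite (J i)" using I J(1) by (auto simp: nonoverlapping_def)
  have "(\<Sum>(i, j)\<in>Sigma I J. v i j - u i j) \<le> (\<Sum>i\<in>I. r i - l i)"
    unfolding sum.Sigma[OF fin, symmetric]
    using I by (intro sum_mono nonoverlapping_sum_length[OF J(1)]) (auto simp: nonoverlapping_def)
  then have "(\<Sum>p\<in>Sigma I J. \<bar>g ((\<lambda>(i,j). v i j) p) - g ((\<lambda>(i,j). u i j) p)\<bar>) \<le> B"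
    by (intro bound nonoverlapping_Sigma[OF I J(1)]) (simp add: split_def)
  then have *: "(\<Sum>i\<in>I. \<Sum>j\<in>J i. \<bar>g (v i j) - g (u i j)\<bar>) \<le> B"
    unfolding sum.Sigma[OF fin] by (simp add: split_def)
  have "(\<Sum>i\<in>I. variation g (l i) (r i)) \<le> (\<Sum>i\<in>I. (\<Sum>j\<in>J i. \<bar>g (v i j) - g (u i j)\<bar>) + c)"
  proof (rule sum_mono)
    fix i
    show "variation g (l i) (r i) \<le> (\<Sum>j\<in>J i. \<bar>g (v i j) - g (u i j)\<bar>) + c"
      using J(2)[of i] by linarith
  qed
  also have "\<dots> \<le> B + real (card I) * c" using * by (simp add: sum.distrib)
  also have "real (card I) * c \<le> e" using e by (simp add: c_def field_simps)
  finally show "(\<Sum>i\<in>I. variation g (l i) (r i)) \<le> B + e" by simp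
qed

lemma variation_superadditive:
  assumes bd: "bdd_above (variation_sums g a b)" and m: "a \<le> m" "m \<le> b"
  shows "variation g a m + variation g m b \<le> variation g a b"
proof -
  let ?l = "\<lambda>i::nat. if i = 0 then a else m" and ?r = "\<lambda>i::nat. if i = 0 then m else b"
  have "nonoverlapping {0, 1} ?l ?r a b" using m by (auto simp: nonoverlapping_def)
  from sum_variation_le[OF this variation_ge[OF bd]]
  show ?thesis by simp
qed

lemma variation_diff:
  assumes ac: "abs_continuous_on a b g" and ab: "a \<le> x" "x \<le> y" "y \<le> b"
  shows "variation g a y - variation g a x = variation g x y" and "\<bar>g y - g x\<bar> \<le> variation g x y"
proof -
  note bd = variation_sums_bdd[OF ac]
  show "variation g a y - variation g a x = variation g x y"
    using variation_subadditive[of g a x y] variation_superadditive[of g a y x]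
      bd[of a x] bd[of x y] bd[of a y] ab by simp
  have n: "nonoverlapping {0::nat} (\<lambda>_. x) (\<lambda>_. y) x y" using ab by (simp add: nonoverlapping_def)
  show "\<bar>g y - g x\<bar> \<le> variation g x y"
    using variation_ge[OF bd n] ab by simp
qed

text \<open>A refinement inside the given intervals is no longer than the intervals themselves, so
  the \<delta> of \<open>g\<close> serves again. It is taken for \<epsilon>/2 because passing to the
  suprema weakens the strict inequality.\<close>

lemma variation_abs_continuous:
  assumes ac: "abs_continuous_on a b g"
  shows "abs_continuous_on a b (variation g a)"
  unfolding abs_continuous_on_def
proof (intro allI impI)
  fix \<epsilon> :: real assume e: "\<epsilon> > 0"
  obtain \<delta> where \<delta>: "\<delta> > 0" "\<And>(I::(nat \<times> nat) set) l r. nonoverlapping I l r a b \<Longrightarrow> (\<Sum>i\<in>I. r i - l i) < \<delta> \<Longrightarrow>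
           (\<Sum>i\<in>I. \<bar>g (r i) - g (l i)\<bar>) < \<epsilon> / 2"
    using abs_continuous_on_nonoverlapping[OF ac half_gt_zero[OF e], where 'i = "nat \<times> nat"] by blast
  show "\<exists>\<delta>>0. \<forall>(n::nat) l r.
        (\<forall>i<n. a \<le> l i \<and> l i \<le> r i \<and> r i \<le> b) \<longrightarrow>
        (\<forall>i<n. \<forall>j<n. i \<noteq> j \<longrightarrow> {l i<..<r i} \<inter> {l j<..<r j} = {}) \<longrightarrow>
        (\<Sum>i<n. r i - l i) < \<delta> \<longrightarrow> (\<Sum>i<n. \<bar>variation g a (r i) - variation g a (l i)\<bar>) < \<epsilon>"
  proof (intro exI[of _ \<delta>] conjI allI impI \<delta>(1))
    fix n :: nat and l r
    assume 1: "\<forall>i<n. a \<le> l i \<and> l i \<le> r i \<and> r i \<le> b"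
      and 2: "\<forall>i<n. \<forall>j<n. i \<noteq> j \<longrightarrow> {l i<..<r i} \<inter> {l j<..<r j} = {}"
      and 3: "(\<Sum>i<n. r i - l i) < \<delta>"
    have n: "nonoverlapping {..<n} l r a b" using 1 2 by (simp add: nonoverlapping_def)
    have "(\<Sum>i<n. \<bar>variation g a (r i) - variation g a (l i)\<bar>) = (\<Sum>i<n. variation g (l i) (r i))"
    proof (rule sum.cong)
      fix i assume "i \<in> {..<n}"
      then have i: "a \<le> l i" "l i \<le> r i" "r i \<le> b" using 1 by auto
      show "\<bar>variation g a (r i) - variation g a (l i)\<bar> = variation g (l i) (r i)"
        using variation_diff[OF ac i] by linarith
    qed simp
    also have "\<dots> \<le> \<epsilon> / 2"
    proof (rule sum_variation_le[OF n])
      fix J :: "(nat \<times> nat) set" and u v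
      assume "nonoverlapping J u v a b" "(\<Sum>j\<in>J. v j - u j) \<le> (\<Sum>i<n. r i - l i)"
      then show "(\<Sum>j\<in>J. \<bar>g (v j) - g (u j)\<bar>) \<le> \<epsilon> / 2" using \<delta>(2)[of J u v] 3 by simp
    qed
    finally show "(\<Sum>i<n. \<bar>variation g a (r i) - variation g a (l i)\<bar>) < \<epsilon>" using e by simp
  qed
qed

lemma abs_continuous_on_diff:
  assumes "abs_continuous_on a b f" "abs_continuous_on a b g"
  shows "abs_continuous_on a b (\<lambda>x. f x - g x)"
  unfolding abs_continuous_on_def
proof (intro allI impI)
  fix \<epsilon> :: real assume e: "\<epsilon> > 0"
  obtain \<delta> where \<delta>: "\<delta> > 0" "\<And>(I::nat set) l r. nonoverlapping I l r a b \<Longrightarrow> (\<Sum>i\<in>I. r i - l i) < \<delta> \<Longrightarrow>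
           (\<Sum>i\<in>I. \<bar>f (r i) - f (l i)\<bar>) < \<epsilon> / 2"
    using abs_continuous_on_nonoverlapping[OF assms(1) half_gt_zero[OF e], where 'i = nat] by blast
  obtain \<delta>' where \<delta>': "\<delta>' > 0" "\<And>(I::nat set) l r. nonoverlapping I l r a b \<Longrightarrow> (\<Sum>i\<in>I. r i - l i) < \<delta>' \<Longrightarrow>
           (\<Sum>i\<in>I. \<bar>g (r i) - g (l i)\<bar>) < \<epsilon> / 2"
    using abs_continuous_on_nonoverlapping[OF assms(2) half_gt_zero[OF e], where 'i = nat] by blast
  show "\<exists>\<delta>>0. \<forall>(n::nat) l r.
        (\<forall>i<n. a \<le> l i \<and> l i \<le> r i \<and> r i \<le> b) \<longrightarrow>
        (\<forall>i<n. \<forall>j<n. i \<noteq> j \<longrightarrow> {l i<..<r i} \<inter> {l j<..<r j} = {}) \<longrightarrow>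
        (\<Sum>i<n. r i - l i) < \<delta> \<longrightarrow> (\<Sum>i<n. \<bar>f (r i) - g (r i) - (f (l i) - g (l i))\<bar>) < \<epsilon>"
  proof (intro exI[of _ "min \<delta> \<delta>'"] conjI allI impI)
    show "0 < min \<delta> \<delta>'" using \<delta>(1) \<delta>'(1) by simp
    fix n :: nat and l r
    assume 1: "\<forall>i<n. a \<le> l i \<and> l i \<le> r i \<and> r i \<le> b"
      and 2: "\<forall>i<n. \<forall>j<n. i \<noteq> j \<longrightarrow> {l i<..<r i} \<inter> {l j<..<r j} = {}"
      and 3: "(\<Sum>i<n. r i - l i) < min \<delta> \<delta>'"
    have n: "nonoverlapping {..<n} l r a b" using 1 2 by (simp add: nonoverlapping_def)
    have "(\<Sum>i<n. \<bar>f (r i) - g (r i) - (f (l i) - g (l i))\<bar>) \<le>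
        (\<Sum>i<n. \<bar>f (r i) - f (l i)\<bar> + \<bar>g (r i) - g (l i)\<bar>)"
      by (rule sum_mono) linarith
    also have "\<dots> < \<epsilon>" using \<delta>(2)[OF n] \<delta>'(2)[OF n] 3 by (simp add: sum.distrib)
    finally show "(\<Sum>i<n. \<bar>f (r i) - g (r i) - (f (l i) - g (l i))\<bar>) < \<epsilon>" .
  qed
qed

text \<open>A nondecreasing \<open>G\<close> defines a Stieltjes measure. Absolute continuity of
  \<open>G\<close> says that Lebesgue null sets are null for this measure, and the Radon-Nikodym
  density is then the integrand.\<close>

lemma abs_continuous_on_mono_density:
  assumes ac: "abs_continuous_on a b G" and ab: "a < b"
    and mono: "\<And>x y. a \<le> x \<Longrightarrow> x \<le> y \<Longrightarrow> y \<le> b \<Longrightarrow> G x \<le> G y"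
  shows "\<exists>f. f absolutely_integrable_on {a..b} \<and> (\<forall>x\<in>{a..b}. (f has_integral (G x - G a)) {a..x})"
proof -
  \<comment> \<open>Extended by constants, so that it is nondecreasing and continuous on the whole
    line, as \<open>interval_measure\<close> expects.\<close>
  define F where "F x = G (max a (min x b))" for x
  have FG: "F x = G x" if "a \<le> x" "x \<le> b" for x using that by (simp add: F_def)
  have Fmono: "F x \<le> F y" if "x \<le> y" for x y
    unfolding F_def using that ab by (intro mono) auto
  have Fcont: "continuous_on UNIV F"
    unfolding continuous_on_iff
  proof (intro ballI allI impI)
    fix x e :: real assume e: "e > 0"
    obtain \<delta> where \<delta>: "\<delta> > 0" "\<And>(I::nat set) l r. nonoverlapping I l r a b \<Longrightarrow> (\<Sum>i\<in>I. r i - l i) < \<delta> \<Longrightarrow>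
           (\<Sum>i\<in>I. \<bar>G (r i) - G (l i)\<bar>) < e"
      using abs_continuous_on_nonoverlapping[OF ac e, where 'i = nat] by blast
    have *: "\<bar>F v - F u\<bar> < e" if "u \<le> v" "v - u < \<delta>" for u v
    proof -
      have "nonoverlapping {0::nat} (\<lambda>_. max a (min u b)) (\<lambda>_. max a (min v b)) a b"
        using that(1) ab by (auto simp: nonoverlapping_def)
      from \<delta>(2)[OF this] show ?thesis using that by (auto simp: F_def max_def min_def split: if_splits)
    qed
    show "\<exists>d>0. \<forall>x'\<in>UNIV. dist x' x < d \<longrightarrow> dist (F x') (F x) < e"
    proof (intro exI[of _ \<delta>] conjI ballI impI \<delta>(1))
      fix x' assume "dist x' x < \<delta>"
      then show "dist (F x') (F x) < e"
        using *[of x x'] *[of x' x] by (cases "x \<le> x'") (auto simp: dist_real_def abs_minus_commute)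
    qed
  qed
  define \<mu> where "\<mu> = interval_measure F"
  have sets_mu[measurable_cong]: "sets \<mu> = sets borel" by (simp add: \<mu>_def)
  have mu_Icc: "emeasure \<mu> {u..v} = F v - F u" if "u \<le> v" for u v
    unfolding \<mu>_def using that Fmono Fcont by (rule emeasure_interval_measure_Icc)
  \<comment> \<open>The null set lies in an open \<open>T\<close> of measure less than \<delta>. A
    covering by countably many nonoverlapping closed intervals inside \<open>T\<close> has total
    length below \<delta>, so the increments of \<open>G\<close> over any finitely many of them sum
    to less than \<open>e\<close>.\<close>
  have null: "emeasure \<mu> (A \<inter> {a..b}) = 0" if A: "A \<in> null_sets lborel" for A
  proof -
    have "emeasure \<mu> (A \<inter> {a..b}) \<le> 0"
    proof (rule ennreal_le_epsilon)
      fix e :: real assume e: "e > 0"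
      obtain \<delta> where \<delta>: "\<delta> > 0" "\<And>(I::nat set) l r. nonoverlapping I l r a b \<Longrightarrow> (\<Sum>i\<in>I. r i - l i) < \<delta> \<Longrightarrow>
             (\<Sum>i\<in>I. \<bar>G (r i) - G (l i)\<bar>) < e"
        using abs_continuous_on_nonoverlapping[OF ac e, where 'i = nat] by blast
      have Al: "A \<in> null_sets lebesgue" using A by (rule null_sets_completionI)
      then have "A \<in> sets lebesgue" by auto
      then obtain T where T: "open T" "A \<subseteq> T" "(T - A) \<in> lmeasurable" "emeasure lebesgue (T - A) < ennreal \<delta>"
        by (rule sets_lebesgue_outer_open[OF _ \<delta>(1)])
      have Tb: "T \<in> sets lebesgue" using T(1) by simp
      have "emeasure lebesgue T = emeasure lebesgue (T - A)"
        using emeasure_Diff_null_set[OF Al Tb] by simp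
      with T(4) have Tm: "emeasure lebesgue T < ennreal \<delta>" by simp
      \<comment> \<open>This gauge forces every interval of the covering into \<open>T\<close>,
        since each is tagged by a point of \<open>A\<close>.\<close>
      define g where "g x = (if x \<in> T then T else UNIV)" for x
      have g: "gauge g" using T(1) by (auto simp: gauge_def g_def)
      have Ac: "A \<inter> {a..b} \<subseteq> cbox a b" and bx: "box a b \<noteq> {}" using ab by auto
      obtain D where D: "countable D" "\<Union>D \<subseteq> cbox a b"
          "\<And>K. K \<in> D \<Longrightarrow> interior K \<noteq> {} \<and> (\<exists>c d. K = cbox c d)"
          "pairwise (\<lambda>A B. interior A \<inter> interior B = {}) D"
          "\<And>K. K \<in> D \<Longrightarrow> \<exists>x \<in> (A \<inter> {a..b}) \<inter> K. K \<subseteq> g x"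
          "\<And>u v. cbox u v \<in> D \<Longrightarrow> \<exists>n. \<forall>i \<in> Basis. v \<bullet> i - u \<bullet> i = (b \<bullet> i - a \<bullet> i) / 2^n"
          "A \<inter> {a..b} \<subseteq> \<Union>D"
        by (rule covering_lemma[OF Ac bx g]) (rule that)
      \<comment> \<open>The intervals are numbered by \<open>to_nat_on D\<close>; a number that is
        not in use gets the degenerate interval at \<open>a\<close>.\<close>
      define l where "l i = (if i \<in> to_nat_on D ` D then Inf (from_nat_into D i) else a)" for i
      define r where "r i = (if i \<in> to_nat_on D ` D then Sup (from_nat_into D i) else a)" for i
      have Dlr: "\<exists>K\<in>D. i = to_nat_on D K \<and> K = {l i..r i} \<and> l i < r i" if "i \<in> to_nat_on D ` D" for i
      proof -
        from that obtain K where K: "i = to_nat_on D K" "K \<in> D" by (rule imageE)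
        then have fK: "from_nat_into D i = K" using D(1) by simp
        obtain c d where cd: "K = {c..d}" using D(3)[OF K(2)] by auto
        have "c < d" using D(3)[OF K(2)] cd by (auto simp: interior_atLeastAtMost_real)
        then show ?thesis using K fK cd that by (intro bexI[of _ K]) (auto simp: l_def r_def)
      qed
      have lr: "a \<le> l i \<and> l i \<le> r i \<and> r i \<le> b" for i
      proof (cases "i \<in> to_nat_on D ` D")
        case True
        then obtain K where "K \<in> D" "K = {l i..r i}" "l i < r i" using Dlr by blast
        moreover from this have "{l i..r i} \<subseteq> cbox a b" using D(2) by blast
        then have "l i \<in> cbox a b" "r i \<in> cbox a b" using \<open>l i < r i\<close> by auto
        ultimately show ?thesis by auto
      qed (use ab in \<open>auto simp: l_def r_def\<close>)
      have dis: "{l i<..<r i} \<inter> {l j<..<r j} = {}" if "i \<noteq> j" for i j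
      proof (cases "i \<in> to_nat_on D ` D \<and> j \<in> to_nat_on D ` D")
        case True
        then obtain K L where K: "K \<in> D" "i = to_nat_on D K" "K = {l i..r i}"
            and L: "L \<in> D" "j = to_nat_on D L" "L = {l j..r j}" using Dlr by metis
        then have "K \<noteq> L" using \<open>i = to_nat_on D K\<close> \<open>j = to_nat_on D L\<close> that by blast
        then have "interior K \<inter> interior L = {}" using D(4) K(1) L(1) by (auto simp: pairwise_def)
        then show ?thesis by (simp add: K(3) L(3) interior_atLeastAtMost_real)
      qed (auto simp: l_def r_def)
      have lrT: "{l i<..<r i} \<subseteq> T" for i
      proof (cases "i \<in> to_nat_on D ` D")
        case True
        then obtain K where K: "K \<in> D" "K = {l i..r i}" using Dlr by blast
        from D(5)[OF K(1)] obtain x where "x \<in> A" "K \<subseteq> g x" by blast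
        then have "K \<subseteq> T" using T(2) by (auto simp: g_def split: if_splits)
        then show ?thesis using K by auto
      qed (simp add: l_def r_def)
      have n: "nonoverlapping {..<k} l r a b" for k using lr dis by (simp add: nonoverlapping_def)
      have len: "(\<Sum>i<k. r i - l i) < \<delta>" for k
      proof -
        have "emeasure lebesgue {l i<..<r i} = ennreal (r i - l i)" for i using lr[of i] by simp
        moreover have "(\<Sum>i<k. ennreal (r i - l i)) = ennreal (\<Sum>i<k. r i - l i)"
          using lr by (intro sum_ennreal) simp
        ultimately have "ennreal (\<Sum>i<k. r i - l i) = (\<Sum>i<k. emeasure lebesgue {l i<..<r i})" by simp
        also have "\<dots> = emeasure lebesgue (\<Union>i<k. {l i<..<r i})"
          using dis by (intro sum_emeasure) (auto simp: disjoint_family_on_def)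
        also have "\<dots> \<le> emeasure lebesgue T" using lrT Tb by (intro emeasure_mono) auto
        also have "\<dots> < ennreal \<delta>" by (rule Tm)
        finally show ?thesis using \<delta>(1) by (simp add: ennreal_less_iff sum_nonneg lr)
      qed
      have "A \<inter> {a..b} \<subseteq> (\<Union>i. {l i..r i})"
      proof
        fix x assume "x \<in> A \<inter> {a..b}"
        then obtain K where K: "K \<in> D" "x \<in> K" using D(7) by blast
        obtain L where L: "L \<in> D" "to_nat_on D K = to_nat_on D L" "L = {l (to_nat_on D K)..r (to_nat_on D K)}"
          using Dlr[of "to_nat_on D K"] K(1) by blast
        have "K = L" using inj_onD[OF inj_on_to_nat_on[OF D(1)] L(2) K(1) L(1)]  by simp
        then show "x \<in> (\<Union>i. {l i..r i})" using L(3) K(2) \<open>K = L\<close> by blast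
      qed
      then have "emeasure \<mu> (A \<inter> {a..b}) \<le> emeasure \<mu> (\<Union>i. {l i..r i})"
        by (intro emeasure_mono) (auto simp: sets_mu)
      also have "\<dots> \<le> (\<Sum>i. emeasure \<mu> {l i..r i})"
        by (intro emeasure_subadditive_countably) (auto simp: sets_mu)
      also have "\<dots> \<le> ennreal e"
      proof (rule suminf_le_const)
        fix k
        have "emeasure \<mu> {l i..r i} = ennreal (\<bar>G (r i) - G (l i)\<bar>)" for i
        proof -
          have "a \<le> l i" "l i \<le> r i" "r i \<le> b" using lr[of i] by auto
          then show ?thesis using mu_Icc[of "l i" "r i"] FG[of "l i"] FG[of "r i"] mono[of "l i" "r i"] by simp
        qed
        then have "(\<Sum>i<k. emeasure \<mu> {l i..r i}) = (\<Sum>i<k. ennreal (\<bar>G (r i) - G (l i)\<bar>))" by simp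
        also have "\<dots> = ennreal (\<Sum>i<k. \<bar>G (r i) - G (l i)\<bar>)" by (simp add: sum_ennreal)
        also have "\<dots> \<le> ennreal e" using \<delta>(2)[OF n len, of k] by (intro ennreal_leI) simp
        finally show "(\<Sum>i<k. emeasure \<mu> {l i..r i}) \<le> ennreal e" .
      qed simp
      finally show "emeasure \<mu> (A \<inter> {a..b}) \<le> 0 + ennreal e" by simp
    qed
    then show ?thesis by simp
  qed
  define \<nu> where "\<nu> = density \<mu> (indicator {a..b})"
  have sets_nu: "sets \<nu> = sets lborel" by (simp add: \<nu>_def sets_mu)
  have nu: "emeasure \<nu> A = emeasure \<mu> (A \<inter> {a..b})" if "A \<in> sets borel" for A
    unfolding \<nu>_def using that by (subst emeasure_density) (auto simp: sets_mu indicator_inter_arith[symmetric]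
        mult.commute nn_integral_indicator)
  have "absolutely_continuous lborel \<nu>"
    unfolding absolutely_continuous_def
  proof
    fix A :: "real set" assume A: "A \<in> null_sets lborel"
    then have "A \<in> sets borel" by auto
    then show "A \<in> null_sets \<nu>" using null[OF A] nu[of A] sets_nu by (intro null_setsI) auto
  qed
  from sigma_finite_measure.Radon_Nikodym[OF sigma_finite_lborel this sets_nu] obtain f where
    f[measurable]: "f \<in> borel_measurable lborel" and fd: "density lborel f = \<nu>" by blast
  have nf: "(\<integral>\<^sup>+y. f y * indicator {a..x} y \<partial>lborel) = ennreal (G x - G a)" if x: "x \<in> {a..b}" for x
  proof -
    have "{a..x} \<inter> {a..b} = {a..x}" using x by auto
    then have "emeasure \<nu> {a..x} = ennreal (G x - G a)" using nu[of "{a..x}"] mu_Icc[of a x] FG x ab by simp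
    then show ?thesis unfolding fd[symmetric] by (subst (asm) emeasure_density) auto
  qed
  define h where "h y = enn2real (f y)" for y
  have hm[measurable]: "h \<in> borel_measurable lborel" unfolding h_def by measurable
  have "AE y in lborel. f y * indicator {a..b} y \<noteq> \<infinity>"
    using nf[of b] ab by (intro nn_integral_PInf_AE) auto
  then have fh: "AE y in lborel. y \<in> {a..b} \<longrightarrow> f y = ennreal (h y)"
    by eventually_elim (auto simp: h_def indicator_def ennreal_enn2real_if)
  have hi: "(h has_integral (G x - G a)) {a..x}" if x: "x \<in> {a..b}" for x
  proof -
    have "(\<integral>\<^sup>+y. ennreal (h y * indicator {a..x} y) \<partial>lborel) = (\<integral>\<^sup>+y. f y * indicator {a..x} y \<partial>lborel)"
      using fh by (intro nn_integral_cong_AE, eventually_elim) (use x in \<open>auto simp: indicator_def\<close>)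
    also note nf[OF x]
    finally have "((\<lambda>y. h y * indicator {a..x} y) has_integral (G x - G a)) UNIV"
      using x mono by (intro nn_integral_has_integral) (auto simp: h_def)
    also have "(\<lambda>y. h y * indicator {a..x} y) = (\<lambda>y. if y \<in> {a..x} then h y else 0)"
      by (auto simp: indicator_def)
    finally show ?thesis by (simp only: has_integral_restrict_UNIV)
  qed
  have "h absolutely_integrable_on {a..b}"
    using hi[of b] ab by (intro nonnegative_absolutely_integrable_1) (auto simp: h_def)
  with hi show ?thesis by blast
qed

text \<open>Jordan decomposition: \<open>g\<close> is the difference of its variation
  \<open>?V\<close> and \<open>?V - g\<close>, both nondecreasing and absolutely continuous, hence
  both integrals of densities. The derivative almost everywhere is then that of an indefinite
  integral.\<close>

theorem abs_continuous_on_FTC: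
  assumes ac: "abs_continuous_on a b g" and ab: "a < b"
  obtains f where "f absolutely_integrable_on {a..b}"
    "\<And>x. x \<in> {a..b} \<Longrightarrow> (f has_integral (g x - g a)) {a..x}"
    "AE x in lebesgue. x \<in> {a<..<b} \<longrightarrow> (g has_real_derivative f x) (at x)"
proof -
  let ?V = "variation g a"
  have V: "abs_continuous_on a b ?V" using ac by (rule variation_abs_continuous)
  have Vd: "\<bar>g y - g x\<bar> \<le> ?V y - ?V x" if "a \<le> x" "x \<le> y" "y \<le> b" for x y
    using variation_diff[OF ac that] by linarith
  obtain f1 where f1: "f1 absolutely_integrable_on {a..b}" "\<forall>x\<in>{a..b}. (f1 has_integral (?V x - ?V a)) {a..x}"
    using abs_continuous_on_mono_density[OF V ab] Vd by (smt (verit))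
  have "?V x - g x \<le> ?V y - g y" if "a \<le> x" "x \<le> y" "y \<le> b" for x y
    using Vd[OF that] by linarith
  then obtain f2 where f2: "f2 absolutely_integrable_on {a..b}"
    "\<forall>x\<in>{a..b}. (f2 has_integral ((?V x - g x) - (?V a - g a))) {a..x}"
    using abs_continuous_on_mono_density[OF abs_continuous_on_diff[OF V ac] ab] by blast
  define f where "f x = f1 x - f2 x" for x
  have 1: "f absolutely_integrable_on {a..b}"
    unfolding f_def using f1(1) f2(1) by (rule set_integral_diff)
  have 2: "(f has_integral (g x - g a)) {a..x}" if "x \<in> {a..b}" for x
    using has_integral_diff[OF f1(2)[rule_format, OF that] f2(2)[rule_format, OF that]]
    unfolding f_def by simp
  define h where "h x = (if x \<in> {a..b} then f x else 0)" for x
  have "h integrable_on UNIV"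
    unfolding h_def using set_lebesgue_integral_eq_integral(1)[OF 1] by (simp only: integrable_restrict_UNIV)
  then have "h integrable_on {u..v}" for u v by (rule integrable_on_subinterval) simp
  from lebesgue_differentiation[OF this]
  have 3: "AE x in lebesgue. x \<in> {a<..<b} \<longrightarrow> (g has_real_derivative f x) (at x)"
  proof eventually_elim
    case (elim x)
    show ?case
    proof
      assume x: "x \<in> {a<..<b}"
      then have d: "((\<lambda>y. integral {a..y} h) has_real_derivative f x) (at x)"
        using elim by (simp add: h_def)
      have "((\<lambda>y. g y - g a) has_real_derivative f x) (at x)"
      proof (rule has_field_derivative_transform_within_open[OF d open_greaterThanLessThan x])
        fix y assume y: "y \<in> {a<..<b}"
        have "integral {a..y} h = integral {a..y} f"
          using y by (intro integral_cong) (auto simp: h_def)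
        then show "integral {a..y} h = g y - g a" using integral_unique[OF 2[of y]] y by simp
      qed
      from DERIV_add[OF this DERIV_const[of "g a"]] show "(g has_real_derivative f x) (at x)" by simp
    qed
  qed
  show thesis using that 1 2 3 by blast
qed

section \<open>The degenerate operator and its resolvent\<close>

lemma L2_fun_bound:
  assumes "f \<in> borel_measurable unit_leb" "L2_fun h" "\<And>x. x \<in> {0<..<1} \<Longrightarrow> \<bar>f x\<bar> \<le> \<bar>h x\<bar>"
  shows "L2_fun f"
  unfolding L2_fun_def
proof
  show "integrable unit_leb (\<lambda>x. (f x)\<^sup>2)"
  proof (rule Bochner_Integration.integrable_bound[OF L2_fun_integrable_sq[OF assms(2)]])
    show "(\<lambda>x. (f x)\<^sup>2) \<in> borel_measurable unit_leb" using assms(1) by (rule borel_measurable_power)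
    show "AE x in unit_leb. norm ((f x)\<^sup>2) \<le> norm ((h x)\<^sup>2)"
      using assms(3) by (intro AE_I2) (simp add: abs_le_square_iff[symmetric])
  qed
qed (rule assms(1))

lemma borel_imp_unit_leb: "f \<in> borel_measurable borel \<Longrightarrow> f \<in> borel_measurable unit_leb"
  by (intro measurable_restrict_space1 measurable_completion) simp

lemma integrable_unit_leb_powr:
  assumes "a > -1" shows "integrable unit_leb (\<lambda>x. x powr a)"
proof -
  have "(\<lambda>x::real. x powr a) integrable_on {0..1}" using assms by (intro integrable_on_powr_from_0) auto
  then have "(\<lambda>x::real. x powr a) absolutely_integrable_on {0..1}"
    by (intro nonnegative_absolutely_integrable_1) auto
  then have "(\<lambda>x::real. x powr a) absolutely_integrable_on {0<..<1}"
    by (rule set_integrable_subset) auto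
  then show ?thesis by (simp add: integrable_restrict_space set_integrable_def)
qed

lemma L2_fun_powr:
  assumes "a > -1/2" shows "L2_fun (\<lambda>x. x powr a)"
  unfolding L2_fun_def
proof
  show "(\<lambda>x. x powr a) \<in> borel_measurable unit_leb" by (rule borel_imp_unit_leb) measurable
  have "(\<lambda>x::real. (x powr a)\<^sup>2) = (\<lambda>x. x powr (2 * a))"
    by (auto simp: power2_eq_square powr_add[symmetric])
  then show "integrable unit_leb (\<lambda>x. (x powr a)\<^sup>2)"
    using integrable_unit_leb_powr[of "2 * a"] assms by simp
qed

lemma AE_unit_lebI: "AE x in lebesgue. x \<in> {0<..<1} \<longrightarrow> P x \<Longrightarrow> AE x in unit_leb. P x"
  by (subst AE_restrict_space_iff) auto

lemma AE_unit_lebD: "AE x in unit_leb. P x \<Longrightarrow> AE x in lebesgue. x \<in> {0<..<1} \<longrightarrow> P x"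
  by (subst (asm) AE_restrict_space_iff) auto

text \<open>Completeness of Lebesgue measure. It is what makes \<open>deriv\<close> of a flux
  measurable, as this is known only almost everywhere.\<close>

lemma AE_unit_leb_cong_measurable:
  assumes f: "f \<in> borel_measurable unit_leb" and ae: "AE x in unit_leb. f x = (g x :: real)"
  shows "g \<in> borel_measurable unit_leb"
proof -
  have "(\<lambda>x. if x \<in> {0<..<1} then f x else 0) \<in> borel_measurable lebesgue"
    using f by (subst (asm) borel_measurable_if[symmetric]) auto
  then have "(\<lambda>x. if x \<in> {0<..<1} then g x else 0) \<in> borel_measurable lebesgue"
    by (rule borel_measurable_AE) (use AE_unit_lebD[OF ae] in \<open>eventually_elim, auto\<close>)
  then show ?thesis by (subst borel_measurable_if[symmetric]) auto
qed

text \<open>The set where the functions differ is open, and a nonempty open set is not null.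
  Equations between elements of \<open>L2\<close> become pointwise in this way.\<close>

lemma AE_unit_leb_continuous_eq:
  fixes f g :: "real \<Rightarrow> real"
  assumes c: "continuous_on {0<..<1} f" "continuous_on {0<..<1} g"
    and ae: "AE x in unit_leb. f x = g x" and x: "x \<in> {0<..<1}"
  shows "f x = g x"
proof (rule ccontr)
  assume ne: "f x \<noteq> g x"
  define U where "U = {y \<in> {0<..<1}. f y - g y \<in> - {0}}"
  have "open U" unfolding U_def
    using continuous_open_preimage[of "{0<..<1::real}" "\<lambda>y. f y - g y" "-{0}"] c
    by (auto intro!: continuous_on_diff simp: vimage_def Int_def)
  moreover have "U \<noteq> {}" using x ne by (auto simp: U_def)
  moreover have "U \<in> null_sets lebesgue"
  proof -
    have "AE y in lebesgue. y \<notin> U" using AE_unit_lebD[OF ae] by eventually_elim (auto simp: U_def)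
    then show ?thesis using \<open>open U\<close> by (subst AE_iff_null_sets) auto
  qed
  ultimately show False using open_not_negligible negligible_iff_null_sets by blast
qed

section \<open>Indefinite integrals of functions on (0,1)\<close>

definition zero_ext :: "(real \<Rightarrow> real) \<Rightarrow> real \<Rightarrow> real" where
  "zero_ext f x = (if x \<in> {0<..<1} then f x else 0)"

lemma zero_ext_absolutely_integrable:
  assumes "integrable unit_leb f" shows "zero_ext f absolutely_integrable_on UNIV"
proof -
  have "f absolutely_integrable_on {0<..<1}"
    using assms by (simp add: integrable_restrict_space set_integrable_def)
  then show ?thesis unfolding zero_ext_def
    by (subst absolutely_integrable_restrict_UNIV)
qed

lemma zero_ext_integrable_on:
  assumes "integrable unit_leb f" shows "zero_ext f integrable_on {a..b}"
  using set_lebesgue_integral_eq_integral(1)[OF zero_ext_absolutely_integrable[OF assms]]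
  by (rule integrable_on_subinterval) simp

lemma integral_unit_leb_indicator:
  assumes f: "integrable unit_leb f" and A: "A \<in> sets lebesgue"
  shows "(\<integral>s. f s * indicator A s \<partial>unit_leb) = integral A (zero_ext f)"
proof -
  have "zero_ext f absolutely_integrable_on A"
    using zero_ext_absolutely_integrable[OF f] A by (rule set_integrable_subset) simp
  note set_lebesgue_integral_eq_integral(2)[OF this, symmetric]
  also have "(LINT x:A|lebesgue. zero_ext f x) = (\<integral>x. indicator {0<..<1} x *\<^sub>R (f x * indicator A x) \<partial>lebesgue)"
    unfolding set_lebesgue_integral_def
    by (intro Bochner_Integration.integral_cong refl) (auto simp: zero_ext_def indicator_def)
  also have "\<dots> = (\<integral>s. f s * indicator A s \<partial>unit_leb)"
    by (rule integral_restrict_space[symmetric]) simp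
  finally show ?thesis by simp
qed

lemma indefinite_integral_has_derivative:
  assumes f: "integrable unit_leb f"
  shows "AE x in unit_leb. ((\<lambda>x. \<integral>s. f s * indicator {..x} s \<partial>unit_leb) has_real_derivative f x) (at x)"
proof -
  have eq: "(\<integral>s. f s * indicator {..x} s \<partial>unit_leb) = integral {-1..x} (zero_ext f)" for x
  proof -
    have "integral {..x} (zero_ext f) = integral {-1..x} (zero_ext f)"
      unfolding integral_restrict_UNIV[of _ "zero_ext f", symmetric]
      by (rule arg_cong[where f = "integral UNIV"]) (auto simp: zero_ext_def)
    then show ?thesis using integral_unit_leb_indicator[OF f, of "{..x}"] by simp
  qed
  show ?thesis unfolding eq
    by (rule AE_unit_lebI) (use lebesgue_differentiation[OF zero_ext_integrable_on[OF f]] in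
      \<open>eventually_elim, auto simp: zero_ext_def\<close>)
qed

lemma lipschitz_imp_abs_continuous_on:
  assumes "\<And>x y. a \<le> x \<Longrightarrow> x \<le> y \<Longrightarrow> y \<le> b \<Longrightarrow> \<bar>g y - g x\<bar> \<le> L * (y - x)"
  shows "abs_continuous_on a b g"
  unfolding abs_continuous_on_def
proof (intro allI impI)
  fix \<epsilon> :: real assume e: "\<epsilon> > 0"
  show "\<exists>\<delta>>0. \<forall>(n::nat) l r.
        (\<forall>i<n. a \<le> l i \<and> l i \<le> r i \<and> r i \<le> b) \<longrightarrow>
        (\<forall>i<n. \<forall>j<n. i \<noteq> j \<longrightarrow> {l i<..<r i} \<inter> {l j<..<r j} = {}) \<longrightarrow>
        (\<Sum>i<n. r i - l i) < \<delta> \<longrightarrow> (\<Sum>i<n. \<bar>g (r i) - g (l i)\<bar>) < \<epsilon>"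
  proof (intro exI[of _ "\<epsilon> / (\<bar>L\<bar> + 1)"] conjI allI impI)
    show "0 < \<epsilon> / (\<bar>L\<bar> + 1)" using e by (simp add: field_simps)
    fix n :: nat and l r
    assume 1: "\<forall>i<n. a \<le> l i \<and> l i \<le> r i \<and> r i \<le> b"
      and 3: "(\<Sum>i<n. r i - l i) < \<epsilon> / (\<bar>L\<bar> + 1)"
    have "(\<Sum>i<n. \<bar>g (r i) - g (l i)\<bar>) \<le> (\<Sum>i<n. (\<bar>L\<bar> + 1) * (r i - l i))"
    proof (rule sum_mono)
      fix i assume "i \<in> {..<n}"
      then have i: "a \<le> l i" "l i \<le> r i" "r i \<le> b" using 1 by auto
      have "\<bar>g (r i) - g (l i)\<bar> \<le> L * (r i - l i)" by (rule assms[OF i])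
      also have "\<dots> \<le> (\<bar>L\<bar> + 1) * (r i - l i)" using i by (intro mult_right_mono) auto
      finally show "\<bar>g (r i) - g (l i)\<bar> \<le> (\<bar>L\<bar> + 1) * (r i - l i)" .
    qed
    also have "\<dots> = (\<bar>L\<bar> + 1) * (\<Sum>i<n. r i - l i)" by (simp add: sum_distrib_left)
    also have "\<dots> < (\<bar>L\<bar> + 1) * (\<epsilon> / (\<bar>L\<bar> + 1))" using 3 by (intro mult_strict_left_mono) auto
    also have "\<dots> = \<epsilon>" by simp
    finally show "(\<Sum>i<n. \<bar>g (r i) - g (l i)\<bar>) < \<epsilon>" .
  qed
qed

text \<open>By Cauchy-Schwarz the integral of \<open>\<bar>f\<bar>\<close> over a union of intervals
  is at most \<open>?M\<close> times the square root of their total length, whence a \<delta>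
  quadratic in \<epsilon>. The + 1 covers \<open>?M = 0\<close>.\<close>

lemma indefinite_integral_abs_continuous_on:
  assumes f: "L2_fun f" and ab: "0 < a" "b < 1"
  shows "abs_continuous_on a b (\<lambda>x. c - (\<integral>s. f s * indicator {..x} s \<partial>unit_leb))"
  unfolding abs_continuous_on_def
proof (intro allI impI)
  fix \<epsilon> :: real assume e: "\<epsilon> > 0"
  define g where "g = (\<lambda>s. \<bar>f s\<bar>)"
  have g: "L2_fun g" using f by (auto simp: L2_fun_def g_def intro!: borel_measurable_abs)
  let ?F = "\<lambda>x. c - (\<integral>s. f s * indicator {..x} s \<partial>unit_leb)"
  let ?M = "norm (L2_class g)"
  show "\<exists>\<delta>>0. \<forall>(n::nat) l r.
        (\<forall>i<n. a \<le> l i \<and> l i \<le> r i \<and> r i \<le> b) \<longrightarrow>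
        (\<forall>i<n. \<forall>j<n. i \<noteq> j \<longrightarrow> {l i<..<r i} \<inter> {l j<..<r j} = {}) \<longrightarrow>
        (\<Sum>i<n. r i - l i) < \<delta> \<longrightarrow> (\<Sum>i<n. \<bar>?F (r i) - ?F (l i)\<bar>) < \<epsilon>"
  proof (intro exI[of _ "(\<epsilon> / (?M + 1))\<^sup>2"] conjI allI impI)
    have M: "?M + 1 > 0" using norm_ge_zero[of "L2_class g"] by linarith
    then show "0 < (\<epsilon> / (?M + 1))\<^sup>2" using e by simp
    fix n :: nat and l r
    assume 1: "\<forall>i<n. a \<le> l i \<and> l i \<le> r i \<and> r i \<le> b"
      and 2: "\<forall>i<n. \<forall>j<n. i \<noteq> j \<longrightarrow> {l i<..<r i} \<inter> {l j<..<r j} = {}"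
      and 3: "(\<Sum>i<n. r i - l i) < (\<epsilon> / (?M + 1))\<^sup>2"
    define J where "J i = {l i<..<r i}" for i
    define U where "U = (\<Union>i<n. J i)"
    have Jl: "J i \<in> sets lebesgue" for i by (simp add: J_def)
    have Ul: "U \<in> sets lebesgue" unfolding U_def by (intro sets.finite_UN Jl) simp
    have dis: "disjoint_family_on J {..<n}" using 2 by (auto simp: disjoint_family_on_def J_def)
    have fi: "integrable unit_leb (\<lambda>s. f s * indicator A s)" if "A \<in> sets lebesgue" for A
      by (intro L2_fun_integrable_mult f L2_fun_indicator that)
    have gi: "integrable unit_leb (\<lambda>s. g s * indicator A s)" if "A \<in> sets lebesgue" for A
      by (intro L2_fun_integrable_mult g L2_fun_indicator that)
    have step: "\<bar>?F (r i) - ?F (l i)\<bar> \<le> (\<integral>s. g s * indicator (J i) s \<partial>unit_leb)" if i: "i < n" for i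
    proof -
      have li: "l i \<le> r i" using 1 i by auto
      have "?F (l i) - ?F (r i) = (\<integral>s. f s * indicator {..r i} s - f s * indicator {..l i} s \<partial>unit_leb)"
        by (simp add: Bochner_Integration.integral_diff fi)
      also have "\<dots> = (\<integral>s. f s * indicator (J i) s \<partial>unit_leb)"
      proof (rule integral_cong_AE)
        have "AE s in lebesgue. s \<notin> {r i}" by (intro AE_not_in) simp
        then have "AE s in unit_leb. s \<noteq> r i" by (intro AE_unit_lebI, eventually_elim) simp
        then show "AE s in unit_leb. f s * indicator {..r i} s - f s * indicator {..l i} s = f s * indicator (J i) s"
          by eventually_elim (use li in \<open>auto simp: J_def indicator_def\<close>)
      qed (use fi Jl in \<open>auto intro!: borel_measurable_diff borel_measurable_integrable\<close>)
      finally have "\<bar>?F (r i) - ?F (l i)\<bar> = \<bar>\<integral>s. f s * indicator (J i) s \<partial>unit_leb\<bar>" by (simp add: abs_minus_commute)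
      also have "\<dots> \<le> (\<integral>s. \<bar>f s * indicator (J i) s\<bar> \<partial>unit_leb)" by (rule integral_abs_bound)
      also have "\<dots> = (\<integral>s. g s * indicator (J i) s \<partial>unit_leb)" by (simp add: g_def abs_mult)
      finally show ?thesis .
    qed
    have "(\<Sum>i<n. \<bar>?F (r i) - ?F (l i)\<bar>) \<le> (\<Sum>i<n. \<integral>s. g s * indicator (J i) s \<partial>unit_leb)"
      using step by (intro sum_mono) auto
    also have "\<dots> = (\<integral>s. (\<Sum>i<n. g s * indicator (J i) s) \<partial>unit_leb)"
      by (rule Bochner_Integration.integral_sum[symmetric]) (rule gi[OF Jl])
    also have "(\<lambda>s. \<Sum>i<n. g s * indicator (J i) s) = (\<lambda>s. g s * indicator U s)"
      by (simp add: U_def indicator_UN_disjoint[OF _ dis] sum_distrib_left)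
    also have "(\<integral>s. g s * indicator U s \<partial>unit_leb) = inner (L2_class g) (L2_class (indicator U))"
      by (rule L2_class_inner[symmetric]) (intro g L2_fun_indicator Ul)+
    also have "\<dots> \<le> ?M * norm (L2_class (indicat_real U))" by (rule norm_cauchy_schwarz)
    also have "norm (L2_class (indicat_real U)) = sqrt (\<integral>s. indicat_real U s \<partial>unit_leb)"
    proof -
      have "(\<lambda>s. (indicat_real U s)\<^sup>2) = indicat_real U" by (auto simp: indicator_def)
      then show ?thesis using L2_class_norm[OF L2_fun_indicator[OF Ul]] by simp
    qed
    also have "(\<integral>s. indicat_real U s \<partial>unit_leb) \<le> (\<Sum>i<n. r i - l i)"
    proof -
      have "U \<subseteq> {0<..<1}" using 1 ab by (force simp: U_def J_def)
      then have "(\<integral>s. indicat_real U s \<partial>unit_leb) = measure lebesgue U"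
        using Ul by (simp add: measure_restrict_space sets_restrict_space_iff Int_absorb2)
      also have "\<dots> = (\<Sum>i<n. measure lebesgue (J i))"
        unfolding U_def
      proof (rule measure_finite_Union[OF _ _ dis])
        show "emeasure lebesgue (J i) \<noteq> \<infinity>" if "i \<in> {..<n}" for i
          using 1 that by (simp add: J_def)
      qed (use Jl in auto)
      also have "\<dots> = (\<Sum>i<n. r i - l i)" using 1 by (intro sum.cong) (auto simp: J_def)
      finally show ?thesis by simp
    qed
    finally have "(\<Sum>i<n. \<bar>?F (r i) - ?F (l i)\<bar>) \<le> ?M * sqrt (\<Sum>i<n. r i - l i)"
      by (simp add: mult_left_mono)
    also have "\<dots> \<le> ?M * (\<epsilon> / (?M + 1))"
      using 3 e M by (intro mult_left_mono real_le_lsqrt) auto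
    also have "\<dots> < \<epsilon>" using e M by (simp add: field_simps)
    finally show "(\<Sum>i<n. \<bar>?F (r i) - ?F (l i)\<bar>) < \<epsilon>" .
  qed
qed

section \<open>Green function, flux and inverse of the operator\<close>

locale degenerate =
  fixes \<alpha> :: real
  assumes alpha: "0 < \<alpha>" "\<alpha> < 2"
begin

text \<open>\<open>pot\<close> is the solution of \<open>(x\<^sup>\<alpha> u')' = 0\<close> with \<open>u(1) = 0\<close> and \<open>x\<^sup>\<alpha> u' = -1\<close>, and \<open>x powr \<beta> = 1 - \<beta> pot x\<close>
  is the one that satisfies the boundary condition at \<open>0\<close>. Hence the Green function
  \<open>pot (max x s) (min x s) powr \<beta>\<close>, written below without powers of the minimum.\<close>

definition pot :: "real \<Rightarrow> real" where
  "pot x = (if \<alpha> = 1 then - ln x else (1 - x powr (1 - \<alpha>)) / (1 - \<alpha>))"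

definition \<beta> :: real where "\<beta> = (if \<alpha> < 1 then 1 - \<alpha> else 0)"

definition green :: "real \<Rightarrow> real \<Rightarrow> real" where
  "green x s = pot (max x s) - \<beta> * pot x * pot s"

lemma pot_deriv: "x > 0 \<Longrightarrow> (pot has_real_derivative - (x powr - \<alpha>)) (at x)"
proof (cases "\<alpha> = 1")
  case True
  assume "x > 0"
  then show ?thesis unfolding pot_def using True
    by (auto intro!: derivative_eq_intros simp: powr_minus divide_inverse)
next
  case False
  assume x: "x > 0"
  have "((\<lambda>x. (1 - x powr (1 - \<alpha>)) / (1 - \<alpha>)) has_real_derivative (0 - (1 - \<alpha>) * x powr (1 - \<alpha> - 1)) / (1 - \<alpha>)) (at x)"
    using x by (intro DERIV_cdivide DERIV_diff DERIV_const has_real_derivative_powr)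
  then show ?thesis unfolding pot_def using False by simp
qed

lemma pot_1: "pot 1 = 0" by (simp add: pot_def)

lemma pot_antimono: "0 < x \<Longrightarrow> x \<le> y \<Longrightarrow> pot y \<le> pot x"
  by (rule DERIV_nonpos_imp_nonincreasing) (auto intro!: exI pot_deriv)

lemma pot_nonneg: "0 < x \<Longrightarrow> x \<le> 1 \<Longrightarrow> 0 \<le> pot x"
  using pot_antimono[of x 1] by (simp add: pot_1)

text \<open>The difference \<open>q\<close> of the two sides is nonincreasing because y^(-\<alpha>)
  is at most y^(-\<alpha>/2 - 1) on (0,1], which is the condition \<alpha> \<le> 2. One weaker power
  covers \<alpha> < 1, the logarithm at \<alpha> = 1 and \<alpha> > 1 alike.\<close>

lemma pot_le: assumes "0 < x" "x \<le> 1" shows "pot x \<le> 2 / \<alpha> * x powr (- \<alpha> / 2)"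
proof -
  define q where "q y = 2 / \<alpha> * y powr (- \<alpha> / 2) - pot y" for y
  have "q 1 \<le> q x"
  proof (rule DERIV_nonpos_imp_nonincreasing[OF assms(2)])
    fix y assume y: "x \<le> y" "y \<le> 1"
    then have "y > 0" using assms(1) by simp
    then have "(q has_real_derivative 2 / \<alpha> * ((- \<alpha> / 2) * y powr (- \<alpha> / 2 - 1)) - (- (y powr - \<alpha>))) (at y)"
      unfolding q_def[abs_def] by (intro DERIV_diff DERIV_cmult has_real_derivative_powr pot_deriv)
    moreover have "2 / \<alpha> * ((- \<alpha> / 2) * y powr (- \<alpha> / 2 - 1)) - (- (y powr - \<alpha>)) \<le> 0"
    proof -
      have "y powr - \<alpha> \<le> y powr (- \<alpha> / 2 - 1)"
        using \<open>y > 0\<close> y alpha by (intro powr_mono') auto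
      then show ?thesis using alpha by simp
    qed
    ultimately show "\<exists>D. (q has_real_derivative D) (at y) \<and> D \<le> 0" by blast
  qed
  moreover have "q 1 \<ge> 0" using alpha by (simp add: q_def pot_1)
  ultimately show ?thesis by (simp add: q_def)
qed

lemma one_minus_pot: "0 < x \<Longrightarrow> 1 - \<beta> * pot x = x powr \<beta>"
  by (simp add: pot_def \<beta>_def)

lemma beta_nonneg: "0 \<le> \<beta>" by (simp add: \<beta>_def)

lemma beta_pot_le: "0 < x \<Longrightarrow> \<beta> * pot x \<le> 1"
  using one_minus_pot[of x] powr_ge_zero[of x \<beta>] by linarith

lemma green_factor: "0 < x \<Longrightarrow> 0 < s \<Longrightarrow> green x s = pot (max x s) * (min x s) powr \<beta>"
proof -
  assume "0 < x" "0 < s"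
  have "green x s = pot (max x s) * (1 - \<beta> * pot (min x s))"
    by (simp add: green_def max_def min_def algebra_simps)
  with \<open>0 < x\<close> \<open>0 < s\<close> show ?thesis by (simp add: one_minus_pot)
qed

lemma green_sym: "green x s = green s x"
  by (simp add: green_def max.commute mult.commute mult.left_commute)

text \<open>The last bound splits the singularity of \<open>pot\<close> evenly between the two
  variables. Each factor has exponent -\<alpha>/4 > -1/2 and is square integrable, so the kernel is
  dominated by a product of two functions in L^2.\<close>

lemma green_bounds:
  assumes "0 < x" "x \<le> 1" "0 < s" "s \<le> 1"
  shows "0 \<le> green x s" "green x s \<le> pot (max x s)" "green x s \<le> pot x"
    and "green x s \<le> 2 / \<alpha> * x powr (- \<alpha> / 4) * s powr (- \<alpha> / 4)"
proof -
  have p: "0 \<le> pot (max x s)" using assms by (intro pot_nonneg) auto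
  have m: "(min x s) powr \<beta> \<le> 1" using assms beta_nonneg by (intro powr_le1) auto
  show "0 \<le> green x s" using p assms by (simp add: green_factor)
  show 1: "green x s \<le> pot (max x s)"
    using mult_left_mono[OF m p] assms by (simp add: green_factor)
  also have "\<dots> \<le> pot x" using assms by (intro pot_antimono) auto
  finally show "green x s \<le> pot x" .
  have "pot (max x s) \<le> 2 / \<alpha> * (max x s) powr (- \<alpha> / 2)" using assms by (intro pot_le) auto
  moreover have "(max x s) powr (- \<alpha> / 2) \<le> x powr (- \<alpha> / 4) * s powr (- \<alpha> / 4)"
  proof -
    have "(max x s) powr (- \<alpha> / 2) = (max x s) powr (- \<alpha> / 4) * (max x s) powr (- \<alpha> / 4)"
      by (simp add: powr_add[symmetric])
    also have "\<dots> \<le> x powr (- \<alpha> / 4) * s powr (- \<alpha> / 4)"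
      using assms alpha by (intro mult_mono powr_mono2') auto
    finally show ?thesis .
  qed
  then have "2 / \<alpha> * (max x s) powr (- \<alpha> / 2) \<le> 2 / \<alpha> * (x powr (- \<alpha> / 4) * s powr (- \<alpha> / 4))"
    using alpha by (intro mult_left_mono) auto
  ultimately show "green x s \<le> 2 / \<alpha> * x powr (- \<alpha> / 4) * s powr (- \<alpha> / 4)"
    using 1 by (simp add: mult.assoc)
qed

lemma pot_measurable[measurable]: "pot \<in> borel_measurable borel"
  unfolding pot_def[abs_def] by measurable

lemma green_measurable[measurable]: "(\<lambda>s. green x s) \<in> borel_measurable borel"
  unfolding green_def by measurable

lemma green_L2: assumes "0 < x" "x \<le> 1" shows "L2_fun (green x)"
proof (rule L2_fun_bound)
  show "green x \<in> borel_measurable unit_leb" by (rule borel_imp_unit_leb) (rule green_measurable)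
  show "L2_fun (\<lambda>s. pot x)" by (rule L2_fun_const)
  show "\<bar>green x s\<bar> \<le> \<bar>pot x\<bar>" if "s \<in> {0<..<1}" for s
    using green_bounds[OF assms, of s] that by auto
qed

text \<open>\<open>kern x s = x\<^sup>\<alpha> \<partial>\<^sub>x green x s\<close>.\<close>

definition kern :: "real \<Rightarrow> real \<Rightarrow> real" where
  "kern x s = \<beta> * pot s - indicator {..x} s"

lemma kern_bound: "0 < s \<Longrightarrow> s \<le> 1 \<Longrightarrow> \<bar>kern x s\<bar> \<le> 1"
  using beta_pot_le[of s] pot_nonneg[of s] beta_nonneg by (auto simp: kern_def indicator_def)

lemma kern_L2: "L2_fun (kern x)"
proof (rule L2_fun_bound)
  show "kern x \<in> borel_measurable unit_leb"
    unfolding kern_def[abs_def] by (rule borel_imp_unit_leb) measurable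
  show "L2_fun (\<lambda>s. 1)" by (rule L2_fun_const)
  show "\<bar>kern x s\<bar> \<le> \<bar>1\<bar>" if "s \<in> {0<..<1}" for s using kern_bound[of s x] that by simp
qed

lemma L2_norm_le:
  assumes f: "L2_fun f" and c: "\<And>s. s \<in> {0<..<1} \<Longrightarrow> \<bar>f s\<bar> \<le> c"
  shows "norm (L2_class f) \<le> c"
proof -
  have c0: "0 \<le> c" using c[of "1/2"] by (smt (verit) greaterThanLessThan_iff field_sum_of_halves)
  have "(\<integral>s. (f s)\<^sup>2 \<partial>unit_leb) \<le> (\<integral>s. c\<^sup>2 \<partial>unit_leb)"
  proof (rule integral_mono)
    show "integrable unit_leb (\<lambda>s. c\<^sup>2)" using L2_fun_const[of c] by (simp add: L2_fun_def)
    show "(f s)\<^sup>2 \<le> c\<^sup>2" if "s \<in> space unit_leb" for s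
      using power_mono[OF c[of s], of 2] that by simp
  qed (use f in \<open>simp add: L2_fun_def\<close>)
  also have "\<dots> = c\<^sup>2" using measure_unit_leb by simp
  finally show ?thesis using c0 by (simp add: L2_class_norm[OF f] real_le_lsqrt)
qed

text \<open>For every \<open>u\<close>, \<open>sol u\<close> is the representative of \<open>\<P>\<^sup>-\<^sup>1 u\<close> defined by the Green function, and \<open>flx u\<close> is its flux.\<close>

definition sol :: "L2 \<Rightarrow> real \<Rightarrow> real" where "sol u x = inner u (L2_class (green x))"
definition flx :: "L2 \<Rightarrow> real \<Rightarrow> real" where "flx u x = inner u (L2_class (kern x))"

text \<open>Three regimes: the first bound gives the boundary value at 1, the second an L^2 majorant
  on the whole interval, the third the boundary value at 0 when \<alpha> < 1.\<close>

lemma green_norm: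
  assumes "0 < x" "x \<le> 1"
  shows "norm (L2_class (green x)) \<le> pot x"
    and "norm (L2_class (green x)) \<le> 2 / \<alpha> * norm (L2_class (\<lambda>s. s powr (- \<alpha> / 4))) * x powr (- \<alpha> / 4)"
    and "\<alpha> < 1 \<Longrightarrow> norm (L2_class (green x)) \<le> x powr \<beta> / \<beta>"
proof -
  show "norm (L2_class (green x)) \<le> pot x"
    using green_bounds[OF assms] by (intro L2_norm_le green_L2 assms) auto
  have L: "L2_fun (\<lambda>s. s powr (- \<alpha> / 4))" using alpha by (intro L2_fun_powr) simp
  define c where "c = 2 / \<alpha> * x powr (- \<alpha> / 4)"
  have c0: "c \<ge> 0" using alpha by (simp add: c_def)
  have "(\<integral>s. (green x s)\<^sup>2 \<partial>unit_leb) \<le> (\<integral>s. (c * s powr (- \<alpha> / 4))\<^sup>2 \<partial>unit_leb)"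
  proof (rule integral_mono)
    show "(green x s)\<^sup>2 \<le> (c * s powr (- \<alpha> / 4))\<^sup>2" if "s \<in> space unit_leb" for s
      using green_bounds[OF assms, of s] that by (intro power_mono) (auto simp: c_def)
  qed (use green_L2[OF assms] L2_fun_scale[OF L, of c] in \<open>simp_all add: L2_fun_def\<close>)
  then have "norm (L2_class (green x)) \<le> norm (L2_class (\<lambda>s. c * s powr (- \<alpha> / 4)))"
    unfolding L2_class_norm[OF green_L2[OF assms]] L2_class_norm[OF L2_fun_scale[OF L]]
    by (rule real_sqrt_le_mono)
  also have "\<dots> = c * norm (L2_class (\<lambda>s. s powr (- \<alpha> / 4)))"
    using c0 unfolding L2_class_scaleR[OF L L2_fun_zero, symmetric] by simp
  finally show "norm (L2_class (green x)) \<le> 2 / \<alpha> * norm (L2_class (\<lambda>s. s powr (- \<alpha> / 4))) * x powr (- \<alpha> / 4)"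
    by (simp add: c_def mult_ac)
  assume a1: "\<alpha> < 1"
  then have b: "\<beta> > 0" by (simp add: \<beta>_def)
  show "norm (L2_class (green x)) \<le> x powr \<beta> / \<beta>"
  proof (rule L2_norm_le[OF green_L2[OF assms]])
    fix s :: real assume s: "s \<in> {0<..<1}"
    have "pot (max x s) \<le> 1 / \<beta>" using beta_pot_le[of "max x s"] assms b by (simp add: field_simps)
    moreover have "(min x s) powr \<beta> \<le> x powr \<beta>" using assms s b by (intro powr_mono2) auto
    ultimately have "pot (max x s) * (min x s) powr \<beta> \<le> 1 / \<beta> * x powr \<beta>"
      using b by (intro mult_mono) auto
    then show "\<bar>green x s\<bar> \<le> x powr \<beta> / \<beta>"
      using green_bounds(1)[OF assms, of s] s assms by (simp add: green_factor)
  qed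
qed

lemma pot_tendsto_1: "(pot \<longlongrightarrow> 0) (at_left 1)"
proof -
  have "isCont pot 1" using pot_deriv[of 1] by (auto intro: DERIV_isCont)
  then have "(pot \<longlongrightarrow> 0) (at 1)" by (simp add: isCont_def pot_1)
  then show ?thesis by (rule filterlim_mono) (auto simp: at_le)
qed

lemma pot_lipschitz:
  assumes "0 < a" "a \<le> x" "a \<le> y" shows "\<bar>pot y - pot x\<bar> \<le> a powr (- \<alpha>) * \<bar>y - x\<bar>"
proof -
  have *: "\<bar>pot v - pot u\<bar> \<le> a powr (- \<alpha>) * (v - u)" if "a \<le> u" "u < v" for u v
  proof -
    note uv = that
    obtain z where z: "u < z" "z < v" "pot v - pot u = (v - u) * - (z powr - \<alpha>)"
      using MVT2[OF uv(2), of pot "\<lambda>x. - (x powr - \<alpha>)"] pot_deriv uv assms(1) by auto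
    have "\<bar>pot v - pot u\<bar> = (v - u) * z powr - \<alpha>" using z by (simp add: abs_mult)
    also have "\<dots> \<le> (v - u) * a powr - \<alpha>"
      using that z assms alpha by (intro mult_left_mono powr_mono2') auto
    finally show ?thesis by (simp add: mult.commute)
  qed
  show ?thesis
    using *[of x y] *[of y x] assms by (cases x y rule: linorder_cases) (auto simp: abs_minus_commute)
qed

text \<open>Differentiation under the integral. Near \<open>x\<close> the difference quotients of
  the kernel are bounded by 2 a^(-\<alpha>) with \<open>a = x / 2\<close>, uniformly in
  \<open>s\<close>, and they converge except at the corner \<open>s = x\<close>.\<close>

lemma sol_deriv:
  assumes x: "0 < x" "x < 1"
  shows "(sol u has_real_derivative x powr (- \<alpha>) * flx u x) (at x)"
proof -
  obtain f where f: "L2_fun f" and u: "u = L2_class f" by (rule L2_class_cases)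
  define a where "a = x / 2"
  define \<delta> where "\<delta> = min (x / 2) (1 - x)"
  have \<delta>: "\<delta> > 0" using x by (simp add: \<delta>_def)
  have fs: "(\<lambda>s. f s * green y s) \<in> borel_measurable unit_leb" if "0 < y" "y \<le> 1" for y
    using L2_fun_integrable_mult[OF f green_L2[OF that]] by simp
  have sol_eq: "sol u y = (\<integral>s. f s * green y s \<partial>unit_leb)" if "0 < y" "y \<le> 1" for y
    unfolding sol_def u by (rule L2_class_inner[OF f green_L2[OF that]])
  have flx_eq: "flx u x = (\<integral>s. f s * kern x s \<partial>unit_leb)"
    unfolding flx_def u by (rule L2_class_inner[OF f kern_L2])
  have "((\<lambda>h. (sol u (x + h) - sol u x) / h) \<longlongrightarrow> x powr (- \<alpha>) * flx u x) (at 0)"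
  proof (subst tendsto_at_iff_sequentially, intro allI impI)
    fix X :: "nat \<Rightarrow> real" assume X: "\<forall>i. X i \<in> UNIV - {0}" and X0: "X \<longlonglongrightarrow> 0"
    have ev: "\<forall>\<^sub>F n in sequentially. \<bar>X n\<bar> < \<delta>" using X0 \<delta>
      by (metis (full_types) order_tendstoD(2) tendsto_rabs_zero)
    \<comment> \<open>The domination must hold for every \<open>n\<close>, so the quotient is set to
      0 for those \<open>n\<close> at which the increment is still too large.\<close>
    define q where "q n s = (if \<bar>X n\<bar> < \<delta> then f s * ((green (x + X n) s - green x s) / X n) else 0)" for n s
    have xX: "0 < x + X n" "x + X n \<le> 1" "a \<le> x + X n" if "\<bar>X n\<bar> < \<delta>" for n
      using that x by (auto simp: \<delta>_def a_def)
    have "(\<lambda>n. \<integral>s. q n s \<partial>unit_leb) \<longlonglongrightarrow> (\<integral>s. x powr (- \<alpha>) * (f s * kern x s) \<partial>unit_leb)"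
    proof (rule integral_dominated_convergence[where w = "\<lambda>s. 2 * a powr (- \<alpha>) * \<bar>f s\<bar>"])
      show "(\<lambda>s. x powr - \<alpha> * (f s * kern x s)) \<in> borel_measurable unit_leb"
        using L2_fun_integrable_mult[OF f kern_L2] by simp
      show "integrable unit_leb (\<lambda>s. 2 * a powr (- \<alpha>) * \<bar>f s\<bar>)"
        using L2_fun_integrable[OF f] by simp
      show "q n \<in> borel_measurable unit_leb" for n
      proof (cases "\<bar>X n\<bar> < \<delta>")
        case True
        have "q n = (\<lambda>s. (f s * green (x + X n) s - f s * green x s) / X n)"
          using True by (auto simp: q_def algebra_simps diff_divide_distrib)
        then show ?thesis using fs[OF xX(1,2)[OF True]] fs[of x] x by simp
      qed (simp add: q_def[abs_def])
      show "AE s in unit_leb. norm (q n s) \<le> 2 * a powr (- \<alpha>) * \<bar>f s\<bar>" for n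
      proof (rule AE_I2)
        fix s assume "s \<in> space unit_leb"
        then have s: "0 < s" "s < 1" by auto
        show "norm (q n s) \<le> 2 * a powr (- \<alpha>) * \<bar>f s\<bar>"
        proof (cases "\<bar>X n\<bar> < \<delta>")
          case True
          have X': "X n \<noteq> 0" using X by simp
          have 1: "\<bar>pot (x + X n) - pot x\<bar> \<le> a powr (- \<alpha>) * \<bar>X n\<bar>"
            using pot_lipschitz[of a x "x + X n"] xX[OF True] x by (simp add: a_def)
          have 2: "\<bar>pot (max (x + X n) s) - pot (max x s)\<bar> \<le> \<bar>pot (x + X n) - pot x\<bar>"
            using pot_antimono[of x s] pot_antimono[of s x] pot_antimono[of "x + X n" s] pot_antimono[of s "x + X n"]
              s x xX[OF True] by (auto simp: max_def)
          have 3: "\<bar>\<beta> * pot s * (pot (x + X n) - pot x)\<bar> \<le> 1 * \<bar>pot (x + X n) - pot x\<bar>"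
            unfolding abs_mult using beta_pot_le[of s] beta_nonneg pot_nonneg[of s] s
            by (intro mult_right_mono) (auto simp: abs_mult)
          have "green (x + X n) s - green x s = (pot (max (x + X n) s) - pot (max x s)) - \<beta> * pot s * (pot (x + X n) - pot x)"
            by (simp add: green_def algebra_simps)
          then have "\<bar>green (x + X n) s - green x s\<bar> \<le> \<bar>pot (max (x + X n) s) - pot (max x s)\<bar> + \<bar>\<beta> * pot s * (pot (x + X n) - pot x)\<bar>"
            by (simp only: abs_triangle_ineq4)
          then have "\<bar>green (x + X n) s - green x s\<bar> \<le> 2 * (a powr (- \<alpha>) * \<bar>X n\<bar>)" using 1 2 3 by linarith
          then have "\<bar>green (x + X n) s - green x s\<bar> \<le> 2 * a powr (- \<alpha>) * \<bar>X n\<bar>" by (simp add: mult.assoc)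
          then have "\<bar>(green (x + X n) s - green x s) / X n\<bar> \<le> 2 * a powr (- \<alpha>)" using X' by (simp add: field_simps)
          then have "\<bar>f s\<bar> * \<bar>(green (x + X n) s - green x s) / X n\<bar> \<le> \<bar>f s\<bar> * (2 * a powr (- \<alpha>))"
            by (intro mult_left_mono) auto
          then show ?thesis using True by (simp add: q_def abs_mult mult_ac)
        qed (simp add: q_def)
      qed
      have "AE s in unit_leb. s \<noteq> x"
      proof (rule AE_unit_lebI)
        have "AE s in lebesgue. s \<notin> {x}" by (intro AE_not_in) simp
        then show "AE s in lebesgue. s \<in> {0<..<1} \<longrightarrow> s \<noteq> x" by eventually_elim simp
      qed
      moreover have "AE s in unit_leb. s \<in> {0<..<1}" by (rule AE_I2) simp
      ultimately show "AE s in unit_leb. (\<lambda>n. q n s) \<longlonglongrightarrow> x powr - \<alpha> * (f s * kern x s)"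
      proof eventually_elim
        case (elim s)
        have d: "((\<lambda>y. green y s) has_real_derivative x powr (- \<alpha>) * kern x s) (at x)"
        proof (cases "s < x")
          case True
          have "((\<lambda>y. pot y - \<beta> * pot y * pot s) has_real_derivative - (x powr - \<alpha>) - \<beta> * (- (x powr - \<alpha>)) * pot s) (at x)"
            by (intro DERIV_diff DERIV_cmult_right DERIV_cmult pot_deriv x)
          moreover have "- (x powr - \<alpha>) - \<beta> * (- (x powr - \<alpha>)) * pot s = x powr (- \<alpha>) * kern x s"
            using True by (simp add: kern_def algebra_simps)
          ultimately have "((\<lambda>y. pot y - \<beta> * pot y * pot s) has_real_derivative x powr (- \<alpha>) * kern x s) (at x)" by simp
          then show ?thesis
            by (rule has_field_derivative_transform_within_open[of _ _ _ "{s<..}"]) (use True in \<open>auto simp: green_def max_def\<close>)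
        next
          case False
          then have sx: "x < s" using elim by simp
          have "((\<lambda>y. pot s - \<beta> * pot y * pot s) has_real_derivative 0 - \<beta> * (- (x powr - \<alpha>)) * pot s) (at x)"
            by (intro DERIV_diff DERIV_cmult_right DERIV_cmult pot_deriv x DERIV_const)
          moreover have "0 - \<beta> * (- (x powr - \<alpha>)) * pot s = x powr (- \<alpha>) * kern x s"
            using sx by (simp add: kern_def algebra_simps)
          ultimately have "((\<lambda>y. pot s - \<beta> * pot y * pot s) has_real_derivative x powr (- \<alpha>) * kern x s) (at x)"
            by (rule DERIV_cong)
          then show ?thesis
            by (rule has_field_derivative_transform_within_open[of _ _ _ "{..<s}"]) (use sx in \<open>auto simp: green_def max_def\<close>)
        qed
        have "(\<lambda>n. (green (x + X n) s - green x s) / X n) \<longlonglongrightarrow> x powr (- \<alpha>) * kern x s"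
          using d X X0 unfolding DERIV_def tendsto_at_iff_sequentially by (auto simp: o_def)
        then have "(\<lambda>n. f s * ((green (x + X n) s - green x s) / X n)) \<longlonglongrightarrow> f s * (x powr (- \<alpha>) * kern x s)"
          by (rule tendsto_mult_left)
        then have "(\<lambda>n. q n s) \<longlonglongrightarrow> f s * (x powr (- \<alpha>) * kern x s)"
          by (rule Lim_transform_eventually) (use ev in \<open>eventually_elim, simp add: q_def\<close>)
        then show ?case by (simp add: mult_ac)
      qed
    qed
    also have "(\<integral>s. x powr (- \<alpha>) * (f s * kern x s) \<partial>unit_leb) = x powr (- \<alpha>) * flx u x" by (simp add: flx_eq)
    finally have "(\<lambda>n. \<integral>s. q n s \<partial>unit_leb) \<longlonglongrightarrow> x powr (- \<alpha>) * flx u x" .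
    moreover have "\<forall>\<^sub>F n in sequentially. (\<integral>s. q n s \<partial>unit_leb) = (sol u (x + X n) - sol u x) / X n"
      using ev
    proof eventually_elim
      case (elim n)
      have "(\<integral>s. q n s \<partial>unit_leb) = (\<integral>s. (f s * green (x + X n) s - f s * green x s) / X n \<partial>unit_leb)"
        using elim by (simp add: q_def algebra_simps diff_divide_distrib)
      also have "\<dots> = ((\<integral>s. f s * green (x + X n) s \<partial>unit_leb) - (\<integral>s. f s * green x s \<partial>unit_leb)) / X n"
        using L2_fun_integrable_mult[OF f green_L2] xX[OF elim] x by (simp add: Bochner_Integration.integral_diff)
      finally show ?case using sol_eq xX[OF elim] x by simp
    qed
    ultimately show "((\<lambda>h. (sol u (x + h) - sol u x) / h) \<circ> X) \<longlonglongrightarrow> x powr (- \<alpha>) * flx u x"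
      unfolding o_def by (rule Lim_transform_eventually)
  qed
  then show ?thesis by (simp add: DERIV_def)
qed

end

context degenerate begin

text \<open>The flux is a constant minus an indefinite integral of \<open>f\<close>, which gives its
  absolute continuity and its derivative. The function \<open>pot'\<close> drops \<open>pot\<close>
  for \<alpha> \<ge> 1, where \<beta> = 0 and \<open>pot\<close> need not be square integrable; for
  \<alpha> < 1 it is bounded by 1/(1 - \<alpha>).\<close>

lemma flx_eq: "flx (L2_class f) x = \<beta> * inner (L2_class f) (L2_class pot') - (\<integral>s. f s * indicator {..x} s \<partial>unit_leb)"
  if f: "L2_fun f" and pot': "pot' = (\<lambda>s. if \<alpha> < 1 then pot s else 0)"
proof -
  have p: "L2_fun pot'"
  proof (rule L2_fun_bound)
    show "pot' \<in> borel_measurable unit_leb" unfolding pot' by (rule borel_imp_unit_leb) measurable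
    show "L2_fun (\<lambda>s. 1 / (1 - \<alpha>))" by (rule L2_fun_const)
    show "\<bar>pot' s\<bar> \<le> \<bar>1 / (1 - \<alpha>)\<bar>" if "s \<in> {0<..<1}" for s
      using beta_pot_le[of s] pot_nonneg[of s] that by (auto simp: pot' \<beta>_def field_simps)
  qed
  have "(\<lambda>s. f s * kern x s) = (\<lambda>s. \<beta> * (f s * pot' s) - f s * indicator {..x} s)"
    by (auto simp: kern_def pot' \<beta>_def algebra_simps)
  then have "flx (L2_class f) x = (\<integral>s. \<beta> * (f s * pot' s) - f s * indicator {..x} s \<partial>unit_leb)"
    by (simp add: flx_def L2_class_inner[OF f kern_L2])
  also have "\<dots> = \<beta> * (\<integral>s. f s * pot' s \<partial>unit_leb) - (\<integral>s. f s * indicator {..x} s \<partial>unit_leb)"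
    using L2_fun_integrable_mult[OF f p] L2_fun_integrable_mult[OF f L2_fun_indicator[of "{..x}"]]
    by (subst Bochner_Integration.integral_diff) auto
  finally show ?thesis by (simp add: L2_class_inner[OF f p])
qed

lemma flx_bound: "\<bar>flx u x\<bar> \<le> norm u"
proof -
  have "norm (L2_class (kern x)) \<le> 1" by (intro L2_norm_le kern_L2 kern_bound) auto
  then have "norm u * norm (L2_class (kern x)) \<le> norm u" by (simp add: mult_left_le)
  then show ?thesis using Cauchy_Schwarz_ineq2[of u "L2_class (kern x)"] unfolding flx_def by linarith
qed

text \<open>Here \<beta> = 0 and \<open>kern x\<close> is minus the indicator of (0,x], of squared
  norm \<open>x\<close>. The gain of a factor \<open>x\<close> yields both the boundary condition at
  0 and the finite energy.\<close>

lemma flx_sq_bound: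
  assumes "1 \<le> \<alpha>" "0 < x" "x < 1" shows "(flx u x)\<^sup>2 \<le> x * (norm u)\<^sup>2"
proof -
  have m: "(\<integral>s. (kern x s)\<^sup>2 \<partial>unit_leb) = x"
  proof -
    have "(\<lambda>s. (kern x s)\<^sup>2) = indicator {..x}" using assms(1) by (auto simp: kern_def \<beta>_def indicator_def)
    then have "(\<integral>s. (kern x s)\<^sup>2 \<partial>unit_leb) = measure unit_leb ({0<..<1} \<inter> {..x})" by (simp add: Int_commute)
    also have "{0<..<1} \<inter> {..x} = {0<..x}" using assms by auto
    also have "measure unit_leb {0<..x} = x" using assms by (subst measure_restrict_space) auto
    finally show ?thesis .
  qed
  have "(flx u x)\<^sup>2 \<le> (norm u * norm (L2_class (kern x)))\<^sup>2"
    unfolding flx_def using Cauchy_Schwarz_ineq2[of u "L2_class (kern x)"] by (simp add: abs_le_square_iff[symmetric])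
  also have "\<dots> = x * (norm u)\<^sup>2" using assms(2) by (simp add: power_mult_distrib L2_class_norm[OF kern_L2] m)
  finally show ?thesis .
qed

lemma flx_tendsto_0: assumes "1 \<le> \<alpha>" shows "(flx u \<longlongrightarrow> 0) (at_right 0)"
proof (rule Lim_null_comparison)
  have "\<bar>flx u x\<bar> \<le> sqrt x * norm u" if "0 < x" "x < 1" for x
    using real_sqrt_le_mono[OF flx_sq_bound[OF assms that, of u]] by (simp add: real_sqrt_mult)
  then show "\<forall>\<^sub>F x in at_right 0. norm (flx u x) \<le> sqrt x * norm u"
    by (auto simp: eventually_at_right[of 0 1] intro!: exI[of _ 1])
  have "((\<lambda>x. sqrt x * norm u) \<longlongrightarrow> sqrt 0 * norm u) (at_right 0)" by (intro tendsto_intros)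
  then show "((\<lambda>x. sqrt x * norm u) \<longlongrightarrow> 0) (at_right 0)" by simp
qed

lemma sol_bound:
  assumes "0 < x" "x \<le> 1"
  shows "\<bar>sol u x\<bar> \<le> norm u * norm (L2_class (green x))"
  using Cauchy_Schwarz_ineq2[of u "L2_class (green x)"] unfolding sol_def .

lemma sol_tendsto_1: "(sol u \<longlongrightarrow> 0) (at_left 1)"
proof (rule Lim_null_comparison)
  have "\<bar>sol u x\<bar> \<le> norm u * pot x" if "0 < x" "x < 1" for x
    using sol_bound[of x u] green_norm(1)[of x] that by (smt (verit) mult_left_mono norm_ge_zero)
  then show "\<forall>\<^sub>F x in at_left 1. norm (sol u x) \<le> norm u * pot x"
    by (auto simp: eventually_at_left[of 0 1] intro!: exI[of _ 0])
  have "((\<lambda>x. norm u * pot x) \<longlongrightarrow> norm u * 0) (at_left 1)" by (intro tendsto_intros pot_tendsto_1)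
  then show "((\<lambda>x. norm u * pot x) \<longlongrightarrow> 0) (at_left 1)" by simp
qed

lemma sol_tendsto_0: assumes "\<alpha> < 1" shows "(sol u \<longlongrightarrow> 0) (at_right 0)"
proof (rule Lim_null_comparison)
  have b: "\<beta> > 0" using assms by (simp add: \<beta>_def)
  have "\<bar>sol u x\<bar> \<le> norm u * (x powr \<beta> / \<beta>)" if "0 < x" "x < 1" for x
    using sol_bound[of x u] green_norm(3)[of x] assms that by (smt (verit) mult_left_mono norm_ge_zero)
  then show "\<forall>\<^sub>F x in at_right 0. norm (sol u x) \<le> norm u * (x powr \<beta> / \<beta>)"
    by (auto simp: eventually_at_right[of 0 1] intro!: exI[of _ 1])
  have "((\<lambda>x. norm u * (x powr \<beta> / \<beta>)) \<longlongrightarrow> norm u * (0 powr \<beta> / \<beta>)) (at_right 0)"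
    using b by (intro tendsto_intros tendsto_powr') (auto simp: eventually_at_right[of 0 1] intro!: exI[of _ 1])
  then show "((\<lambda>x. norm u * (x powr \<beta> / \<beta>)) \<longlongrightarrow> 0) (at_right 0)" using b by simp
qed

lemma sol_cont: "continuous_on {0<..<1} (sol u)"
  by (rule DERIV_continuous_on) (auto intro: has_field_derivative_at_within sol_deriv)

lemma unit_leb_continuous_measurable:
  fixes g :: "real \<Rightarrow> real"
  assumes "continuous_on {0<..<1} g" shows "g \<in> borel_measurable unit_leb"
  using assms by (intro continuous_imp_measurable_on_sets_lebesgue) auto

lemma sol_L2: "L2_fun (sol u)"
proof (rule L2_fun_bound)
  define c where "c = norm u * (2 / \<alpha> * norm (L2_class (\<lambda>s. s powr (- \<alpha> / 4))))"
  show "sol u \<in> borel_measurable unit_leb" by (rule unit_leb_continuous_measurable[OF sol_cont])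
  show "L2_fun (\<lambda>x. c * x powr (- \<alpha> / 4))" using alpha by (intro L2_fun_scale L2_fun_powr) simp
  show "\<bar>sol u x\<bar> \<le> \<bar>c * x powr (- \<alpha> / 4)\<bar>" if x: "x \<in> {0<..<1}" for x
  proof -
    have "\<bar>sol u x\<bar> \<le> norm u * norm (L2_class (green x))" using sol_bound x by auto
    also have "\<dots> \<le> norm u * (2 / \<alpha> * norm (L2_class (\<lambda>s. s powr (- \<alpha> / 4))) * x powr (- \<alpha> / 4))"
      using green_norm(2)[of x] x by (intro mult_left_mono) auto
    also have "\<dots> = c * x powr (- \<alpha> / 4)" by (simp add: c_def mult.assoc)
    finally show ?thesis by simp
  qed
qed

definition resolvent :: "L2 \<Rightarrow> L2" where "resolvent u = L2_class (sol u)"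

lemma flx_abs_continuous: "loc_abs_continuous (flx u)"
proof -
  obtain f where f: "L2_fun f" and u: "u = L2_class f" by (rule L2_class_cases)
  show ?thesis unfolding loc_abs_continuous_def u flx_eq[OF f refl]
    using indefinite_integral_abs_continuous_on[OF f] by auto
qed

lemma flx_deriv:
  assumes "L2_fun f" shows "AE x in unit_leb. (flx (L2_class f) has_real_derivative - f x) (at x)"
  using indefinite_integral_has_derivative[OF L2_fun_integrable[OF assms]]
proof eventually_elim
  case (elim x)
  then show ?case unfolding flx_eq[OF assms refl] by (auto intro!: derivative_eq_intros)
qed

lemma sol_abs_continuous: "loc_abs_continuous (sol u)"
  unfolding loc_abs_continuous_def
proof (intro allI impI)
  fix a b :: real assume ab: "0 < a" "a \<le> b" "b < 1"
  show "abs_continuous_on a b (sol u)"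
  proof (rule lipschitz_imp_abs_continuous_on[where L = "a powr (- \<alpha>) * norm u"])
    fix x y assume xy: "a \<le> x" "x \<le> y" "y \<le> b"
    show "\<bar>sol u y - sol u x\<bar> \<le> a powr (- \<alpha>) * norm u * (y - x)"
    proof (cases "x = y")
      case False
      then have "x < y" using xy by simp
      then obtain z where z: "x < z" "z < y" "sol u y - sol u x = (y - x) * (z powr (- \<alpha>) * flx u z)"
        using MVT2[of x y "sol u" "\<lambda>z. z powr (- \<alpha>) * flx u z"] sol_deriv xy ab by auto
      have "\<bar>sol u y - sol u x\<bar> = (y - x) * (z powr (- \<alpha>) * \<bar>flx u z\<bar>)" using z \<open>x < y\<close> by (simp add: abs_mult)
      also have "\<dots> \<le> (y - x) * (a powr (- \<alpha>) * norm u)"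
        using z xy ab alpha \<open>x < y\<close> by (intro mult_left_mono mult_mono powr_mono2' flx_bound) auto
      finally show ?thesis by (simp add: mult_ac)
    qed simp
  qed
qed

lemma flx_cont: "continuous_on {0<..<1} (flx u)"
proof -
  have "isCont (flx u) x" if x: "x \<in> {0<..<1}" for x
  proof -
    have "((\<lambda>y. flx u y) \<longlongrightarrow> flx u x) (at x)"
    proof (subst tendsto_at_iff_sequentially, intro allI impI)
      fix X :: "nat \<Rightarrow> real" assume X: "\<forall>i. X i \<in> UNIV - {x}" "X \<longlonglongrightarrow> x"
      have "(\<lambda>n. L2_class (kern (X n))) \<longlonglongrightarrow> L2_class (kern x)"
      proof (rule L2_dominated_convergence(3)[where h = "\<lambda>_. 1"])
        show "L2_fun (\<lambda>_. 1)" by (rule L2_fun_const)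
        show "kern (X n) \<in> borel_measurable unit_leb" for n using kern_L2 by (simp add: L2_fun_def)
        show "kern x \<in> borel_measurable unit_leb" using kern_L2 by (simp add: L2_fun_def)
        show "AE s in unit_leb. \<bar>kern (X n) s\<bar> \<le> 1" for n by (rule AE_I2) (auto intro: kern_bound)
        have "AE s in lebesgue. s \<notin> {x}" by (intro AE_not_in) simp
        then have "AE s in unit_leb. s \<noteq> x" by (intro AE_unit_lebI, eventually_elim) simp
        then show "AE s in unit_leb. (\<lambda>n. kern (X n) s) \<longlonglongrightarrow> kern x s"
        proof eventually_elim
          case (elim s)
          have "\<forall>\<^sub>F n in sequentially. kern (X n) s = kern x s"
          proof (cases "s < x")
            case True
            with X(2) have "\<forall>\<^sub>F n in sequentially. s < X n" by (rule order_tendstoD)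
            then show ?thesis by eventually_elim (use True in \<open>simp add: kern_def\<close>)
          next
            case False
            then have "x < s" using elim by simp
            with X(2) have "\<forall>\<^sub>F n in sequentially. X n < s" by (rule order_tendstoD)
            then show ?thesis by eventually_elim (use \<open>x < s\<close> in \<open>simp add: kern_def\<close>)
          qed
          then show ?case by (rule tendsto_eventually)
        qed
      qed
      then show "((\<lambda>y. flx u y) \<circ> X) \<longlonglongrightarrow> flx u x" unfolding flx_def o_def by (intro tendsto_intros)
    qed
    then show ?thesis by (simp add: isCont_def)
  qed
  then show ?thesis by (simp add: continuous_at_imp_continuous_on)
qed

lemma deriv_sol: "0 < x \<Longrightarrow> x < 1 \<Longrightarrow> deriv (sol u) x = x powr (- \<alpha>) * flx u x"
  by (rule DERIV_imp_deriv[OF sol_deriv])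

lemma resolvent_in_graph: "(resolvent u, u) \<in> P_graph \<alpha>"
proof -
  obtain f where f: "L2_fun f" and u: "u = L2_class f" by (rule L2_class_cases)
  have ae: "AE x in unit_leb. f x = - deriv (flx u) x"
    using flx_deriv[OF f] by eventually_elim (simp add: u DERIV_imp_deriv)
  have m: "(\<lambda>x. - deriv (flx u) x) \<in> borel_measurable unit_leb"
    by (rule AE_unit_leb_cong_measurable[OF L2_fun_measurable[OF f] ae])
  have d: "L2_fun (\<lambda>x. - deriv (flx u) x)"
    unfolding L2_fun_def
  proof
    have "AE x in unit_leb. (f x)\<^sup>2 = (- deriv (flx u) x)\<^sup>2" using ae by eventually_elim simp
    from integrable_cong_AE_imp[OF L2_fun_integrable_sq[OF f] borel_measurable_power[OF m, of 2] this]
    show "integrable unit_leb (\<lambda>x. (- deriv (flx u) x)\<^sup>2)" .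
  qed (rule m)
  have "u = L2_class (\<lambda>x. - deriv (flx u) x)"
    using u L2_class_cong_AE[OF f d ae] by (rule trans)
  moreover have "H1_alpha \<alpha> (sol u)"
    unfolding H1_alpha_def
  proof (intro conjI sol_L2 sol_abs_continuous sol_tendsto_1)
    \<comment> \<open>The exponent of a majorant for x^(-\<alpha>) (\<open>flx u x\<close>)^2: for
      \<alpha> < 1 the flux is merely bounded, otherwise its square gains a factor x. Both values
      exceed -1.\<close>
    define \<gamma> where "\<gamma> = (if \<alpha> < 1 then - \<alpha> else 1 - \<alpha>)"
    have eq: "x powr \<alpha> * (deriv (sol u) x)\<^sup>2 = x powr - \<alpha> * (flx u x)\<^sup>2" if "0 < x" "x < 1" for x
      using that by (simp add: deriv_sol power_mult_distrib power2_eq_square powr_minus field_simps)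
    have m': "(\<lambda>x. x powr - \<alpha> * (flx u x)\<^sup>2) \<in> borel_measurable unit_leb"
      by (intro unit_leb_continuous_measurable continuous_intros flx_cont) auto
    have "integrable unit_leb (\<lambda>x. x powr - \<alpha> * (flx u x)\<^sup>2)"
    proof (rule Bochner_Integration.integrable_bound[where f = "\<lambda>x. (norm u)\<^sup>2 * x powr \<gamma>", OF _ m'])
      show "integrable unit_leb (\<lambda>x. (norm u)\<^sup>2 * x powr \<gamma>)"
        using alpha by (intro integrable_mult_right integrable_unit_leb_powr) (auto simp: \<gamma>_def)
      show "AE x in unit_leb. norm (x powr - \<alpha> * (flx u x)\<^sup>2) \<le> norm ((norm u)\<^sup>2 * x powr \<gamma>)"
      proof (rule AE_I2)
        fix x assume "x \<in> space unit_leb"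
        then have x: "0 < x" "x < 1" by auto
        have "x powr - \<alpha> * (flx u x)\<^sup>2 \<le> (norm u)\<^sup>2 * x powr \<gamma>"
        proof (cases "\<alpha> < 1")
          case True
          have "(flx u x)\<^sup>2 \<le> (norm u)\<^sup>2" using power_mono[OF flx_bound, of u x 2] by simp
          then show ?thesis using True by (simp add: \<gamma>_def mult.commute mult_left_mono)
        next
          case False
          have "x powr - \<alpha> * (flx u x)\<^sup>2 \<le> x powr - \<alpha> * (x * (norm u)\<^sup>2)"
            using False x by (intro mult_left_mono flx_sq_bound) auto
          also have "x powr - \<alpha> * (x * (norm u)\<^sup>2) = (norm u)\<^sup>2 * x powr \<gamma>"
          proof -
            have "x powr (1 - \<alpha>) = x powr 1 * x powr - \<alpha>" unfolding powr_add[symmetric] by simp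
            then show ?thesis using False x by (simp add: \<gamma>_def)
          qed
          finally show ?thesis .
        qed
        then show "norm (x powr - \<alpha> * (flx u x)\<^sup>2) \<le> norm ((norm u)\<^sup>2 * x powr \<gamma>)" by simp
      qed
    qed
    moreover have "integrable unit_leb (\<lambda>x. x powr \<alpha> * (deriv (sol u) x)\<^sup>2) \<longleftrightarrow> integrable unit_leb (\<lambda>x. x powr - \<alpha> * (flx u x)\<^sup>2)"
      by (rule Bochner_Integration.integrable_cong[OF refl]) (auto intro: eq)
    ultimately show "integrable unit_leb (\<lambda>x. x powr \<alpha> * (deriv (sol u) x)\<^sup>2)" by blast
  qed
  moreover have "flux \<alpha> (sol u) (flx u)"
    unfolding flux_def
  proof (intro conjI flx_abs_continuous AE_I2)
    fix x assume "x \<in> space unit_leb"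
    then show "flx u x = x powr \<alpha> * deriv (sol u) x" by (simp add: deriv_sol powr_minus)
  qed
  moreover have "BC \<alpha> (sol u) (flx u)"
    unfolding BC_def using sol_tendsto_0 flx_tendsto_0 by auto
  ultimately show ?thesis unfolding P_graph_def resolvent_def using d by auto
qed

end

section \<open>Compact self-adjoint operators\<close>

definition compact_operator :: "('a::real_normed_vector \<Rightarrow> 'b::real_normed_vector) \<Rightarrow> bool" where
  "compact_operator K \<longleftrightarrow> bounded_linear K \<and>
     (\<forall>u :: nat \<Rightarrow> 'a. bounded (range u) \<longrightarrow> (\<exists>r l. strict_mono r \<and> (\<lambda>n. K (u (r n))) \<longlonglongrightarrow> l))"

text \<open>Let \<open>s\<close> be the norm of \<open>K\<close> on \<open>V\<close>, and let
  vectors \<open>v n\<close> of the unit ball almost attain it. Self-adjointness forces K (K (v n))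
  - s^2 v n to 0, so compactness makes a subsequence of the \<open>v n\<close> themselves converge,
  to a \<open>w\<close> with K (K w) = s^2 w. Either K w + s w vanishes, and \<open>w\<close>
  belongs to the eigenvalue -s, or this vector belongs to s.\<close>

lemma eigenvector_exists:
  fixes K :: "'a::real_inner \<Rightarrow> 'a"
  assumes K: "compact_operator K" and sa: "\<And>u v. inner (K u) v = inner u (K v)"
    and V: "subspace V" "closed V" and inv: "\<And>v. v \<in> V \<Longrightarrow> K v \<in> V"
    and v0: "v0 \<in> V" "K v0 \<noteq> 0"
  obtains e \<mu> where "e \<in> V" "norm e = 1" "K e = \<mu> *\<^sub>R e" "\<And>v. v \<in> V \<Longrightarrow> norm (K v) \<le> \<bar>\<mu>\<bar> * norm v"
proof -
  interpret K: bounded_linear K using K by (simp add: compact_operator_def)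
  define A where "A = (\<lambda>v. norm (K v)) ` {v \<in> V. norm v \<le> 1}"
  define s where "s = Sup A"
  obtain B where B: "\<And>v. norm (K v) \<le> norm v * B" using K.nonneg_bounded by blast
  have Abdd: "bdd_above A"
  proof (rule bdd_aboveI)
    fix a assume "a \<in> A"
    then obtain v where v: "norm v \<le> 1" "a = norm (K v)" by (auto simp: A_def)
    have "norm v * B \<le> norm v * \<bar>B\<bar>" by (simp add: mult_left_mono)
    also have "\<dots> \<le> \<bar>B\<bar>" using v(1) mult_right_mono[of "norm v" 1 "\<bar>B\<bar>"] by simp
    finally show "a \<le> \<bar>B\<bar>" using B[of v] v(2) by linarith
  qed
  have le_s: "norm (K v) \<le> s * norm v" if v: "v \<in> V" for v
  proof (cases "v = 0")
    case False
    have "(1 / norm v) *\<^sub>R v \<in> V" using V(1) v by (rule subspace_scale)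
    then have "norm (K ((1 / norm v) *\<^sub>R v)) \<in> A" using False by (auto simp: A_def)
    then have "norm (K ((1 / norm v) *\<^sub>R v)) \<le> s" unfolding s_def by (rule cSup_upper[OF _ Abdd])
    then show ?thesis using False by (simp add: K.scaleR field_simps)
  qed simp
  have vn0: "norm v0 > 0" using v0(2) by auto
  have "0 < s * norm v0" using le_s[OF v0(1)] v0(2) by (meson less_le_trans zero_less_norm_iff)
  then have s: "s > 0" using vn0 by (simp add: zero_less_mult_iff)
  have Ane: "A \<noteq> {}" using subspace_0[OF V(1)] by (auto simp: A_def)
  have "\<exists>v. v \<in> V \<and> norm v \<le> 1 \<and> s - 1 / real (Suc n) < norm (K v)" for n
  proof -
    have "s - 1 / real (Suc n) < Sup A" by (simp add: s_def)
    from less_cSupD[OF Ane this] show ?thesis by (auto simp: A_def)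
  qed
  then obtain v where v: "\<And>n. v n \<in> V" "\<And>n. norm (v n) \<le> 1" "\<And>n. s - 1 / real (Suc n) < norm (K (v n))"
    by metis
  have "bounded (range v)" unfolding bounded_iff using v(2) by blast
  then obtain r l where r: "strict_mono r" and l: "(\<lambda>n. K (v (r n))) \<longlonglongrightarrow> l"
    using K unfolding compact_operator_def by blast
  have "(\<lambda>n. norm (K (v n))) \<longlonglongrightarrow> s"
  proof (rule tendsto_sandwich)
    show "(\<lambda>n. s - 1 / real (Suc n)) \<longlonglongrightarrow> s"
      using tendsto_diff[OF tendsto_const LIMSEQ_inverse_real_of_nat, of s]
      by (simp add: inverse_eq_divide)
    show "\<forall>\<^sub>F n in sequentially. norm (K (v n)) \<le> s"
    proof (rule always_eventually, rule allI)
      fix n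
      have "s * norm (v n) \<le> s * 1" using s v(2) by (intro mult_left_mono) auto
      then show "norm (K (v n)) \<le> s" using le_s[OF v(1)[of n]] by linarith
    qed
  qed (use v(3) in \<open>auto intro!: always_eventually less_imp_le\<close>)
  from LIMSEQ_subseq_LIMSEQ[OF this r] have ns: "(\<lambda>n. norm (K (v (r n)))) \<longlonglongrightarrow> s" by (simp add: o_def)
  have key: "(norm (K (K x) - s\<^sup>2 *\<^sub>R x))\<^sup>2 \<le> s\<^sup>2 * (s\<^sup>2 - (norm (K x))\<^sup>2)" if x: "x \<in> V" "norm x \<le> 1" for x
  proof -
    have 1: "(norm (K (K x)))\<^sup>2 \<le> s\<^sup>2 * (norm (K x))\<^sup>2"
      using power_mono[OF le_s[OF inv[OF x(1)]], of 2] by (simp add: power_mult_distrib)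
    have 2: "(norm x)\<^sup>2 \<le> 1" using x(2) by (simp add: power_le_one)
    have 3: "inner (K (K x)) x = (norm (K x))\<^sup>2" by (simp add: sa power2_norm_eq_inner)
    have 4: "inner x (K (K x)) = (norm (K x))\<^sup>2" using 3 by (simp add: inner_commute)
    have "(norm (K (K x) - s\<^sup>2 *\<^sub>R x))\<^sup>2 = (norm (K (K x)))\<^sup>2 - 2 * s\<^sup>2 * (norm (K x))\<^sup>2 + s\<^sup>2 * s\<^sup>2 * (norm x)\<^sup>2"
      unfolding power2_norm_eq_inner inner_diff_left inner_diff_right inner_scaleR_left inner_scaleR_right
      using 3 4 by (simp add: power2_norm_eq_inner algebra_simps)
    also have "s\<^sup>2 * s\<^sup>2 * (norm x)\<^sup>2 \<le> s\<^sup>2 * s\<^sup>2" using mult_left_mono[OF 2, of "s\<^sup>2 * s\<^sup>2"] by simp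
    finally show ?thesis using 1 by (simp add: algebra_simps)
  qed
  have "(\<lambda>n. (norm (K (K (v (r n))) - s\<^sup>2 *\<^sub>R v (r n)))\<^sup>2) \<longlonglongrightarrow> 0"
  proof (rule tendsto_sandwich[OF _ _ tendsto_const])
    have "(\<lambda>n. s\<^sup>2 * (s\<^sup>2 - (norm (K (v (r n))))\<^sup>2)) \<longlonglongrightarrow> s\<^sup>2 * (s\<^sup>2 - s\<^sup>2)"
      by (intro tendsto_intros ns)
    then show "(\<lambda>n. s\<^sup>2 * (s\<^sup>2 - (norm (K (v (r n))))\<^sup>2)) \<longlonglongrightarrow> 0" by simp
    show "\<forall>\<^sub>F n in sequentially. (norm (K (K (v (r n))) - s\<^sup>2 *\<^sub>R v (r n)))\<^sup>2 \<le> s\<^sup>2 * (s\<^sup>2 - (norm (K (v (r n))))\<^sup>2)"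
      using key v by (intro always_eventually allI) blast
  qed simp
  then have "(\<lambda>n. sqrt ((norm (K (K (v (r n))) - s\<^sup>2 *\<^sub>R v (r n)))\<^sup>2)) \<longlonglongrightarrow> sqrt 0"
    by (rule tendsto_real_sqrt)
  then have "(\<lambda>n. norm (K (K (v (r n))) - s\<^sup>2 *\<^sub>R v (r n))) \<longlonglongrightarrow> 0" by simp
  then have d: "(\<lambda>n. K (K (v (r n))) - s\<^sup>2 *\<^sub>R v (r n)) \<longlonglongrightarrow> 0" by (rule tendsto_norm_zero_cancel)
  have "(\<lambda>n. K (K (v (r n)))) \<longlonglongrightarrow> K l" using l by (rule K.tendsto)
  from tendsto_diff[OF this d] have "(\<lambda>n. s\<^sup>2 *\<^sub>R v (r n)) \<longlonglongrightarrow> K l" by simp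
  from tendsto_scaleR[OF tendsto_const this, of "1 / s\<^sup>2"]
  have vl: "(\<lambda>n. v (r n)) \<longlonglongrightarrow> (1 / s\<^sup>2) *\<^sub>R K l" using s by simp
  define w where "w = (1 / s\<^sup>2) *\<^sub>R K l"
  have wV: "w \<in> V" using closed_sequentially[OF V(2), of "\<lambda>n. v (r n)" w] v(1) vl by (simp add: w_def)
  have "(\<lambda>n. K (v (r n))) \<longlonglongrightarrow> K w" using K.tendsto[OF vl] by (simp add: w_def)
  then have Kw: "K w = l" using l by (rule LIMSEQ_unique)
  then have nKw: "norm (K w) = s" using tendsto_norm[OF l] ns LIMSEQ_unique by metis
  have "s\<^sup>2 *\<^sub>R w = K l" using s by (simp add: w_def)
  then have KKw: "K (K w) = s\<^sup>2 *\<^sub>R w" by (simp add: Kw)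
  note obt = that
  have norm_ev: thesis if x: "x \<in> V" "x \<noteq> 0" "K x = \<mu> *\<^sub>R x" "\<bar>\<mu>\<bar> = s" for x \<mu>
  proof (rule obt[of "(1 / norm x) *\<^sub>R x" \<mu>])
    show "(1 / norm x) *\<^sub>R x \<in> V" using V(1) x(1) by (rule subspace_scale)
    show "norm ((1 / norm x) *\<^sub>R x) = 1" using x(2) by simp
    show "K ((1 / norm x) *\<^sub>R x) = \<mu> *\<^sub>R (1 / norm x) *\<^sub>R x" by (simp add: K.scaleR x(3))
    show "norm (K v) \<le> \<bar>\<mu>\<bar> * norm v" if "v \<in> V" for v using le_s[OF that] x(4) by simp
  qed
  show thesis
  proof (cases "K w + s *\<^sub>R w = 0")
    case True
    then have "K w = (- s) *\<^sub>R w" by (simp add: eq_neg_iff_add_eq_0)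
    moreover have "w \<noteq> 0" using nKw s by auto
    ultimately show thesis using norm_ev[OF wV, of "- s"] s by simp
  next
    case False
    have "K (K w + s *\<^sub>R w) = s *\<^sub>R (K w + s *\<^sub>R w)"
      by (simp add: K.add K.scaleR KKw scaleR_add_right power2_eq_square)
    moreover have "K w + s *\<^sub>R w \<in> V" by (intro subspace_add subspace_scale V(1) inv wV)
    ultimately show thesis using norm_ev[OF _ False, of s] s by simp
  qed
qed

text \<open>Each eigenvector has an eigenvalue of maximal modulus on the orthogonal complement of
  its predecessors; \<open>inf\<close> keeps that complement nontrivial. A vector \<open>u\<close>
  orthogonal to all of them satisfies \<open>norm (K u) \<le> \<bar>\<mu> n\<bar> * norm u\<close>
  for every \<open>n\<close>, so \<open>K u = 0\<close>, and injectivity gives completeness.\<close>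

theorem compact_selfadjoint_eigenbasis:
  fixes K :: "'a::real_inner \<Rightarrow> 'a"
  assumes K: "compact_operator K" and sa: "\<And>u v. inner (K u) v = inner u (K v)"
    and inj: "\<And>u. K u = 0 \<Longrightarrow> u = 0"
    and inf: "\<And>F :: 'a set. finite F \<Longrightarrow> (\<And>x y. x \<in> F \<Longrightarrow> y \<in> F \<Longrightarrow> inner x y = (if x = y then 1 else 0)) \<Longrightarrow> \<exists>v\<noteq>0. \<forall>f\<in>F. inner f v = 0"
  obtains e \<mu> where "\<And>i j. inner (e i) (e j) = (if i = j then 1 else 0)"
    "\<And>n. K (e n) = \<mu> n *\<^sub>R e n" "\<And>n. \<mu> n \<noteq> 0" "\<mu> \<longlonglongrightarrow> 0"
    "\<And>u. (\<And>n::nat. inner u (e n) = 0) \<Longrightarrow> u = 0"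
proof -
  interpret K: bounded_linear K using K by (simp add: compact_operator_def)
  define P where "P f n x \<longleftrightarrow> norm x = 1 \<and> (\<forall>i<n. inner (f i) x = 0) \<and>
      (\<exists>\<mu>. K x = \<mu> *\<^sub>R x \<and> (\<forall>v. (\<forall>i<n. inner (f i) v = 0) \<longrightarrow> norm (K v) \<le> \<bar>\<mu>\<bar> * norm v))"
    for f :: "nat \<Rightarrow> 'a" and n x
  have "\<exists>f. \<forall>n. P f n (f n)"
  proof (rule dependent_wellorder_choice)
    show "P f x r = P g x r" if "\<And>y. y < x \<Longrightarrow> f y = g y" for r f g x
      using that by (simp add: P_def)
    show "\<exists>r. P f n r" if IH: "\<And>y. y < n \<Longrightarrow> P f y (f y)" for n f
    proof -
      define V where "V = {v. \<forall>i<n. inner (f i) v = 0}"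
      have "V = (\<Inter>i\<in>{..<n}. {v. inner (f i) v = 0})" by (auto simp: V_def)
      moreover have "closed {v. inner (f i) v = 0}" for i
        by (intro closed_Collect_eq continuous_intros)
      ultimately have "closed V" by (simp add: closed_INT)
      have sV: "subspace V" by (auto simp: V_def subspace_def inner_add_right)
      have inv: "K v \<in> V" if "v \<in> V" for v
        unfolding V_def
      proof safe
        fix i assume i: "i < n"
        then obtain \<mu> where "K (f i) = \<mu> *\<^sub>R f i" using IH unfolding P_def by blast
        then show "inner (f i) (K v) = 0" using that i by (simp add: sa[symmetric] V_def)
      qed
      have f0: "inner (f i) (f j) = 0" if "i < j" "j < n" for i j using IH[of j] that by (simp add: P_def)
      have "inner x y = (if x = y then 1 else 0)" if xy: "x \<in> f ` {..<n}" "y \<in> f ` {..<n}" for x y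
      proof -
        obtain i j where ij: "i < n" "j < n" "x = f i" "y = f j" using xy by auto
        have "inner x x = 1" using IH[of i] ij by (simp add: P_def norm_eq_1)
        moreover have "inner x y = 0" if "x \<noteq> y"
          using f0[of i j] f0[of j i] ij that by (cases i j rule: linorder_cases) (auto simp: inner_commute)
        ultimately show ?thesis by auto
      qed
      then obtain v0 where "v0 \<noteq> 0" "\<forall>x\<in>f ` {..<n}. inner x v0 = 0" using inf[of "f ` {..<n}"] by blast
      then have v0: "v0 \<in> V" "K v0 \<noteq> 0" using inj by (auto simp: V_def)
      obtain e \<mu> where "e \<in> V" "norm e = 1" "K e = \<mu> *\<^sub>R e" "\<And>v. v \<in> V \<Longrightarrow> norm (K v) \<le> \<bar>\<mu>\<bar> * norm v"
        using eigenvector_exists[OF K sa sV \<open>closed V\<close> inv v0] by blast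
      then have "P f n e" unfolding P_def V_def by blast
      then show ?thesis by blast
    qed
  qed
  then obtain e where e: "\<And>n. P e n (e n)" by blast
  then have "\<forall>n. \<exists>\<mu>. K (e n) = \<mu> *\<^sub>R e n \<and> (\<forall>v. (\<forall>i<n. inner (e i) v = 0) \<longrightarrow> norm (K v) \<le> \<bar>\<mu>\<bar> * norm v)"
    unfolding P_def by blast
  from this[unfolded choice_iff] obtain \<mu> where \<mu>: "\<And>n. K (e n) = \<mu> n *\<^sub>R e n"
    "\<And>n v. (\<forall>i<n. inner (e i) v = 0) \<Longrightarrow> norm (K v) \<le> \<bar>\<mu> n\<bar> * norm v" by blast
  have ne: "norm (e n) = 1" for n using e by (simp add: P_def)
  have orth': "inner (e i) (e j) = 0" if "i < j" for i j using e[of j] that by (simp add: P_def)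
  have orth: "inner (e i) (e j) = (if i = j then 1 else 0)" for i j
    using orth'[of i j] orth'[of j i] ne[of i]
    by (cases i j rule: linorder_cases) (auto simp: inner_commute norm_eq_1)
  have \<mu>0: "\<mu> n \<noteq> 0" for n using \<mu>(1)[of n] inj[of "e n"] ne[of n] by auto
  have dec: "decseq (\<lambda>n. \<bar>\<mu> n\<bar>)"
  proof (rule decseq_SucI)
    fix n
    have "norm (K (e (Suc n))) \<le> \<bar>\<mu> n\<bar> * norm (e (Suc n))" using orth' by (intro \<mu>(2)) auto
    then show "\<bar>\<mu> (Suc n)\<bar> \<le> \<bar>\<mu> n\<bar>" by (simp add: \<mu>(1) ne)
  qed
  have "bounded (range e)" unfolding bounded_iff using ne by (metis order_refl rangeE)
  then obtain r l where r: "strict_mono r" and l: "(\<lambda>n. K (e (r n))) \<longlonglongrightarrow> l"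
    using K unfolding compact_operator_def by blast
  \<comment> \<open>Consecutive terms of a convergent sequence get close, but by orthogonality their
    squared distance is the sum of the squares of two eigenvalues. Monotonicity of the moduli then
    passes from the subsequence to the full sequence.\<close>
  have "(\<lambda>n. K (e (r (Suc n))) - K (e (r n))) \<longlonglongrightarrow> l - l"
    by (intro tendsto_diff l LIMSEQ_Suc)
  then have "(\<lambda>n. (norm (K (e (r (Suc n))) - K (e (r n))))\<^sup>2) \<longlonglongrightarrow> (norm (0::'a))\<^sup>2"
    by (intro tendsto_intros) simp
  moreover have "(norm (K (e (r (Suc n))) - K (e (r n))))\<^sup>2 = (\<mu> (r (Suc n)))\<^sup>2 + (\<mu> (r n))\<^sup>2" for n
  proof -
    have "r n \<noteq> r (Suc n)" "r (Suc n) \<noteq> r n" using strict_monoD[OF r, of n "Suc n"] by simp_all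
    then show ?thesis
      unfolding power2_norm_eq_inner
      by (simp add: \<mu>(1) inner_diff_left inner_diff_right orth power2_eq_square)
  qed
  ultimately have sq: "(\<lambda>n. (\<mu> (r (Suc n)))\<^sup>2 + (\<mu> (r n))\<^sup>2) \<longlonglongrightarrow> 0" by simp
  have "(\<lambda>n. (\<mu> (r n))\<^sup>2) \<longlonglongrightarrow> 0"
    by (rule tendsto_sandwich[OF _ _ tendsto_const sq]) (auto intro!: always_eventually)
  then have "(\<lambda>n. sqrt ((\<mu> (r n))\<^sup>2)) \<longlonglongrightarrow> sqrt 0" by (rule tendsto_real_sqrt)
  then have sub: "(\<lambda>n. \<bar>\<mu> (r n)\<bar>) \<longlonglongrightarrow> 0" by simp
  have "(\<lambda>n. \<bar>\<mu> n\<bar>) \<longlonglongrightarrow> 0"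
  proof (rule LIMSEQ_I)
    fix \<epsilon> :: real assume "\<epsilon> > 0"
    then obtain N where N: "\<bar>\<mu> (r N)\<bar> < \<epsilon>" using LIMSEQ_D[OF sub, of \<epsilon>] by fastforce
    have "norm (\<bar>\<mu> n\<bar> - 0) < \<epsilon>" if "n \<ge> r N" for n using decseqD[OF dec that] N by simp
    then show "\<exists>no. \<forall>n\<ge>no. norm (\<bar>\<mu> n\<bar> - 0) < \<epsilon>" by blast
  qed
  then have \<mu>lim: "\<mu> \<longlonglongrightarrow> 0" by (simp add: tendsto_rabs_zero_iff)
  have complete: "u = 0" if u: "\<And>n. inner u (e n) = 0" for u
  proof -
    have "(\<lambda>n. \<bar>\<mu> n\<bar> * norm u) \<longlonglongrightarrow> 0 * norm u"
      by (intro tendsto_intros) (simp add: tendsto_rabs_zero_iff \<mu>lim)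
    then have "norm (K u) \<le> 0 * norm u"
      by (rule LIMSEQ_le_const) (use \<mu>(2) u in \<open>auto simp: inner_commute\<close>)
    then show "u = 0" using inj by simp
  qed
  show thesis using that[OF orth \<mu>(1) \<mu>0 \<mu>lim complete] .
qed

section \<open>The graph of the operator\<close>

lemma abs_continuous_on_deriv:
  assumes "abs_continuous_on a b g" "a < b"
  shows "AE x in lebesgue. x \<in> {a<..<b} \<longrightarrow> (g has_real_derivative deriv g x) (at x)"
proof -
  obtain f where "AE x in lebesgue. x \<in> {a<..<b} \<longrightarrow> (g has_real_derivative f x) (at x)"
    using abs_continuous_on_FTC[OF assms] by blast
  then show ?thesis by eventually_elim (auto simp: DERIV_imp_deriv)
qed

text \<open>Absolute continuity is essential: the Cantor function is continuous with derivative 0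
  almost everywhere. This is the step that makes solutions of the equation with distributional data
  unique up to constants.\<close>

lemma abs_continuous_on_deriv_zero:
  assumes ac: "abs_continuous_on a b g" "a < b"
    and d: "AE x in lebesgue. x \<in> {a<..<b} \<longrightarrow> (g has_real_derivative 0) (at x)"
  shows "g b = g a"
proof -
  obtain f where f: "\<And>x. x \<in> {a..b} \<Longrightarrow> (f has_integral (g x - g a)) {a..x}"
    "AE x in lebesgue. x \<in> {a<..<b} \<longrightarrow> (g has_real_derivative f x) (at x)"
    using abs_continuous_on_FTC[OF ac] by blast
  have "AE x in lebesgue. x \<in> {a<..<b} \<longrightarrow> f x = 0"
    using d f(2) by eventually_elim (auto dest: DERIV_unique)
  then obtain N where N: "N \<in> null_sets lebesgue" "{x. \<not> (x \<in> {a<..<b} \<longrightarrow> f x = 0)} \<subseteq> N"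
    by (auto simp: eventually_ae_filter)
  have "(f has_integral 0) {a..b}"
  proof (rule has_integral_spike[where f = "\<lambda>_. 0" and S = "N \<union> {a, b}"])
    show "negligible (N \<union> {a, b})" using N(1) by (simp add: negligible_iff_null_sets)
    fix x assume "x \<in> {a..b} - (N \<union> {a, b})"
    then have "x \<in> {a<..<b}" "x \<notin> N" by auto
    then show "f x = 0" using N(2) by blast
  qed simp
  moreover have "(f has_integral (g b - g a)) {a..b}" using f(1)[of b] ac(2) by simp
  ultimately have "0 = g b - g a" by (rule has_integral_unique)
  then show ?thesis by simp
qed

text \<open>A diagonal subsequence works for a countable dense set of test vectors, and an
  \<epsilon>/3 argument extends this to all of them. Convergence of each inner product is enough,
  since \<open>compact_resolvent\<close> builds its limit pointwise.\<close>

lemma weakly_convergent_subsequence: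
  fixes u :: "nat \<Rightarrow> 'a::{real_inner, second_countable_topology}"
  assumes "bounded (range u)"
  obtains r :: "nat \<Rightarrow> nat" where "strict_mono r" "\<And>v. convergent (\<lambda>n. inner (u (r n)) v)"
proof -
  obtain M where M: "\<And>n. norm (u n) \<le> M" using assms by (auto simp: bounded_iff)
  obtain D :: "'a set" where D: "countable D" "\<And>X. open X \<Longrightarrow> X \<noteq> {} \<Longrightarrow> \<exists>d\<in>D. d \<in> X"
    using countable_dense_exists[where 'a = 'a] by auto
  have Dne: "D \<noteq> {}" using D(2)[of UNIV] by auto
  define d where "d = from_nat_into D"
  have range_d: "range d = D" using D(1) Dne by (simp add: d_def range_from_nat_into)
  define P where "P k s \<longleftrightarrow> convergent (\<lambda>n. inner (u (s n)) (d k))" for k and s :: "nat \<Rightarrow> nat"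
  interpret subseqs P
  proof
    fix k and s :: "nat \<Rightarrow> nat" assume "strict_mono s"
    have "\<bar>inner (u (s n)) (d k)\<bar> \<le> M * norm (d k)" for n
      by (rule order_trans[OF Cauchy_Schwarz_ineq2]) (intro mult_right_mono M, simp)
    then have "bounded (range (\<lambda>n. inner (u (s n)) (d k)))" by (auto simp: bounded_iff)
    then obtain l r where "strict_mono r" "((\<lambda>n. inner (u (s n)) (d k)) \<circ> r) \<longlonglongrightarrow> l"
      using bounded_imp_convergent_subsequence by blast
    then show "\<exists>r. strict_mono r \<and> P k (s \<circ> r)" by (auto simp: P_def o_def convergent_def)
  qed
  have conv: "convergent (\<lambda>n. inner (u (diagseq n)) (d k))" for k
  proof -
    have "P n (s \<circ> r)" if "strict_mono r" "P n s" for n s r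
      using convergent_subseq_convergent[of "\<lambda>i. inner (u (s i)) (d n)" r] that by (simp add: P_def o_def)
    then have "P k (diagseq \<circ> ((+) (Suc k)))" by (intro diagseq_holds) auto
    then have "convergent (\<lambda>n. inner (u (diagseq (n + Suc k))) (d k))" by (simp add: P_def o_def add.commute)
    then show ?thesis using convergent_ignore_initial_segment[of "\<lambda>n. inner (u (diagseq n)) (d k)" "Suc k"] by simp
  qed
  have "convergent (\<lambda>n. inner (u (diagseq n)) v)" for v
  proof -
    have "Cauchy (\<lambda>n. inner (u (diagseq n)) v)"
    proof (rule metric_CauchyI)
      fix \<epsilon> :: real assume \<epsilon>: "\<epsilon> > 0"
      have M0: "M \<ge> 0" using M[of 0] norm_ge_zero order_trans by blast
      define \<eta> where "\<eta> = \<epsilon> / (3 * (M + 1))"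
      have \<eta>: "\<eta> > 0" using \<epsilon> M0 by (simp add: \<eta>_def)
      obtain x where "x \<in> D" "x \<in> ball v \<eta>" using D(2)[of "ball v \<eta>"] \<eta> by auto
      then obtain k where k: "norm (v - d k) < \<eta>" using range_d by (auto simp: dist_norm)
      have small: "\<bar>inner (u n) v - inner (u n) (d k)\<bar> < \<epsilon> / 3" for n
      proof -
        have "\<bar>inner (u n) (v - d k)\<bar> \<le> norm (u n) * norm (v - d k)" by (rule Cauchy_Schwarz_ineq2)
        also have "\<dots> \<le> M * \<eta>" using M[of n] k M0 by (intro mult_mono) auto
        also have "\<dots> < \<epsilon> / 3" using \<epsilon> M0 by (simp add: \<eta>_def field_simps)
        finally show ?thesis by (simp add: inner_diff_right)
      qed
      have "Cauchy (\<lambda>n. inner (u (diagseq n)) (d k))" using conv by (rule convergent_Cauchy)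
      from metric_CauchyD[OF this, of "\<epsilon> / 3"] obtain N where
        N: "\<And>m n. m \<ge> N \<Longrightarrow> n \<ge> N \<Longrightarrow> dist (inner (u (diagseq m)) (d k)) (inner (u (diagseq n)) (d k)) < \<epsilon> / 3"
        using \<epsilon> by auto
      have "dist (inner (u (diagseq m)) v) (inner (u (diagseq n)) v) < \<epsilon>" if "m \<ge> N" "n \<ge> N" for m n
        using small[of "diagseq m"] small[of "diagseq n"] N[OF that] unfolding dist_real_def by linarith
      then show "\<exists>N. \<forall>m\<ge>N. \<forall>n\<ge>N. dist (inner (u (diagseq m)) v) (inner (u (diagseq n)) v) < \<epsilon>" by blast
    qed
    then show ?thesis by (simp add: Cauchy_convergent_iff)
  qed
  with that[OF subseq_diagseq] show thesis by blast
qed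

lemma L2_norm_mono:
  assumes "L2_fun f" "L2_fun h" "\<And>x. x \<in> {0<..<1} \<Longrightarrow> \<bar>f x\<bar> \<le> \<bar>h x\<bar>"
  shows "norm (L2_class f) \<le> norm (L2_class h)"
  unfolding L2_class_norm[OF assms(1)] L2_class_norm[OF assms(2)]
proof (rule real_sqrt_le_mono, rule integral_mono)
  show "(f x)\<^sup>2 \<le> (h x)\<^sup>2" if "x \<in> space unit_leb" for x
    using assms(3)[of x] that by (simp add: abs_le_square_iff)
qed (use assms in \<open>auto simp: L2_fun_def\<close>)

context degenerate begin

text \<open>The fluxes \<open>w\<close> and \<open>flx b\<close> have the same derivative almost
  everywhere and differ by a constant \<open>c\<close>. Then \<theta> - \<open>sol b\<close> + c
  \<open>pot\<close> has derivative 0 almost everywhere and is a constant \<open>d\<close>. The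
  condition at 1 gives d = 0 and the one at 0 gives c = 0.\<close>

lemma graph_imp_resolvent:
  assumes "(a, b) \<in> P_graph \<alpha>" shows "a = resolvent b"
proof -
  obtain \<theta> w where \<theta>: "a = L2_class \<theta>" "b = L2_class (\<lambda>x. - deriv w x)" "H1_alpha \<alpha> \<theta>" "flux \<alpha> \<theta> w"
    "L2_fun (\<lambda>x. - deriv w x)" "BC \<alpha> \<theta> w" using assms unfolding P_graph_def by blast
  have acw: "abs_continuous_on s t w" if "0 < s" "s \<le> t" "t < 1" for s t
    using \<theta>(4) that by (simp add: flux_def loc_abs_continuous_def)
  have ac\<theta>: "abs_continuous_on s t \<theta>" if "0 < s" "s \<le> t" "t < 1" for s t
    using \<theta>(3) that by (simp add: H1_alpha_def loc_abs_continuous_def)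
  have flux_ae: "AE x in lebesgue. x \<in> {0<..<1} \<longrightarrow> w x = x powr \<alpha> * deriv \<theta> x"
    using \<theta>(4) by (intro AE_unit_lebD) (simp add: flux_def)
  have flx_ae: "AE x in lebesgue. x \<in> {0<..<1} \<longrightarrow> (flx b has_real_derivative deriv w x) (at x)"
    using AE_unit_lebD[OF flx_deriv[OF \<theta>(5)]] by (simp add: \<theta>(2))
  define D where "D x = w x - flx b x" for x
  have Dst: "D s = D t" if st: "0 < s" "s < t" "t < 1" for s t
  proof (rule sym, rule abs_continuous_on_deriv_zero[of s t D])
    show "abs_continuous_on s t D" unfolding D_def
      using st flx_abs_continuous by (intro abs_continuous_on_diff acw) (auto simp: loc_abs_continuous_def)
    have "AE x in lebesgue. x \<in> {s<..<t} \<longrightarrow> (w has_real_derivative deriv w x) (at x)"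
      using st by (intro abs_continuous_on_deriv acw) auto
    then show "AE x in lebesgue. x \<in> {s<..<t} \<longrightarrow> (D has_real_derivative 0) (at x)"
      using flx_ae
    proof eventually_elim
      case (elim x)
      show ?case
      proof
        assume "x \<in> {s<..<t}"
        then have "(w has_real_derivative deriv w x) (at x)" "(flx b has_real_derivative deriv w x) (at x)"
          using elim st by auto
        from DERIV_diff[OF this] show "(D has_real_derivative 0) (at x)" by (simp add: D_def[abs_def])
      qed
    qed
  qed (rule st(2))
  define c where "c = D (1/2)"
  have Dc: "D x = c" if "0 < x" "x < 1" for x
  proof (cases x "1/2::real" rule: linorder_cases)
    case less
    then show ?thesis using Dst[of x "1/2"] that unfolding c_def by simp
  next
    case greater
    then show ?thesis using Dst[of "1/2" x] that unfolding c_def by simp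
  next
    case equal
    then show ?thesis by (simp only: c_def)
  qed
  define D2 where "D2 x = \<theta> x - sol b x - (- c * pot x)" for x
  have D2st: "D2 s = D2 t" if st: "0 < s" "s < t" "t < 1" for s t
  proof (rule sym, rule abs_continuous_on_deriv_zero[of s t D2])
    have "abs_continuous_on s t (\<lambda>x. - c * pot x)"
    proof (rule lipschitz_imp_abs_continuous_on[where L = "\<bar>c\<bar> * s powr (- \<alpha>)"])
      fix x y assume xy: "s \<le> x" "x \<le> y" "y \<le> t"
      have "\<bar>- c * pot y - - c * pot x\<bar> = \<bar>c\<bar> * \<bar>pot y - pot x\<bar>"
        by (simp add: abs_mult[symmetric] algebra_simps abs_minus_commute)
      also have "\<dots> \<le> \<bar>c\<bar> * (s powr (- \<alpha>) * \<bar>y - x\<bar>)"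
        using xy st by (intro mult_left_mono pot_lipschitz) auto
      finally show "\<bar>- c * pot y - - c * pot x\<bar> \<le> \<bar>c\<bar> * s powr (- \<alpha>) * (y - x)"
        using xy by (simp add: mult.assoc)
    qed
    then show "abs_continuous_on s t D2" unfolding D2_def
      using st sol_abs_continuous by (intro abs_continuous_on_diff ac\<theta>) (auto simp: loc_abs_continuous_def)
    have "AE x in lebesgue. x \<in> {s<..<t} \<longrightarrow> (\<theta> has_real_derivative deriv \<theta> x) (at x)"
      using st by (intro abs_continuous_on_deriv ac\<theta>) auto
    then show "AE x in lebesgue. x \<in> {s<..<t} \<longrightarrow> (D2 has_real_derivative 0) (at x)"
      using flux_ae
    proof eventually_elim
      case (elim x)
      show ?case
      proof
        assume x: "x \<in> {s<..<t}"
        then have x01: "0 < x" "x < 1" using st by auto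
        have d: "(\<theta> has_real_derivative deriv \<theta> x) (at x)" "w x = x powr \<alpha> * deriv \<theta> x" using elim x x01 by auto
        have "deriv \<theta> x = x powr (- \<alpha>) * w x" using d(2) x01 by (simp add: powr_minus)
        moreover have "w x = flx b x + c" using Dc[OF x01] by (simp add: D_def)
        ultimately have "deriv \<theta> x - x powr (- \<alpha>) * flx b x - (- c * (- (x powr - \<alpha>))) = 0"
          by (simp add: algebra_simps)
        moreover have "(D2 has_real_derivative deriv \<theta> x - x powr (- \<alpha>) * flx b x - (- c * (- (x powr - \<alpha>)))) (at x)"
          unfolding D2_def[abs_def] using x01 by (intro DERIV_diff DERIV_cmult d(1) sol_deriv pot_deriv)
        ultimately show "(D2 has_real_derivative 0) (at x)" by simp
      qed
    qed
  qed (rule st(2))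
  define d where "d = D2 (1/2)"
  have D2d: "D2 x = d" if "0 < x" "x < 1" for x
  proof (cases x "1/2::real" rule: linorder_cases)
    case less
    then show ?thesis using D2st[of x "1/2"] that unfolding d_def by simp
  next
    case greater
    then show ?thesis using D2st[of "1/2" x] that unfolding d_def by simp
  next
    case equal
    then show ?thesis by (simp only: d_def)
  qed
  have "(D2 \<longlongrightarrow> 0 - 0 - (- c * 0)) (at_left 1)"
    unfolding D2_def[abs_def] using \<theta>(3) by (intro tendsto_intros sol_tendsto_1 pot_tendsto_1) (simp add: H1_alpha_def)
  moreover have "(D2 \<longlongrightarrow> d) (at_left 1)"
    by (rule tendsto_eventually) (auto simp: eventually_at_left[of 0 1] D2d intro!: exI[of _ 0])
  ultimately have d0: "d = 0" using tendsto_unique[of "at_left (1::real)"] by fastforce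
  have \<theta>_eq: "\<theta> x = sol b x - c * pot x" if "0 < x" "x < 1" for x
    using D2d[OF that] d0 by (simp add: D2_def)
  have c0: "c = 0"
  proof (cases "\<alpha> < 1")
    case True
    then have b: "\<beta> > 0" by (simp add: \<beta>_def)
    \<comment> \<open>The factor \<beta> turns \<open>pot\<close> into 1 - x^\<beta>, which tends to
      1 at 0, whereas both \<open>sol b\<close> and \<theta> tend to 0.\<close>
    have "((\<lambda>x. \<beta> * (sol b x - \<theta> x)) \<longlongrightarrow> \<beta> * (0 - 0)) (at_right 0)"
      using \<theta>(6) True by (intro tendsto_intros sol_tendsto_0) (auto simp: BC_def)
    then have "((\<lambda>x. c * (1 - x powr \<beta>)) \<longlongrightarrow> \<beta> * (0 - 0)) (at_right 0)"
    proof (rule Lim_transform_eventually)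
      show "\<forall>\<^sub>F x in at_right 0. \<beta> * (sol b x - \<theta> x) = c * (1 - x powr \<beta>)"
        unfolding eventually_at_right[OF zero_less_one]
      proof (intro exI[of _ 1] conjI allI impI)
        fix x :: real assume x: "0 < x" "x < 1"
        have e1: "1 - x powr \<beta> = \<beta> * pot x" using one_minus_pot[OF x(1)] by simp
        have e2: "sol b x - \<theta> x = c * pot x" using \<theta>_eq[OF x] by simp
        show "\<beta> * (sol b x - \<theta> x) = c * (1 - x powr \<beta>)" unfolding e1 e2 by (rule mult.left_commute)
      qed simp
    qed
    moreover have "((\<lambda>x. c * (1 - x powr \<beta>)) \<longlongrightarrow> c * (1 - 0 powr \<beta>)) (at_right 0)"
      using b by (intro tendsto_intros tendsto_powr') (auto simp: eventually_at_right[of 0 1] intro!: exI[of _ 1])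
    ultimately have "\<beta> * (0 - 0) = c * (1 - 0 powr \<beta>)" by (rule tendsto_unique[rotated]) simp
    then show ?thesis using b by simp
  next
    case False
    have "((\<lambda>x. w x - flx b x) \<longlongrightarrow> 0 - 0) (at_right 0)"
      using \<theta>(6) False by (intro tendsto_intros flx_tendsto_0) (auto simp: BC_def)
    moreover have "((\<lambda>x. w x - flx b x) \<longlongrightarrow> c) (at_right 0)"
      by (rule tendsto_eventually)
        (auto simp: eventually_at_right[of 0 1] Dc[unfolded D_def] intro!: exI[of _ 1])
    ultimately have "0 - 0 = c" by (rule tendsto_unique[rotated]) simp
    then show ?thesis by simp
  qed
  have "L2_fun \<theta>" using \<theta>(3) by (simp add: H1_alpha_def)
  moreover have "AE x in unit_leb. \<theta> x = sol b x" by (rule AE_I2) (simp add: \<theta>_eq c0)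
  ultimately show ?thesis unfolding \<theta>(1) resolvent_def by (intro L2_class_cong_AE sol_L2)
qed

theorem P_graph_eq: "P_graph \<alpha> = {(resolvent v, v) | v. True}"
  using graph_imp_resolvent resolvent_in_graph by auto

lemma bounded_linear_resolvent: "bounded_linear resolvent"
proof (rule bounded_linear_intro)
  define c0 where "c0 = 2 / \<alpha> * norm (L2_class (\<lambda>s. s powr (- \<alpha> / 4)))"
  define h where "h = (\<lambda>s. s powr (- \<alpha> / 4))"
  have h: "L2_fun h" unfolding h_def using alpha by (intro L2_fun_powr) simp
  show "resolvent (u + v) = resolvent u + resolvent v" for u v
    unfolding resolvent_def L2_class_add[OF sol_L2 sol_L2] by (rule arg_cong[where f = L2_class]) (simp add: fun_eq_iff sol_def inner_add_left)
  show "resolvent (r *\<^sub>R u) = r *\<^sub>R resolvent u" for r u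
    unfolding resolvent_def L2_class_scaleR[OF sol_L2 sol_L2] by (rule arg_cong[where f = L2_class]) (simp add: fun_eq_iff sol_def)
  show "norm (resolvent u) \<le> norm u * (c0 * norm (L2_class h))" for u
  proof -
    have c: "norm u * c0 \<ge> 0" using alpha by (simp add: c0_def)
    have "norm (resolvent u) \<le> norm (L2_class (\<lambda>x. norm u * c0 * h x))"
      unfolding resolvent_def
    proof (rule L2_norm_mono[OF sol_L2 L2_fun_scale[OF h]])
      fix x :: real assume x: "x \<in> {0<..<1}"
      have "\<bar>sol u x\<bar> \<le> norm u * norm (L2_class (green x))" using sol_bound x by auto
      also have "\<dots> \<le> norm u * (c0 * h x)"
        using green_norm(2)[of x] x by (intro mult_left_mono) (auto simp: c0_def h_def)
      also have "\<dots> \<le> \<bar>norm u * c0 * h x\<bar>" by (simp add: mult.assoc)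
      finally show "\<bar>sol u x\<bar> \<le> \<bar>norm u * c0 * h x\<bar>" .
    qed
    also have "\<dots> = norm u * (c0 * norm (L2_class h))"
      using c unfolding L2_class_scaleR[OF h L2_fun_zero, symmetric] by (simp add: mult.assoc)
    finally show ?thesis .
  qed
qed

text \<open>The value \<open>sol u x\<close> is an inner product of \<open>u\<close> with a fixed
  vector, so weak convergence of a subsequence makes these functions converge pointwise. They share
  the square integrable majorant given by \<open>green_norm\<close>, and dominated convergence gives
  the limit in norm.\<close>

lemma compact_resolvent: "compact_operator resolvent"
  unfolding compact_operator_def
proof (intro conjI bounded_linear_resolvent allI impI)
  fix u :: "nat \<Rightarrow> L2" assume b: "bounded (range u)"
  then obtain M where M: "\<And>n. norm (u n) \<le> M" by (auto simp: bounded_iff)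
  obtain r where r: "strict_mono r" "\<And>v. convergent (\<lambda>n. inner (u (r n)) v)"
    using weakly_convergent_subsequence[OF b] by blast
  define c0 where "c0 = 2 / \<alpha> * norm (L2_class (\<lambda>s. s powr (- \<alpha> / 4)))"
  have c0: "c0 \<ge> 0" using alpha by (simp add: c0_def)
  define g where "g x = lim (\<lambda>n. sol (u (r n)) x)" for x
  have lim: "(\<lambda>n. sol (u (r n)) x) \<longlonglongrightarrow> g x" for x
    using r(2)[of "L2_class (green x)"] unfolding g_def sol_def by (simp add: convergent_LIMSEQ_iff)
  have "(\<lambda>n. L2_class (sol (u (r n)))) \<longlonglongrightarrow> L2_class g"
  proof (rule L2_dominated_convergence(3)[where h = "\<lambda>x. M * c0 * x powr (- \<alpha> / 4)"])
    show "L2_fun (\<lambda>x. M * c0 * x powr (- \<alpha> / 4))" using alpha by (intro L2_fun_scale L2_fun_powr) simp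
    show m: "sol (u (r n)) \<in> borel_measurable unit_leb" for n using sol_L2 by (simp add: L2_fun_def)
    show "g \<in> borel_measurable unit_leb" by (rule borel_measurable_LIMSEQ_real[OF lim m])
    show "AE x in unit_leb. (\<lambda>n. sol (u (r n)) x) \<longlonglongrightarrow> g x" using lim by simp
    show "AE x in unit_leb. \<bar>sol (u (r n)) x\<bar> \<le> M * c0 * x powr (- \<alpha> / 4)" for n
    proof (rule AE_I2)
      fix x assume "x \<in> space unit_leb"
      then have x: "0 < x" "x \<le> 1" by auto
      have "\<bar>sol (u (r n)) x\<bar> \<le> norm (u (r n)) * norm (L2_class (green x))" by (rule sol_bound[OF x])
      also have "\<dots> \<le> M * (c0 * x powr (- \<alpha> / 4))"
        using green_norm(2)[OF x] M[of "r n"] M[of 0] c0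
        by (intro mult_mono) (auto simp: c0_def intro: order_trans[OF norm_ge_zero])
      finally show "\<bar>sol (u (r n)) x\<bar> \<le> M * c0 * x powr (- \<alpha> / 4)" by (simp add: mult.assoc)
    qed
  qed
  then show "\<exists>r l. strict_mono r \<and> (\<lambda>n. resolvent (u (r n))) \<longlonglongrightarrow> l"
    using r(1) unfolding resolvent_def by blast
qed

text \<open>Fubini and the symmetry of \<open>green\<close>. Integrability over the square comes
  from the product bound on the kernel, because \<open>h\<close> is square integrable.\<close>

lemma selfadjoint_resolvent: "inner (resolvent u) v = inner u (resolvent v)"
proof -
  obtain f where f: "L2_fun f" and u: "u = L2_class f" by (rule L2_class_cases)
  obtain g where g: "L2_fun g" and v: "v = L2_class g" by (rule L2_class_cases)
  interpret sigma_finite_measure unit_leb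
    using finite_measure_unit_leb by (rule finite_measure.axioms)
  interpret pair_sigma_finite unit_leb unit_leb ..
  have [measurable]: "f \<in> borel_measurable unit_leb" "g \<in> borel_measurable unit_leb"
    using f g by (auto simp: L2_fun_def)
  have id_m[measurable]: "(\<lambda>x::real. x) \<in> borel_measurable unit_leb" by (rule borel_imp_unit_leb) simp
  define h where "h s = s powr (- \<alpha> / 4)" for s :: real
  have h: "L2_fun h" unfolding h_def using alpha by (intro L2_fun_powr) simp
  have inn: "inner (resolvent (L2_class a)) (L2_class b) = (\<integral>x. (\<integral>s. a s * green x s * b x \<partial>unit_leb) \<partial>unit_leb)"
    if "L2_fun a" "L2_fun b" for a b
  proof -
    have "inner (resolvent (L2_class a)) (L2_class b) = (\<integral>x. sol (L2_class a) x * b x \<partial>unit_leb)"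
      unfolding resolvent_def by (rule L2_class_inner[OF sol_L2 that(2)])
    also have "\<dots> = (\<integral>x. (\<integral>s. a s * green x s * b x \<partial>unit_leb) \<partial>unit_leb)"
    proof (rule Bochner_Integration.integral_cong[OF refl])
      fix x assume "x \<in> space unit_leb"
      then have "0 < x" "x \<le> 1" by auto
      then show "sol (L2_class a) x * b x = (\<integral>s. a s * green x s * b x \<partial>unit_leb)"
        using L2_fun_integrable_mult[OF that(1) green_L2] unfolding sol_def by (simp add: L2_class_inner that(1) green_L2)
    qed
    finally show ?thesis .
  qed
  have "integrable (unit_leb \<Otimes>\<^sub>M unit_leb) (\<lambda>(x, s). f s * green x s * g x)"
  proof (rule Fubini_integrable)
    show "(\<lambda>(x, s). f s * green x s * g x) \<in> borel_measurable (unit_leb \<Otimes>\<^sub>M unit_leb)"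
      unfolding green_def by measurable
    have bd: "\<bar>f s * green x s * g x\<bar> \<le> 2 / \<alpha> * (\<bar>f s\<bar> * h s) * (\<bar>g x\<bar> * h x)"
      if "x \<in> {0<..<1}" "s \<in> {0<..<1}" for x s
    proof -
      have "\<bar>green x s\<bar> \<le> 2 / \<alpha> * h x * h s" using green_bounds[of x s] that by (simp add: h_def)
      then have "\<bar>f s\<bar> * \<bar>g x\<bar> * \<bar>green x s\<bar> \<le> \<bar>f s\<bar> * \<bar>g x\<bar> * (2 / \<alpha> * h x * h s)" by (intro mult_left_mono) auto
      then show ?thesis by (simp add: abs_mult mult_ac)
    qed
    have fa: "L2_fun (\<lambda>s. \<bar>f s\<bar>)" "L2_fun (\<lambda>s. \<bar>g s\<bar>)" using f g by (auto simp: L2_fun_def intro!: borel_measurable_abs)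
    have fs: "integrable unit_leb (\<lambda>s. f s * green x s * g x)" if "x \<in> {0<..<1}" for x
      using L2_fun_integrable_mult[OF f green_L2[of x]] that by simp
    show "AE x in unit_leb. integrable unit_leb (\<lambda>y. case (x, y) of (x, s) \<Rightarrow> f s * green x s * g x)"
      by (rule AE_I2) (use fs in simp)
    show "integrable unit_leb (\<lambda>x. \<integral>y. norm (case (x, y) of (x, s) \<Rightarrow> f s * green x s * g x) \<partial>unit_leb)"
    proof (rule Bochner_Integration.integrable_bound)
      show "integrable unit_leb (\<lambda>x. (\<integral>s. 2 / \<alpha> * (\<bar>f s\<bar> * h s) \<partial>unit_leb) * (\<bar>g x\<bar> * h x))"
        using L2_fun_integrable_mult[OF fa(2) h] by simp
      show "(\<lambda>x. \<integral>y. norm (case (x, y) of (x, s) \<Rightarrow> f s * green x s * g x) \<partial>unit_leb) \<in> borel_measurable unit_leb"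
        unfolding green_def by measurable
      show "AE x in unit_leb. norm (\<integral>y. norm (case (x, y) of (x, s) \<Rightarrow> f s * green x s * g x) \<partial>unit_leb)
          \<le> norm ((\<integral>s. 2 / \<alpha> * (\<bar>f s\<bar> * h s) \<partial>unit_leb) * (\<bar>g x\<bar> * h x))"
      proof (rule AE_I2)
        fix x assume "x \<in> space unit_leb"
        then have x: "x \<in> {0<..<1}" by simp
        have "(\<integral>s. \<bar>f s * green x s * g x\<bar> \<partial>unit_leb) \<le> (\<integral>s. 2 / \<alpha> * (\<bar>f s\<bar> * h s) * (\<bar>g x\<bar> * h x) \<partial>unit_leb)"
          using fs[OF x] L2_fun_integrable_mult[OF fa(1) h] bd[OF x] by (intro integral_mono) auto
        also have "\<dots> = (\<integral>s. 2 / \<alpha> * (\<bar>f s\<bar> * h s) \<partial>unit_leb) * (\<bar>g x\<bar> * h x)" by simp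
        finally have "(\<integral>s. \<bar>f s * green x s * g x\<bar> \<partial>unit_leb) \<le> (\<integral>s. 2 / \<alpha> * (\<bar>f s\<bar> * h s) \<partial>unit_leb) * (\<bar>g x\<bar> * h x)" .
        moreover have "0 \<le> (\<integral>s. \<bar>f s * green x s * g x\<bar> \<partial>unit_leb)" by simp
        ultimately show "norm (\<integral>y. norm (case (x, y) of (x, s) \<Rightarrow> f s * green x s * g x) \<partial>unit_leb)
          \<le> norm ((\<integral>s. 2 / \<alpha> * (\<bar>f s\<bar> * h s) \<partial>unit_leb) * (\<bar>g x\<bar> * h x))"
          unfolding prod.case real_norm_def by linarith
      qed
    qed
  qed
  from Fubini_integral[OF this]
  have "(\<integral>s. (\<integral>x. f s * green x s * g x \<partial>unit_leb) \<partial>unit_leb) = (\<integral>x. (\<integral>s. f s * green x s * g x \<partial>unit_leb) \<partial>unit_leb)"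
    by simp
  also have "\<dots> = inner (resolvent u) v" unfolding u v by (rule inn[OF f g, symmetric])
  also have "(\<integral>s. (\<integral>x. f s * green x s * g x \<partial>unit_leb) \<partial>unit_leb) = (\<integral>s. (\<integral>x. g x * green s x * f s \<partial>unit_leb) \<partial>unit_leb)"
    by (simp add: green_sym[of s x for s x] mult_ac)
  also have "\<dots> = inner (resolvent v) u" unfolding u v by (rule inn[OF g f, symmetric])
  finally show ?thesis by (simp add: inner_commute)
qed

text \<open>The function \<open>sol u\<close> vanishes almost everywhere, hence everywhere by
  continuity; so does its derivative, therefore the flux, and finally the derivative of the flux,
  which is -f almost everywhere.\<close>

lemma resolvent_inj: assumes "resolvent u = 0" shows "u = 0"
proof -
  obtain f where f: "L2_fun f" and u: "u = L2_class f" by (rule L2_class_cases)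
  have "L2_class (sol u) = L2_class (\<lambda>_. 0)" using assms by (simp add: resolvent_def L2_class_zero)
  then have "AE x in unit_leb. sol u x = 0" by (simp add: L2_class_eq_iff[OF sol_L2 L2_fun_zero])
  from AE_unit_leb_continuous_eq[OF sol_cont continuous_on_const this]
  have s0: "sol u x = 0" if "x \<in> {0<..<1}" for x using that by blast
  have w0: "flx u x = 0" if x: "x \<in> {0<..<1}" for x
  proof -
    have "((\<lambda>_. 0) has_real_derivative x powr (- \<alpha>) * flx u x) (at x)"
      by (rule has_field_derivative_transform_within_open[of "sol u" _ _ "{0<..<1}"]) (use x s0 sol_deriv in auto)
    then have "x powr (- \<alpha>) * flx u x = 0" using DERIV_unique DERIV_const by blast
    then show ?thesis using x by simp
  qed
  have "AE x in unit_leb. x \<in> {0<..<1}" by (rule AE_I2) simp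
  with flx_deriv[OF f] have "AE x in unit_leb. f x = 0"
  proof eventually_elim
    case (elim x)
    have "((\<lambda>_. 0) has_real_derivative - f x) (at x)"
      by (rule has_field_derivative_transform_within_open[of "flx u" _ _ "{0<..<1}"]) (use elim w0 u in auto)
    then have "- f x = 0" using DERIV_unique DERIV_const by blast
    then show ?case by simp
  qed
  then show ?thesis using f by (simp add: u L2_class_zero[symmetric] L2_class_eq_iff L2_fun_zero)
qed

end

text \<open>Indicators of disjoint intervals are orthogonal and nonzero, and one more of them than
  \<open>card F\<close> cannot all lie in the span of \<open>F\<close>. A vector outside the span,
  minus its projection, is the witness.\<close>

lemma L2_infinite_dimensional:
  fixes F :: "L2 set"
  assumes F: "finite F" and on: "\<And>x y. x \<in> F \<Longrightarrow> y \<in> F \<Longrightarrow> inner x y = (if x = y then 1 else 0)"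
  shows "\<exists>v\<noteq>0. \<forall>f\<in>F. inner f v = 0"
proof -
  define J where "J k = {1 / real (k + 2)<..<1 / real (k + 1)}" for k
  define b where "b k = L2_class (indicator (J k))" for k
  have J: "J k \<in> sets lebesgue" for k by (simp add: J_def)
  have dis: "J k \<inter> J l = {}" if "k < l" for k l
  proof -
    have "1 / real (l + 1) \<le> 1 / real (k + 2)" using that by (intro divide_left_mono) auto
    then show ?thesis by (auto simp: J_def)
  qed
  have dis': "J k \<inter> J l = {}" if "k \<noteq> l" for k l using dis[of k l] dis[of l k] that by (cases k l rule: linorder_cases) auto
  have inn: "inner (b k) (b l) = measure lebesgue (J k \<inter> J l)" for k l
  proof -
    have s: "J k \<inter> J l \<subseteq> {0<..<1}"
    proof
      fix x assume "x \<in> J k \<inter> J l"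
      then have x: "1 / real (k + 2) < x" "x < 1 / real (k + 1)" by (auto simp: J_def)
      have "0 < 1 / real (k + 2)" "1 / real (k + 1) \<le> 1" by auto
      then have "0 < x" "x < 1" using x by linarith+
      then show "x \<in> {0<..<1}" by simp
    qed
    have "inner (b k) (b l) = (\<integral>s. indicat_real (J k \<inter> J l) s \<partial>unit_leb)"
      unfolding b_def L2_class_inner[OF L2_fun_indicator[OF J] L2_fun_indicator[OF J]] by (simp add: indicator_inter_arith)
    also have "\<dots> = measure lebesgue (J k \<inter> J l)"
      using s J by (simp add: measure_restrict_space Int_absorb2)
    finally show ?thesis .
  qed
  have bb: "inner (b k) (b k) > 0" for k
  proof -
    have "1 / real (k + 2) < 1 / real (k + 1)" by (intro divide_strict_left_mono) auto
    then show ?thesis unfolding inn by (simp add: J_def)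
  qed
  have orth: "inner (b k) (b l) = 0" if "k \<noteq> l" for k l using dis'[OF that] by (simp add: inn)
  have injb: "inj b" using orth bb by (intro injI) (metis less_irrefl)
  define B where "B = b ` {..card F}"
  have "pairwise orthogonal B" by (auto simp: B_def pairwise_def orthogonal_def intro!: orth)
  moreover have "0 \<notin> B"
  proof
    assume "0 \<in> B"
    then obtain k where "b k = 0" by (auto simp: B_def)
    with bb[of k] show False by simp
  qed
  ultimately have "independent B" by (rule pairwise_orthogonal_independent)
  moreover have "card B = Suc (card F)"
    unfolding B_def using card_image[OF inj_on_subset[OF injb], of "{..card F}"] by simp
  ultimately have "\<not> B \<subseteq> span F" using real_vector.independent_span_bound[OF F, of B] by auto
  then obtain w where w: "w \<notin> span F" by blast
  define v where "v = w - (\<Sum>f\<in>F. inner w f *\<^sub>R f)"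
  have "(\<Sum>f\<in>F. inner w f *\<^sub>R f) \<in> span F" by (intro span_sum span_scale span_base)
  then have "v \<noteq> 0" using w by (auto simp: v_def)
  moreover have "inner f v = 0" if f: "f \<in> F" for f
  proof -
    have "(\<Sum>x\<in>F. inner w x * inner f x) = (\<Sum>x\<in>F. if x = f then inner w f else 0)"
      using on f by (intro sum.cong) auto
    also have "\<dots> = inner f w" using F f by (simp add: inner_commute)
    finally show ?thesis by (simp add: v_def inner_diff_right inner_sum_right)
  qed
  ultimately show ?thesis by blast
qed

section \<open>Eigenfunctions\<close>

text \<open>R exp(-C x) is nonincreasing and R exp(C x) nondecreasing, so a zero of the nonnegative
  \<open>R\<close> propagates to the right and to the left.\<close>

lemma gronwall_zero:
  fixes R :: "real \<Rightarrow> real"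
  assumes d: "\<And>x. x \<in> {a..b} \<Longrightarrow> (R has_real_derivative R' x) (at x)"
    and bd: "\<And>x. x \<in> {a..b} \<Longrightarrow> \<bar>R' x\<bar> \<le> C * R x" and nn: "\<And>x. R x \<ge> 0"
    and x0: "x0 \<in> {a..b}" "R x0 = 0" and x: "x \<in> {a..b}"
  shows "R x = 0"
proof (cases "x0 \<le> x")
  case True
  have "R x * exp (- C * x) \<le> R x0 * exp (- C * x0)"
  proof (rule DERIV_nonpos_imp_nonincreasing[OF True])
    fix y assume "x0 \<le> y" "y \<le> x"
    then have y: "y \<in> {a..b}" using x0 x by auto
    have "((\<lambda>x. R x * exp (- C * x)) has_real_derivative R' y * exp (- C * y) + exp (- C * y) * (- C) * R y) (at y)"
      by (auto intro!: derivative_eq_intros d y)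
    moreover have "R' y * exp (- C * y) + exp (- C * y) * (- C) * R y = exp (- C * y) * (R' y - C * R y)"
      by (simp add: algebra_simps)
    moreover have "exp (- C * y) * (R' y - C * R y) \<le> 0"
      using bd[OF y] by (intro mult_nonneg_nonpos) auto
    ultimately show "\<exists>D. ((\<lambda>x. R x * exp (- C * x)) has_real_derivative D) (at y) \<and> D \<le> 0" by auto
  qed
  then show ?thesis using nn[of x] x0(2) by (simp add: mult_le_0_iff)
next
  case False
  then have le: "x \<le> x0" by simp
  have "R x * exp (C * x) \<le> R x0 * exp (C * x0)"
  proof (rule DERIV_nonneg_imp_nondecreasing[OF le])
    fix y assume "x \<le> y" "y \<le> x0"
    then have y: "y \<in> {a..b}" using x0 x by auto
    have "((\<lambda>x. R x * exp (C * x)) has_real_derivative R' y * exp (C * y) + exp (C * y) * C * R y) (at y)"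
      by (auto intro!: derivative_eq_intros d y)
    moreover have "R' y * exp (C * y) + exp (C * y) * C * R y = exp (C * y) * (R' y + C * R y)"
      by (simp add: algebra_simps)
    moreover have "exp (C * y) * (R' y + C * R y) \<ge> 0"
      using bd[OF y] by (intro mult_nonneg_nonneg) auto
    ultimately show "\<exists>D. ((\<lambda>x. R x * exp (C * x)) has_real_derivative D) (at y) \<and> 0 \<le> D" by auto
  qed
  then show ?thesis using nn[of x] x0(2) by (simp add: mult_le_0_iff)
qed

section \<open>Power series of the Frobenius solution\<close>

context degenerate begin

definition \<kappa> :: real where "\<kappa> = 2 - \<alpha>"

lemma kappa_pos: "\<kappa> > 0" using alpha by (simp add: \<kappa>_def)

text \<open>The coefficients of the Frobenius solution \<open>\<psi> = x\<^sup>\<beta> \<Sum>n. fc n (- \<lambda> x\<^sup>\<kappa>)\<^sup>n\<close> of \<open>(x\<^sup>\<alpha> \<psi>')' = - \<lambda> \<psi>\<close>: the recursion uses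
  \<open>2 \<beta> + \<alpha> - 1 = \<bar>\<alpha> - 1\<bar>\<close> for both values of \<open>\<beta>\<close>. The flux of \<open>\<psi>\<close> is \<open>wpsi\<close> below.\<close>

primrec fc :: "nat \<Rightarrow> real" where
  "fc 0 = 1"
| "fc (Suc n) = fc n / ((real (Suc n) * \<kappa>) * (real (Suc n) * \<kappa> + \<bar>\<alpha> - 1\<bar>))"

lemma fc_pos: "fc n > 0"
  by (induction n) (use kappa_pos in \<open>auto intro!: divide_pos_pos mult_pos_pos add_pos_nonneg\<close>)

lemma fc_le: "fc n \<le> (1 / \<kappa>\<^sup>2) ^ n / (fact n)\<^sup>2"
proof (induction n)
  case (Suc n)
  have k: "real (Suc n) * \<kappa> > 0" using kappa_pos by simp
  have "fc (Suc n) \<le> fc n / ((real (Suc n) * \<kappa>) * (real (Suc n) * \<kappa>))"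
  proof -
    have "c / (X * (X + a)) \<le> c / (X * X)" if "c > 0" "X > 0" "a \<ge> 0" for c X a :: real
      using that by (intro divide_left_mono mult_left_mono mult_pos_pos) auto
    then show ?thesis unfolding fc.simps using fc_pos[of n] k by simp
  qed
  also have "\<dots> \<le> (1 / \<kappa>\<^sup>2) ^ n / (fact n)\<^sup>2 / ((real (Suc n) * \<kappa>) * (real (Suc n) * \<kappa>))"
    using Suc.IH k by (intro divide_right_mono) auto
  also have "\<dots> = (1 / \<kappa>\<^sup>2) ^ Suc n / (fact (Suc n))\<^sup>2"
    by (simp add: power2_eq_square field_simps)
  finally show ?case .
qed simp

lemma summable_fc: "summable (\<lambda>n. fc n * \<bar>z\<bar> ^ n)"
proof (rule summable_comparison_test)
  define y where "y = \<bar>z\<bar> / \<kappa>\<^sup>2"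
  show "summable (\<lambda>n. y ^ n / fact n)"
    using summable_exp[of y] by (simp add: field_simps)
  have "norm (fc n * \<bar>z\<bar> ^ n) \<le> y ^ n / fact n" for n
  proof -
    have f1: "(1::real) \<le> fact n" by (rule fact_ge_1)
    have "fc n * \<bar>z\<bar> ^ n \<le> (1 / \<kappa>\<^sup>2) ^ n / (fact n)\<^sup>2 * \<bar>z\<bar> ^ n"
      using fc_le by (intro mult_right_mono) auto
    also have "\<dots> = y ^ n / (fact n)\<^sup>2" by (simp add: y_def power_divide)
    also have "\<dots> \<le> y ^ n / fact n"
    proof (rule divide_left_mono)
      show "fact n \<le> (fact n :: real)\<^sup>2" using f1 mult_left_mono[OF f1, of "fact n"] by (simp add: power2_eq_square)
    qed (auto simp: y_def)
    finally show ?thesis using fc_pos[of n] by (simp add: abs_mult)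
  qed
  then show "\<exists>N. \<forall>n\<ge>N. norm (fc n * \<bar>z\<bar> ^ n) \<le> y ^ n / fact n" by blast
qed

lemma summable_fc': "summable (\<lambda>n. fc n * z ^ n)"
  by (rule summable_norm_cancel) (use summable_fc[of z] fc_pos in \<open>simp add: abs_mult power_abs less_imp_le\<close>)

text \<open>The factor \<beta> + n \<kappa> is the exponent of the n-th term of the Frobenius
  series, brought down by x d/dx. Thus \<open>H\<close> is the series that belongs to the
  flux.\<close>

definition hc :: "nat \<Rightarrow> real" where "hc n = (\<beta> + real n * \<kappa>) * fc n"

definition F :: "real \<Rightarrow> real" where "F z = (\<Sum>n. fc n * z ^ n)"
definition F1 :: "real \<Rightarrow> real" where "F1 z = (\<Sum>n. diffs fc n * z ^ n)"
definition H :: "real \<Rightarrow> real" where "H z = (\<Sum>n. hc n * z ^ n)"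
definition H1 :: "real \<Rightarrow> real" where "H1 z = (\<Sum>n. diffs hc n * z ^ n)"

lemma F_deriv: "(F has_real_derivative F1 z) (at z)"
  unfolding F_def[abs_def] F1_def by (rule termdiffs_strong_converges_everywhere) (rule summable_fc')

lemma euler_sums:
  fixes c :: "nat \<Rightarrow> real"
  assumes "\<And>z. summable (\<lambda>n. c n * z ^ n)"
  shows "(\<lambda>n. real n * c n * z ^ n) sums (z * (\<Sum>n. diffs c n * z ^ n))"
proof -
  have "summable (\<lambda>n. diffs c n * z ^ n)"
    by (rule termdiff_converges_all) (rule assms)
  from sums_mult[OF diffs_equiv[OF this], of z]
  have "(\<lambda>n. z * (real n * c n * z ^ (n - Suc 0))) sums (z * (\<Sum>n. diffs c n * z ^ n))" by simp
  moreover have "(\<lambda>n. z * (real n * c n * z ^ (n - Suc 0))) = (\<lambda>n. real n * c n * z ^ n)"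
  proof
    fix n show "z * (real n * c n * z ^ (n - Suc 0)) = real n * c n * z ^ n" by (cases n) auto
  qed
  ultimately show ?thesis by simp
qed

lemma H_sums: "(\<lambda>n. hc n * z ^ n) sums (\<beta> * F z + \<kappa> * (z * F1 z))"
proof -
  have "(\<lambda>n. \<beta> * (fc n * z ^ n) + \<kappa> * (real n * fc n * z ^ n)) sums (\<beta> * F z + \<kappa> * (z * F1 z))"
    unfolding F_def F1_def by (intro sums_add sums_mult summable_sums[OF summable_fc'] euler_sums summable_fc')
  then show ?thesis by (simp add: hc_def algebra_simps)
qed

lemma H_eq: "H z = \<beta> * F z + \<kappa> * (z * F1 z)"
  unfolding H_def using H_sums by (rule sums_unique[symmetric])

lemma summable_hc: "summable (\<lambda>n. hc n * z ^ n)"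
  using H_sums by (rule sums_summable)

lemma H_deriv: "(H has_real_derivative H1 z) (at z)"
  unfolding H_def[abs_def] H1_def by (rule termdiffs_strong_converges_everywhere) (rule summable_hc)

text \<open>The eigenvalue equation for power series. The n-th coefficient on the left is (n
  \<kappa>)(n \<kappa> + |\<alpha> - 1|) \<open>fc n\<close>, for either value of \<beta>; it
  vanishes at n = 0, and the recursion of \<open>fc\<close> identifies the rest with a
  shift.\<close>

lemma H1_eq: "(\<alpha> + \<beta> - 1) * H z + \<kappa> * (z * H1 z) = z * F z"
proof -
  have "(\<lambda>n. (\<alpha> + \<beta> - 1) * (hc n * z ^ n) + \<kappa> * (real n * hc n * z ^ n)) sums ((\<alpha> + \<beta> - 1) * H z + \<kappa> * (z * H1 z))"
    unfolding H_def H1_def by (intro sums_add sums_mult summable_sums[OF summable_hc] euler_sums summable_hc)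
  moreover have "(\<alpha> + \<beta> - 1) * (hc n * z ^ n) + \<kappa> * (real n * hc n * z ^ n) = (real n * \<kappa>) * (real n * \<kappa> + \<bar>\<alpha> - 1\<bar>) * fc n * z ^ n" for n
    by (auto simp: hc_def \<beta>_def algebra_simps)
  ultimately have 1: "(\<lambda>n. (real n * \<kappa>) * (real n * \<kappa> + \<bar>\<alpha> - 1\<bar>) * fc n * z ^ n) sums ((\<alpha> + \<beta> - 1) * H z + \<kappa> * (z * H1 z))" by simp
  have eq: "(real (Suc n) * \<kappa>) * (real (Suc n) * \<kappa> + \<bar>\<alpha> - 1\<bar>) * fc (Suc n) = fc n" for n
  proof -
    have "(real (Suc n) * \<kappa>) * (real (Suc n) * \<kappa> + \<bar>\<alpha> - 1\<bar>) > 0"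
      using kappa_pos by (intro mult_pos_pos add_pos_nonneg) auto
    moreover have "X * (c / X) = c" if "X > 0" for X c :: real using that by simp
    ultimately show ?thesis unfolding fc.simps by blast
  qed
  have "(\<lambda>n. (real (Suc n) * \<kappa>) * (real (Suc n) * \<kappa> + \<bar>\<alpha> - 1\<bar>) * fc (Suc n) * z ^ Suc n) sums ((\<alpha> + \<beta> - 1) * H z + \<kappa> * (z * H1 z))"
    using 1 by (subst sums_Suc_iff) simp
  moreover have "(\<lambda>n. z * (fc n * z ^ n)) sums (z * F z)"
    unfolding F_def by (intro sums_mult summable_sums[OF summable_fc'])
  ultimately show ?thesis unfolding eq by (simp add: mult_ac sums_unique2)
qed

lemma F_0: "F 0 = 1" unfolding F_def using powser_zero[of fc] by simp

lemma F_ge_1: "z \<ge> 0 \<Longrightarrow> F z \<ge> 1"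
  unfolding F_def using sum_le_suminf[OF summable_fc'[of z], of "{0}"] fc_pos by (simp add: less_imp_le)

definition psi :: "real \<Rightarrow> real \<Rightarrow> real" where "psi lam x = x powr \<beta> * F (- lam * x powr \<kappa>)"
definition wpsi :: "real \<Rightarrow> real \<Rightarrow> real" where "wpsi lam x = x powr (\<alpha> + \<beta> - 1) * H (- lam * x powr \<kappa>)"

lemma psi_deriv: assumes x: "x > 0"
  shows "(psi lam has_real_derivative x powr (- \<alpha>) * wpsi lam x) (at x)"
proof -
  let ?z = "- lam * x powr \<kappa>"
  have "((\<lambda>x. F (- lam * x powr \<kappa>)) has_real_derivative F1 ?z * (- lam * (\<kappa> * x powr (\<kappa> - 1)))) (at x)"
    by (rule DERIV_chain'[OF _ F_deriv]) (intro DERIV_cmult has_real_derivative_powr x)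
  from DERIV_mult[OF has_real_derivative_powr[OF x, of \<beta>] this]
  have "(psi lam has_real_derivative \<beta> * x powr (\<beta> - 1) * F ?z + F1 ?z * (- lam * (\<kappa> * x powr (\<kappa> - 1))) * x powr \<beta>) (at x)"
    unfolding psi_def[abs_def] .
  moreover have "\<beta> * x powr (\<beta> - 1) * F ?z + F1 ?z * (- lam * (\<kappa> * x powr (\<kappa> - 1))) * x powr \<beta> = x powr (- \<alpha>) * wpsi lam x"
  proof -
    have 1: "x powr (- \<alpha>) * x powr (\<alpha> + \<beta> - 1) = x powr (\<beta> - 1)" by (simp add: powr_add[symmetric])
    have 2: "x powr (\<kappa> - 1) * x powr \<beta> = x powr (\<beta> - 1) * x powr \<kappa>" by (simp add: powr_add[symmetric] algebra_simps)
    have "x powr (- \<alpha>) * wpsi lam x = x powr (\<beta> - 1) * (\<beta> * F ?z + \<kappa> * (?z * F1 ?z))"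
      unfolding wpsi_def H_eq using 1 by (simp add: mult.assoc[symmetric])
    also have "\<dots> = \<beta> * x powr (\<beta> - 1) * F ?z - F1 ?z * lam * \<kappa> * (x powr (\<beta> - 1) * x powr \<kappa>)" by (simp add: algebra_simps)
    finally show ?thesis unfolding 2[symmetric] by (simp add: algebra_simps)
  qed
  ultimately show ?thesis by simp
qed

lemma wpsi_deriv: assumes x: "x > 0"
  shows "(wpsi lam has_real_derivative - lam * psi lam x) (at x)"
proof -
  let ?z = "- lam * x powr \<kappa>" and ?g = "\<alpha> + \<beta> - 1"
  have "((\<lambda>x. H (- lam * x powr \<kappa>)) has_real_derivative H1 ?z * (- lam * (\<kappa> * x powr (\<kappa> - 1)))) (at x)"
    by (rule DERIV_chain'[OF _ H_deriv]) (intro DERIV_cmult has_real_derivative_powr x)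
  from DERIV_mult[OF has_real_derivative_powr[OF x, of ?g] this]
  have "(wpsi lam has_real_derivative ?g * x powr (?g - 1) * H ?z + H1 ?z * (- lam * (\<kappa> * x powr (\<kappa> - 1))) * x powr ?g) (at x)"
    unfolding wpsi_def[abs_def] .
  moreover have "?g * x powr (?g - 1) * H ?z + H1 ?z * (- lam * (\<kappa> * x powr (\<kappa> - 1))) * x powr ?g = - lam * psi lam x"
  proof -
    have 2: "x powr (\<kappa> - 1) * x powr ?g = x powr (?g - 1) * x powr \<kappa>" by (simp add: powr_add[symmetric] algebra_simps)
    have 3: "x powr (?g - 1) * x powr \<kappa> = x powr \<beta>" by (simp add: powr_add[symmetric] \<kappa>_def)
    have "?g * x powr (?g - 1) * H ?z + H1 ?z * (- lam * (\<kappa> * x powr (\<kappa> - 1))) * x powr ?g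
        = ?g * x powr (?g - 1) * H ?z - H1 ?z * lam * \<kappa> * (x powr (\<kappa> - 1) * x powr ?g)" by (simp add: algebra_simps)
    also have "\<dots> = x powr (?g - 1) * (?g * H ?z + \<kappa> * (?z * H1 ?z))" unfolding 2 by (simp add: algebra_simps)
    also have "\<dots> = - lam * (x powr (?g - 1) * x powr \<kappa>) * F ?z" unfolding H1_eq by simp
    also have "\<dots> = - lam * psi lam x" unfolding 3 psi_def by simp
    finally show ?thesis .
  qed
  ultimately show ?thesis by simp
qed

text \<open>For continuous \<open>f\<close> the derivative exists at every point. Eigenfunctions
  therefore satisfy the differential equation classically, and their Wronskian can be differentiated
  everywhere.\<close>

lemma flx_deriv_continuous:
  assumes f: "L2_fun f" and c: "continuous_on {0<..<1} f" and x: "0 < x" "x < 1"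
  shows "(flx (L2_class f) has_real_derivative - f x) (at x)"
proof -
  let ?g = "zero_ext f"
  have gi: "?g integrable_on {a..b}" for a b by (rule zero_ext_integrable_on[OF L2_fun_integrable[OF f]])
  have eq: "(\<integral>s. f s * indicator {..y} s \<partial>unit_leb) = integral {0..y} ?g" for y
  proof -
    have "integral {..y} ?g = integral {0..y} ?g"
      unfolding integral_restrict_UNIV[of _ ?g, symmetric]
      by (rule arg_cong[where f = "integral UNIV"]) (auto simp: zero_ext_def)
    then show ?thesis using integral_unit_leb_indicator[OF L2_fun_integrable[OF f], of "{..y}"] by simp
  qed
  have "isCont f x" using c x by (simp add: continuous_on_eq_continuous_at)
  moreover have "\<forall>\<^sub>F y in nhds x. ?g y = f y"
    using x eventually_nhds_in_open[of "{0<..<1}" x] by (auto simp: zero_ext_def elim: eventually_mono)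
  ultimately have "isCont ?g x" using isCont_cong by blast
  then have cg: "continuous (at x within ({0..1} - {})) ?g" by (simp add: continuous_at_imp_continuous_at_within)
  have "((\<lambda>y. integral {0..y} ?g) has_vector_derivative ?g x) (at x within ({0..1} - {}))"
    by (rule integral_has_vector_derivative_continuous_at[OF gi _ _ cg]) (use x in auto)
  then have "((\<lambda>y. integral {0..y} ?g) has_vector_derivative f x) (at x within {0..1})"
    using x by (simp add: zero_ext_def)
  then have "((\<lambda>y. integral {0..y} ?g) has_real_derivative f x) (at x)"
    using x by (simp add: has_real_derivative_iff_has_vector_derivative at_within_Icc_at)
  then show ?thesis unfolding flx_eq[OF f refl] eq by (auto intro!: derivative_eq_intros)
qed

end

section \<open>Identification of the eigenfunctions\<close>

context degenerate begin

lemma H_over_z_tendsto: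
  assumes "\<beta> = 0" shows "((\<lambda>z. H z / z) \<longlongrightarrow> H1 0) (at 0)"
proof -
  have "H 0 = 0" using H_eq[of 0] assms by simp
  then show ?thesis using H_deriv[of 0] by (simp add: DERIV_def)
qed

lemma zarg_tendsto: "((\<lambda>x. - lam * x powr \<kappa>) \<longlongrightarrow> 0) (at_right 0)"
proof -
  have "((\<lambda>x. - lam * x powr \<kappa>) \<longlongrightarrow> - lam * 0 powr \<kappa>) (at_right 0)"
    using kappa_pos by (intro tendsto_intros tendsto_powr') (auto simp: eventually_at_right[of 0 1] intro!: exI[of _ 1])
  then show ?thesis by simp
qed

lemma F_arg_tendsto: "((\<lambda>x. F (- lam * x powr \<kappa>)) \<longlongrightarrow> 1) (at_right 0)"
  using isCont_tendsto_compose[OF DERIV_isCont[OF F_deriv[of 0]] zarg_tendsto[of lam]] by (simp add: F_0)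

lemma H_arg_tendsto: "((\<lambda>x. H (- lam * x powr \<kappa>)) \<longlongrightarrow> \<beta>) (at_right 0)"
  using isCont_tendsto_compose[OF DERIV_isCont[OF H_deriv[of 0]] zarg_tendsto[of lam]] H_eq[of 0] by (simp add: F_0)

lemma powr_tendsto_0: "a > 0 \<Longrightarrow> ((\<lambda>x::real. x powr a) \<longlongrightarrow> 0) (at_right 0)"
proof -
  assume a: "a > 0"
  then have "((\<lambda>x::real. x powr a) \<longlongrightarrow> 0 powr a) (at_right 0)"
    by (intro tendsto_intros tendsto_powr') (auto simp: eventually_at_right[of 0 1] intro!: exI[of _ 1])
  then show ?thesis by simp
qed

text \<open>The Wronskian of an eigenfunction and \<open>psi\<close> is constant; that it vanishes at \<open>0\<close> makes the two proportional.\<close>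

lemma wronskian_tendsto:
  assumes lam: "lam \<noteq> 0"
  shows "((\<lambda>x. flx u x * psi lam x - sol u x * wpsi lam x) \<longlongrightarrow> 0) (at_right 0)"
proof (cases "\<alpha> < 1")
  case True
  then have b: "\<beta> > 0" "\<alpha> + \<beta> - 1 = 0" by (auto simp: \<beta>_def)
  have p: "((\<lambda>x. psi lam x) \<longlongrightarrow> 0 * 1) (at_right 0)"
    unfolding psi_def by (intro tendsto_mult powr_tendsto_0 b F_arg_tendsto)
  have "((\<lambda>x. flx u x * psi lam x) \<longlongrightarrow> 0) (at_right 0)"
  proof (rule tendsto_0_le[of "psi lam" _ _ "norm u"])
    show "(psi lam \<longlongrightarrow> 0) (at_right 0)" using p by simp
    show "\<forall>\<^sub>F x in at_right 0. norm (flx u x * psi lam x) \<le> norm (psi lam x) * norm u"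
      using flx_bound[of u] by (intro always_eventually allI) (simp add: abs_mult mult.commute[of "\<bar>flx u _\<bar>"] mult_left_mono)
  qed
  moreover have "((\<lambda>x. sol u x * wpsi lam x) \<longlongrightarrow> 0 * \<beta>) (at_right 0)"
  proof (intro tendsto_mult sol_tendsto_0 True)
    show "(wpsi lam \<longlongrightarrow> \<beta>) (at_right 0)"
    proof (rule Lim_transform_eventually[OF H_arg_tendsto[of lam]])
      show "\<forall>\<^sub>F x in at_right 0. H (- lam * x powr \<kappa>) = wpsi lam x"
        using b by (auto simp: eventually_at_right[of 0 1] wpsi_def intro!: exI[of _ 1])
    qed
  qed
  ultimately show ?thesis using tendsto_diff by fastforce
next
  case False
  then have b: "\<beta> = 0" by (simp add: \<beta>_def)
  have "((\<lambda>x. psi lam x) \<longlongrightarrow> 1) (at_right 0)"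
  proof (rule Lim_transform_eventually[OF F_arg_tendsto[of lam]])
    show "\<forall>\<^sub>F x in at_right 0. F (- lam * x powr \<kappa>) = psi lam x"
      using b by (auto simp: eventually_at_right[of 0 1] psi_def intro!: exI[of _ 1])
  qed
  then have 1: "((\<lambda>x. flx u x * psi lam x) \<longlongrightarrow> 0 * 1) (at_right 0)"
    using False by (intro tendsto_mult flx_tendsto_0) auto
  \<comment> \<open>Here \<open>sol u\<close> may blow up, but not faster than x^(-\<alpha>/2). As
    \<beta> = 0, \<open>H\<close> vanishes at 0, so that \<open>wpsi lam\<close> is x^(\<alpha>-1)
    times O(x^\<kappa>), that is O(x). The product is O(x^(1-\<alpha>/2)).\<close>
  let ?M = "norm u * (2 / \<alpha>) * \<bar>lam\<bar>"
  let ?g = "\<lambda>x. ?M * (x powr (1 - \<alpha> / 2) * \<bar>H (- lam * x powr \<kappa>) / (- lam * x powr \<kappa>)\<bar>)"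
  have "((\<lambda>x. sol u x * wpsi lam x) \<longlongrightarrow> 0) (at_right 0)"
  proof (rule Lim_null_comparison[of _ ?g])
    have "filterlim (\<lambda>x. - lam * x powr \<kappa>) (at 0) (at_right 0)"
      unfolding filterlim_at using zarg_tendsto[of lam] lam
      by (auto simp: eventually_at_right[of 0 1] intro!: exI[of _ 1])
    from filterlim_compose[OF H_over_z_tendsto[OF b] this]
    have "(?g \<longlongrightarrow> ?M * (0 * \<bar>H1 0\<bar>)) (at_right 0)"
      using alpha by (intro tendsto_intros powr_tendsto_0) auto
    then show "(?g \<longlongrightarrow> 0) (at_right 0)" by simp
    have "norm (sol u x * wpsi lam x) \<le> ?g x" if x: "0 < x" "x < 1" for x
    proof -
      let ?z = "- lam * x powr \<kappa>"
      have z: "\<bar>?z\<bar> = \<bar>lam\<bar> * x powr \<kappa>" "?z \<noteq> 0" using lam x by (auto simp: abs_mult)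
      have "\<bar>sol u x\<bar> \<le> norm u * (2 / \<alpha> * x powr (- \<alpha> / 2))"
        using sol_bound[of x u] green_norm(1)[of x] pot_le[of x] x
        by (meson less_imp_le mult_left_mono norm_ge_zero order_trans)
      then have 0: "\<bar>sol u x\<bar> * \<bar>wpsi lam x\<bar> \<le> norm u * (2 / \<alpha> * x powr (- \<alpha> / 2)) * \<bar>wpsi lam x\<bar>"
        by (intro mult_right_mono) auto
      define A where "A = \<bar>H ?z / ?z\<bar>"
      have 1: "\<bar>wpsi lam x\<bar> = x powr (\<alpha> - 1) * (\<bar>lam\<bar> * x powr \<kappa> * A)"
      proof -
        have "\<bar>a\<bar> = \<bar>z\<bar> * \<bar>a / z\<bar>" if "z \<noteq> 0" for a z :: real using that by (simp add: abs_divide)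
        from this[OF z(2)] have "\<bar>H ?z\<bar> = \<bar>?z\<bar> * A" unfolding A_def .
        then show ?thesis unfolding wpsi_def using b z(1) by (simp add: abs_mult)
      qed
      have 2: "x powr (- \<alpha> / 2) * x powr (\<alpha> - 1) * x powr \<kappa> = x powr (1 - \<alpha> / 2)"
        by (simp add: powr_add[symmetric] \<kappa>_def)
      have "norm u * (2 / \<alpha> * x powr (- \<alpha> / 2)) * \<bar>wpsi lam x\<bar>
          = ?M * ((x powr (- \<alpha> / 2) * x powr (\<alpha> - 1) * x powr \<kappa>) * A)" unfolding 1 by (simp only: mult_ac)
      then have "\<bar>sol u x\<bar> * \<bar>wpsi lam x\<bar> \<le> ?M * (x powr (1 - \<alpha> / 2) * A)" using 0 unfolding 2 by linarith
      then show ?thesis unfolding A_def real_norm_def abs_mult[of "sol u x"] .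
    qed
    then show "\<forall>\<^sub>F x in at_right 0. norm (sol u x * wpsi lam x) \<le> ?g x"
      by (auto simp: eventually_at_right[of 0 1] intro!: exI[of _ 1])
  qed
  from tendsto_diff[OF 1 this] show ?thesis by simp
qed

lemma F_near_0:
  obtains t0 where "0 < t0" "t0 < 1" "\<And>z. \<bar>z\<bar> \<le> t0 \<Longrightarrow> 1/2 \<le> F z"
proof -
  have "isCont F 0" by (rule DERIV_isCont[OF F_deriv])
  then have "(F \<longlongrightarrow> F 0) (nhds 0)" by (simp add: isCont_def tendsto_at_iff_tendsto_nhds)
  then have "\<forall>\<^sub>F z in nhds 0. dist (F z) (F 0) < 1/2" by (rule tendstoD) simp
  then obtain d where d: "d > 0" "\<And>z. \<bar>z\<bar> < d \<Longrightarrow> \<bar>F z - 1\<bar> < 1/2"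
    by (auto simp: eventually_nhds_metric F_0 dist_real_def)
  show thesis
  proof (rule that[of "min (d / 2) (1/2)"])
    show "1/2 \<le> F z" if "\<bar>z\<bar> \<le> min (d / 2) (1/2)" for z using d(2)[of z] d(1) that by (simp add: abs_if split: if_splits)
  qed (use d(1) in auto)
qed

text \<open>The pairs (\<open>sol v\<close>, \<open>flx v\<close>) and (\<open>psi lam\<close>,
  \<open>wpsi lam\<close>) with lam = 1/\<mu> solve the same first order linear system. Their
  Wronskian vanishes identically, so they are proportional at a point \<open>x0\<close> where
  \<open>psi lam\<close> is positive, and then everywhere by uniqueness for the system.\<close>

lemma eigenfunction:
  assumes K: "resolvent v = \<mu> *\<^sub>R v" and \<mu>: "\<mu> \<noteq> 0" and v: "v \<noteq> 0"
  shows "\<mu> > 0" and "\<exists>n. (\<forall>x\<in>{0<..<1}. sol v x / \<mu> = n * psi (1 / \<mu>) x) \<and> v = L2_class (\<lambda>x. n * psi (1 / \<mu>) x)"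
proof -
  define lam where "lam = 1 / \<mu>"
  have lam: "lam \<noteq> 0" using \<mu> by (simp add: lam_def)
  define \<theta> where "\<theta> x = lam * sol v x" for x
  have \<theta>L: "L2_fun \<theta>" unfolding \<theta>_def by (intro L2_fun_scale sol_L2)
  have v\<theta>: "v = L2_class \<theta>"
  proof -
    have "L2_class \<theta> = lam *\<^sub>R resolvent v" unfolding \<theta>_def resolvent_def by (rule L2_class_scaleR[symmetric, OF sol_L2 sol_L2])
    then show ?thesis using \<mu> by (simp add: K lam_def)
  qed
  have \<theta>c: "continuous_on {0<..<1} \<theta>" unfolding \<theta>_def by (intro continuous_intros sol_cont)
  have flx_d: "(flx v has_real_derivative - \<theta> x) (at x)" if "0 < x" "x < 1" for x
    using flx_deriv_continuous[OF \<theta>L \<theta>c that] v\<theta> by simp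
  define W where "W x = flx v x * psi lam x - sol v x * wpsi lam x" for x
  have Wd: "(W has_real_derivative 0) (at x)" if x: "0 < x" "x < 1" for x
  proof -
    have "(W has_real_derivative (- \<theta> x * psi lam x + x powr (- \<alpha>) * wpsi lam x * flx v x)
        - (x powr (- \<alpha>) * flx v x * wpsi lam x + - lam * psi lam x * sol v x)) (at x)"
      unfolding W_def[abs_def] by (intro DERIV_diff DERIV_mult flx_d sol_deriv psi_deriv wpsi_deriv x)
    then show ?thesis by (simp add: \<theta>_def algebra_simps)
  qed
  have W0: "W x = 0" if x: "0 < x" "x < 1" for x
  proof -
    have "W y = W x" if "0 < y" "y < 1" for y
    proof (cases x y rule: linorder_cases)
      case less
      then show ?thesis using that x by (intro DERIV_isconst2[of x y W y]) (auto intro!: Wd continuous_at_imp_continuous_on DERIV_isCont[OF Wd])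
    next
      case greater
      then show ?thesis using that x by (intro DERIV_isconst2[of y x W x, symmetric]) (auto intro!: Wd continuous_at_imp_continuous_on DERIV_isCont[OF Wd])
    qed simp
    then have "(W \<longlongrightarrow> W x) (at_right 0)"
      by (intro tendsto_eventually) (auto simp: eventually_at_right[of 0 1] intro!: exI[of _ 1])
    moreover have "(W \<longlongrightarrow> 0) (at_right 0)" unfolding W_def[abs_def] by (rule wronskian_tendsto[OF lam])
    ultimately show ?thesis by (rule tendsto_unique[rotated]) simp
  qed
  obtain t0 where t0: "0 < t0" "t0 < 1" "\<And>z. \<bar>z\<bar> \<le> t0 \<Longrightarrow> 1/2 \<le> F z" by (rule F_near_0) blast
  have "\<exists>x0. 0 < x0 \<and> x0 < 1 \<and> psi lam x0 > 0"
  proof -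
    have "\<forall>\<^sub>F x in at_right 0. 1/2 < F (- lam * x powr \<kappa>)" by (rule order_tendstoD(1)[OF F_arg_tendsto]) simp
    then obtain b where b: "b > 0" "\<And>y. 0 < y \<Longrightarrow> y < b \<Longrightarrow> 1/2 < F (- lam * y powr \<kappa>)"
      by (auto simp: eventually_at_right[of 0 1])
    define x0 where "x0 = min (b / 2) (1/2)"
    have x0: "0 < x0" "x0 < b" "x0 < 1" using b(1) by (auto simp: x0_def)
    have "F (- lam * x0 powr \<kappa>) > 0" using b(2)[OF x0(1,2)] by linarith
    then have "psi lam x0 > 0" unfolding psi_def using x0 by (intro mult_pos_pos) auto
    with x0 show ?thesis by blast
  qed
  then obtain x0 where x0: "0 < x0" "x0 < 1" "psi lam x0 > 0" by blast
  define n0 where "n0 = sol v x0 / psi lam x0"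
  define D where "D x = sol v x - n0 * psi lam x" for x
  define V where "V x = flx v x - n0 * wpsi lam x" for x
  have D0: "D x0 = 0" using x0 by (simp add: D_def n0_def)
  have V0: "V x0 = 0" using W0[OF x0(1,2)] x0(3) by (simp add: V_def W_def n0_def field_simps)
  have Dx: "D x = 0" if x: "0 < x" "x < 1" for x
  proof -
    define a where "a = min x x0" define b where "b = max x x0"
    have ab: "0 < a" "b < 1" "x \<in> {a..b}" "x0 \<in> {a..b}" using x x0 by (auto simp: a_def b_def)
    define C where "C = a powr (- \<alpha>) + \<bar>lam\<bar>"
    \<comment> \<open>The squared distance of the two solutions. On \<open>{a..b}\<close>, away from
      the singular point 0, the coefficients of the system are bounded, which gives the differential
      inequality with constant \<open>C\<close>.\<close>
    define R where "R y = (D y)\<^sup>2 + (V y)\<^sup>2" for y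
    have "R x = 0"
    proof (rule gronwall_zero[of a b R "\<lambda>y. 2 * D y * (y powr (- \<alpha>) * V y) + 2 * V y * (- lam * D y)" C x0 x])
      fix y assume y: "y \<in> {a..b}"
      then have y01: "0 < y" "y < 1" using ab by auto
      have Dd: "(D has_real_derivative y powr (- \<alpha>) * V y) (at y)"
        unfolding D_def[abs_def] V_def using y01
        by (auto intro!: derivative_eq_intros sol_deriv psi_deriv simp: algebra_simps)
      have Vd: "(V has_real_derivative - lam * D y) (at y)"
        unfolding V_def[abs_def] D_def using y01
        by (auto intro!: derivative_eq_intros flx_d wpsi_deriv simp: \<theta>_def algebra_simps)
      show "(R has_real_derivative 2 * D y * (y powr (- \<alpha>) * V y) + 2 * V y * (- lam * D y)) (at y)"
        unfolding R_def[abs_def] by (auto intro!: derivative_eq_intros Dd Vd)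
      have ya: "y powr (- \<alpha>) \<le> a powr (- \<alpha>)" using y ab alpha by (intro powr_mono2') auto
      have dv: "\<bar>2 * D y * V y\<bar> \<le> (D y)\<^sup>2 + (V y)\<^sup>2"
        using sum_squares_bound[of "\<bar>D y\<bar>" "\<bar>V y\<bar>"] by (simp add: abs_mult)
      have "2 * D y * (y powr (- \<alpha>) * V y) + 2 * V y * (- lam * D y) = (y powr (- \<alpha>) - lam) * (2 * D y * V y)"
        by (simp add: algebra_simps)
      then have "\<bar>2 * D y * (y powr (- \<alpha>) * V y) + 2 * V y * (- lam * D y)\<bar> = \<bar>y powr (- \<alpha>) - lam\<bar> * \<bar>2 * D y * V y\<bar>"
        by (simp only: abs_mult)
      also have "\<dots> \<le> C * ((D y)\<^sup>2 + (V y)\<^sup>2)"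
      proof (rule mult_mono[OF _ dv])
        have "\<bar>y powr (- \<alpha>) - lam\<bar> \<le> y powr (- \<alpha>) + \<bar>lam\<bar>" using abs_triangle_ineq4[of "y powr (- \<alpha>)" lam] by simp
        then show "\<bar>y powr (- \<alpha>) - lam\<bar> \<le> C" using ya by (simp add: C_def)
      qed (auto simp: C_def)
      finally show "\<bar>2 * D y * (y powr (- \<alpha>) * V y) + 2 * V y * (- lam * D y)\<bar> \<le> C * R y" unfolding R_def .
    qed (use ab D0 V0 in \<open>auto simp: R_def\<close>)
    then show ?thesis by (simp add: R_def)
  qed
  define n where "n = lam * n0"
  have \<theta>n: "\<theta> x = n * psi lam x" if "x \<in> {0<..<1}" for x
    using Dx[of x] that by (simp add: D_def \<theta>_def n_def)
  have nL: "L2_fun (\<lambda>x. n * psi lam x)"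
  proof (rule L2_fun_bound[OF _ \<theta>L])
    show "(\<lambda>x. n * psi lam x) \<in> borel_measurable unit_leb"
      by (intro unit_leb_continuous_measurable continuous_intros continuous_at_imp_continuous_on ballI DERIV_isCont[OF psi_deriv]) auto
  qed (use \<theta>n in auto)
  have vn: "v = L2_class (\<lambda>x. n * psi lam x)"
    unfolding v\<theta> by (rule L2_class_cong_AE[OF \<theta>L nL], rule AE_I2) (simp add: \<theta>n)
  then show "\<exists>n. (\<forall>x\<in>{0<..<1}. sol v x / \<mu> = n * psi (1 / \<mu>) x) \<and> v = L2_class (\<lambda>x. n * psi (1 / \<mu>) x)"
    using \<theta>n by (intro exI[of _ n]) (simp add: \<theta>_def lam_def)
  show "\<mu> > 0"
  proof (rule ccontr)
    assume "\<not> \<mu> > 0"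
    then have lneg: "lam < 0" using \<mu> by (simp add: lam_def)
    have "(\<theta> \<longlongrightarrow> lam * 0) (at_left 1)" unfolding \<theta>_def by (intro tendsto_intros sol_tendsto_1)
    moreover have "(\<theta> \<longlongrightarrow> n * psi lam 1) (at_left 1)"
    proof (rule Lim_transform_eventually)
      have "isCont (psi lam) 1" by (rule DERIV_isCont[OF psi_deriv]) simp
      then have "(psi lam \<longlongrightarrow> psi lam 1) (at_left 1)" by (simp add: isCont_def filterlim_at_split)
      then show "((\<lambda>x. n * psi lam x) \<longlongrightarrow> n * psi lam 1) (at_left 1)" by (intro tendsto_intros)
      show "\<forall>\<^sub>F x in at_left 1. n * psi lam x = \<theta> x"
        using \<theta>n by (auto simp: eventually_at_left[of 0 1] intro!: exI[of _ 0])
    qed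
    ultimately have "lam * 0 = n * psi lam 1" by (rule tendsto_unique[rotated]) simp
    \<comment> \<open>For negative \<open>lam\<close> the argument of \<open>F\<close> is positive
      and so are all its coefficients; \<open>psi lam\<close> cannot meet the boundary condition at
      1, which \<theta> satisfies.\<close>
    moreover have "psi lam 1 \<ge> 1" unfolding psi_def using F_ge_1[of "- lam"] lneg by simp
    ultimately have "n = 0" by auto
    then have "v = 0" using vn by (simp add: L2_class_zero)
    with v show False by simp
  qed
qed

end

section \<open>Expansion in a Hilbert basis\<close>

locale hilbert_basis =
  fixes e :: "nat \<Rightarrow> 'a::{real_inner, banach}"
  assumes orth: "inner (e i) (e j) = (if i = j then 1 else 0)"
    and complete: "(\<And>n. inner u (e n) = 0) \<Longrightarrow> u = 0"
begin

lemma coeff_eqI: "(\<And>n. inner u (e n) = inner v (e n)) \<Longrightarrow> u = v"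
  using complete[of "u - v"] by (simp add: inner_diff_left)

lemma inner_sum_e:
  assumes "finite F" shows "inner (\<Sum>k\<in>F. c k *\<^sub>R e k) (e j) = (if j \<in> F then c j else 0)"
  using assms by (simp add: inner_sum_left orth if_distrib cong: if_cong)

lemma norm_sum_sq:
  assumes "finite F" shows "(norm (\<Sum>k\<in>F. c k *\<^sub>R e k))\<^sup>2 = (\<Sum>k\<in>F. (c k)\<^sup>2)"
proof -
  define p where "p = (\<Sum>k\<in>F. c k *\<^sub>R e k)"
  have "inner p (\<Sum>k\<in>F. c k *\<^sub>R e k) = (\<Sum>k\<in>F. c k * inner p (e k))" by (simp add: inner_sum_right)
  also have "\<dots> = (\<Sum>k\<in>F. c k * c k)"
    unfolding p_def using assms by (intro sum.cong refl) (simp add: inner_sum_e)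
  finally show ?thesis unfolding power2_norm_eq_inner p_def by (simp add: power2_eq_square)
qed

lemma bessel:
  assumes "finite F" shows "(\<Sum>k\<in>F. (inner u (e k))\<^sup>2) \<le> (norm u)\<^sup>2"
proof -
  define p where "p = (\<Sum>k\<in>F. inner u (e k) *\<^sub>R e k)"
  have "inner u p = (\<Sum>k\<in>F. (inner u (e k))\<^sup>2)"
    by (simp add: p_def inner_sum_right power2_eq_square)
  moreover have "inner p p = (\<Sum>k\<in>F. (inner u (e k))\<^sup>2)"
    using norm_sum_sq[OF assms, of "\<lambda>k. inner u (e k)"] by (simp add: p_def power2_norm_eq_inner)
  moreover have "0 \<le> inner (u - p) (u - p)" by simp
  ultimately show ?thesis
    by (simp add: inner_diff_left inner_diff_right power2_norm_eq_inner inner_commute)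
qed

lemma summable_coeff_sq: "summable (\<lambda>k. (inner u (e k))\<^sup>2)"
  by (rule summableI_nonneg_bounded[where x = "(norm u)\<^sup>2"]) (auto intro: bessel)

lemma summable_expansion:
  assumes c: "summable (\<lambda>k. (c k)\<^sup>2)" shows "summable (\<lambda>k. c k *\<^sub>R e k)"
  unfolding summable_Cauchy
proof (intro allI impI)
  fix \<epsilon> :: real assume \<epsilon>: "\<epsilon> > 0"
  then have "\<epsilon>\<^sup>2 > 0" by simp
  then obtain N where N: "\<And>m n. m \<ge> N \<Longrightarrow> norm (\<Sum>k\<in>{m..<n}. (c k)\<^sup>2) < \<epsilon>\<^sup>2"
    using c unfolding summable_Cauchy by blast
  have "norm (\<Sum>k\<in>{m..<n}. c k *\<^sub>R e k) < \<epsilon>" if "m \<ge> N" for m n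
  proof -
    have "(norm (\<Sum>k\<in>{m..<n}. c k *\<^sub>R e k))\<^sup>2 < \<epsilon>\<^sup>2"
      using N[OF that, of n] by (simp add: norm_sum_sq)
    then show ?thesis using \<epsilon> by (meson less_imp_le power2_less_imp_less)
  qed
  then show "\<exists>N. \<forall>m\<ge>N. \<forall>n. norm (\<Sum>k\<in>{m..<n}. c k *\<^sub>R e k) < \<epsilon>" by blast
qed

lemma coeff_suminf:
  assumes c: "summable (\<lambda>k. (c k)\<^sup>2)" shows "inner (\<Sum>k. c k *\<^sub>R e k) (e j) = c j"
proof -
  have s: "(\<lambda>k. c k *\<^sub>R e k) sums (\<Sum>k. c k *\<^sub>R e k)" using summable_expansion[OF c] by (rule summable_sums)
  have "(\<lambda>k. inner (c k *\<^sub>R e k) (e j)) sums inner (\<Sum>k. c k *\<^sub>R e k) (e j)"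
    by (rule bounded_linear.sums[OF bounded_linear_inner_left s])
  moreover have "(\<lambda>k. inner (c k *\<^sub>R e k) (e j)) = (\<lambda>k. if k = j then c j else 0)"
    by (auto simp: orth)
  ultimately show ?thesis using sums_single[of j "\<lambda>_. c j"] sums_unique2 by metis
qed

lemma expansion: "(\<lambda>k. inner u (e k) *\<^sub>R e k) sums u"
proof -
  have "(\<Sum>k. inner u (e k) *\<^sub>R e k) = u"
    by (rule coeff_eqI) (rule coeff_suminf[OF summable_coeff_sq])
  then show ?thesis using summable_sums[OF summable_expansion[OF summable_coeff_sq[of u]]] by simp
qed

lemma parseval: "(\<lambda>k. (inner u (e k))\<^sup>2) sums (norm u)\<^sup>2"
proof -
  have "(\<lambda>k. inner u (inner u (e k) *\<^sub>R e k)) sums inner u u"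
    by (rule bounded_linear.sums[OF bounded_linear_inner_right expansion])
  then show ?thesis unfolding power2_norm_eq_inner by (simp add: power2_eq_square)
qed

lemma norm_le_coeff:
  assumes "\<And>n. \<bar>inner u (e n)\<bar> \<le> B * \<bar>inner v (e n)\<bar>" "0 \<le> B" shows "norm u \<le> B * norm v"
proof (rule power2_le_imp_le)
  have "(inner u (e n))\<^sup>2 \<le> B\<^sup>2 * (inner v (e n))\<^sup>2" for n
    using power_mono[OF assms(1)[of n], of 2] by (simp add: power_mult_distrib)
  then show "(norm u)\<^sup>2 \<le> (B * norm v)\<^sup>2"
    using sums_le[OF _ parseval[of u] sums_mult[OF parseval[of v], of "B\<^sup>2"]]
    by (simp add: power_mult_distrib)
qed (simp add: assms(2))

definition multiplier :: "(nat \<Rightarrow> real) \<Rightarrow> 'a \<Rightarrow> 'a" where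
  "multiplier m u = (\<Sum>k. (m k * inner u (e k)) *\<^sub>R e k)"

lemma coeff_multiplier:
  assumes "\<And>k. \<bar>m k\<bar> \<le> B" shows "inner (multiplier m u) (e n) = m n * inner u (e n)"
  unfolding multiplier_def
proof (rule coeff_suminf, rule summable_comparison_test)
  have "norm ((m k * inner u (e k))\<^sup>2) \<le> B\<^sup>2 * (inner u (e k))\<^sup>2" for k
    using power_mono[OF assms[of k], of 2] by (simp add: power_mult_distrib mult_right_mono)
  then show "\<exists>N. \<forall>k\<ge>N. norm ((m k * inner u (e k))\<^sup>2) \<le> B\<^sup>2 * (inner u (e k))\<^sup>2" by blast
  show "summable (\<lambda>k. B\<^sup>2 * (inner u (e k))\<^sup>2)" by (intro summable_mult summable_coeff_sq)
qed

lemma norm_multiplier: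
  assumes "\<And>k. \<bar>m k\<bar> \<le> B" shows "norm (multiplier m u) \<le> B * norm u"
proof (rule norm_le_coeff)
  show B: "0 \<le> B" using assms[of 0] by linarith
  show "\<bar>inner (multiplier m u) (e n)\<bar> \<le> B * \<bar>inner u (e n)\<bar>" for n
    using assms[of n] by (simp add: coeff_multiplier[OF assms] abs_mult mult_right_mono)
qed

lemma bounded_linear_multiplier:
  assumes "\<And>k. \<bar>m k\<bar> \<le> B" shows "bounded_linear (multiplier m)"
proof (rule bounded_linear_intro[where K = B])
  show "norm (multiplier m u) \<le> norm u * B" for u using norm_multiplier[OF assms] by (simp add: mult.commute)
qed (rule coeff_eqI, simp add: coeff_multiplier[OF assms] inner_add_left algebra_simps)+

text \<open>On finite combinations the convergence is that of finitely many coefficients. All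
  multipliers involved are contractions, so replacing \<open>u\<close> by such a combination costs
  less than \<epsilon>/4 on either side, uniformly in \<open>h\<close>.\<close>

lemma tendsto_multiplier:
  assumes m: "\<And>h k. \<bar>m h k\<bar> \<le> 1" and lim: "\<And>k. ((\<lambda>h. m h k) \<longlongrightarrow> a k) F"
    and a: "\<And>k. \<bar>a k\<bar> \<le> 1"
  shows "((\<lambda>h. multiplier (m h) u) \<longlongrightarrow> multiplier a u) F"
proof (rule tendstoI)
  fix \<epsilon> :: real assume \<epsilon>: "\<epsilon> > 0"
  obtain N where N: "norm (u - (\<Sum>k<N. inner u (e k) *\<^sub>R e k)) < \<epsilon> / 4"
  proof -
    have "(\<lambda>N. \<Sum>k<N. inner u (e k) *\<^sub>R e k) \<longlonglongrightarrow> u" using expansion by (simp add: sums_def)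
    from LIMSEQ_D[OF this, of "\<epsilon> / 4"] \<epsilon> show thesis using that by (metis divide_pos_pos norm_minus_commute order_refl zero_less_numeral)
  qed
  define p where "p = (\<Sum>k<N. inner u (e k) *\<^sub>R e k)"
  have mp: "multiplier b p = (\<Sum>k<N. (b k * inner u (e k)) *\<^sub>R e k)" if "\<And>k. \<bar>b k\<bar> \<le> 1" for b
    by (rule coeff_eqI) (simp add: coeff_multiplier[OF that] p_def inner_sum_e)
  have "((\<lambda>h. \<Sum>k<N. (m h k * inner u (e k)) *\<^sub>R e k) \<longlongrightarrow> (\<Sum>k<N. (a k * inner u (e k)) *\<^sub>R e k)) F"
    by (intro tendsto_intros lim)
  then have "((\<lambda>h. multiplier (m h) p) \<longlongrightarrow> multiplier a p) F" by (simp add: mp m a)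
  then have "\<forall>\<^sub>F h in F. dist (multiplier (m h) p) (multiplier a p) < \<epsilon> / 2"
    using \<epsilon> by (intro tendstoD) auto
  then show "\<forall>\<^sub>F h in F. dist (multiplier (m h) u) (multiplier a u) < \<epsilon>"
  proof eventually_elim
    case (elim h)
    have 1: "norm (multiplier (m h) u - multiplier (m h) p) < \<epsilon> / 4"
      using norm_multiplier[of "m h" 1 "u - p", OF m] N
      by (simp add: p_def[symmetric] linear_diff[OF bounded_linear.linear[OF bounded_linear_multiplier[where m = "m h", OF m]]])
    have 2: "norm (multiplier a u - multiplier a p) < \<epsilon> / 4"
      using norm_multiplier[of a 1 "u - p", OF a] N
      by (simp add: p_def[symmetric] linear_diff[OF bounded_linear.linear[OF bounded_linear_multiplier[OF a]]])
    have 3: "norm (multiplier (m h) p - multiplier a p) < \<epsilon> / 2" using elim by (simp add: dist_norm)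
    have "norm (x - z) \<le> norm (x - x') + norm (x' - z') + norm (z - z')" for x x' z z' :: 'a
      using norm_triangle_ineq[of "x - x'" "x' - z'"] norm_triangle_ineq4[of "x - z'" "z - z'"] by simp
    from this[of "multiplier (m h) u" "multiplier a u" "multiplier (m h) p" "multiplier a p"]
    have "norm (multiplier (m h) u - multiplier a u) < \<epsilon>" using 1 2 3 by linarith
    then show ?case by (simp add: dist_norm)
  qed
qed

end

section \<open>The eigenbasis of the degenerate operator\<close>

text \<open>The representative chosen by \<open>rep_L2\<close> is arbitrary; for Lebesgue measurable
  sets \<open>restr_class\<close> shows that the result does not depend on it.\<close>

definition restr :: "real set \<Rightarrow> L2 \<Rightarrow> L2" where
  "restr A u = L2_class (\<lambda>x. indicat_real A x * rep_L2 u x)"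

lemma rep_L2: "L2_fun (rep_L2 u)" "L2_class (rep_L2 u) = u"
proof -
  have "L2_rel (rep_L2 u) (rep_L2 u)" using Quotient3_rep_reflp[OF Quotient3_L2] .
  then show "L2_fun (rep_L2 u)" by (simp add: L2_rel_def)
  then show "L2_class (rep_L2 u) = u" using Quotient3_abs_rep[OF Quotient3_L2] by (simp add: L2_class_def)
qed

lemma L2_fun_indicator_mult:
  assumes "A \<in> sets lebesgue" "L2_fun f" shows "L2_fun (\<lambda>x. indicat_real A x * f x)"
proof (rule L2_fun_bound[OF _ assms(2)])
  show "(\<lambda>x. indicat_real A x * f x) \<in> borel_measurable unit_leb"
    using L2_fun_measurable[OF L2_fun_indicator[OF assms(1)]] L2_fun_measurable[OF assms(2)] by (rule borel_measurable_times)
qed (auto simp: indicator_def)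

lemma restr_class:
  assumes "A \<in> sets lebesgue" "L2_fun f"
  shows "restr A (L2_class f) = L2_class (\<lambda>x. indicat_real A x * f x)"
  unfolding restr_def
proof (rule L2_class_cong_AE)
  have "AE x in unit_leb. rep_L2 (L2_class f) x = f x"
    using rep_L2[of "L2_class f"] assms(2) by (simp add: L2_class_eq_iff[symmetric])
  then show "AE x in unit_leb. indicat_real A x * rep_L2 (L2_class f) x = indicat_real A x * f x"
    by eventually_elim simp
qed (intro L2_fun_indicator_mult assms rep_L2)+

lemma restr_idem: "A \<in> sets lebesgue \<Longrightarrow> restr A (restr A u) = restr A u"
proof -
  assume A: "A \<in> sets lebesgue"
  show ?thesis unfolding restr_def[of A u]
    unfolding restr_class[OF A L2_fun_indicator_mult[OF A rep_L2(1)]]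
    by (rule arg_cong[where f = L2_class]) (auto simp: indicator_def)
qed

lemma inner_restr: "A \<in> sets lebesgue \<Longrightarrow> inner (restr A u) v = (\<integral>x. indicat_real A x * (rep_L2 u x * rep_L2 v x) \<partial>unit_leb)"
  using L2_class_inner[OF L2_fun_indicator_mult[OF _ rep_L2(1)] rep_L2(1), of A u v]
  by (simp add: rep_L2 restr_def mult.assoc)

lemma restr_selfadjoint: "A \<in> sets lebesgue \<Longrightarrow> inner (restr A u) v = inner u (restr A v)"
  using inner_restr[of A u v] inner_restr[of A v u] by (simp add: inner_commute mult.commute)

lemma restr_add: "A \<in> sets lebesgue \<Longrightarrow> restr A (u + v) = restr A u + restr A v"
  using restr_class[OF _ L2_fun_add[OF rep_L2(1) rep_L2(1)], of A u v]
    L2_class_add[OF L2_fun_indicator_mult[OF _ rep_L2(1)] L2_fun_indicator_mult[OF _ rep_L2(1)], of A A u v]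
  by (simp add: restr_def[symmetric] L2_class_add[OF rep_L2(1) rep_L2(1), symmetric] rep_L2(2) distrib_left)

lemma restr_scaleR: "A \<in> sets lebesgue \<Longrightarrow> restr A (c *\<^sub>R u) = c *\<^sub>R restr A u"
  using restr_class[OF _ L2_fun_scale[OF rep_L2(1)], of A c u]
    L2_class_scaleR[OF L2_fun_indicator_mult[OF _ rep_L2(1)] L2_fun_zero, of A c u]
  by (simp add: restr_def[symmetric] L2_class_scaleR[OF rep_L2(1) L2_fun_zero, symmetric] rep_L2(2) mult.left_commute)

lemma norm_restr_sq: "A \<in> sets lebesgue \<Longrightarrow> (norm (restr A u))\<^sup>2 = inner (restr A u) u"
proof -
  assume A: "A \<in> sets lebesgue"
  have "inner (restr A u) (restr A u) = inner (restr A (restr A u)) u" by (rule restr_selfadjoint[OF A, symmetric])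
  then show ?thesis by (simp add: power2_norm_eq_inner restr_idem[OF A])
qed

lemma norm_restr_le: "A \<in> sets lebesgue \<Longrightarrow> norm (restr A u) \<le> norm u"
proof -
  assume A: "A \<in> sets lebesgue"
  have "(norm (restr A u))\<^sup>2 \<le> norm (restr A u) * norm u"
    unfolding norm_restr_sq[OF A] by (rule norm_cauchy_schwarz)
  then show ?thesis by (metis linorder_not_less mult_le_cancel_left_pos norm_ge_zero order_le_less power2_eq_square)
qed

lemma bounded_linear_restr: "A \<in> sets lebesgue \<Longrightarrow> bounded_linear (restr A)"
  by (rule bounded_linear_intro[where K = 1]) (simp_all add: restr_add restr_scaleR norm_restr_le)

context degenerate begin

theorem eigenbasis:
  obtains e :: "nat \<Rightarrow> L2" and lam nk :: "nat \<Rightarrow> real"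
  where "hilbert_basis e" "\<And>k. lam k > 0" "filterlim lam at_top sequentially"
    "\<And>k. resolvent (e k) = (1 / lam k) *\<^sub>R e k"
    "\<And>k x. x \<in> {0<..<1} \<Longrightarrow> lam k * sol (e k) x = nk k * psi (lam k) x"
    "\<And>k. e k = L2_class (\<lambda>x. nk k * psi (lam k) x)"
proof -
  obtain e \<mu> where e: "\<And>i j. inner (e i) (e j) = (if i = j then 1 else 0)"
    "\<And>n. resolvent (e n) = \<mu> n *\<^sub>R e n" "\<And>n. \<mu> n \<noteq> 0" "\<mu> \<longlonglongrightarrow> 0"
    "\<And>u. (\<And>n::nat. inner u (e n) = 0) \<Longrightarrow> u = 0"
    by (rule compact_selfadjoint_eigenbasis[OF compact_resolvent selfadjoint_resolvent resolvent_inj L2_infinite_dimensional]) blast+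
  have ne: "e n \<noteq> 0" for n using e(1)[of n n] by auto
  define lam where "lam k = 1 / \<mu> k" for k
  have pos: "\<mu> k > 0" for k by (rule eigenfunction(1)[OF e(2) e(3) ne])
  have "\<forall>k. \<exists>n. (\<forall>x\<in>{0<..<1}. sol (e k) x / \<mu> k = n * psi (1 / \<mu> k) x) \<and> e k = L2_class (\<lambda>x. n * psi (1 / \<mu> k) x)"
    using eigenfunction(2)[OF e(2) e(3) ne] by blast
  then obtain nk where nk: "\<And>k. (\<forall>x\<in>{0<..<1}. sol (e k) x / \<mu> k = nk k * psi (1 / \<mu> k) x) \<and> e k = L2_class (\<lambda>x. nk k * psi (1 / \<mu> k) x)"
    unfolding choice_iff by blast
  have "filterlim lam at_top sequentially"
  proof -
    have "filterlim \<mu> (at_right 0) sequentially"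
      using e(3,4) pos by (auto simp: filterlim_at intro!: always_eventually)
    from filterlim_compose[OF filterlim_inverse_at_top_right this]
    show ?thesis by (simp add: lam_def[abs_def] inverse_eq_divide)
  qed
  moreover have "hilbert_basis e"
  proof (rule hilbert_basis.intro)
    show "inner (e i) (e j) = (if i = j then 1 else 0)" for i j by (rule e(1))
    show "u = 0" if "\<And>n. inner u (e n) = 0" for u using that by (rule e(5))
  qed
  ultimately show thesis
  proof (intro that[of e lam nk])
    show "lam k > 0" for k using pos by (simp add: lam_def)
    show "resolvent (e k) = (1 / lam k) *\<^sub>R e k" for k by (simp add: lam_def e(2))
    show "lam k * sol (e k) x = nk k * psi (lam k) x" if "x \<in> {0<..<1}" for k x
      using nk[of k] that by (auto simp: lam_def)
    show "e k = L2_class (\<lambda>x. nk k * psi (lam k) x)" for k using nk[of k] by (simp only: lam_def)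
  qed
qed

end

locale degenerate_basis = degenerate \<alpha> + hilbert_basis e for \<alpha> and e :: "nat \<Rightarrow> L2" +
  fixes lam nk :: "nat \<Rightarrow> real"
  assumes lam_pos: "lam k > 0" and lam_lim: "filterlim lam at_top sequentially"
    and resolvent_e: "resolvent (e k) = (1 / lam k) *\<^sub>R e k"
    and sol_e: "x \<in> {0<..<1} \<Longrightarrow> lam k * sol (e k) x = nk k * psi (lam k) x"
    and e_class: "e k = L2_class (\<lambda>x. nk k * psi (lam k) x)"
begin

text \<open>The value \<open>nk k * psi (lam k) x\<close> is \<open>lam k\<close> times a
  coefficient of \<open>green x\<close> in the basis. If x^\<kappa> = t0/\<Lambda>, then
  \<open>F\<close> is at least 1/2 at the arguments of all frequencies up to \<Lambda>, so no
  \<open>psi (lam k) x\<close> is small, and Bessel's inequality for \<open>green x\<close> controls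
  all \<open>nk k\<close> at once.\<close>

lemma sum_nk_le:
  obtains C :: real and N :: nat where "C \<ge> 0"
    "\<And>\<Lambda> A. \<Lambda> \<ge> 1 \<Longrightarrow> finite A \<Longrightarrow> (\<And>k. k \<in> A \<Longrightarrow> lam k \<le> \<Lambda>) \<Longrightarrow> (\<Sum>k\<in>A. (nk k)\<^sup>2) \<le> (C * \<Lambda> ^ N)\<^sup>2"
proof -
  obtain t0 where t0: "0 < t0" "t0 < 1" "\<And>z. \<bar>z\<bar> \<le> t0 \<Longrightarrow> 1/2 \<le> F z" by (rule F_near_0) blast
  \<comment> \<open>The lower bound for \<open>psi\<close> loses x^\<beta> and the norm of
    \<open>green x\<close> grows like x^(-\<alpha>/2). At the chosen \<open>x\<close> these amount
    to (\<Lambda>/t0)^s, with s rounded up to a natural number below.\<close>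
  define s where "s = (\<beta> + \<alpha> / 2) / \<kappa>"
  have s: "s \<ge> 0" using beta_nonneg alpha kappa_pos by (simp add: s_def)
  define N where "N = nat \<lceil>s\<rceil>"
  have sN: "s \<le> real N" using s by (simp add: N_def)
  define C where "C = 4 / \<alpha> * (1 / t0) ^ N"
  show thesis
  proof (rule that[of C "Suc N"])
    show "C \<ge> 0" using alpha t0 by (simp add: C_def)
    fix \<Lambda> :: real and A assume L: "\<Lambda> \<ge> 1" and A: "finite A" "\<And>k. k \<in> A \<Longrightarrow> lam k \<le> \<Lambda>"
    define x where "x = (t0 / \<Lambda>) powr (1 / \<kappa>)"
    have tL: "0 < t0 / \<Lambda>" "t0 / \<Lambda> < 1" using t0 L by auto
    have x: "0 < x" "x < 1"
      using tL kappa_pos powr_less_mono2[of "1 / \<kappa>" "t0 / \<Lambda>" 1] by (auto simp: x_def)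
    have xk: "x powr \<kappa> = t0 / \<Lambda>" using t0 L kappa_pos unfolding x_def powr_powr by simp
    define Q where "Q = 2 * \<Lambda> / x powr \<beta>"
    have Q: "Q \<ge> 0" using L by (simp add: Q_def)
    have psi_ge: "x powr \<beta> / 2 \<le> psi (lam k) x" if "k \<in> A" for k
    proof -
      have "lam k * (t0 / \<Lambda>) \<le> \<Lambda> * (t0 / \<Lambda>)" using A(2)[OF that] tL by (intro mult_right_mono) auto
      then have "\<bar>- lam k * x powr \<kappa>\<bar> \<le> t0" using lam_pos[of k] L t0 by (simp add: xk abs_mult)
      from t0(3)[OF this] have "x powr \<beta> * (1/2) \<le> x powr \<beta> * F (- lam k * x powr \<kappa>)" by (intro mult_left_mono) auto
      then show ?thesis by (simp add: psi_def)
    qed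
    have le: "(nk k)\<^sup>2 \<le> Q\<^sup>2 * (inner (L2_class (green x)) (e k))\<^sup>2" if k: "k \<in> A" for k
    proof -
      have "\<bar>nk k\<bar> * (x powr \<beta> / 2) \<le> \<bar>nk k\<bar> * psi (lam k) x" using psi_ge[OF k] by (intro mult_left_mono) auto
      also have "\<dots> \<le> \<bar>nk k * psi (lam k) x\<bar>" by (simp add: abs_mult mult_left_mono)
      also have "nk k * psi (lam k) x = lam k * inner (L2_class (green x)) (e k)"
        using sol_e[of x k] x by (simp add: sol_def inner_commute)
      also have "\<bar>lam k * inner (L2_class (green x)) (e k)\<bar> = lam k * \<bar>inner (L2_class (green x)) (e k)\<bar>"
        using lam_pos[of k] by (simp add: abs_mult)
      also have "\<dots> \<le> \<Lambda> * \<bar>inner (L2_class (green x)) (e k)\<bar>" using A(2)[OF k] by (intro mult_right_mono) auto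
      finally have "\<bar>nk k\<bar> \<le> Q * \<bar>inner (L2_class (green x)) (e k)\<bar>" using x by (simp add: Q_def field_simps)
      from power_mono[OF this, of 2] show ?thesis by (simp add: power_mult_distrib)
    qed
    have "(\<Sum>k\<in>A. (nk k)\<^sup>2) \<le> (\<Sum>k\<in>A. Q\<^sup>2 * (inner (L2_class (green x)) (e k))\<^sup>2)"
      using le by (rule sum_mono)
    also have "\<dots> = Q\<^sup>2 * (\<Sum>k\<in>A. (inner (L2_class (green x)) (e k))\<^sup>2)" by (simp add: sum_distrib_left)
    also have "\<dots> \<le> Q\<^sup>2 * (norm (L2_class (green x)))\<^sup>2" using A(1) by (intro mult_left_mono bessel) auto
    also have "\<dots> = (Q * norm (L2_class (green x)))\<^sup>2" by (simp add: power_mult_distrib)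
    also have "\<dots> \<le> (C * \<Lambda> ^ Suc N)\<^sup>2"
    proof (rule power_mono)
      have "norm (L2_class (green x)) \<le> 2 / \<alpha> * x powr (- \<alpha> / 2)"
        using green_norm(1)[of x] pot_le[of x] x by simp
      then have "Q * norm (L2_class (green x)) \<le> Q * (2 / \<alpha> * x powr (- \<alpha> / 2))"
        using Q by (intro mult_left_mono) auto
      also have "\<dots> = 4 / \<alpha> * \<Lambda> * (x powr (- \<beta>) * x powr (- \<alpha> / 2))"
      proof -
        have "Q = 2 * \<Lambda> * x powr (- \<beta>)" by (simp add: Q_def powr_minus divide_inverse)
        then show ?thesis by simp
      qed
      also have "x powr (- \<beta>) * x powr (- \<alpha> / 2) = (\<Lambda> / t0) powr s"
      proof -
        have "x powr (- \<beta>) * x powr (- \<alpha> / 2) = (t0 / \<Lambda>) powr (- s)"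
          unfolding x_def powr_powr powr_add[symmetric] using kappa_pos
          by (intro arg_cong[where f = "\<lambda>y. (t0 / \<Lambda>) powr y"]) (simp add: s_def field_simps)
        also have "\<dots> = (\<Lambda> / t0) powr s" using tL t0 L by (simp add: powr_minus powr_divide)
        finally show ?thesis .
      qed
      finally have 1: "Q * norm (L2_class (green x)) \<le> 4 / \<alpha> * \<Lambda> * (\<Lambda> / t0) powr s" .
      have "(\<Lambda> / t0) powr s \<le> (\<Lambda> / t0) powr real N"
      proof (rule powr_mono[OF sN])
        show "1 \<le> \<Lambda> / t0" using t0 L by (simp add: field_simps)
      qed
      also have "(\<Lambda> / t0) powr real N = (\<Lambda> / t0) ^ N" using t0 L by (intro powr_realpow) auto
      finally have "4 / \<alpha> * \<Lambda> * (\<Lambda> / t0) powr s \<le> 4 / \<alpha> * \<Lambda> * (\<Lambda> / t0) ^ N"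
        using alpha L by (intro mult_left_mono) auto
      also have "\<dots> = C * \<Lambda> ^ Suc N" by (simp add: C_def power_divide)
      finally show "Q * norm (L2_class (green x)) \<le> C * \<Lambda> ^ Suc N" using 1 by linarith
    qed (use Q in auto)
    finally show "(\<Sum>k\<in>A. (nk k)\<^sup>2) \<le> (C * \<Lambda> ^ Suc N)\<^sup>2" .
  qed
qed

end

section \<open>A Remez inequality\<close>

lemma lagrange_interpolation:
  fixes p :: "real poly" and t :: "nat \<Rightarrow> real"
  assumes inj: "inj_on t {..<m}" and deg: "degree p < m"
  shows "poly p x = (\<Sum>i<m. poly p (t i) * (\<Prod>j\<in>{..<m} - {i}. (x - t j) / (t i - t j)))"
proof -
  define L where "L i = (\<Prod>j\<in>{..<m} - {i}. smult (1 / (t i - t j)) [:- t j, 1:])" for i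
  define q where "q = (\<Sum>i<m. smult (poly p (t i)) (L i))"
  have pL: "poly (L i) y = (\<Prod>j\<in>{..<m} - {i}. (y - t j) / (t i - t j))" for i y
    unfolding L_def poly_prod by (intro prod.cong refl) (simp add: divide_inverse algebra_simps)
  have dL: "degree (L i) < m" if "i < m" for i
  proof -
    have "degree (L i) \<le> (\<Sum>j\<in>{..<m} - {i}. degree (smult (1 / (t i - t j)) [:- t j, 1:]))"
      unfolding L_def using degree_prod_sum_le[of "{..<m} - {i}" "\<lambda>j. smult (1 / (t i - t j)) [:- t j, 1:]"]
      by (simp add: o_def)
    also have "\<dots> \<le> (\<Sum>j\<in>{..<m} - {i}. 1)" by (intro sum_mono) (auto intro: order_trans[OF degree_smult_le])
    also have "\<dots> = m - 1" using that by (simp add: card_Diff_subset)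
    finally show ?thesis using that by simp
  qed
  have "degree q < m"
    unfolding q_def using deg by (intro degree_sum_less) (auto intro: le_less_trans[OF degree_smult_le] dL)
  moreover have "poly p y = poly q y" if "y \<in> t ` {..<m}" for y
  proof -
    from that obtain k where k: "k < m" "y = t k" by auto
    have "poly q y = (\<Sum>i<m. poly p (t i) * poly (L i) (t k))" by (simp add: q_def poly_sum k)
    also have "\<dots> = (\<Sum>i<m. if i = k then poly p (t k) else 0)"
    proof (rule sum.cong[OF refl])
      fix i assume i: "i \<in> {..<m}"
      show "poly p (t i) * poly (L i) (t k) = (if i = k then poly p (t k) else 0)"
      proof (cases "i = k")
        case True
        have "(t k - t j) / (t k - t j) = 1" if "j \<in> {..<m} - {k}" for j
          using inj_onD[OF inj, of j k] that k by auto
        then show ?thesis using True by (simp add: pL)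
      next
        case False
        then have "poly (L i) (t k) = 0" unfolding pL using k by (intro prod_zero) auto
        then show ?thesis using False by simp
      qed
    qed
    finally show ?thesis using k by simp
  qed
  moreover have "card (t ` {..<m}) = m" using inj by (simp add: card_image)
  ultimately have "p = q" using deg by (intro poly_eqI_degree[of "t ` {..<m}"]) auto
  then have "poly p x = poly q x" by simp
  then show ?thesis by (simp add: q_def poly_sum pL)
qed

text \<open>The product is i! (m-1-i)!, that is (m-1)! divided by a binomial coefficient, which is
  at most 2^(m-1).\<close>

lemma prod_dist_ge:
  fixes i m :: nat
  assumes "i < m"
  shows "fact (m - 1) / 2 ^ (m - 1) \<le> (\<Prod>j\<in>{..<m} - {i}. \<bar>real i - real j\<bar>)"
proof -
  have split: "{..<m} - {i} = {..<i} \<union> {Suc i..<m}" using assms by auto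
  have 1: "(\<Prod>j<i. \<bar>real i - real j\<bar>) = fact i"
  proof -
    have "(\<Prod>j<i. \<bar>real i - real j\<bar>) = (\<Prod>j<i. real (Suc j))"
      by (rule prod.reindex_bij_witness[of _ "\<lambda>j. i - Suc j" "\<lambda>j. i - Suc j"]) (auto simp: of_nat_diff)
    then show ?thesis by (simp add: fact_prod_Suc lessThan_atLeast0)
  qed
  have 2: "(\<Prod>j\<in>{Suc i..<m}. \<bar>real i - real j\<bar>) = fact (m - 1 - i)"
  proof -
    have "(\<Prod>j\<in>{Suc i..<m}. \<bar>real i - real j\<bar>) = (\<Prod>j<m - 1 - i. real (Suc j))"
      using assms by (intro prod.reindex_bij_witness[of _ "\<lambda>j. j + Suc i" "\<lambda>j. j - Suc i"]) (auto simp: of_nat_diff)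
    then show ?thesis by (simp add: fact_prod_Suc lessThan_atLeast0)
  qed
  have "(\<Prod>j\<in>{..<m} - {i}. \<bar>real i - real j\<bar>) =
      (\<Prod>j<i. \<bar>real i - real j\<bar>) * (\<Prod>j\<in>{Suc i..<m}. \<bar>real i - real j\<bar>)"
    unfolding split by (rule prod.union_disjoint) auto
  then have "(\<Prod>j\<in>{..<m} - {i}. \<bar>real i - real j\<bar>) = fact i * fact (m - 1 - i)"
    unfolding 1 2 .
  moreover have "(fact (m - 1) :: real) = fact i * fact (m - 1 - i) * real ((m - 1) choose i)"
    using binomial_fact_lemma[of i "m - 1"] assms by (metis Suc_pred' gr_implies_not0 less_Suc_eq_le not_gr_zero of_nat_fact of_nat_mult)
  moreover have "real ((m - 1) choose i) \<le> 2 ^ (m - 1)"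
    using binomial_le_pow2[of "m - 1" i] by (metis of_nat_le_iff of_nat_numeral of_nat_power)
  ultimately have "fact (m - 1) \<le> (\<Prod>j\<in>{..<m} - {i}. \<bar>real i - real j\<bar>) * 2 ^ (m - 1)"
    by (simp add: mult_left_mono)
  then show ?thesis by (simp add: field_simps)
qed

text \<open>The left side divided by n! is one term of the series of exp(n).\<close>

lemma power_le_fact: "real n ^ n \<le> exp (real n) * fact n"
proof -
  have "real n ^ n / fact n \<le> (\<Sum>k. real n ^ k / fact k)"
    using sum_le_suminf[OF summable_exp[of "real n"], of "{n}"] by (simp add: divide_inverse mult.commute)
  also have "\<dots> = exp (real n)" by (simp add: exp_def divide_inverse scaleR_conv_of_real mult.commute)
  finally show ?thesis by (simp add: field_simps)
qed

text \<open>The constant is exponential in \<open>m\<close> only, because \<open>m\<^sup>m \<le> e\<^sup>m m!\<close> compensates the factorials in the Lagrange basis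
  for nodes that are \<open>\<delta>/m\<close> apart.\<close>

lemma remez_bound:
  fixes p :: "real poly" and t :: "nat \<Rightarrow> real"
  assumes deg: "degree p < m" and t: "\<And>i. i < m \<Longrightarrow> t i \<in> {0..1}"
    and sep: "\<And>i j. i < m \<Longrightarrow> j < m \<Longrightarrow> \<delta> / real m * \<bar>real i - real j\<bar> \<le> \<bar>t i - t j\<bar>"
    and \<delta>: "0 < \<delta>" "\<delta> \<le> 1" and x: "x \<in> {0..1}"
  shows "\<bar>poly p x\<bar> \<le> (2 * exp 1 / \<delta>) ^ m * (\<Sum>i<m. \<bar>poly p (t i)\<bar>)"
proof -
  have m: "m > 0" using deg by simp
  have inj: "inj_on t {..<m}"
  proof (rule inj_onI)
    fix i j assume ij: "i \<in> {..<m}" "j \<in> {..<m}" "t i = t j"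
    then have "\<delta> / real m * \<bar>real i - real j\<bar> \<le> 0" using sep[of i j] by simp
    then show "i = j" using \<delta> m by (auto simp: mult_le_0_iff divide_le_0_iff)
  qed
  have w: "\<bar>\<Prod>j\<in>{..<m} - {i}. (x - t j) / (t i - t j)\<bar> \<le> (2 * exp 1 / \<delta>) ^ m" if i: "i < m" for i
  proof -
    have dp: "\<delta> / real m > 0" using \<delta> m by simp
    have "\<bar>\<Prod>j\<in>{..<m} - {i}. (x - t j) / (t i - t j)\<bar> = (\<Prod>j\<in>{..<m} - {i}. \<bar>x - t j\<bar> / \<bar>t i - t j\<bar>)"
      by (simp add: abs_prod)
    also have "\<dots> \<le> (\<Prod>j\<in>{..<m} - {i}. 1 / (\<delta> / real m * \<bar>real i - real j\<bar>))"
    proof (rule prod_mono, intro conjI)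
      fix j assume j: "j \<in> {..<m} - {i}"
      have "\<bar>x - t j\<bar> \<le> 1" using t[of j] j x by auto
      moreover have "0 < \<delta> / real m * \<bar>real i - real j\<bar>" using j dp by (intro mult_pos_pos) auto
      ultimately show "\<bar>x - t j\<bar> / \<bar>t i - t j\<bar> \<le> 1 / (\<delta> / real m * \<bar>real i - real j\<bar>)"
        using sep[of i j] i j by (intro frac_le) auto
    qed simp
    also have "\<dots> = 1 / ((\<delta> / real m) ^ (m - 1) * (\<Prod>j\<in>{..<m} - {i}. \<bar>real i - real j\<bar>))"
      using i by (simp add: prod_dividef prod.distrib card_Diff_subset del: times_divide_eq_left)
    also have "\<dots> \<le> 1 / ((\<delta> / real m) ^ (m - 1) * (fact (m - 1) / 2 ^ (m - 1)))"
      using prod_dist_ge[OF i] dp by (intro divide_left_mono mult_left_mono mult_pos_pos) (auto intro: less_le_trans[rotated])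
    also have "\<dots> = (2 / \<delta>) ^ (m - 1) * (real m ^ (m - 1) / fact (m - 1))"
      using m \<delta> by (simp add: power_divide field_simps power_mult_distrib)
    also have "\<dots> \<le> (2 / \<delta>) ^ m * exp 1 ^ m"
    proof (rule mult_mono)
      have "real m ^ m = real m * real m ^ (m - 1)" "(fact m :: real) = real m * fact (m - 1)"
        using m by (auto simp: power_eq_if fact_reduce)
      then have "real m ^ (m - 1) / fact (m - 1) = real m ^ m / fact m" using m by simp
      also have "\<dots> \<le> exp 1 ^ m" using power_le_fact[of m] by (simp add: field_simps exp_of_nat_mult[symmetric])
      finally show "real m ^ (m - 1) / fact (m - 1) \<le> exp 1 ^ m" .
      show "(2 / \<delta>) ^ (m - 1) \<le> (2 / \<delta>) ^ m" using \<delta> by (intro power_increasing) (auto simp: field_simps)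
    qed (use \<delta> in auto)
    also have "\<dots> = (2 * exp 1 / \<delta>) ^ m" unfolding power_mult_distrib[symmetric] by simp
    finally show ?thesis .
  qed
  have "\<bar>poly p x\<bar> \<le> (\<Sum>i<m. \<bar>poly p (t i) * (\<Prod>j\<in>{..<m} - {i}. (x - t j) / (t i - t j))\<bar>)"
    unfolding lagrange_interpolation[OF inj deg, of x] by (rule sum_abs)
  also have "\<dots> \<le> (\<Sum>i<m. \<bar>poly p (t i)\<bar> * (2 * exp 1 / \<delta>) ^ m)"
    unfolding abs_mult using w by (intro sum_mono mult_left_mono) auto
  finally show ?thesis by (simp add: sum_distrib_right[symmetric] mult.commute)
qed

section \<open>The spectral inequality\<close>

lemma fact_sq_inverse_le: "1 / (fact n)\<^sup>2 \<le> ((exp 1)\<^sup>2 / (real n)\<^sup>2) ^ n" if "n > 0"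
proof -
  have "real n ^ n \<le> exp 1 ^ n * fact n" using power_le_fact[of n] by (simp add: exp_of_nat_mult[symmetric])
  then have "(real n ^ n)\<^sup>2 \<le> (exp 1 ^ n * fact n)\<^sup>2" by (intro power_mono) auto
  then have "1 / (fact n)\<^sup>2 \<le> (exp 1 ^ n)\<^sup>2 / (real n ^ n)\<^sup>2" using that by (simp add: field_simps power_mult_distrib)
  also have "\<dots> = ((exp 1)\<^sup>2 / (real n)\<^sup>2) ^ n" by (simp add: power_divide power_mult[symmetric] mult.commute)
  finally show ?thesis .
qed

context degenerate begin

definition tail :: "real \<Rightarrow> nat \<Rightarrow> real" where "tail \<Lambda> m = (\<Sum>n. fc (n + m) * \<Lambda> ^ (n + m))"

lemma F_truncate:
  assumes "\<bar>z\<bar> \<le> \<Lambda>" shows "\<bar>F z - (\<Sum>n<m. fc n * z ^ n)\<bar> \<le> tail \<Lambda> m"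
proof -
  have "F z - (\<Sum>n<m. fc n * z ^ n) = (\<Sum>n. fc (n + m) * z ^ (n + m))"
    unfolding F_def by (rule suminf_minus_initial_segment[OF summable_fc', symmetric])
  moreover have "\<bar>\<Sum>n. fc (n + m) * z ^ (n + m)\<bar> \<le> tail \<Lambda> m"
    unfolding tail_def
  proof (rule norm_suminf_le[of "\<lambda>n. fc (n + m) * z ^ (n + m)", unfolded real_norm_def])
    show "\<bar>fc (n + m) * z ^ (n + m)\<bar> \<le> fc (n + m) * \<Lambda> ^ (n + m)" for n
      using fc_pos[of "n + m"] power_mono[OF assms, of "n + m"] by (simp add: abs_mult power_abs)
    show "summable (\<lambda>n. fc (n + m) * \<Lambda> ^ (n + m))" by (rule summable_ignore_initial_segment[OF summable_fc'])
  qed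
  ultimately show ?thesis by simp
qed

lemma tail_nonneg: "\<Lambda> \<ge> 0 \<Longrightarrow> 0 \<le> tail \<Lambda> m"
  unfolding tail_def using fc_pos by (intro suminf_nonneg summable_ignore_initial_segment[OF summable_fc']) (auto simp: less_imp_le)

text \<open>As \<open>fc n\<close> is at most \<kappa>^(-2n)/n!^2 and n! is at least (n/e)^n, the
  n-th term is at most the n-th power of e^2 \<Lambda>/(\<kappa> n)^2, which is at most \<epsilon>
  from n = m on. The square of the factorial is why m of the order of sqrt \<Lambda> is
  enough.\<close>

lemma tail_le:
  assumes L: "\<Lambda> \<ge> 0" and \<epsilon>: "0 < \<epsilon>" "\<epsilon> \<le> 1/2" and m: "m > 0" "(exp 1)\<^sup>2 * \<Lambda> / \<kappa>\<^sup>2 \<le> \<epsilon> * (real m)\<^sup>2"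
  shows "tail \<Lambda> m \<le> 2 * \<epsilon> ^ m"
proof -
  have "tail \<Lambda> m \<le> (\<Sum>n. \<epsilon> ^ (n + m))"
    unfolding tail_def
  proof (rule suminf_le)
    show "summable (\<lambda>n. fc (n + m) * \<Lambda> ^ (n + m))" by (rule summable_ignore_initial_segment[OF summable_fc'])
    show "summable (\<lambda>n. \<epsilon> ^ (n + m))" using \<epsilon> by (intro summable_ignore_initial_segment summable_geometric) auto
    fix n
    define k where "k = n + m"
    have k: "k > 0" "real m \<le> real k" using m by (auto simp: k_def)
    have "fc k * \<Lambda> ^ k \<le> (1 / \<kappa>\<^sup>2) ^ k / (fact k)\<^sup>2 * \<Lambda> ^ k" using fc_le L by (intro mult_right_mono) auto
    also have "\<dots> = (\<Lambda> / \<kappa>\<^sup>2) ^ k * (1 / (fact k)\<^sup>2)" by (simp add: power_divide)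
    also have "\<dots> \<le> (\<Lambda> / \<kappa>\<^sup>2) ^ k * ((exp 1)\<^sup>2 / (real k)\<^sup>2) ^ k"
      using L by (intro mult_left_mono fact_sq_inverse_le k) auto
    also have "\<dots> = ((exp 1)\<^sup>2 * \<Lambda> / \<kappa>\<^sup>2 / (real k)\<^sup>2) ^ k" by (simp add: power_mult_distrib[symmetric] mult.commute)
    also have "\<dots> \<le> \<epsilon> ^ k"
    proof (rule power_mono)
      have "\<epsilon> * (real m)\<^sup>2 \<le> \<epsilon> * (real k)\<^sup>2" using k \<epsilon> by (intro mult_left_mono power_mono) auto
      then have "(exp 1)\<^sup>2 * \<Lambda> / \<kappa>\<^sup>2 \<le> \<epsilon> * (real k)\<^sup>2" using m(2) by linarith
      then show "(exp 1)\<^sup>2 * \<Lambda> / \<kappa>\<^sup>2 / (real k)\<^sup>2 \<le> \<epsilon>"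
      proof (rule mult_imp_div_pos_le[rotated])
        show "0 < (real k)\<^sup>2" using k by simp
      qed
    qed (use L in auto)
    finally show "fc (n + m) * \<Lambda> ^ (n + m) \<le> \<epsilon> ^ (n + m)" by (simp add: k_def)
  qed
  also have "\<dots> = \<epsilon> ^ m * (\<Sum>n. \<epsilon> ^ n)"
    using suminf_mult[OF summable_geometric[of \<epsilon>], of "\<epsilon> ^ m"] \<epsilon> by (simp add: power_add mult.commute)
  also have "(\<Sum>n. \<epsilon> ^ n) = 1 / (1 - \<epsilon>)" using \<epsilon> by (intro suminf_geometric) auto
  also have "\<epsilon> ^ m * (1 / (1 - \<epsilon>)) \<le> \<epsilon> ^ m * 2" using \<epsilon> by (intro mult_left_mono) (auto simp: field_simps)
  finally show ?thesis by simp
qed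

end

text \<open>At a minimum point of \<open>\<bar>U\<bar>\<close> the constant function with that value
  lies below \<open>\<bar>U\<bar>\<close> on the interval, so the L^2 norms compare.\<close>

lemma sample_point:
  assumes U: "L2_fun U" "continuous_on {c..d} U" and cd: "c < d" "{c..d} \<subseteq> \<omega>" "{c..d} \<subseteq> {0<..<1}" and \<omega>: "\<omega> \<in> sets lebesgue"
  obtains x where "x \<in> {c..d}" "\<bar>U x\<bar> \<le> norm (restr \<omega> (L2_class U)) / sqrt (d - c)"
proof -
  have "continuous_on {c..d} (\<lambda>x. \<bar>U x\<bar>)" using U(2) by (intro continuous_intros)
  from continuous_attains_inf[OF _ _ this] obtain x where x: "x \<in> {c..d}" "\<And>y. y \<in> {c..d} \<Longrightarrow> \<bar>U x\<bar> \<le> \<bar>U y\<bar>"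
    using cd(1) by auto
  have c: "{c..d} \<in> sets lebesgue" by simp
  have "\<bar>U x\<bar> * sqrt (d - c) = norm (L2_class (\<lambda>y. \<bar>U x\<bar> * indicat_real {c..d} y))"
  proof -
    have "(\<integral>y. (\<bar>U x\<bar> * indicat_real {c..d} y)\<^sup>2 \<partial>unit_leb) = (\<integral>y. \<bar>U x\<bar>\<^sup>2 * indicat_real {c..d} y \<partial>unit_leb)"
      by (intro Bochner_Integration.integral_cong refl) (simp add: indicator_def)
    also have "\<dots> = \<bar>U x\<bar>\<^sup>2 * measure unit_leb ({0<..<1} \<inter> {c..d})" by (simp add: Int_commute)
    also have "measure unit_leb ({0<..<1} \<inter> {c..d}) = d - c"
      using cd by (simp add: measure_restrict_space Int_absorb1 Int_absorb2)
    finally show ?thesis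
      using cd(1) by (simp add: L2_class_norm L2_fun_scale L2_fun_indicator real_sqrt_mult)
  qed
  also have "\<dots> \<le> norm (L2_class (\<lambda>y. indicat_real \<omega> y * U y))"
    by (rule L2_norm_mono[OF L2_fun_scale[OF L2_fun_indicator[OF c]] L2_fun_indicator_mult[OF \<omega> U(1)]])
      (use x cd in \<open>auto simp: indicator_def\<close>)
  also have "\<dots> = norm (restr \<omega> (L2_class U))" by (simp add: restr_class[OF \<omega> U(1)])
  finally have "\<bar>U x\<bar> \<le> norm (restr \<omega> (L2_class U)) / sqrt (d - c)" using cd(1) by (simp add: field_simps)
  with x(1) show thesis by (rule that)
qed

context degenerate_basis begin

lemma combination_class:
  assumes "finite A"
  shows "L2_fun (\<lambda>x. \<Sum>k\<in>A. c k * (nk k * psi (lam k) x))"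
    and "(\<Sum>k\<in>A. c k *\<^sub>R e k) = L2_class (\<lambda>x. \<Sum>k\<in>A. c k * (nk k * psi (lam k) x))"
proof -
  have L: "L2_fun (\<lambda>x. nk k * psi (lam k) x)" for k
  proof (rule L2_fun_bound)
    show "(\<lambda>x. nk k * psi (lam k) x) \<in> borel_measurable unit_leb"
      by (intro unit_leb_continuous_measurable continuous_intros continuous_at_imp_continuous_on ballI DERIV_isCont[OF psi_deriv]) auto
    show "L2_fun (\<lambda>x. lam k * sol (e k) x)" by (intro L2_fun_scale sol_L2)
    show "\<bar>nk k * psi (lam k) x\<bar> \<le> \<bar>lam k * sol (e k) x\<bar>" if "x \<in> {0<..<1}" for x by (simp add: sol_e[OF that])
  qed
  have "L2_fun (\<lambda>x. \<Sum>k\<in>A. c k * (nk k * psi (lam k) x)) \<and>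
      (\<Sum>k\<in>A. c k *\<^sub>R e k) = L2_class (\<lambda>x. \<Sum>k\<in>A. c k * (nk k * psi (lam k) x))"
    using assms
  proof induction
    case empty
    then show ?case by (simp add: L2_fun_zero L2_class_zero)
  next
    case (insert k A)
    have 1: "c k *\<^sub>R e k = L2_class (\<lambda>x. c k * (nk k * psi (lam k) x))"
      unfolding e_class[of k] by (rule L2_class_scaleR[OF L L2_fun_zero])
    show ?case unfolding sum.insert[OF insert.hyps]
      using L2_fun_add[OF L2_fun_scale[OF L] conjunct1[OF insert.IH], of "c k" k]
        L2_class_add[OF L2_fun_scale[OF L] conjunct1[OF insert.IH], of "c k" k] insert.IH 1 by simp
  qed
  then show "L2_fun (\<lambda>x. \<Sum>k\<in>A. c k * (nk k * psi (lam k) x))"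
    "(\<Sum>k\<in>A. c k *\<^sub>R e k) = L2_class (\<lambda>x. \<Sum>k\<in>A. c k * (nk k * psi (lam k) x))" by auto
qed

text \<open>\<open>B * tail \<Lambda> m\<close> bounds the error of replacing each \<open>F\<close> by its Taylor polynomial of degree less than \<open>m\<close>.\<close>

lemma observation_estimate:
  fixes c :: "nat \<Rightarrow> real"
  assumes ab: "0 < a" "a < b" "b < 1" "{a..b} \<subseteq> \<omega>" and \<omega>: "\<omega> \<in> sets lebesgue"
    and L: "0 \<le> \<Lambda>" and A: "finite A" "\<And>k. k \<in> A \<Longrightarrow> lam k \<le> \<Lambda>" and m: "m > 0"
  defines "u \<equiv> \<Sum>k\<in>A. c k *\<^sub>R e k" and "B \<equiv> \<Sum>k\<in>A. \<bar>c k * nk k\<bar>"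
    and "\<delta> \<equiv> \<kappa> * a * (b - a) / 2"
  shows "norm u \<le> (2 * exp 1 / \<delta>) ^ m * (real m * (a powr (- \<beta>) * (norm (restr \<omega> u) / sqrt ((b - a) / (2 * real m))) + B * tail \<Lambda> m)) + B * tail \<Lambda> m"
proof -
  define G where "G t = (\<Sum>k\<in>A. c k * nk k * F (- lam k * t))" for t
  define P :: "real poly" where "P = (\<Sum>k\<in>A. smult (c k * nk k) (\<Sum>n<m. monom (fc n * (- lam k) ^ n) n))"
  define U where "U x = (\<Sum>k\<in>A. c k * (nk k * psi (lam k) x))" for x
  have U: "L2_fun U" "u = L2_class U" unfolding U_def[abs_def] u_def using combination_class[OF A(1)] by auto
  have UG: "U x = x powr \<beta> * G (x powr \<kappa>)" for x
    by (simp add: U_def G_def psi_def sum_distrib_left mult_ac)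
  have Pp: "poly P t = (\<Sum>k\<in>A. c k * nk k * (\<Sum>n<m. fc n * (- lam k * t) ^ n))" for t
    by (simp add: P_def poly_sum poly_monom mult.assoc power_mult_distrib[symmetric])
  have degP: "degree P < m"
    unfolding P_def using m by (intro degree_sum_less) (auto intro!: le_less_trans[OF degree_smult_le] degree_sum_less le_less_trans[OF degree_monom_le])
  have B: "B \<ge> 0" unfolding B_def by (simp add: sum_nonneg)
  have GP: "\<bar>G t - poly P t\<bar> \<le> B * tail \<Lambda> m" if t: "t \<in> {0..1}" for t
  proof -
    have "G t - poly P t = (\<Sum>k\<in>A. c k * nk k * (F (- lam k * t) - (\<Sum>n<m. fc n * (- lam k * t) ^ n)))"
      unfolding G_def Pp by (simp add: sum_subtractf algebra_simps)
    also have "\<bar>\<dots>\<bar> \<le> (\<Sum>k\<in>A. \<bar>c k * nk k\<bar> * tail \<Lambda> m)"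
    proof (rule order_trans[OF sum_abs], rule sum_mono)
      fix k assume k: "k \<in> A"
      have "lam k * t \<le> \<Lambda> * 1" using t lam_pos[of k] A(2)[OF k] L by (intro mult_mono) auto
      then have "\<bar>- lam k * t\<bar> \<le> \<Lambda>" using t lam_pos[of k] by (simp add: abs_mult)
      from F_truncate[OF this, of m]
      show "\<bar>c k * nk k * (F (- lam k * t) - (\<Sum>n<m. fc n * (- lam k * t) ^ n))\<bar> \<le> \<bar>c k * nk k\<bar> * tail \<Lambda> m"
        unfolding abs_mult[of "c k * nk k"] by (intro mult_left_mono) auto
    qed
    also have "\<dots> = B * tail \<Lambda> m" by (simp add: B_def sum_distrib_right)
    finally show ?thesis .
  qed
  \<comment> \<open>Only every other one of the 2m intervals of length \<open>h\<close> is sampled,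
    so the points of the i-th and the j-th are at least |j - i| h apart, wherever in their intervals
    they lie.\<close>
  define h where "h = (b - a) / (2 * real m)"
  have h: "h > 0" using ab m by (simp add: h_def)
  have ctsU: "continuous_on {s..t} U" if "0 < s" for s t
    unfolding U_def[abs_def] using that by (intro continuous_intros continuous_at_imp_continuous_on ballI DERIV_isCont[OF psi_deriv]) auto
  define M where "M = norm (restr \<omega> u)"
  have "\<exists>x. x \<in> {a + 2 * real i * h..a + (2 * real i + 1) * h} \<and> \<bar>U x\<bar> \<le> M / sqrt h" if i: "i < m" for i
  proof -
    define l r where "l = a + 2 * real i * h" and "r = a + (2 * real i + 1) * h"
    have dc: "r - l = h" by (simp add: l_def r_def algebra_simps)
    have "(2 * real i + 1) * h \<le> 2 * real m * h" using i h by (intro mult_right_mono) auto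
    also have "\<dots> = b - a" using m by (simp add: h_def)
    finally have d: "r \<le> b" by (simp add: r_def)
    have "0 \<le> 2 * real i * h" using h by simp
    then have c: "a \<le> l" by (simp add: l_def)
    have lr: "l < r" using dc h by linarith
    have "{l..r} \<subseteq> {a..b}" using c d by auto
    then have s2: "{l..r} \<subseteq> \<omega>" and s3: "{l..r} \<subseteq> {0<..<1}" using ab by auto
    have "0 < l" using c ab by simp
    from sample_point[OF U(1) ctsU[OF this] lr s2 s3 \<omega>] obtain x
      where x: "x \<in> {l..r}" "\<bar>U x\<bar> \<le> norm (restr \<omega> (L2_class U)) / sqrt (r - l)" by blast
    have "\<bar>U x\<bar> \<le> M / sqrt h" using x(2) unfolding dc M_def U(2) .
    with x(1) show ?thesis unfolding l_def r_def by (intro exI conjI)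
  qed
  then obtain x where x: "\<And>i. i < m \<Longrightarrow> x i \<in> {a + 2 * real i * h..a + (2 * real i + 1) * h}" "\<And>i. i < m \<Longrightarrow> \<bar>U (x i)\<bar> \<le> M / sqrt h"
    by metis
  have xab: "a \<le> x i" "x i \<le> b" if i: "i < m" for i
  proof -
    have "0 \<le> 2 * real i * h" using h by simp
    then show "a \<le> x i" using x(1)[OF i] unfolding atLeastAtMost_iff by linarith
    have "(2 * real i + 1) * h \<le> 2 * real m * h" using i h by (intro mult_right_mono) auto
    also have "\<dots> = b - a" using m by (simp add: h_def)
    finally show "x i \<le> b" using x(1)[OF i] unfolding atLeastAtMost_iff by linarith
  qed
  define t where "t i = x i powr \<kappa>" for i
  have t01: "t i \<in> {0..1}" if "i < m" for i using xab[OF that] ab kappa_pos by (auto simp: t_def intro!: powr_le1)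
  have sepx: "real j - real i \<le> (x j - x i) / h" if "i < j" "j < m" for i j
  proof -
    have "x j - x i \<ge> (2 * real j - (2 * real i + 1)) * h" using x(1)[of i] x(1)[of j] that by (auto simp: algebra_simps)
    moreover have "(real j - real i) * h \<le> (2 * real j - (2 * real i + 1)) * h" using that h by (intro mult_right_mono) auto
    ultimately show ?thesis using h by (simp add: field_simps)
  qed
  have sept': "\<kappa> * a * (x j - x i) \<le> t j - t i" if "i < j" "j < m" for i j
  proof -
    have lt: "x i < x j"
    proof -
      have "0 < real j - real i" using that by simp
      also note sepx[OF that]
      finally show ?thesis using h by (simp add: field_simps)
    qed
    have xi: "0 < x i" using xab[of i] that ab by auto
    obtain z where z: "x i < z" "z < x j" "x j powr \<kappa> - x i powr \<kappa> = (x j - x i) * (\<kappa> * z powr (\<kappa> - 1))"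
      using MVT2[OF lt, of "\<lambda>y. y powr \<kappa>" "\<lambda>y. \<kappa> * y powr (\<kappa> - 1)"] has_real_derivative_powr xi by auto
    have z': "a \<le> z" "z < 1" "0 < z" using z xab[of i] xab[of j] that ab by auto
    \<comment> \<open>The exponent \<kappa> - 1 = 1 - \<alpha> can have either sign, but it is below
      1, so that z^(\<kappa>-1) \<ge> z \<ge> a. Hence the change of variable keeps the sample
      points separated.\<close>
    have "a \<le> z powr 1" using z' by simp
    also have "z powr 1 \<le> z powr (\<kappa> - 1)" using z' alpha by (intro powr_mono') (auto simp: \<kappa>_def)
    finally have "(x j - x i) * (\<kappa> * a) \<le> (x j - x i) * (\<kappa> * z powr (\<kappa> - 1))"
      using lt kappa_pos by (intro mult_left_mono) auto
    then show ?thesis using z(3) by (simp add: t_def mult_ac)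
  qed
  have sept'': "\<delta> / real m * \<bar>real i - real j\<bar> \<le> \<bar>t i - t j\<bar>" if "i < j" "j < m" for i j
  proof -
    have "\<delta> / real m = \<kappa> * a * h" by (simp add: \<delta>_def h_def)
    moreover have "\<kappa> * a * h * (real j - real i) \<le> \<kappa> * a * h * ((x j - x i) / h)"
      using sepx[OF that] kappa_pos ab h by (intro mult_left_mono) auto
    moreover have "\<kappa> * a * h * ((x j - x i) / h) = \<kappa> * a * (x j - x i)" using h by simp
    ultimately show ?thesis using sept'[OF that] that by (simp add: abs_minus_commute)
  qed
  have sep: "\<delta> / real m * \<bar>real i - real j\<bar> \<le> \<bar>t i - t j\<bar>" if "i < m" "j < m" for i j
    using sept''[of i j] sept''[of j i] that by (cases i j rule: linorder_cases) (auto simp: abs_minus_commute)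
  have \<delta>: "0 < \<delta>" "\<delta> \<le> 1"
  proof -
    show "0 < \<delta>" using kappa_pos ab by (simp add: \<delta>_def)
    have "\<kappa> * a * (b - a) \<le> 2 * 1 * 1" using kappa_pos alpha ab by (intro mult_mono) (auto simp: \<kappa>_def)
    then show "\<delta> \<le> 1" by (simp add: \<delta>_def)
  qed
  have Gt: "\<bar>poly P (t i)\<bar> \<le> a powr (- \<beta>) * (M / sqrt h) + B * tail \<Lambda> m" if i: "i < m" for i
  proof -
    have xi: "0 < x i" using xab[OF i] ab by simp
    have "G (t i) = x i powr (- \<beta>) * U (x i)" unfolding UG t_def using xi by (simp add: powr_minus)
    then have "\<bar>G (t i)\<bar> = x i powr (- \<beta>) * \<bar>U (x i)\<bar>" by (simp add: abs_mult)
    also have "\<dots> \<le> a powr (- \<beta>) * (M / sqrt h)"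
      using xab[OF i] ab beta_nonneg x(2)[OF i] by (intro mult_mono powr_mono2') auto
    finally show ?thesis using GP[OF t01[OF i]] by linarith
  qed
  have Pbound: "\<bar>poly P s\<bar> \<le> (2 * exp 1 / \<delta>) ^ m * (real m * (a powr (- \<beta>) * (M / sqrt h) + B * tail \<Lambda> m))" if s: "s \<in> {0..1}" for s
  proof -
    have "\<bar>poly P s\<bar> \<le> (2 * exp 1 / \<delta>) ^ m * (\<Sum>i<m. \<bar>poly P (t i)\<bar>)"
      by (rule remez_bound[OF degP t01 sep \<delta> s])
    also have "\<dots> \<le> (2 * exp 1 / \<delta>) ^ m * (\<Sum>i<m. a powr (- \<beta>) * (M / sqrt h) + B * tail \<Lambda> m)"
      using Gt \<delta> by (intro mult_left_mono sum_mono) auto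
    finally show ?thesis by simp
  qed
  have "norm u \<le> (2 * exp 1 / \<delta>) ^ m * (real m * (a powr (- \<beta>) * (M / sqrt h) + B * tail \<Lambda> m)) + B * tail \<Lambda> m"
    unfolding U(2)
  proof (rule L2_norm_le[OF U(1)])
    fix y :: real assume y: "y \<in> {0<..<1}"
    then have yk: "y powr \<kappa> \<in> {0..1}" using kappa_pos by (auto intro!: powr_le1)
    have "\<bar>U y\<bar> = y powr \<beta> * \<bar>G (y powr \<kappa>)\<bar>" by (simp add: UG abs_mult)
    also have "\<dots> \<le> 1 * \<bar>G (y powr \<kappa>)\<bar>" using y beta_nonneg by (intro mult_right_mono powr_le1) auto
    finally show "\<bar>U y\<bar> \<le> (2 * exp 1 / \<delta>) ^ m * (real m * (a powr (- \<beta>) * (M / sqrt h) + B * tail \<Lambda> m)) + B * tail \<Lambda> m"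
      using GP[OF yk] Pbound[OF yk] by linarith
  qed
  then show ?thesis by (simp only: M_def h_def)
qed

text \<open>In \<open>observation_estimate\<close> the truncation error is multiplied by K1^m m and
  by \<open>B\<close>, and \<open>B\<close> is at most \<open>norm u\<close> times a constant and a
  power of \<open>m\<close>. The error itself is at most 2 \<epsilon>^m, with an \<epsilon>
  independent of \<Lambda> that can be fixed so small that these terms amount to at most half of
  \<open>norm u\<close> and are absorbed on the left.\<close>

theorem spectral_inequality:
  assumes ab: "0 < a" "a < b" "b < 1" "{a..b} \<subseteq> \<omega>" and \<omega>: "\<omega> \<in> sets lebesgue"
  obtains D :: real where "D > 0" "\<And>\<Lambda> A c. \<Lambda> \<ge> 1 \<Longrightarrow> finite A \<Longrightarrow> (\<And>k. k \<in> A \<Longrightarrow> lam k \<le> \<Lambda>) \<Longrightarrow>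
    norm (\<Sum>k\<in>A. c k *\<^sub>R e k) \<le> exp (D * sqrt \<Lambda>) * norm (restr \<omega> (\<Sum>k\<in>A. c k *\<^sub>R e k))"
proof -
  obtain C :: real and N :: nat where C: "C \<ge> 0"
    "\<And>\<Lambda> A. \<Lambda> \<ge> 1 \<Longrightarrow> finite A \<Longrightarrow> (\<And>k. k \<in> A \<Longrightarrow> lam k \<le> \<Lambda>) \<Longrightarrow> (\<Sum>k\<in>A. (nk k)\<^sup>2) \<le> (C * \<Lambda> ^ N)\<^sup>2"
    by (rule sum_nk_le) blast
  define \<delta> where "\<delta> = \<kappa> * a * (b - a) / 2"
  have \<delta>: "0 < \<delta>" "\<delta> \<le> 1"
  proof -
    show "0 < \<delta>" using kappa_pos ab by (simp add: \<delta>_def)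
    have "\<kappa> * a * (b - a) \<le> 2 * 1 * 1" using kappa_pos alpha ab by (intro mult_mono) (auto simp: \<kappa>_def)
    then show "\<delta> \<le> 1" by (simp add: \<delta>_def)
  qed
  define K1 where "K1 = 2 * exp 1 / \<delta>"
  have K1: "K1 \<ge> 1"
  proof -
    have "\<delta> \<le> 2 * exp 1" using \<delta>(2) exp_ge_add_one_self[of 1] by linarith
    then show ?thesis using \<delta>(1) by (simp add: K1_def)
  qed
  \<comment> \<open>Each factor of the denominator absorbs one loss: the power of 2 beats m^(2N+1)
    by m \<le> 2^m, K1 is the Remez constant, and 8 C + 1 leaves 4 C/(8 C + 1) \<le> 1/2.\<close>
  define \<epsilon> where "\<epsilon> = 1 / (2 ^ (2 * N + 1) * K1 * (8 * C + 1))"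
  have "2 ^ (2 * N + 1) * K1 * (8 * C + 1) \<ge> 2 * 1 * 1"
    using K1 C(1) by (intro mult_mono) auto
  then have \<epsilon>: "0 < \<epsilon>" "\<epsilon> \<le> 1/2" unfolding \<epsilon>_def by (auto simp: field_simps)
  \<comment> \<open>With m \<ge> Mc sqrt \<Lambda> the second entry yields the hypothesis of
    \<open>tail_le\<close>, and the first yields \<Lambda> \<le> m^2, which trades powers of
    \<Lambda> for powers of m.\<close>
  define Mc where "Mc = max 1 (exp 1 / (\<kappa> * sqrt \<epsilon>))"
  define c0 where "c0 = 2 * a powr (- \<beta>) * sqrt (2 / (b - a))"
  have c0: "c0 > 0" using ab by (simp add: c0_def)
  define D where "D = (Mc + 1) * (ln K1 + 2) + c0"
  have D: "D > 0" using c0 K1 by (simp add: D_def Mc_def add_nonneg_pos)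
  show thesis
  proof (rule that[OF D])
    fix \<Lambda> :: real and A and c :: "nat \<Rightarrow> real"
    assume L: "\<Lambda> \<ge> 1" and A: "finite A" "\<And>k. k \<in> A \<Longrightarrow> lam k \<le> \<Lambda>"
    define u where "u = (\<Sum>k\<in>A. c k *\<^sub>R e k)"
    define B where "B = (\<Sum>k\<in>A. \<bar>c k * nk k\<bar>)"
    define m where "m = nat \<lceil>Mc * sqrt \<Lambda>\<rceil>"
    have sL: "sqrt \<Lambda> \<ge> 1" using L by simp
    have L0: "0 \<le> \<Lambda>" using L by simp
    have Mc1: "Mc \<ge> 1" by (simp add: Mc_def)
    have ms: "Mc * sqrt \<Lambda> \<ge> 1" using mult_mono[OF Mc1 sL] Mc1 by simp
    have m_ge: "real m \<ge> Mc * sqrt \<Lambda>" unfolding m_def using ms by linarith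
    have m_le: "real m \<le> (Mc + 1) * sqrt \<Lambda>"
    proof -
      have "real m \<le> Mc * sqrt \<Lambda> + 1" unfolding m_def using ms by linarith
      then show ?thesis unfolding distrib_right using sL by linarith
    qed
    have m0: "m > 0" using m_ge ms by (cases m) auto
    have Lm: "\<Lambda> \<le> (real m)\<^sup>2"
    proof -
      have "1 * sqrt \<Lambda> \<le> Mc * sqrt \<Lambda>" using Mc1 L by (intro mult_right_mono) auto
      then have "sqrt \<Lambda> \<le> real m" using m_ge by linarith
      then show ?thesis using L by (simp add: sqrt_le_D)
    qed
    have "(exp 1)\<^sup>2 * \<Lambda> / \<kappa>\<^sup>2 \<le> \<epsilon> * (real m)\<^sup>2"
    proof -
      have "exp 1 / (\<kappa> * sqrt \<epsilon>) * sqrt \<Lambda> \<le> Mc * sqrt \<Lambda>" using sL by (intro mult_right_mono) (auto simp: Mc_def)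
      then have "exp 1 / (\<kappa> * sqrt \<epsilon>) * sqrt \<Lambda> \<le> real m" using m_ge by linarith
      then have "(exp 1 / (\<kappa> * sqrt \<epsilon>) * sqrt \<Lambda>)\<^sup>2 \<le> (real m)\<^sup>2"
        using kappa_pos \<epsilon> L by (intro power_mono) auto
      then have "(exp 1)\<^sup>2 * \<Lambda> / (\<kappa>\<^sup>2 * \<epsilon>) \<le> (real m)\<^sup>2"
        using \<epsilon> L by (simp add: power_mult_distrib power_divide)
      then show ?thesis using \<epsilon>(1) kappa_pos by (simp add: field_simps)
    qed
    then have T: "tail \<Lambda> m \<le> 2 * \<epsilon> ^ m" using L \<epsilon> m0 by (intro tail_le) auto
    have nu: "(norm u)\<^sup>2 = (\<Sum>k\<in>A. (c k)\<^sup>2)" unfolding u_def by (rule norm_sum_sq[OF A(1)])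
    \<comment> \<open>Cauchy-Schwarz against the coefficients, whose squares sum to the squared norm
      of \<open>u\<close>, and \<open>sum_nk_le\<close> for the normalising factors.\<close>
    have B_le: "B \<le> norm u * (C * (real m) ^ (2 * N))"
    proof -
      have "B\<^sup>2 = (\<Sum>k\<in>A. \<bar>c k\<bar> * \<bar>nk k\<bar>)\<^sup>2" by (simp add: B_def abs_mult)
      also have "\<dots> \<le> (\<Sum>k\<in>A. \<bar>c k\<bar>\<^sup>2) * (\<Sum>k\<in>A. \<bar>nk k\<bar>\<^sup>2)" by (rule Cauchy_Schwarz_ineq_sum)
      also have "\<dots> \<le> (norm u)\<^sup>2 * (C * \<Lambda> ^ N)\<^sup>2"
        using C(2)[OF L A] by (simp add: nu mult_left_mono sum_nonneg)
      finally have "B\<^sup>2 \<le> (norm u * (C * \<Lambda> ^ N))\<^sup>2" unfolding power_mult_distrib[of "norm u"] .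
      moreover have "0 \<le> norm u * (C * \<Lambda> ^ N)" using C(1) L0 by simp
      ultimately have "B \<le> norm u * (C * \<Lambda> ^ N)" by (rule power2_le_imp_le)
      also have "\<dots> \<le> norm u * (C * ((real m)\<^sup>2) ^ N)" using C(1) L Lm by (intro mult_left_mono power_mono) auto
      finally show ?thesis by (simp add: power_mult)
    qed
    have small: "2 * (K1 ^ m * real m) * (B * tail \<Lambda> m) \<le> norm u / 2"
    proof -
      have m2: "real m ^ (2 * N + 1) \<le> (2 ^ (2 * N + 1)) ^ m"
      proof -
        have "real m \<le> 2 ^ m" by (simp add: less_imp_le of_nat_less_two_power)
        then have "real m ^ (2 * N + 1) \<le> (2 ^ m) ^ (2 * N + 1)" by (intro power_mono) auto
        also have "\<dots> = (2 ^ (2 * N + 1)) ^ m" by (simp only: power_mult[symmetric] mult.commute)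
        finally show ?thesis .
      qed
      have "2 * (K1 ^ m * real m) * (B * tail \<Lambda> m) \<le> 2 * (K1 ^ m * real m) * ((norm u * (C * (real m) ^ (2 * N))) * (2 * \<epsilon> ^ m))"
        using B_le T K1 C(1) tail_nonneg[of \<Lambda> m] L by (intro mult_left_mono mult_mono) auto
      also have "\<dots> = 4 * C * norm u * (real m ^ (2 * N + 1) * (K1 * \<epsilon>) ^ m)" by (simp add: power_mult_distrib mult_ac)
      also have "\<dots> \<le> 4 * C * norm u * ((2 ^ (2 * N + 1)) ^ m * (K1 * \<epsilon>) ^ m)"
        using m2 K1 \<epsilon> C(1) by (intro mult_left_mono mult_right_mono) auto
      also have "(2 ^ (2 * N + 1)) ^ m * (K1 * \<epsilon>) ^ m = (1 / (8 * C + 1)) ^ m"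
      proof -
        have "2 ^ (2 * N + 1) * (K1 * \<epsilon>) = 1 / (8 * C + 1)" using K1 by (simp add: \<epsilon>_def)
        then show ?thesis by (simp only: power_mult_distrib[symmetric])
      qed
      also have "4 * C * norm u * (1 / (8 * C + 1)) ^ m \<le> 4 * C * norm u * (1 / (8 * C + 1))"
      proof (rule mult_left_mono)
        show "(1 / (8 * C + 1)) ^ m \<le> 1 / (8 * C + 1)"
          using power_decreasing[of 1 m "1 / (8 * C + 1)"] C(1) m0 by simp
      qed (use C(1) in auto)
      also have "\<dots> = norm u * (4 * C / (8 * C + 1))" by simp
      also have "\<dots> \<le> norm u * (1 / 2)" using C(1) by (intro mult_left_mono) (auto simp: field_simps)
      finally show ?thesis by simp
    qed
    define M where "M = norm (restr \<omega> u)"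
    have M: "M \<ge> 0" by (simp add: M_def)
    have BT: "0 \<le> B * tail \<Lambda> m" using tail_nonneg[of \<Lambda> m] L by (simp add: B_def sum_nonneg)
    have K1m: "1 \<le> K1 ^ m * real m" using mult_mono[of 1 "K1 ^ m" 1 "real m"] K1 m0 by (simp add: one_le_power)
    have sq: "1 / sqrt ((b - a) / (2 * real m)) = sqrt (2 / (b - a)) * sqrt (real m)"
      using ab m0 by (simp add: real_sqrt_divide real_sqrt_mult)
    have "norm u \<le> K1 ^ m * (real m * (a powr (- \<beta>) * (M / sqrt ((b - a) / (2 * real m))) + B * tail \<Lambda> m)) + B * tail \<Lambda> m"
      using observation_estimate[OF ab \<omega> L0 A m0, of c] unfolding u_def[symmetric] B_def[symmetric] \<delta>_def[symmetric] K1_def[symmetric] M_def[symmetric] .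
    also have "\<dots> = K1 ^ m * real m * a powr (- \<beta>) * M * (1 / sqrt ((b - a) / (2 * real m))) + (K1 ^ m * real m) * (B * tail \<Lambda> m) + B * tail \<Lambda> m"
      by (simp add: algebra_simps)
    also have "\<dots> \<le> K1 ^ m * real m * a powr (- \<beta>) * M * (1 / sqrt ((b - a) / (2 * real m))) + 2 * (K1 ^ m * real m) * (B * tail \<Lambda> m)"
    proof -
      have "1 * (B * tail \<Lambda> m) \<le> K1 ^ m * real m * (B * tail \<Lambda> m)" by (rule mult_right_mono[OF K1m BT])
      moreover have "2 * (K1 ^ m * real m) * (B * tail \<Lambda> m) =
          K1 ^ m * real m * (B * tail \<Lambda> m) + K1 ^ m * real m * (B * tail \<Lambda> m)" by simp
      ultimately show ?thesis by linarith
    qed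
    also have "\<dots> \<le> K1 ^ m * real m * a powr (- \<beta>) * M * (1 / sqrt ((b - a) / (2 * real m))) + norm u / 2" using small by simp
    finally have "norm u \<le> 2 * (K1 ^ m * real m * a powr (- \<beta>) * M * (1 / sqrt ((b - a) / (2 * real m))))" by linarith
    also have "\<dots> = c0 * (K1 ^ m * (real m * sqrt (real m))) * M" unfolding sq by (simp add: c0_def mult_ac)
    also have "\<dots> \<le> exp (D * sqrt \<Lambda>) * M"
    proof (rule mult_right_mono[OF _ M])
      have em: "real m \<le> exp (real m)" using exp_ge_add_one_self[of "real m"] by linarith
      have "sqrt (real m) \<le> real m" using m0 by (intro real_le_lsqrt) (auto simp: power2_eq_square)
      then have "real m * sqrt (real m) \<le> exp (real m) * exp (real m)" using em by (intro mult_mono) auto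
      also have "\<dots> = exp (2 * real m)" by (simp add: exp_add[symmetric])
      finally have 1: "K1 ^ m * (real m * sqrt (real m)) \<le> K1 ^ m * exp (2 * real m)" using K1 by (intro mult_left_mono) auto
      have "K1 ^ m = exp (real m * ln K1)" using K1 by (simp add: exp_of_nat_mult)
      then have "K1 ^ m * exp (2 * real m) = exp (real m * (ln K1 + 2))" by (simp add: exp_add[symmetric] algebra_simps)
      also have "\<dots> \<le> exp ((Mc + 1) * sqrt \<Lambda> * (ln K1 + 2))" using m_le K1 by (simp add: mult_right_mono)
      finally have 2: "K1 ^ m * (real m * sqrt (real m)) \<le> exp ((Mc + 1) * sqrt \<Lambda> * (ln K1 + 2))" using 1 by linarith
      have "c0 \<le> exp c0" using exp_ge_add_one_self[of c0] by linarith
      also have "\<dots> \<le> exp (c0 * sqrt \<Lambda>)" using c0 sL by simp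
      finally have 3: "c0 \<le> exp (c0 * sqrt \<Lambda>)" .
      have "c0 * (K1 ^ m * (real m * sqrt (real m))) \<le> exp (c0 * sqrt \<Lambda>) * exp ((Mc + 1) * sqrt \<Lambda> * (ln K1 + 2))"
        using 2 3 K1 c0 by (intro mult_mono) auto
      also have "\<dots> = exp (D * sqrt \<Lambda>)" by (simp add: D_def exp_add[symmetric] algebra_simps)
      finally show "c0 * (K1 ^ m * (real m * sqrt (real m))) \<le> exp (D * sqrt \<Lambda>)" .
    qed
    finally show "norm (\<Sum>k\<in>A. c k *\<^sub>R e k) \<le> exp (D * sqrt \<Lambda>) * norm (restr \<omega> (\<Sum>k\<in>A. c k *\<^sub>R e k))"
      unfolding M_def u_def .
  qed
qed

end

section \<open>Diagonal semigroups\<close>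

text \<open>The uniform boundedness principle along a sequence of times. If the claim fails, there
  are \<open>t n\<close> tending to 0 at which the operator norms grow without bound; but every
  orbit converges along these times and is bounded, so Baire's theorem gives a uniform
  bound.\<close>

lemma C0_semigroup_bounded:
  fixes S :: "real \<Rightarrow> 'a::banach \<Rightarrow> 'a"
  assumes S: "C0_semigroup S"
  obtains \<delta> M where "\<delta> > 0" "\<And>t u. 0 \<le> t \<Longrightarrow> t \<le> \<delta> \<Longrightarrow> norm (S t u) \<le> M * norm u"
proof (rule ccontr)
  assume neg: "\<not> thesis"
  have lin: "bounded_linear (S t)" if "t \<ge> 0" for t using S that by (simp add: C0_semigroup_def)
  have "\<exists>t u. 0 \<le> t \<and> t \<le> 1 / real (Suc n) \<and> real n * norm u < norm (S t u)" for n
  proof (rule ccontr)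
    assume "\<not> ?thesis"
    then have "norm (S t u) \<le> real n * norm u" if "0 \<le> t" "t \<le> 1 / real (Suc n)" for t u
      using that by (meson not_le)
    moreover have "1 / real (Suc n) > 0" by simp
    ultimately show False using neg that by blast
  qed
  then obtain t w where t: "\<And>n. 0 \<le> t n" "\<And>n. t n \<le> 1 / real (Suc n)" and w: "\<And>n. real n * norm (w n) < norm (S (t n) (w n))"
    by metis
  define A where "A k = {u. \<forall>n. norm (S (t n) u) \<le> real k}" for k :: nat
  have cl: "closed (A k)" for k
  proof -
    have "A k = (\<Inter>n. {u. norm (S (t n) u) \<le> real k})" by (auto simp: A_def)
    moreover have "closed {u. norm (S (t n) u) \<le> real k}" for n
      by (intro closed_Collect_le continuous_intros linear_continuous_on lin t)
    ultimately show ?thesis by (simp add: closed_INT)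
  qed
  have t0: "t \<longlonglongrightarrow> 0"
  proof (rule tendsto_sandwich[OF _ _ tendsto_const])
    show "(\<lambda>n. 1 / real (Suc n)) \<longlonglongrightarrow> 0" using LIMSEQ_inverse_real_of_nat by (simp add: inverse_eq_divide)
  qed (use t in \<open>auto intro!: always_eventually\<close>)
  have conv: "(\<lambda>n. S (t n) u) \<longlonglongrightarrow> u" for u
  proof -
    have r: "((\<lambda>t. S t u) \<longlongrightarrow> u) (at_right 0)" and S0: "S 0 u = u" using S by (auto simp: C0_semigroup_def)
    show ?thesis
    proof (rule LIMSEQ_I)
      fix e :: real assume e: "e > 0"
      from tendstoD[OF r e] obtain b where b: "b > 0" "\<And>y. 0 < y \<Longrightarrow> y < b \<Longrightarrow> dist (S y u) u < e"
        by (auto simp: eventually_at_right[of 0 1])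
      from order_tendstoD(2)[OF t0 b(1)] obtain N where N: "\<And>n. n \<ge> N \<Longrightarrow> t n < b" by (auto simp: eventually_sequentially)
      have "norm (S (t n) u - u) < e" if "n \<ge> N" for n
        using b(2)[of "t n"] N[OF that] t(1)[of n] S0 e by (cases "t n = 0") (auto simp: dist_norm)
      then show "\<exists>N. \<forall>n\<ge>N. norm (S (t n) u - u) < e" by blast
    qed
  qed
  have cover: "\<exists>k. u \<in> A k" for u
  proof -
    have "Bseq (\<lambda>n. S (t n) u)" using conv by (intro convergent_imp_Bseq) (auto simp: convergent_def)
    then obtain K where "\<And>n. norm (S (t n) u) \<le> K" by (auto simp: Bseq_def)
    moreover obtain k :: nat where "K \<le> real k" using real_arch_simple by blast
    ultimately show ?thesis unfolding A_def by (intro exI[of _ k]) (auto intro: order_trans)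
  qed
  have "\<exists>k. interior (A k) \<noteq> {}"
  proof (rule ccontr)
    assume "\<not> ?thesis"
    then have int: "interior (A k) = {}" for k by blast
    have "Met_TC.mtopology closure_of (\<Inter>((\<lambda>k. - A k) ` UNIV)) = (UNIV :: 'a set)"
    proof (rule Met_TC.metric_Baire_category)
      show "Met_TC.mcomplete TYPE('a)" by (simp add: complete_UNIV)
      fix T assume "T \<in> (\<lambda>k. - A k) ` UNIV"
      then obtain k where k: "T = - A k" by blast
      show "openin Met_TC.mtopology T \<and> Met_TC.mtopology closure_of T = UNIV"
        using cl[of k] int[of k] by (simp add: k closure_complement open_Compl)
    qed auto
    moreover have "\<Inter>((\<lambda>k. - A k) ` UNIV) = {}" using cover by auto
    ultimately show False by simp
  qed
  then obtain k x where "x \<in> interior (A k)" by blast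
  then obtain r where r: "r > 0" "cball x r \<subseteq> A k" by (auto simp: mem_interior_cball)
  \<comment> \<open>The ball need not be centred at 0. A multiple of \<open>u\<close> is the
    difference of two of its points, whence the factor 2.\<close>
  have bound: "norm (S (t n) u) \<le> 2 * real k / r * norm u" for n u
  proof (cases "u = 0")
    case True
    then show ?thesis using linear_0[OF bounded_linear.linear[OF lin[OF t(1)]]] by simp
  next
    case False
    let ?v = "(r / norm u) *\<^sub>R u"
    have "x + ?v \<in> cball x r" "x \<in> cball x r" using False r by (auto simp: dist_norm)
    then have "x + ?v \<in> A k" "x \<in> A k" using r(2) by blast+
    then have 1: "norm (S (t n) (x + ?v)) \<le> real k" "norm (S (t n) x) \<le> real k" unfolding A_def by blast+
    have "S (t n) ?v = S (t n) (x + ?v) - S (t n) x"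
      using linear_diff[OF bounded_linear.linear[OF lin[OF t(1)[of n]]], of "x + ?v" x] by simp
    then have "norm (S (t n) ?v) \<le> norm (S (t n) (x + ?v)) + norm (S (t n) x)" by (simp only: norm_triangle_ineq4)
    then have "norm (S (t n) ?v) \<le> 2 * real k" using 1 by linarith
    then have "r / norm u * norm (S (t n) u) \<le> 2 * real k"
      using r(1) by (simp add: linear_scale[OF bounded_linear.linear[OF lin[OF t(1)[of n]]]])
    then show ?thesis using False r(1) by (simp add: field_simps)
  qed
  obtain n :: nat where n: "2 * real k / r \<le> real n" using real_arch_simple by blast
  have "norm (S (t n) (w n)) \<le> real n * norm (w n)"
    using bound[of n "w n"] mult_right_mono[OF n, of "norm (w n)"] by simp
  with w[of n] show False by simp
qed

text \<open>Only the right derivative of the orbit at 0 is given. The error of replacing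
  \<open>S h e\<close> by its exponential multiple is o(h), and boundedness of \<open>S\<close> on
  [0,t] lets m such errors with h = t/m add up to o(1).\<close>

lemma C0_semigroup_eigenvector:
  fixes S :: "real \<Rightarrow> 'a::banach \<Rightarrow> 'a"
  assumes S: "C0_semigroup S" and g: "(e, - lam *\<^sub>R e) \<in> generator S" and t: "t \<ge> 0"
  shows "S t e = exp (- lam * t) *\<^sub>R e"
proof -
  obtain \<delta> M where \<delta>: "\<delta> > 0" "\<And>t u. 0 \<le> t \<Longrightarrow> t \<le> \<delta> \<Longrightarrow> norm (S t u) \<le> M * norm u"
    using C0_semigroup_bounded[OF S] by blast
  have lin: "bounded_linear (S t)" if "t \<ge> 0" for t using S that by (simp add: C0_semigroup_def)
  have sg: "S (s + t) u = S s (S t u)" if "s \<ge> 0" "t \<ge> 0" for s t u using S that by (simp add: C0_semigroup_def)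
  have S0: "S 0 u = u" for u using S by (simp add: C0_semigroup_def)
  have D: "((\<lambda>h. (S h e - e) /\<^sub>R h) \<longlongrightarrow> - lam *\<^sub>R e) (at_right 0)" using g by (simp add: generator_def)
  define B where "B = max M 1"
  have B1: "B \<ge> 1" by (simp add: B_def)
  \<comment> \<open>The local bound extends to [0, n \<delta>] by induction, splitting off a time of
    at most \<delta>.\<close>
  have bd: "\<exists>K\<ge>0. \<forall>s. 0 \<le> s \<and> s \<le> real n * \<delta> \<longrightarrow> (\<forall>u. norm (S s u) \<le> K * norm u)" for n
  proof (induction n)
    case 0
    have "norm (S s u) \<le> 1 * norm u" if "0 \<le> s \<and> s \<le> real 0 * \<delta>" for s u using that S0 by (cases "s = 0") auto
    then show ?case by (intro exI[of _ 1]) auto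
  next
    case (Suc n)
    then obtain K where K: "K \<ge> 0" "\<And>s u. 0 \<le> s \<Longrightarrow> s \<le> real n * \<delta> \<Longrightarrow> norm (S s u) \<le> K * norm u" by blast
    have "norm (S s u) \<le> B * (1 + K) * norm u" if s: "0 \<le> s" "s \<le> real (Suc n) * \<delta>" for s u
    proof -
      define p where "p = min s \<delta>"
      have p: "0 \<le> p" "p \<le> \<delta>" "0 \<le> s - p" "s - p \<le> real n * \<delta>"
        using s \<delta>(1) by (auto simp: p_def min_def algebra_simps)
      have "norm (S s u) = norm (S p (S (s - p) u))" using sg[of p "s - p" u] p by simp
      also have "\<dots> \<le> M * norm (S (s - p) u)" using \<delta>(2) p by blast
      also have "\<dots> \<le> B * norm (S (s - p) u)" by (simp add: B_def mult_right_mono)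
      also have "\<dots> \<le> B * (K * norm u)" using K(2)[of "s - p" u] p B1 by (intro mult_left_mono) auto
      also have "\<dots> \<le> B * ((1 + K) * norm u)" using B1 by (intro mult_left_mono mult_right_mono) auto
      finally show ?thesis by (simp add: mult.assoc)
    qed
    then show ?case using B1 K(1) by (intro exI[of _ "B * (1 + K)"]) auto
  qed
  obtain n where n: "t / \<delta> \<le> real n" using real_arch_simple by blast
  then have tn: "t \<le> real n * \<delta>" using \<delta>(1) by (simp add: field_simps)
  obtain K where K: "K \<ge> 0" "\<And>s u. 0 \<le> s \<Longrightarrow> s \<le> t \<Longrightarrow> norm (S s u) \<le> K * norm u" using bd[of n] tn by (meson order_trans)
  define \<phi> where "\<phi> s = exp (- lam * s) *\<^sub>R S (t - s) e" for s
  have ratio: "((\<lambda>h. ((S h e - exp (- lam * h) *\<^sub>R e)) /\<^sub>R h) \<longlongrightarrow> 0) (at_right 0)"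
  proof -
    have "((\<lambda>h. (exp (- lam * h) - exp (- lam * 0)) / h) \<longlongrightarrow> - lam) (at 0)"
    proof -
      have "((\<lambda>h. exp (- lam * h)) has_real_derivative - lam) (at 0)" by (auto intro!: derivative_eq_intros)
      then show ?thesis by (simp add: DERIV_def)
    qed
    then have "((\<lambda>h. (exp (- lam * h) - 1) / h) \<longlongrightarrow> - lam) (at_right 0)"
      by (simp add: filterlim_at_split)
    from tendsto_diff[OF D tendsto_scaleR[OF this tendsto_const[of e]]]
    have "((\<lambda>h. (S h e - e) /\<^sub>R h - ((exp (- lam * h) - 1) / h) *\<^sub>R e) \<longlongrightarrow> 0) (at_right 0)" by simp
    moreover have "(S h e - e) /\<^sub>R h - ((exp (- lam * h) - 1) / h) *\<^sub>R e = (S h e - exp (- lam * h) *\<^sub>R e) /\<^sub>R h" for h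
    proof -
      have "((exp (- lam * h) - 1) / h) *\<^sub>R e = (exp (- lam * h) *\<^sub>R e - e) /\<^sub>R h"
        by (simp add: divide_inverse algebra_simps)
      then show ?thesis by (simp add: scaleR_diff_right[symmetric])
    qed
    ultimately show ?thesis by simp
  qed
  text \<open>Telescoping over \<open>m\<close> equal steps: each step costs \<open>o(t/m)\<close>.\<close>
  define r where "r h = S h e - exp (- lam * h) *\<^sub>R e" for h
  have step: "S (real j * h) e - exp (- lam * (real j * h)) *\<^sub>R e =
      (\<Sum>i<j. exp (- lam * (real (j - 1 - i) * h)) *\<^sub>R S (real i * h) (r h))" if h: "h \<ge> 0" for j h
  proof (induction j)
    case 0
    then show ?case by (simp add: S0)
  next
    case (Suc j)
    have jh: "real j * h \<ge> 0" using h by simp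
    have "S (real (Suc j) * h) e = S (real j * h) (S h e)"
      using sg[OF jh h, of e] by (simp add: algebra_simps)
    also have "S h e = r h + exp (- lam * h) *\<^sub>R e" by (simp add: r_def)
    also have "S (real j * h) (r h + exp (- lam * h) *\<^sub>R e) = S (real j * h) (r h) + exp (- lam * h) *\<^sub>R S (real j * h) e"
      by (simp add: linear_add[OF bounded_linear.linear[OF lin[OF jh]]] linear_scale[OF bounded_linear.linear[OF lin[OF jh]]])
    finally have "S (real (Suc j) * h) e - exp (- lam * (real (Suc j) * h)) *\<^sub>R e
        = S (real j * h) (r h) + exp (- lam * h) *\<^sub>R (S (real j * h) e - exp (- lam * (real j * h)) *\<^sub>R e)"
      by (simp add: scaleR_diff_right exp_add[symmetric] algebra_simps)
    also have "exp (- lam * h) *\<^sub>R (S (real j * h) e - exp (- lam * (real j * h)) *\<^sub>R e)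
        = (\<Sum>i<j. exp (- lam * (real (Suc j - 1 - i) * h)) *\<^sub>R S (real i * h) (r h))"
      unfolding Suc.IH scaleR_sum_right
    proof (rule sum.cong[OF refl])
      fix i assume "i \<in> {..<j}"
      then have "real (Suc j - 1 - i) = real (j - 1 - i) + 1" by auto
      then have "exp (- lam * h) * exp (- lam * (real (j - 1 - i) * h)) = exp (- lam * (real (Suc j - 1 - i) * h))"
        by (simp add: exp_add[symmetric] algebra_simps)
      then show "exp (- lam * h) *\<^sub>R exp (- lam * (real (j - 1 - i) * h)) *\<^sub>R S (real i * h) (r h) =
          exp (- lam * (real (Suc j - 1 - i) * h)) *\<^sub>R S (real i * h) (r h)" by simp
    qed
    finally show ?case by simp
  qed
  define L where "L = exp (\<bar>lam\<bar> * t)"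
  have key: "norm (S t e - exp (- lam * t) *\<^sub>R e) \<le> L * K * t * norm (r (t / real (Suc m)) /\<^sub>R (t / real (Suc m)))" if tp: "t > 0" for m
  proof -
    define h where "h = t / real (Suc m)"
    have h: "h > 0" "real (Suc m) * h = t" using tp by (auto simp: h_def)
    have "norm (S t e - exp (- lam * t) *\<^sub>R e) \<le> (\<Sum>i<Suc m. norm (exp (- lam * (real (Suc m - 1 - i) * h)) *\<^sub>R S (real i * h) (r h)))"
      using step[of h "Suc m"] h by (simp only: less_imp_le norm_sum)
    also have "\<dots> \<le> (\<Sum>i<Suc m. L * (K * norm (r h)))"
    proof (rule sum_mono)
      fix i assume i: "i \<in> {..<Suc m}"
      have "real i * h \<le> real (Suc m) * h" using i h by (intro mult_right_mono) auto
      then have ih: "real i * h \<le> t" "0 \<le> real i * h" using h by auto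
      have "real (Suc m - 1 - i) * h \<le> real (Suc m) * h" using i h by (intro mult_right_mono) auto
      then have "\<bar>lam\<bar> * (real (Suc m - 1 - i) * h) \<le> \<bar>lam\<bar> * t" using h by (intro mult_left_mono) auto
      moreover have "- lam * (real (Suc m - 1 - i) * h) \<le> \<bar>lam\<bar> * (real (Suc m - 1 - i) * h)"
        using h by (intro mult_right_mono) auto
      ultimately have "exp (- lam * (real (Suc m - 1 - i) * h)) \<le> L" unfolding L_def by simp
      then show "norm (exp (- lam * (real (Suc m - 1 - i) * h)) *\<^sub>R S (real i * h) (r h)) \<le> L * (K * norm (r h))"
        unfolding norm_scaleR using K(2)[OF ih(2,1)] by (intro mult_mono) (auto simp: L_def)
    qed
    also have "\<dots> = L * K * (real (Suc m) * norm (r h))" by simp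
    also have "real (Suc m) * norm (r h) = t * norm (r h /\<^sub>R h)"
    proof -
      have "t * norm (r h /\<^sub>R h) = t / h * norm (r h)" using h(1) by (simp add: divide_inverse)
      also have "t / h = real (Suc m)" using h(1) by (simp add: h(2)[symmetric])
      finally show ?thesis by (rule sym)
    qed
    finally show ?thesis by (simp add: h_def mult.assoc)
  qed
  show ?thesis
  proof (cases "t = 0")
    case True
    then show ?thesis by (simp add: S0)
  next
    case False
    then have tp: "t > 0" using t by simp
    have "filterlim (\<lambda>m. t / real (Suc m)) (at_right 0) sequentially"
    proof (subst filterlim_at, intro conjI)
      have "(\<lambda>m. t * inverse (real (Suc m))) \<longlonglongrightarrow> t * 0" by (intro tendsto_intros LIMSEQ_inverse_real_of_nat)
      then show "(\<lambda>m. t / real (Suc m)) \<longlonglongrightarrow> 0" by (simp add: divide_inverse)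
    qed (use tp in simp)
    from filterlim_compose[OF ratio this]
    have "(\<lambda>m. r (t / real (Suc m)) /\<^sub>R (t / real (Suc m))) \<longlonglongrightarrow> 0" unfolding r_def .
    then have "(\<lambda>m. L * K * t * norm (r (t / real (Suc m)) /\<^sub>R (t / real (Suc m)))) \<longlonglongrightarrow> L * K * t * norm (0::'a)"
      by (intro tendsto_intros)
    then have "norm (S t e - exp (- lam * t) *\<^sub>R e) \<le> L * K * t * norm (0::'a)"
      by (rule LIMSEQ_le_const) (use key[OF tp] in blast)
    then show ?thesis by simp
  qed
qed

section \<open>The semigroup of a diagonal operator, and its uniqueness\<close>

locale spectral_semigroup = hilbert_basis e for e :: "nat \<Rightarrow> 'a::{real_inner, banach}" +
  fixes lam :: "nat \<Rightarrow> real"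
  assumes lam_pos: "lam k > 0"
begin

text \<open>The cut-off at 0 keeps all multipliers in [0,1] for negative times too, so the family is
  contractive and continuous on the whole line and integrands need no restriction of the time
  argument.\<close>

definition semigroup :: "real \<Rightarrow> 'a \<Rightarrow> 'a" where
  "semigroup t = multiplier (\<lambda>k. exp (- lam k * max t 0))"

lemma exp_lam_le: "\<bar>exp (- lam k * max t 0)\<bar> \<le> 1"
  using lam_pos[of k] by simp

lemma coeff_semigroup: "t \<ge> 0 \<Longrightarrow> inner (semigroup t u) (e k) = exp (- lam k * t) * inner u (e k)"
  unfolding semigroup_def by (subst coeff_multiplier[OF exp_lam_le]) simp

lemma bounded_linear_semigroup: "bounded_linear (semigroup t)"
  unfolding semigroup_def by (rule bounded_linear_multiplier[OF exp_lam_le])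

lemma norm_semigroup_le: "norm (semigroup t u) \<le> norm u"
  unfolding semigroup_def using norm_multiplier[where m = "\<lambda>k. exp (- lam k * max t 0)" and B = 1, OF exp_lam_le] by simp

lemma semigroup_add: "s \<ge> 0 \<Longrightarrow> t \<ge> 0 \<Longrightarrow> semigroup (s + t) u = semigroup s (semigroup t u)"
  by (rule coeff_eqI) (simp add: coeff_semigroup exp_add[symmetric] algebra_simps)

lemma semigroup_0: "semigroup 0 u = u"
  by (rule coeff_eqI) (simp add: coeff_semigroup)

lemma continuous_semigroup: "continuous_on UNIV (\<lambda>t. semigroup t u)"
  unfolding continuous_on_def semigroup_def
  by (intro ballI tendsto_multiplier exp_lam_le) (intro tendsto_intros)

text \<open>Contractivity reduces this to continuity in time for a fixed vector. Joint continuity is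
  what makes \<open>semigroup (b - s) (c s)\<close> Borel measurable in \<open>s\<close> for a
  measurable \<open>c\<close>.\<close>

lemma continuous_semigroup_joint: "continuous_on UNIV (\<lambda>(t, u). semigroup t u)"
  unfolding continuous_on_def
proof (intro ballI, clarify)
  fix t u
  have "((\<lambda>p. semigroup (fst p) (snd p)) \<longlongrightarrow> semigroup t u) (at (t, u))"
  proof (rule LIM_zero_cancel, rule Lim_null_comparison)
    have fs: "((\<lambda>p. semigroup (fst p) u) \<longlongrightarrow> semigroup t u) (at (t, u))"
      using continuous_semigroup[of u] unfolding continuous_on_def
      by (intro isCont_tendsto_compose[where g = "\<lambda>t. semigroup t u"]) (auto intro!: tendsto_eq_intros simp: isCont_def)
    have "((\<lambda>p. norm (snd p - u) + norm (semigroup (fst p) u - semigroup t u)) \<longlongrightarrow>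
        norm (u - u) + norm (semigroup t u - semigroup t u)) (at (t, u))"
      by (intro tendsto_intros fs) (auto intro!: tendsto_eq_intros)
    then show "((\<lambda>p. norm (snd p - u) + norm (semigroup (fst p) u - semigroup t u)) \<longlongrightarrow> 0) (at (t, u))" by simp
    have "norm (semigroup s v - semigroup t u) \<le> norm (v - u) + norm (semigroup s u - semigroup t u)" for s v
    proof -
      have "norm (semigroup s v - semigroup s u) \<le> norm (v - u)"
        using norm_semigroup_le[of s "v - u"] by (simp add: linear_diff[OF bounded_linear.linear[OF bounded_linear_semigroup]])
      then show ?thesis using norm_triangle_ineq[of "semigroup s v - semigroup s u" "semigroup s u - semigroup t u"] by simp
    qed
    then show "\<forall>\<^sub>F p in at (t, u). norm (semigroup (fst p) (snd p) - semigroup t u)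
        \<le> norm (snd p - u) + norm (semigroup (fst p) u - semigroup t u)" by (intro always_eventually) auto
  qed
  then show "((\<lambda>(t, u). semigroup t u) \<longlongrightarrow> semigroup t u) (at (t, u))" by (simp add: split_def)
qed

lemma C0_semigroup: "C0_semigroup semigroup"
  unfolding C0_semigroup_def
proof (intro conjI allI impI)
  show "((\<lambda>t. semigroup t u) \<longlongrightarrow> u) (at_right 0)" for u
    using continuous_semigroup[of u] unfolding continuous_on_def
    by (metis UNIV_I filterlim_at_split semigroup_0)
qed (auto intro: bounded_linear_semigroup semigroup_0 semigroup_add)

text \<open>\<open>K\<close> is the inverse of the (negated) generator.\<close>

lemma generator_semigroup:
  assumes K: "\<And>v k. inner (K v) (e k) = inner v (e k) / lam k"
  shows "generator semigroup = {(K v, - v) | v. True}"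
proof (intro equalityI subsetI)
  fix p assume "p \<in> generator semigroup"
  then obtain u v where p: "p = (u, v)" and lim: "((\<lambda>h. (semigroup h u - u) /\<^sub>R h) \<longlongrightarrow> v) (at_right 0)"
    by (auto simp: generator_def)
  have "u = K (- v)"
  proof (rule coeff_eqI)
    fix k
    have "((\<lambda>h. inner ((semigroup h u - u) /\<^sub>R h) (e k)) \<longlongrightarrow> inner v (e k)) (at_right 0)"
      by (intro tendsto_intros lim)
    moreover have "((\<lambda>h. inner ((semigroup h u - u) /\<^sub>R h) (e k)) \<longlongrightarrow> - lam k * inner u (e k)) (at_right 0)"
    proof (rule Lim_transform_eventually)
      have "((\<lambda>h. exp (- lam k * h)) has_real_derivative - lam k) (at 0)" by (auto intro!: derivative_eq_intros)
      then have "((\<lambda>h. (exp (- lam k * h) - 1) / h) \<longlongrightarrow> - lam k) (at_right 0)"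
        by (simp add: DERIV_def filterlim_at_split)
      then show "((\<lambda>h. (exp (- lam k * h) - 1) / h * inner u (e k)) \<longlongrightarrow> - lam k * inner u (e k)) (at_right 0)"
        by (intro tendsto_intros)
      show "\<forall>\<^sub>F h in at_right 0. (exp (- lam k * h) - 1) / h * inner u (e k) = inner ((semigroup h u - u) /\<^sub>R h) (e k)"
        by (auto simp: eventually_at_right[of 0 1] coeff_semigroup inner_diff_left divide_inverse algebra_simps intro!: exI[of _ 1])
    qed
    ultimately have "inner v (e k) = - lam k * inner u (e k)" by (rule tendsto_unique[rotated]) simp
    then show "inner u (e k) = inner (K (- v)) (e k)" using lam_pos[of k] by (simp add: K field_simps)
  qed
  then show "p \<in> {(K v, - v) | v. True}" using p by (auto intro!: exI[of _ "- v"])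
next
  fix p assume "p \<in> {(K v, - v) | v. True}"
  then obtain v where p: "p = (K v, - v)" by blast
  \<comment> \<open>Up to sign the multiplier of the difference quotient on the range of
    \<open>K\<close>: the factor 1/\<open>lam k\<close> of \<open>K\<close> turns an unbounded
    symbol into one with values in [0,1] that tends to 1. The value 0 for h \<le> 0 only makes these
    bounds hold for all \<open>h\<close>.\<close>
  define m where "m h k = (if h > 0 then (1 - exp (- lam k * h)) / (lam k * h) else 0)" for h k
  have m1: "\<bar>m h k\<bar> \<le> 1" for h k
  proof (cases "h > 0")
    case True
    then have lh: "lam k * h > 0" using lam_pos by simp
    have "1 - lam k * h \<le> exp (- lam k * h)" using exp_ge_add_one_self[of "- lam k * h"] by simp
    moreover have "exp (- lam k * h) \<le> 1" using lh by simp
    ultimately show ?thesis using True lh unfolding m_def by (simp add: field_simps)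
  qed (simp add: m_def)
  have mlim: "((\<lambda>h. m h k) \<longlongrightarrow> 1) (at_right 0)" for k
  proof (rule Lim_transform_eventually)
    have "((\<lambda>h. exp (- lam k * h)) has_real_derivative - lam k) (at 0)" by (auto intro!: derivative_eq_intros)
    then have "((\<lambda>h. (exp (- lam k * h) - 1) / h) \<longlongrightarrow> - lam k) (at_right 0)"
      by (simp add: DERIV_def filterlim_at_split)
    from tendsto_mult[OF this tendsto_const[of "- 1 / lam k"]]
    show "((\<lambda>h. (exp (- lam k * h) - 1) / h * (- 1 / lam k)) \<longlongrightarrow> 1) (at_right 0)" using lam_pos[of k] by simp
    show "\<forall>\<^sub>F h in at_right 0. (exp (- lam k * h) - 1) / h * (- 1 / lam k) = m h k"
      using lam_pos[of k] by (auto simp: eventually_at_right[of 0 1] m_def field_simps intro!: exI[of _ 1])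
  qed
  have "((\<lambda>h. multiplier (m h) v) \<longlongrightarrow> multiplier (\<lambda>_. 1) v) (at_right 0)"
    by (rule tendsto_multiplier[OF m1 mlim]) simp
  moreover have "multiplier (\<lambda>_. 1) v = v" by (rule coeff_eqI) (simp add: coeff_multiplier[where B = 1])
  ultimately have "((\<lambda>h. - multiplier (m h) v) \<longlongrightarrow> - v) (at_right 0)" using tendsto_minus by fastforce
  then have "((\<lambda>h. (semigroup h (K v) - K v) /\<^sub>R h) \<longlongrightarrow> - v) (at_right 0)"
  proof (rule Lim_transform_eventually)
    have "- multiplier (m h) v = (semigroup h (K v) - K v) /\<^sub>R h" if "h > 0" for h
    proof (rule coeff_eqI)
      fix k
      have l: "lam k \<noteq> 0" using lam_pos[of k] by simp
      have "- ((1 - E) / (l * h) * x) = inverse h * (E * (x / l) - x / l)" if "l \<noteq> 0" for E l x :: real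
        using that \<open>h > 0\<close> by (simp add: field_simps)
      from this[OF l, of "exp (- lam k * h)" "inner v (e k)"]
      show "inner (- multiplier (m h) v) (e k) = inner ((semigroup h (K v) - K v) /\<^sub>R h) (e k)"
        using that by (simp add: coeff_multiplier[where m = "m h", OF m1] coeff_semigroup inner_diff_left K m_def)
    qed
    then show "\<forall>\<^sub>F h in at_right 0. - multiplier (m h) v = (semigroup h (K v) - K v) /\<^sub>R h"
      by (auto simp: eventually_at_right[of 0 1] intro!: exI[of _ 1])
  qed
  then show "p \<in> generator semigroup" by (simp add: generator_def p)
qed

text \<open>Each \<open>e k\<close> lies in the domain, so \<open>S t\<close> acts on it as the
  exponential; boundedness of \<open>S t\<close> carries this over to the expansion of
  \<open>u\<close>. This ties down the semigroup that \<open>solution\<close> leaves open.\<close>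

lemma semigroup_unique:
  assumes S: "C0_semigroup S" and g: "generator S = {(K v, - v) | v. True}"
    and K: "\<And>v k. inner (K v) (e k) = inner v (e k) / lam k" and t: "t \<ge> 0"
  shows "S t u = semigroup t u"
proof -
  have Se: "S t (e k) = exp (- lam k * t) *\<^sub>R e k" for k
  proof (rule C0_semigroup_eigenvector[OF S _ t])
    have "e k = K (lam k *\<^sub>R e k)"
      by (rule coeff_eqI) (use lam_pos in \<open>auto simp: K orth less_imp_neq[symmetric]\<close>)
    then show "(e k, - lam k *\<^sub>R e k) \<in> generator S" unfolding g by (auto intro!: exI[of _ "lam k *\<^sub>R e k"])
  qed
  interpret S: bounded_linear "S t" using S t by (simp add: C0_semigroup_def)
  have "(\<lambda>k. S t (inner u (e k) *\<^sub>R e k)) sums S t u" by (rule S.sums[OF expansion])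
  moreover have "S t (inner u (e k) *\<^sub>R e k) = inner (semigroup t u) (e k) *\<^sub>R e k" for k
    by (simp add: S.scaleR Se coeff_semigroup[OF t] mult.commute)
  ultimately have "(\<lambda>k. inner (semigroup t u) (e k) *\<^sub>R e k) sums S t u" by simp
  then show ?thesis using expansion[of "semigroup t u"] by (rule sums_unique2)
qed

lemma semigroup_high_frequency:
  assumes t: "t \<ge> 0" and A: "\<And>k. k \<notin> A \<Longrightarrow> lam k \<ge> \<Lambda>" and u: "\<And>k. k \<in> A \<Longrightarrow> inner u (e k) = 0"
  shows "norm (semigroup t u) \<le> exp (- \<Lambda> * t) * norm u"
proof (rule norm_le_coeff)
  show "\<bar>inner (semigroup t u) (e k)\<bar> \<le> exp (- \<Lambda> * t) * \<bar>inner u (e k)\<bar>" for k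
    using A[of k] u[of k] t by (cases "k \<in> A") (auto simp: coeff_semigroup abs_mult intro!: mult_right_mono mult_right_mono)
qed simp

end

section \<open>Null control from a spectral inequality\<close>

lemma emeasure_lborel_Ioc_eq: "emeasure lborel {x<..y::real} = ennreal (y - x)"
  using emeasure_lborel_Ioc[of x y] by (cases "x \<le> y") (auto simp: ennreal_neg)

lemma bounded_Ioc: "bounded {x<..y::real}"
  by (rule bounded_subset[OF bounded_closed_interval[of x y]]) auto

text \<open>Here \<open>Q\<close> is an orthogonal projection that stands for the restriction to
  \<omega>. The construction of the control sees the degenerate operator only through its
  eigenvalues, its eigenbasis and \<open>observation\<close>.\<close>

locale observed_semigroup = spectral_semigroup e lam
  for e :: "nat \<Rightarrow> 'a::{real_inner, banach, second_countable_topology}" and lam +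
  fixes Q :: "'a \<Rightarrow> 'a" and D :: real
  assumes lam_lim: "filterlim lam at_top sequentially"
    and Q_linear: "bounded_linear Q" and Q_sa: "inner (Q u) v = inner u (Q v)" and Q_idem: "Q (Q u) = Q u"
    and D_pos: "D > 0"
    and observation: "\<Lambda> \<ge> 1 \<Longrightarrow> finite A \<Longrightarrow> (\<And>k. k \<in> A \<Longrightarrow> lam k \<le> \<Lambda>) \<Longrightarrow>
      norm (\<Sum>k\<in>A. c k *\<^sub>R e k) \<le> exp (D * sqrt \<Lambda>) * norm (Q (\<Sum>k\<in>A. c k *\<^sub>R e k))"
begin

lemma norm_Q_sq: "(norm (Q u))\<^sup>2 = inner (Q u) u"
  by (simp add: power2_norm_eq_inner Q_sa Q_idem)

definition low :: "real \<Rightarrow> nat set" where "low \<Lambda> = {k. lam k \<le> \<Lambda>}"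

lemma finite_low: "finite (low \<Lambda>)"
proof -
  have "\<forall>\<^sub>F k in sequentially. lam k > \<Lambda>" using lam_lim by (simp add: filterlim_at_top_dense)
  then obtain N where "\<And>k. k \<ge> N \<Longrightarrow> lam k > \<Lambda>" by (auto simp: eventually_sequentially)
  then have "low \<Lambda> \<subseteq> {..<N}" unfolding low_def by (auto simp: not_le[symmetric])
  then show ?thesis by (rule finite_subset) simp
qed

definition proj :: "real \<Rightarrow> 'a \<Rightarrow> 'a" where "proj \<Lambda> u = (\<Sum>k\<in>low \<Lambda>. inner u (e k) *\<^sub>R e k)"

lemma coeff_proj: "inner (proj \<Lambda> u) (e k) = (if k \<in> low \<Lambda> then inner u (e k) else 0)"
  unfolding proj_def by (rule inner_sum_e[OF finite_low])

lemma norm_proj_le: "norm (proj \<Lambda> u) \<le> norm u"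
proof -
  have "norm (proj \<Lambda> u) \<le> 1 * norm u" by (rule norm_le_coeff) (simp_all add: coeff_proj)
  then show ?thesis by simp
qed

lemma bounded_linear_proj: "bounded_linear (proj \<Lambda>)"
  by (rule bounded_linear_intro[where K = 1]) (auto intro!: coeff_eqI norm_proj_le simp: coeff_proj inner_add_left)

lemma proj_observation: "\<Lambda> \<ge> 1 \<Longrightarrow> proj \<Lambda> u = u \<Longrightarrow> norm u \<le> exp (D * sqrt \<Lambda>) * norm (Q u)"
proof -
  assume L: "\<Lambda> \<ge> 1" and u: "proj \<Lambda> u = u"
  have "norm (proj \<Lambda> u) \<le> exp (D * sqrt \<Lambda>) * norm (Q (proj \<Lambda> u))"
    unfolding proj_def by (rule observation[OF L finite_low]) (simp add: low_def)
  then show "norm u \<le> exp (D * sqrt \<Lambda>) * norm (Q u)" unfolding u .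
qed

lemma proj_idem: "proj \<Lambda> (proj \<Lambda> u) = proj \<Lambda> u"
  by (rule coeff_eqI) (simp add: coeff_proj)

lemma inner_proj: "proj \<Lambda> z = z \<Longrightarrow> inner (proj \<Lambda> u) z = inner u z"
proof -
  assume z: "proj \<Lambda> z = z"
  have "inner (proj \<Lambda> u) z = (\<Sum>k\<in>low \<Lambda>. inner u (e k) * inner z (e k))"
    unfolding proj_def inner_sum_left inner_scaleR_left by (simp only: inner_commute[of z])
  also have "\<dots> = inner u (proj \<Lambda> z)" unfolding proj_def unfolding inner_sum_right inner_scaleR_right by (simp only: mult.commute)
  finally show ?thesis by (simp add: z)
qed

text \<open>Duality: the square of \<open>norm (Q z)\<close> is the inner product of
  \<open>v\<close> and \<open>z\<close>, and \<open>norm z\<close> is at most exp(D sqrt \<Lambda>)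
  times \<open>norm (Q z)\<close>. The observability constant is thus lost only once.\<close>

lemma right_inverse_bound:
  assumes L: "\<Lambda> \<ge> 1" and z: "proj \<Lambda> z = z" "proj \<Lambda> (Q z) = v"
  shows "norm (Q z) \<le> exp (D * sqrt \<Lambda>) * norm v"
proof (cases "norm (Q z) = 0")
  case False
  then have pos: "norm (Q z) > 0" by simp
  have "(norm (Q z))\<^sup>2 = inner v z" unfolding norm_Q_sq using inner_proj[OF z(1), of "Q z"] z(2) by simp
  also have "\<dots> \<le> norm v * norm z" by (rule norm_cauchy_schwarz)
  also have "\<dots> \<le> norm v * (exp (D * sqrt \<Lambda>) * norm (Q z))" using proj_observation[OF L z(1)] by (intro mult_left_mono) auto
  finally have "norm (Q z) * norm (Q z) \<le> (exp (D * sqrt \<Lambda>) * norm v) * norm (Q z)" by (simp add: power2_eq_square mult_ac)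
  then show ?thesis using pos by (rule mult_right_le_imp_le)
qed simp

text \<open>The operator \<open>proj \<circ> Q\<close> is at least \<open>exp(- 2 D sqrt \<Lambda>)\<close> on the low frequencies, so \<open>z \<mapsto> v + z - proj (Q z)\<close> is a contraction there.\<close>

lemma right_inverse_exists:
  assumes L: "\<Lambda> \<ge> 1" and v: "proj \<Lambda> v = v"
  shows "\<exists>z. proj \<Lambda> z = z \<and> proj \<Lambda> (Q z) = v"
proof -
  interpret Q: bounded_linear Q by (rule Q_linear)
  interpret P: bounded_linear "proj \<Lambda>" by (rule bounded_linear_proj)
  define V where "V = {u. proj \<Lambda> u = u}"
  define f where "f z = v + z - proj \<Lambda> (Q z)" for z
  define c where "c = (exp (- D * sqrt \<Lambda>))\<^sup>2"
  have c: "0 < c" "c \<le> 1"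
    using D_pos L by (auto simp: c_def power2_eq_square exp_add[symmetric])
  have "closed V" unfolding V_def by (intro closed_Collect_eq continuous_intros P.continuous_on)
  then have "complete V" by (simp add: complete_eq_closed)
  moreover have "V \<noteq> {}" using v by (auto simp: V_def)
  moreover have "f ` V \<subseteq> V" unfolding V_def f_def using v by (auto simp: P.add P.diff proj_idem)
  moreover have "dist (f x) (f y) \<le> sqrt (1 - c) * dist x y" if xy: "x \<in> V" "y \<in> V" for x y
  proof -
    define d where "d = x - y"
    have d: "proj \<Lambda> d = d" using xy by (simp add: d_def V_def P.diff)
    have "f x - f y = proj \<Lambda> (d - Q d)" unfolding P.diff d by (simp add: f_def d_def Q.diff P.diff)
    then have "norm (f x - f y) \<le> norm (d - Q d)" by (simp add: norm_proj_le)
    also have "\<dots> \<le> sqrt ((1 - c) * (norm d)\<^sup>2)"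
    proof (rule real_le_rsqrt)
      \<comment> \<open>Pythagoras for the projection \<open>Q\<close>; the part that it removes is
        bounded below by observability, with the square of the reciprocal constant.\<close>
      have "(norm (d - Q d))\<^sup>2 = (norm d)\<^sup>2 - (norm (Q d))\<^sup>2"
        unfolding norm_Q_sq unfolding power2_norm_eq_inner inner_diff_left inner_diff_right by (simp add: Q_sa Q_idem inner_commute)
      moreover have "exp (- D * sqrt \<Lambda>) * norm d \<le> norm (Q d)"
        using proj_observation[OF L d] by (simp add: exp_minus field_simps)
      then have "(exp (- D * sqrt \<Lambda>) * norm d)\<^sup>2 \<le> (norm (Q d))\<^sup>2" by (intro power_mono) auto
      then have "c * (norm d)\<^sup>2 \<le> (norm (Q d))\<^sup>2" unfolding power_mult_distrib c_def .
      ultimately show "(norm (d - Q d))\<^sup>2 \<le> (1 - c) * (norm d)\<^sup>2" by (simp add: left_diff_distrib)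
    qed
    also have "\<dots> = sqrt (1 - c) * norm d" by (simp add: real_sqrt_mult)
    finally show "dist (f x) (f y) \<le> sqrt (1 - c) * dist x y" by (simp add: dist_norm d_def)
  qed
  moreover have "0 \<le> sqrt (1 - c)" "sqrt (1 - c) < 1" using c by auto
  ultimately have "\<exists>!x\<in>V. f x = x" by (intro Banach_fix)
  then obtain z where "z \<in> V" "f z = z" by blast
  then show ?thesis by (auto simp: V_def f_def intro!: exI[of _ z])
qed

text \<open>Solving for the finitely many low \<open>e k\<close> and extending linearly makes the
  choice of \<open>z\<close> a bounded linear map, so that a control built from it depends
  continuously on the state.\<close>

lemma right_inverse:
  assumes L: "\<Lambda> \<ge> 1"
  obtains R where "bounded_linear R" "\<And>v. proj \<Lambda> (Q (R v)) = proj \<Lambda> v"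
    "\<And>v. norm (Q (R v)) \<le> exp (D * sqrt \<Lambda>) * norm v"
proof -
  interpret Q: bounded_linear Q by (rule Q_linear)
  interpret P: bounded_linear "proj \<Lambda>" by (rule bounded_linear_proj)
  have pe: "proj \<Lambda> (e k) = e k" if "k \<in> low \<Lambda>" for k
    by (rule coeff_eqI) (use that in \<open>auto simp: coeff_proj orth\<close>)
  have "\<forall>k. \<exists>z. k \<in> low \<Lambda> \<longrightarrow> proj \<Lambda> z = z \<and> proj \<Lambda> (Q z) = e k"
    using right_inverse_exists[OF L pe] by blast
  then obtain z where z: "\<And>k. k \<in> low \<Lambda> \<Longrightarrow> proj \<Lambda> (z k) = z k \<and> proj \<Lambda> (Q (z k)) = e k"
    unfolding choice_iff by blast
  define R where "R v = (\<Sum>k\<in>low \<Lambda>. inner v (e k) *\<^sub>R z k)" for v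
  have 1: "bounded_linear R"
    unfolding R_def by (intro bounded_linear_sum bounded_linear_compose[OF bounded_linear_scaleR_left bounded_linear_inner_left])
  have 2: "proj \<Lambda> (Q (R v)) = proj \<Lambda> v" for v
    unfolding R_def proj_def[of \<Lambda> v] Q.sum P.sum Q.scaleR P.scaleR using z by (intro sum.cong) auto
  have 3: "proj \<Lambda> (R v) = R v" for v
    unfolding R_def P.sum P.scaleR using z by (intro sum.cong) auto
  have "norm (Q (R v)) \<le> exp (D * sqrt \<Lambda>) * norm v" for v
    using right_inverse_bound[OF L 3 2, of v] norm_proj_le[of \<Lambda> v]
    by (meson exp_ge_zero mult_left_mono order_trans)
  with that 1 2 show thesis by blast
qed

text \<open>The interval is half-open, so that consecutive intervals are disjoint and
  \<open>duhamel_split\<close> adds up exactly.\<close>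

definition duhamel :: "(real \<Rightarrow> 'a) \<Rightarrow> real \<Rightarrow> real \<Rightarrow> 'a" where
  "duhamel c a b = (LINT s:{a<..b}|lebesgue. semigroup (b - s) (c s))"

lemma duhamel_integrable:
  assumes c: "c \<in> borel_measurable borel" "\<And>s. norm (c s) \<le> M" and A: "A \<in> sets borel" "emeasure lborel A < \<infinity>"
  shows "set_integrable lebesgue A (\<lambda>s. semigroup (b - s) (c s))"
proof -
  have m: "(\<lambda>s. semigroup (b - s) (c s)) \<in> borel_measurable borel"
  proof -
    have "(\<lambda>s. (b - s, c s)) \<in> borel_measurable borel" using c(1) by measurable
    from measurable_compose[OF this borel_measurable_continuous_onI[OF continuous_semigroup_joint]]
    show ?thesis by simp
  qed
  have "integrable lborel (\<lambda>s. indicator A s *\<^sub>R semigroup (b - s) (c s))"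
  proof (rule integrableI_bounded_set[where A = A and B = M])
    show "AE s in lborel. s \<in> A \<longrightarrow> norm (indicat_real A s *\<^sub>R semigroup (b - s) (c s)) \<le> M"
      using c(2) norm_semigroup_le by (intro AE_I2) (auto intro: order_trans)
    show "(\<lambda>s. indicat_real A s *\<^sub>R semigroup (b - s) (c s)) \<in> borel_measurable lborel" using m A(1) by measurable
  qed (use A in auto)
  moreover have "(\<lambda>s. indicat_real A s *\<^sub>R semigroup (b - s) (c s)) \<in> borel_measurable lborel" using m A(1) by measurable
  ultimately show ?thesis unfolding set_integrable_def by (simp add: integrable_completion)
qed

lemma duhamel_split:
  assumes c: "c \<in> borel_measurable borel" "\<And>s. norm (c s) \<le> M" and ab: "t0 \<le> a" "a \<le> b"
  shows "duhamel c t0 b = semigroup (b - a) (duhamel c t0 a) + duhamel c a b"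
proof -
  have i: "set_integrable lebesgue {x<..y} (\<lambda>s. semigroup (z - s) (c s))" for x y z
    by (rule duhamel_integrable[OF c]) (auto simp: emeasure_lborel_Ioc_eq)
  have "duhamel c t0 b = (LINT s:{t0<..a} \<union> {a<..b}|lebesgue. semigroup (b - s) (c s))"
    using ab by (simp add: duhamel_def ivl_disj_un)
  also have "\<dots> = (LINT s:{t0<..a}|lebesgue. semigroup (b - s) (c s)) + duhamel c a b"
    unfolding duhamel_def by (intro set_integral_Un i) auto
  also have "(LINT s:{t0<..a}|lebesgue. semigroup (b - s) (c s)) = semigroup (b - a) (duhamel c t0 a)"
  proof -
    have "semigroup (b - a) (duhamel c t0 a) = (\<integral>s. semigroup (b - a) (indicator {t0<..a} s *\<^sub>R semigroup (a - s) (c s)) \<partial>lebesgue)"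
      unfolding duhamel_def set_lebesgue_integral_def
      by (rule integral_bounded_linear[OF bounded_linear_semigroup, symmetric]) (use i[of t0 a a] in \<open>simp add: set_integrable_def\<close>)
    also have "\<dots> = (LINT s:{t0<..a}|lebesgue. semigroup (b - s) (c s))"
      unfolding set_lebesgue_integral_def
    proof (rule Bochner_Integration.integral_cong[OF refl])
      fix s
      show "semigroup (b - a) (indicat_real {t0<..a} s *\<^sub>R semigroup (a - s) (c s)) = indicat_real {t0<..a} s *\<^sub>R semigroup (b - s) (c s)"
      proof (cases "s \<in> {t0<..a}")
        case True
        then show ?thesis using semigroup_add[of "b - a" "a - s" "c s"] ab by simp
      next
        case False
        then show ?thesis using linear_0[OF bounded_linear.linear[OF bounded_linear_semigroup]] by simp
      qed
    qed
    finally show ?thesis by simp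
  qed
  finally show ?thesis .
qed

lemma duhamel_cong:
  "(\<And>s. a < s \<Longrightarrow> s \<le> b \<Longrightarrow> c s = c' s) \<Longrightarrow> duhamel c a b = duhamel c' a b"
  unfolding duhamel_def by (rule set_lebesgue_integral_cong) auto

lemma duhamel_zero: "(\<And>s. a < s \<Longrightarrow> s \<le> b \<Longrightarrow> c s = 0) \<Longrightarrow> duhamel c a b = 0"
  unfolding duhamel_def set_lebesgue_integral_def
  by (rule trans[OF Bochner_Integration.integral_cong[of _ _ _ "\<lambda>_. 0"]])
     (auto simp: indicator_def linear_0[OF bounded_linear.linear[OF bounded_linear_semigroup]])

lemma continuous_duhamel:
  assumes c: "c \<in> borel_measurable borel" "\<And>s. norm (c s) \<le> M"
  shows "continuous_on {t0..t1} (\<lambda>t. duhamel c t0 t)"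
  unfolding continuous_on_sequentially
proof (intro allI ballI impI, elim conjE)
  fix X t assume t: "t \<in> {t0..t1}" and X: "\<forall>n. X n \<in> {t0..t1}" "X \<longlonglongrightarrow> t"
  have M: "M \<ge> 0" using c(2)[of 0] norm_ge_zero order_trans by blast
  have i: "set_integrable lebesgue {x<..y} (\<lambda>s. semigroup (z - s) (c s))" for x y z
    by (rule duhamel_integrable[OF c]) (auto simp: emeasure_lborel_Ioc_eq)
  have "(\<lambda>n. \<integral>s. indicator {t0<..X n} s *\<^sub>R semigroup (X n - s) (c s) \<partial>lebesgue) \<longlonglongrightarrow>
      (\<integral>s. indicator {t0<..t} s *\<^sub>R semigroup (t - s) (c s) \<partial>lebesgue)"
  proof (rule integral_dominated_convergence[where w = "\<lambda>s. indicator {t0..t1} s * M"])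
    show "(\<lambda>s. indicat_real {t0<..t} s *\<^sub>R semigroup (t - s) (c s)) \<in> borel_measurable lebesgue"
      using i[of t0 t t] unfolding set_integrable_def by (rule borel_measurable_integrable)
    show "(\<lambda>s. indicat_real {t0<..X n} s *\<^sub>R semigroup (X n - s) (c s)) \<in> borel_measurable lebesgue" for n
      using i[of t0 "X n" "X n"] unfolding set_integrable_def by (rule borel_measurable_integrable)
    show "integrable lebesgue (\<lambda>s. indicat_real {t0..t1} s * M)"
      by (intro integrable_mult_left integrable_real_indicator) (auto simp: emeasure_lborel_Icc_eq)
    show "AE s in lebesgue. norm (indicat_real {t0<..X n} s *\<^sub>R semigroup (X n - s) (c s)) \<le> indicat_real {t0..t1} s * M" for n
    proof (rule AE_I2)
      fix s
      have "norm (semigroup (X n - s) (c s)) \<le> M" using norm_semigroup_le c(2) order_trans by blast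
      moreover have "X n \<le> t1" using X(1) by auto
      ultimately show "norm (indicat_real {t0<..X n} s *\<^sub>R semigroup (X n - s) (c s)) \<le> indicat_real {t0..t1} s * M"
        using M by (auto simp: indicator_def)
    qed
    have "AE s in lebesgue. s \<notin> {t}" by (intro AE_not_in) simp
    then show "AE s in lebesgue. (\<lambda>n. indicat_real {t0<..X n} s *\<^sub>R semigroup (X n - s) (c s)) \<longlonglongrightarrow> indicat_real {t0<..t} s *\<^sub>R semigroup (t - s) (c s)"
    proof eventually_elim
      case (elim s)
      have sg: "(\<lambda>n. semigroup (X n - s) (c s)) \<longlonglongrightarrow> semigroup (t - s) (c s)"
        using continuous_semigroup[of "c s"] X(2) unfolding continuous_on_def
        by (intro isCont_tendsto_compose[where g = "\<lambda>t. semigroup t (c s)"] tendsto_intros) (auto simp: isCont_def)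
      have "\<forall>\<^sub>F n in sequentially. indicat_real {t0<..X n} s = indicat_real {t0<..t} s"
      proof (cases "s < t")
        case True
        from order_tendstoD(1)[OF X(2) this] show ?thesis by eventually_elim (use True in \<open>auto simp: indicator_def\<close>)
      next
        case False
        then have "t < s" using elim by simp
        from order_tendstoD(2)[OF X(2) this] show ?thesis by eventually_elim (use \<open>t < s\<close> in \<open>auto simp: indicator_def\<close>)
      qed
      then have "(\<lambda>n. indicat_real {t0<..X n} s) \<longlonglongrightarrow> indicat_real {t0<..t} s" by (rule tendsto_eventually)
      then show ?case using sg by (rule tendsto_scaleR)
    qed
  qed
  then show "((\<lambda>t. duhamel c t0 t) \<circ> X) \<longlonglongrightarrow> duhamel c t0 t"
    unfolding duhamel_def set_lebesgue_integral_def o_def .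
qed

end

section \<open>Control on one time interval and its iteration\<close>

context observed_semigroup
begin

text \<open>The control steers the low frequencies to zero with an impulse spread uniformly over \<open>J\<close>: for each low \<open>k\<close>
  the integrand of the \<open>k\<close>-th coefficient of Duhamel's integral does not depend on the time \<open>s \<in> J\<close>.\<close>

lemma control_step:
  assumes L: "\<Lambda> \<ge> 1" and tau: "\<tau> > 0" and J: "J \<in> sets borel" "J \<subseteq> {a<..a + \<tau> / 2}" and mu: "measure lebesgue J > 0"
  obtains c where "c \<in> borel_measurable borel" "\<And>s. Q (c s) = c s" "\<And>s. s \<notin> J \<Longrightarrow> c s = 0"
    "\<And>s. norm (c s) \<le> exp (D * sqrt \<Lambda>) * norm v / measure lebesgue J"
    "norm (semigroup \<tau> v + duhamel c a (a + \<tau>)) \<le> exp (- \<Lambda> * (\<tau> / 2)) * (2 * exp (D * sqrt \<Lambda>)) * norm v"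
proof -
  interpret Q: bounded_linear Q by (rule Q_linear)
  define \<mu> where "\<mu> = measure lebesgue J"
  have mu: "\<mu> > 0" using mu by (simp add: \<mu>_def)
  obtain R where R: "bounded_linear R" "\<And>v. proj \<Lambda> (Q (R v)) = proj \<Lambda> v" "\<And>v. norm (Q (R v)) \<le> exp (D * sqrt \<Lambda>) * norm v"
    using right_inverse[OF L] by blast
  interpret R: bounded_linear R by (rule R(1))
  \<comment> \<open>The negative low part of the free state at time \<open>s\<close>, spread with
    total weight 1 over \<open>J\<close>. Acting through \<open>Q\<close> does not change the low
    coefficients, because \<open>R\<close> is a right inverse of \<open>proj\<close> after
    \<open>Q\<close>.\<close>
  define c where "c s = (- indicator J s / \<mu>) *\<^sub>R Q (R (semigroup (s - a) v))" for s
  define B where "B = exp (D * sqrt \<Lambda>) * norm v / \<mu>"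
  have cont: "continuous_on UNIV (\<lambda>s. Q (R (semigroup (s - a) v)))"
    by (intro Q.continuous_on R.continuous_on continuous_on_compose2[OF continuous_semigroup] continuous_intros) simp
  have c1: "c \<in> borel_measurable borel"
    unfolding c_def using borel_measurable_continuous_onI[OF cont] J(1) by measurable
  have c2: "Q (c s) = c s" for s unfolding c_def Q.scaleR Q_idem ..
  have c3: "c s = 0" if "s \<notin> J" for s using that by (simp add: c_def)
  have c4: "norm (c s) \<le> B" for s
  proof (cases "s \<in> J")
    case True
    have "norm (Q (R (semigroup (s - a) v))) \<le> exp (D * sqrt \<Lambda>) * norm (semigroup (s - a) v)" by (rule R(3))
    also have "\<dots> \<le> exp (D * sqrt \<Lambda>) * norm v" by (intro mult_left_mono norm_semigroup_le) simp
    finally show ?thesis using True mu by (simp add: c_def B_def divide_right_mono)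
  qed (use mu in \<open>simp add: c3 B_def\<close>)
  define h where "h = a + \<tau> / 2"
  define w where "w = semigroup (\<tau> / 2) v + duhamel c a h"
  have i: "set_integrable lebesgue {x<..y} (\<lambda>s. semigroup (z - s) (c s))" for x y z
    by (rule duhamel_integrable[OF c1 c4]) (auto simp: emeasure_lborel_Ioc_eq)
  have Jm: "J \<in> lmeasurable"
    using J by (intro bounded_set_imp_lmeasurable bounded_subset[OF bounded_Ioc J(2)]) auto
  have Jlt: "emeasure lebesgue J < \<infinity>" using fmeasurableD2[OF Jm] by (simp add: less_top)
  have low: "inner w (e k) = 0" if k: "k \<in> low \<Lambda>" for k
  proof -
    have "inner (duhamel c a h) (e k) = (\<integral>s. inner (indicator {a<..h} s *\<^sub>R semigroup (h - s) (c s)) (e k) \<partial>lebesgue)"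
      unfolding duhamel_def set_lebesgue_integral_def
      by (rule integral_bounded_linear[OF bounded_linear_inner_left, symmetric]) (use i[of a h h] in \<open>simp add: set_integrable_def\<close>)
    also have "\<dots> = (\<integral>s. (- exp (- lam k * (\<tau> / 2)) * inner v (e k) / \<mu>) * indicator J s \<partial>lebesgue)"
    proof (rule Bochner_Integration.integral_cong[OF refl])
      fix s
      show "inner (indicator {a<..h} s *\<^sub>R semigroup (h - s) (c s)) (e k) = (- exp (- lam k * (\<tau> / 2)) * inner v (e k) / \<mu>) * indicator J s"
      proof (cases "s \<in> J")
        case True
        then have s: "a < s" "s \<le> h" using J(2) by (auto simp: h_def)
        have "inner (Q (R (semigroup (s - a) v))) (e k) = inner (semigroup (s - a) v) (e k)"
          using arg_cong[OF R(2)[of "semigroup (s - a) v"], of "\<lambda>u. inner u (e k)"] k by (simp add: coeff_proj)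
        also have "\<dots> = exp (- lam k * (s - a)) * inner v (e k)" using s by (intro coeff_semigroup) simp
        finally have "inner (semigroup (h - s) (c s)) (e k) = exp (- lam k * (h - s)) * (- (exp (- lam k * (s - a)) * inner v (e k)) / \<mu>)"
          using s True by (simp add: coeff_semigroup c_def)
        moreover have "exp (- lam k * (h - s)) * exp (- lam k * (s - a)) = exp (- lam k * (\<tau> / 2))"
          unfolding exp_add[symmetric] by (simp add: h_def algebra_simps)
        ultimately show ?thesis using s True by (simp add: mult.assoc[symmetric])
      next
        case False
        have "semigroup (h - s) 0 = 0" using linear_0[OF bounded_linear.linear[OF bounded_linear_semigroup]] .
        with False show ?thesis by (simp add: c3)
      qed
    qed
    also have "\<dots> = - exp (- lam k * (\<tau> / 2)) * inner v (e k) / \<mu> * \<mu>"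
      using Jm by (simp add: \<mu>_def)
    also have "\<dots> = - exp (- lam k * (\<tau> / 2)) * inner v (e k)" using mu by simp
    finally show ?thesis unfolding w_def inner_add_left using tau by (simp add: coeff_semigroup)
  qed
  have "norm (duhamel c a h) \<le> (\<integral>s. norm (indicator {a<..h} s *\<^sub>R semigroup (h - s) (c s)) \<partial>lebesgue)"
    unfolding duhamel_def set_lebesgue_integral_def by (rule integral_norm_bound)
  also have "\<dots> \<le> (\<integral>s. B * indicator J s \<partial>lebesgue)"
  proof (rule integral_mono)
    show "integrable lebesgue (\<lambda>s. norm (indicator {a<..h} s *\<^sub>R semigroup (h - s) (c s)))"
      using i[of a h h] by (intro integrable_norm) (simp add: set_integrable_def)
    show "integrable lebesgue (\<lambda>s. B * indicator J s)"
      using J Jlt by (intro integrable_mult_right integrable_real_indicator) auto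
    show "norm (indicator {a<..h} s *\<^sub>R semigroup (h - s) (c s)) \<le> B * indicator J s" for s
    proof (cases "s \<in> J")
      case True
      then show ?thesis using order_trans[OF norm_semigroup_le c4, of "h - s" s] J(2) by (auto simp: indicator_def h_def)
    next
      case False
      have "semigroup (h - s) 0 = 0" using linear_0[OF bounded_linear.linear[OF bounded_linear_semigroup]] .
      with False show ?thesis by (simp add: c3)
    qed
  qed
  also have "\<dots> = B * \<mu>" using Jm by (simp add: \<mu>_def)
  also have "\<dots> = exp (D * sqrt \<Lambda>) * norm v" using mu by (simp add: B_def)
  finally have "norm w \<le> norm v + exp (D * sqrt \<Lambda>) * norm v"
    unfolding w_def using norm_triangle_ineq[of "semigroup (\<tau> / 2) v" "duhamel c a h"] norm_semigroup_le[of "\<tau> / 2" v] by linarith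
  moreover have "1 * norm v \<le> exp (D * sqrt \<Lambda>) * norm v"
    using L D_pos by (intro mult_right_mono) auto
  ultimately have w: "norm w \<le> 2 * exp (D * sqrt \<Lambda>) * norm v" by linarith
  have "duhamel c a (a + \<tau>) = semigroup (a + \<tau> - h) (duhamel c a h) + duhamel c h (a + \<tau>)"
    using tau by (intro duhamel_split[OF c1 c4]) (auto simp: h_def)
  moreover have "duhamel c h (a + \<tau>) = 0"
    by (rule duhamel_zero, rule c3) (use J(2) in \<open>auto simp: h_def\<close>)
  moreover have "a + \<tau> - h = \<tau> / 2" by (simp add: h_def)
  moreover have "semigroup \<tau> v = semigroup (\<tau> / 2) (semigroup (\<tau> / 2) v)"
    using semigroup_add[of "\<tau> / 2" "\<tau> / 2" v] tau by simp
  ultimately have "semigroup \<tau> v + duhamel c a (a + \<tau>) = semigroup (\<tau> / 2) w"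
    unfolding w_def using linear_add[OF bounded_linear.linear[OF bounded_linear_semigroup]] by simp
  also have "norm \<dots> \<le> exp (- \<Lambda> * (\<tau> / 2)) * norm w"
    using tau by (intro semigroup_high_frequency[where A = "low \<Lambda>"] low) (auto simp: low_def)
  also have "\<dots> \<le> exp (- \<Lambda> * (\<tau> / 2)) * (2 * exp (D * sqrt \<Lambda>) * norm v)" by (intro mult_left_mono w) simp
  finally have c5: "norm (semigroup \<tau> v + duhamel c a (a + \<tau>)) \<le> exp (- \<Lambda> * (\<tau> / 2)) * (2 * exp (D * sqrt \<Lambda>)) * norm v"
    by (simp add: mult.assoc)
  show thesis by (rule that[OF c1 c2 c3 _ c5]) (use c4 in \<open>auto simp: B_def \<mu>_def\<close>)
qed

text \<open>Let x = b 3^m. The decay exponent x^2 \<delta>/2^(m+2) is at least x b \<delta>/4,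
  because 9^m/2^m \<ge> 3^m, hence at least x (5 D + 1). Of this, D x pays the cost of the control,
  4 D x the passage from exp(-2 D x) to exp(-6 D x), and the remaining x \<ge> 1 the factor 2, which
  is below e.\<close>

lemma growth_absorbed:
  fixes b \<delta> :: real
  assumes b: "b \<ge> 1" "b * (\<delta> / 4) \<ge> 5 * D + 1" and \<delta>: "\<delta> > 0"
  shows "exp (- (b * 3 ^ m)\<^sup>2 * (\<delta> / 2 ^ Suc m / 2)) * (2 * exp (D * (b * 3 ^ m))) * exp (- 2 * D * b * 3 ^ m)
    \<le> exp (- 2 * D * b * 3 ^ Suc m)"
proof -
  have b3: "b * 3 ^ m \<ge> 1" using b(1) mult_mono[of 1 b 1 "3 ^ m"] by simp
  have "(6::real) ^ m \<le> 9 ^ m" by (intro power_mono) auto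
  then have "(3::real) ^ m \<le> 9 ^ m / 2 ^ m" by (simp add: field_simps power_mult_distrib[symmetric])
  then have "(b * 3 ^ m) * (b * (\<delta> / 4)) \<le> b * (9 ^ m / 2 ^ m) * (b * (\<delta> / 4))"
    using b \<delta> by (intro mult_right_mono mult_left_mono) auto
  also have "(9::real) ^ m = 3 ^ m * 3 ^ m" by (simp add: power_mult_distrib[symmetric])
  also have "b * (3 ^ m * 3 ^ m / 2 ^ m) * (b * (\<delta> / 4)) = (b * 3 ^ m)\<^sup>2 * (\<delta> / 2 ^ Suc m / 2)"
    by (simp add: power2_eq_square field_simps)
  finally have 1: "(b * 3 ^ m) * (b * (\<delta> / 4)) \<le> (b * 3 ^ m)\<^sup>2 * (\<delta> / 2 ^ Suc m / 2)" .
  have "(b * 3 ^ m) * (5 * D + 1) \<le> (b * 3 ^ m) * (b * (\<delta> / 4))" using b b3 by (intro mult_left_mono) auto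
  then have "5 * D * b * 3 ^ m + 1 \<le> (b * 3 ^ m)\<^sup>2 * (\<delta> / 2 ^ Suc m / 2)" using 1 b3 by (simp add: algebra_simps)
  then have "1 + (- ((b * 3 ^ m)\<^sup>2 * (\<delta> / 2 ^ Suc m / 2)) + (D * (b * 3 ^ m) + - 2 * D * b * 3 ^ m)) \<le> - 2 * D * b * 3 ^ Suc m"
    by (simp add: algebra_simps)
  then have "exp 1 * (exp (- ((b * 3 ^ m)\<^sup>2 * (\<delta> / 2 ^ Suc m / 2))) * (exp (D * (b * 3 ^ m)) * exp (- 2 * D * b * 3 ^ m))) \<le> exp (- 2 * D * b * 3 ^ Suc m)"
    unfolding exp_add[symmetric] by simp
  moreover have "2 * (exp (- ((b * 3 ^ m)\<^sup>2 * (\<delta> / 2 ^ Suc m / 2))) * (exp (D * (b * 3 ^ m)) * exp (- 2 * D * b * 3 ^ m)))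
     \<le> exp 1 * (exp (- ((b * 3 ^ m)\<^sup>2 * (\<delta> / 2 ^ Suc m / 2))) * (exp (D * (b * 3 ^ m)) * exp (- 2 * D * b * 3 ^ m)))"
    using exp_ge_add_one_self[of 1] by (intro mult_right_mono) auto
  ultimately have "2 * (exp (- ((b * 3 ^ m)\<^sup>2 * (\<delta> / 2 ^ Suc m / 2))) * (exp (D * (b * 3 ^ m)) * exp (- 2 * D * b * 3 ^ m)))
    \<le> exp (- 2 * D * b * 3 ^ Suc m)" by linarith
  then show ?thesis by (simp only: mult_minus_left mult.assoc mult.left_commute[of _ 2])
qed

theorem null_control:
  assumes E: "E \<in> sets borel" and \<delta>: "\<delta> > 0" and Ts: "0 \<le> Ts - \<delta>" "Ts \<le> T"
    and dens: "\<And>s. Ts - \<delta> \<le> s \<Longrightarrow> s < Ts \<Longrightarrow> 7 / 8 * (Ts - s) \<le> measure lebesgue (E \<inter> {s<..<Ts})"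
  obtains c M where "c \<in> borel_measurable borel" "\<And>s. norm (c s) \<le> M" "\<And>s. Q (c s) = c s"
    "\<And>s. s \<notin> E \<Longrightarrow> c s = 0" "semigroup T y0 + duhamel c 0 T = 0"
proof -
  define t where "t m = Ts - \<delta> / 2 ^ m" for m :: nat
  define \<tau> where "\<tau> m = \<delta> / 2 ^ Suc m" for m :: nat
  define J where "J m = E \<inter> {t m<..t m + \<tau> m / 2}" for m
  \<comment> \<open>The second entry provides the condition on b \<delta>/4 in
    \<open>growth_absorbed\<close>; the first keeps every \<open>L m\<close> at least 1.\<close>
  define b where "b = max 1 (4 / \<delta> * (5 * D + 1))"
  define L where "L m = (b * 3 ^ m)\<^sup>2" for m :: nat
  have tau: "\<tau> m > 0" "t (Suc m) = t m + \<tau> m" "Ts - t m = 2 * \<tau> m" "t m < Ts" "Ts - \<delta> \<le> t m" for m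
    using \<delta> by (auto simp: t_def \<tau>_def field_simps)
  have b: "b \<ge> 1" "b * (\<delta> / 4) \<ge> 5 * D + 1"
  proof -
    have "4 / \<delta> * (5 * D + 1) \<le> b" by (simp add: b_def)
    then have "4 / \<delta> * (5 * D + 1) * (\<delta> / 4) \<le> b * (\<delta> / 4)" using \<delta> by (intro mult_right_mono) auto
    then show "b * (\<delta> / 4) \<ge> 5 * D + 1" using \<delta> by simp
  qed (simp add: b_def)
  have b3: "b * 3 ^ m \<ge> 1" for m :: nat using b(1) mult_mono[of 1 b 1 "3 ^ m"] by simp
  have L: "L m \<ge> 1" "sqrt (L m) = b * 3 ^ m" for m using b3[of m] by (auto simp: L_def)
  have J1: "J m \<in> sets borel" "J m \<subseteq> {t m<..t m + \<tau> m / 2}" for m using E by (auto simp: J_def)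
  \<comment> \<open>The interval from \<open>t m\<close> to \<open>Ts\<close> has length 2 \<tau>,
    so \<open>E\<close> fills at least 7/4 \<tau> of it. The part beyond t m + \<tau>/2 has length
    3/2 \<tau>, which leaves \<tau>/4 for \<open>J m\<close>.\<close>
  have J2: "\<tau> m / 4 \<le> measure lebesgue (J m)" for m
  proof -
    have lm: "J m \<in> lmeasurable" using J1
      by (intro bounded_set_imp_lmeasurable bounded_subset[OF bounded_Ioc J1(2)]) auto
    have "E \<inter> {t m<..<Ts} \<subseteq> J m \<union> {t m + \<tau> m / 2..Ts}" by (auto simp: J_def)
    then have "measure lebesgue (E \<inter> {t m<..<Ts}) \<le> measure lebesgue (J m \<union> {t m + \<tau> m / 2..Ts})"
      using E lm by (intro measure_mono_fmeasurable fmeasurable.Un) auto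
    also have "\<dots> \<le> measure lebesgue (J m) + measure lebesgue {t m + \<tau> m / 2..Ts}"
      using J1(1) by (intro measure_Un_le) auto
    also have "measure lebesgue {t m + \<tau> m / 2..Ts} = 3 / 2 * \<tau> m"
      using tau(1,3)[of m] by simp
    finally show ?thesis using dens[of "t m"] tau[of m] by simp
  qed
  have J3: "measure lebesgue (J m) > 0" for m using J2[of m] tau(1)[of m] by linarith
  \<comment> \<open>The state at \<open>t m\<close> depends on the controls chosen before, so a
    control is selected in advance for every pair of a step and a state, and the recursion for
    \<open>y\<close> picks the relevant ones.\<close>
  have "\<exists>c. \<forall>p. c p \<in> borel_measurable borel \<and> (\<forall>s. Q (c p s) = c p s) \<and> (\<forall>s. s \<notin> J (fst p) \<longrightarrow> c p s = 0) \<and>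
      (\<forall>s. norm (c p s) \<le> exp (D * sqrt (L (fst p))) * norm (snd p) / measure lebesgue (J (fst p))) \<and>
      norm (semigroup (\<tau> (fst p)) (snd p) + duhamel (c p) (t (fst p)) (t (fst p) + \<tau> (fst p)))
        \<le> exp (- L (fst p) * (\<tau> (fst p) / 2)) * (2 * exp (D * sqrt (L (fst p)))) * norm (snd p)"
  proof (rule choice, rule allI)
    fix p :: "nat \<times> 'a"
    show "\<exists>c. c \<in> borel_measurable borel \<and> (\<forall>s. Q (c s) = c s) \<and> (\<forall>s. s \<notin> J (fst p) \<longrightarrow> c s = 0) \<and>
      (\<forall>s. norm (c s) \<le> exp (D * sqrt (L (fst p))) * norm (snd p) / measure lebesgue (J (fst p))) \<and>
      norm (semigroup (\<tau> (fst p)) (snd p) + duhamel c (t (fst p)) (t (fst p) + \<tau> (fst p)))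
        \<le> exp (- L (fst p) * (\<tau> (fst p) / 2)) * (2 * exp (D * sqrt (L (fst p)))) * norm (snd p)"
      by (rule control_step[OF L(1) tau(1) J1 J3, where v = "snd p"]) blast
  qed
  then obtain C where C: "\<And>p. C p \<in> borel_measurable borel" "\<And>p s. Q (C p s) = C p s" "\<And>p s. s \<notin> J (fst p) \<Longrightarrow> C p s = 0"
      "\<And>p s. norm (C p s) \<le> exp (D * sqrt (L (fst p))) * norm (snd p) / measure lebesgue (J (fst p))"
      "\<And>p. norm (semigroup (\<tau> (fst p)) (snd p) + duhamel (C p) (t (fst p)) (t (fst p) + \<tau> (fst p)))
        \<le> exp (- L (fst p) * (\<tau> (fst p) / 2)) * (2 * exp (D * sqrt (L (fst p)))) * norm (snd p)"
    by blast
  define y where "y = rec_nat (semigroup (t 0) y0) (\<lambda>m v. semigroup (\<tau> m) v + duhamel (C (m, v)) (t m) (t m + \<tau> m))"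
  have y_0: "y 0 = semigroup (t 0) y0" and y_Suc: "y (Suc m) = semigroup (\<tau> m) (y m) + duhamel (C (m, y m)) (t m) (t m + \<tau> m)" for m
    by (simp_all add: y_def)
  \<comment> \<open>Makes the decay estimate an equality at m = 0. One half of the exponent 2 D b
    3^m pays the cost exp(D b 3^m) of the control, the other half the division by the measure of
    \<open>J m\<close>, which may be as small as a multiple of 2^(-m).\<close>
  define M where "M = norm (y 0) * exp (2 * D * b)"
  have M: "M \<ge> 0" by (simp add: M_def)
  have decay: "norm (y m) \<le> M * exp (- 2 * D * b * 3 ^ m)" for m
  proof (induction m)
    case 0
    show ?case by (simp add: M_def mult.assoc exp_add[symmetric])
  next
    case (Suc m)
    let ?g = "exp (- L m * (\<tau> m / 2)) * (2 * exp (D * sqrt (L m)))"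
    have "norm (y (Suc m)) \<le> ?g * norm (y m)" unfolding y_Suc using C(5)[of "(m, y m)"] by simp
    also have "\<dots> \<le> ?g * (M * exp (- 2 * D * b * 3 ^ m))" by (intro mult_left_mono Suc.IH) simp
    also have "\<dots> = M * (?g * exp (- 2 * D * b * 3 ^ m))" by simp
    also have "\<dots> \<le> M * exp (- 2 * D * b * 3 ^ Suc m)"
      using growth_absorbed[OF b \<delta>, of m] M unfolding L(2) unfolding L_def \<tau>_def by (intro mult_left_mono) 
    finally show ?case .
  qed
  \<comment> \<open>The sets \<open>J m\<close> are disjoint, so at most one term is nonzero at each
    time; as a series, the control is visibly measurable.\<close>
  define c where "c s = (\<Sum>m. C (m, y m) s)" for s
  define B where "B = 8 * M / (\<delta> * D * b)"
  have Cb: "norm (C (m, y m) s) \<le> B" for m s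
  proof -
    have p: "D * b > 0" using D_pos b by simp
    have "(2::real) ^ m \<le> 3 ^ m" by (intro power_mono) auto
    then have "D * b * 2 ^ m \<le> D * b * 3 ^ m" using p by (intro mult_left_mono) auto
    also have "\<dots> \<le> exp (D * b * 3 ^ m)" using exp_ge_add_one_self[of "D * b * 3 ^ m"] by linarith
    finally have e: "D * b * 2 ^ m \<le> exp (D * b * 3 ^ m)" .
    have "norm (C (m, y m) s) \<le> exp (D * (b * 3 ^ m)) * norm (y m) / measure lebesgue (J m)"
      using C(4)[of "(m, y m)" s] by (simp add: L(2))
    also have "\<dots> \<le> exp (D * (b * 3 ^ m)) * norm (y m) / (\<tau> m / 4)"
      using J2[of m] tau(1)[of m] by (intro divide_left_mono mult_pos_pos J3) auto
    also have "\<dots> \<le> exp (D * (b * 3 ^ m)) * (M * exp (- 2 * D * b * 3 ^ m)) / (\<tau> m / 4)"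
      using tau(1)[of m] by (intro divide_right_mono mult_left_mono decay) auto
    also have "\<dots> = M * (exp (D * (b * 3 ^ m)) * exp (- 2 * D * b * 3 ^ m)) * (8 * 2 ^ m / \<delta>)"
      using \<delta> by (simp add: \<tau>_def field_simps)
    also have "exp (D * (b * 3 ^ m)) * exp (- 2 * D * b * 3 ^ m) = 1 / exp (D * b * 3 ^ m)"
    proof -
      have "D * (b * 3 ^ m) + - 2 * D * b * 3 ^ m = - (D * b * 3 ^ m)" by simp
      then show ?thesis unfolding exp_add[symmetric] by (simp only: exp_minus divide_inverse mult_1)
    qed
    also have "M * (1 / exp (D * b * 3 ^ m)) * (8 * 2 ^ m / \<delta>) = (8 * M / \<delta>) * (2 ^ m / exp (D * b * 3 ^ m))"
      by (simp only: times_divide_eq_left times_divide_eq_right mult_ac divide_divide_eq_left mult_1)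
    also have "\<dots> \<le> (8 * M / \<delta>) * (1 / (D * b))"
      using M \<delta> e p by (intro mult_left_mono) (auto simp: field_simps)
    finally show ?thesis by (simp add: B_def mult_ac)
  qed
  have t_mono: "t m \<le> t n" if "m \<le> n" for m n
    by (rule lift_Suc_mono_le[OF _ that]) (use tau in \<open>simp add: less_imp_le\<close>)
  have c_eq: "c s = C (m, y m) s" if s: "t m < s" "s \<le> t (Suc m)" for s m
  proof -
    have "C (n, y n) s = 0" if "n \<noteq> m" for n
    proof (rule C(3))
      have "s \<notin> J n"
      proof (cases "n < m")
        case True
        then have "t n + \<tau> n < s" using t_mono[of "Suc n" m] tau(2)[of n] s by simp
        then show ?thesis using tau(1)[of n] by (auto simp: J_def)
      next
        case False
        then have "s \<le> t n" using t_mono[of "Suc m" n] s \<open>n \<noteq> m\<close> by simp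
        then show ?thesis by (auto simp: J_def)
      qed
      then show "s \<notin> J (fst (n, y n))" by simp
    qed
    then show ?thesis unfolding c_def by (subst suminf_finite[of "{m}"]) auto
  qed
  have c_cases: "(\<exists>m. s \<in> J m \<and> c s = C (m, y m) s) \<or> (c s = 0 \<and> (\<forall>m. s \<notin> J m))" for s
  proof (cases "\<exists>m. s \<in> J m")
    case True
    then obtain m where m: "s \<in> J m" by blast
    then have "t m < s" "s \<le> t (Suc m)" using J1(2)[of m] tau(1,2)[of m] by auto
    from c_eq[OF this] m show ?thesis by blast
  next
    case False
    then have "C (m, y m) s = 0" for m by (intro C(3)) simp
    then show ?thesis using False by (simp add: c_def)
  qed
  have c1: "c \<in> borel_measurable borel"
    unfolding c_def by (intro borel_measurable_suminf C(1))
  have B: "B \<ge> 0" using M \<delta> D_pos b by (simp add: B_def)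
  have c2: "norm (c s) \<le> B" for s using c_cases[of s] Cb B by auto
  have c3: "Q (c s) = c s" for s
    using c_cases[of s] C(2) linear_0[OF bounded_linear.linear[OF Q_linear]] by auto
  have c4: "c s = 0" if "s \<notin> E" for s using c_cases[of s] that by (auto simp: J_def)
  have c0: "c s = 0" if "s \<le> t 0 \<or> Ts \<le> s" for s
  proof -
    have "s \<notin> J m" for m
      using that t_mono[of 0 m] tau[of m] by (auto simp: J_def)
    then show ?thesis using c_cases[of s] by auto
  qed
  \<comment> \<open>The trajectory from time 0. It agrees with \<open>y m\<close> at the times
    \<open>t m\<close>, so continuity gives \<open>Y Ts = 0\<close>, and after \<open>Ts\<close> the
    control is off.\<close>
  define Y where "Y r = semigroup r y0 + duhamel c 0 r" for r
  have t0: "0 \<le> t m" for m using tau(5)[of m] Ts by linarith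
  have Y_step: "Y r' = semigroup (r' - r) (Y r) + duhamel c r r'" if "0 \<le> r" "r \<le> r'" for r r'
    unfolding Y_def using duhamel_split[OF c1 c2 that] semigroup_add[of "r' - r" r y0] that
      linear_add[OF bounded_linear.linear[OF bounded_linear_semigroup]] by simp
  have Yt: "Y (t m) = y m" for m
  proof (induction m)
    case 0
    have "duhamel c 0 (t 0) = 0" by (intro duhamel_zero c0) simp
    then show ?case by (simp add: Y_def y_0)
  next
    case (Suc m)
    have "duhamel c (t m) (t (Suc m)) = duhamel (C (m, y m)) (t m) (t (Suc m))"
      by (intro duhamel_cong c_eq) auto
    then show ?case using Y_step[OF t0, of m "t (Suc m)"] tau(1,2)[of m] by (simp add: Suc.IH y_Suc)
  qed
  have "(\<lambda>m. norm (y m)) \<longlonglongrightarrow> 0"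
  proof (rule Lim_null_comparison)
    show "\<forall>\<^sub>F m in sequentially. norm (norm (y m)) \<le> M / (2 * D * b) * (1 / 3) ^ m"
    proof (rule always_eventually, rule allI)
      fix m
      have p: "2 * D * b * 3 ^ m > 0" using D_pos b by simp
      have "2 * D * b * 3 ^ m \<le> exp (2 * D * b * 3 ^ m)" using exp_ge_add_one_self[of "2 * D * b * 3 ^ m"] by linarith
      then have "exp (- 2 * D * b * 3 ^ m) \<le> 1 / (2 * D * b * 3 ^ m)"
        using p by (simp add: exp_minus field_simps)
      then have "M * exp (- 2 * D * b * 3 ^ m) \<le> M * (1 / (2 * D * b * 3 ^ m))" by (intro mult_left_mono M)
      with decay[of m] show "norm (norm (y m)) \<le> M / (2 * D * b) * (1 / 3) ^ m" by (simp add: power_divide)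
    qed
    show "(\<lambda>m. M / (2 * D * b) * (1 / 3) ^ m) \<longlonglongrightarrow> 0"
      by (intro tendsto_mult_right_zero LIMSEQ_power_zero) simp
  qed
  then have y_lim: "y \<longlonglongrightarrow> 0" by (simp add: tendsto_norm_zero_iff)
  have "(\<lambda>m. (1 / 2 :: real) ^ m) \<longlonglongrightarrow> 0" by (intro LIMSEQ_power_zero) simp
  from tendsto_diff[OF tendsto_const tendsto_mult[OF tendsto_const this], of Ts \<delta>]
  have t_lim: "t \<longlonglongrightarrow> Ts" by (simp add: t_def[abs_def] power_divide)
  have "continuous_on {0..Ts} Y"
    unfolding Y_def by (intro continuous_on_add continuous_on_subset[OF continuous_semigroup] continuous_duhamel[OF c1 c2]) simp
  moreover have "Ts \<in> {0..Ts}" "\<And>m. t m \<in> {0..Ts}" using Ts \<delta> t0 tau(4) by (auto simp: less_imp_le)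
  ultimately have "(\<lambda>m. Y (t m)) \<longlonglongrightarrow> Y Ts"
    using t_lim by (intro continuous_on_tendsto_compose[of "{0..Ts}" Y]) auto
  then have "Y Ts = 0" unfolding Yt using y_lim LIMSEQ_unique by blast
  moreover have "duhamel c Ts T = 0" by (intro duhamel_zero c0) simp
  moreover have "Y T = semigroup (T - Ts) (Y Ts) + duhamel c Ts T" using Ts \<delta> by (intro Y_step) auto
  ultimately have "Y T = 0" using linear_0[OF bounded_linear.linear[OF bounded_linear_semigroup]] by simp
  then show thesis using that[OF c1 c2 c3 c4] by (simp add: Y_def)
qed

end

section \<open>Realisation of the control as a function\<close>

lemma L2_class_indicator_continuous: "continuous_on UNIV (\<lambda>x. L2_class (indicat_real {..x}))"
  unfolding continuous_on_sequentially o_def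
proof (intro allI ballI impI, elim conjE)
  fix X :: "nat \<Rightarrow> real" and x assume X: "X \<longlonglongrightarrow> x"
  show "(\<lambda>n. L2_class (indicat_real {..X n})) \<longlonglongrightarrow> L2_class (indicat_real {..x})"
  proof (rule L2_dominated_convergence(3)[where h = "\<lambda>_. 1"])
    have "AE s in lebesgue. s \<notin> {x}" by (intro AE_not_in) simp
    then show "AE s in unit_leb. (\<lambda>n. indicat_real {..X n} s) \<longlonglongrightarrow> indicat_real {..x} s"
    proof (intro AE_unit_lebI, eventually_elim)
      case (elim s)
      have "\<forall>\<^sub>F n in sequentially. indicat_real {..X n} s = indicat_real {..x} s"
      proof (cases "s < x")
        case True
        from order_tendstoD(1)[OF X this] show ?thesis by eventually_elim (use True in \<open>auto simp: indicator_def\<close>)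
      next
        case False
        then have "x < s" using elim by simp
        from order_tendstoD(2)[OF X this] show ?thesis by eventually_elim (use \<open>x < s\<close> in \<open>auto simp: indicator_def\<close>)
      qed
      then show ?case by (auto intro: tendsto_eventually)
    qed
    show "AE s in unit_leb. \<bar>indicat_real {..X n} s\<bar> \<le> 1" for n by (simp add: indicator_def)
  qed (auto intro!: L2_fun_const measurable_indicator_unit_leb)
qed

text \<open>An element of \<open>L\<^sup>2(0,1)\<close> has no values. The limits of difference quotients of its indefinite integral select a representative
  that depends on the element and the point in a jointly measurable way, so that an \<open>L\<^sup>2\<close>-valued control becomes a measurable function of \<open>(x, t)\<close>.\<close>

definition diff_val :: "L2 \<Rightarrow> nat \<Rightarrow> real \<Rightarrow> real" where
  "diff_val u n x = inner u (L2_class (indicat_real {..x + 1 / Suc n}) - L2_class (indicat_real {..x})) * Suc n"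

definition val :: "L2 \<Rightarrow> real \<Rightarrow> real" where "val u x = lim (\<lambda>n. diff_val u n x)"

lemma val_zero: "val 0 x = 0"
  by (simp add: val_def diff_val_def)

lemma val_class:
  assumes g: "L2_fun g" shows "AE x in unit_leb. val (L2_class g) x = g x"
  using indefinite_integral_has_derivative[OF L2_fun_integrable[OF g]]
proof eventually_elim
  case (elim x)
  let ?W = "\<lambda>x. \<integral>s. g s * indicator {..x} s \<partial>unit_leb"
  have W: "inner (L2_class g) (L2_class (indicat_real {..y})) = ?W y" for y
    by (rule L2_class_inner[OF g L2_fun_indicator]) simp
  have "(\<lambda>h. (?W (x + h) - ?W x) / h) \<midarrow>0\<rightarrow> g x" using elim by (simp add: DERIV_def)
  moreover have "filterlim (\<lambda>n. 1 / real (Suc n)) (at 0) sequentially"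
    unfolding filterlim_at using LIMSEQ_inverse_real_of_nat by (simp add: inverse_eq_divide)
  ultimately have "(\<lambda>n. (?W (x + 1 / real (Suc n)) - ?W x) / (1 / real (Suc n))) \<longlonglongrightarrow> g x"
    by (rule filterlim_compose)
  then have "(\<lambda>n. diff_val (L2_class g) n x) \<longlonglongrightarrow> g x"
    unfolding diff_val_def inner_diff_right W by simp
  then show ?case unfolding val_def by (rule limI)
qed

lemma val: "L2_fun (val u)" "L2_class (val u) = u"
proof -
  obtain g where g: "L2_fun g" "u = L2_class g" by (rule L2_class_cases)
  have ae: "AE x in unit_leb. g x = val u x" using val_class[OF g(1)] unfolding g(2) by eventually_elim simp
  have m: "val u \<in> borel_measurable unit_leb" by (rule AE_unit_leb_cong_measurable[OF L2_fun_measurable[OF g(1)] ae])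
  have "integrable unit_leb (\<lambda>x. (val u x)\<^sup>2)"
  proof (rule integrable_cong_AE_imp[OF L2_fun_integrable_sq[OF g(1)]])
    show "(\<lambda>x. (val u x)\<^sup>2) \<in> borel_measurable unit_leb" using m by (rule borel_measurable_power)
    show "AE x in unit_leb. (g x)\<^sup>2 = (val u x)\<^sup>2" using ae by eventually_elim simp
  qed
  then have v: "L2_fun (val u)" using m by (simp add: L2_fun_def)
  have "L2_class (val u) = L2_class g"
    by (rule L2_class_cong_AE[OF v g(1)]) (use ae in eventually_elim, simp)
  with v g(2) show "L2_fun (val u)" "L2_class (val u) = u" by simp_all
qed

lemma val_measurable:
  assumes c: "c \<in> borel_measurable borel"
  shows "(\<lambda>p. val (c (snd p)) (fst p)) \<in> borel_measurable (borel :: (real \<times> real) measure)"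
proof -
  have c': "(\<lambda>p. c (snd p)) \<in> borel_measurable (borel :: (real \<times> real) measure)"
    by (rule measurable_compose[OF _ c]) (intro borel_measurable_continuous_onI continuous_intros)
  have "(\<lambda>p. diff_val (c (snd p)) n (fst p)) \<in> borel_measurable (borel :: (real \<times> real) measure)" for n
    unfolding diff_val_def
    by (intro borel_measurable_times borel_measurable_inner c' borel_measurable_const
        borel_measurable_continuous_onI continuous_intros continuous_on_compose2[OF L2_class_indicator_continuous]) auto
  then show ?thesis unfolding val_def by (rule borel_measurable_lim_metric)
qed

lemma nn_integral_val:
  assumes A: "A \<subseteq> {0<..<1}"
  shows "(\<integral>\<^sup>+x. ennreal (indicator A x * (val u x)\<^sup>2) \<partial>lborel) \<le> ennreal ((norm u)\<^sup>2)"
proof -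
  have "(\<integral>\<^sup>+x. ennreal (indicator A x * (val u x)\<^sup>2) \<partial>lborel) = (\<integral>\<^sup>+x. ennreal (indicator A x * (val u x)\<^sup>2) \<partial>lebesgue)"
    by (rule nn_integral_completion[symmetric])
  also have "\<dots> \<le> (\<integral>\<^sup>+x. ennreal ((val u x)\<^sup>2) * indicator {0<..<1} x \<partial>lebesgue)"
    using A by (intro nn_integral_mono) (auto simp: indicator_def)
  also have "\<dots> = (\<integral>\<^sup>+x. ennreal ((val u x)\<^sup>2) \<partial>unit_leb)"
    by (subst nn_integral_restrict_space) auto
  also have "\<dots> = ennreal (\<integral>x. (val u x)\<^sup>2 \<partial>unit_leb)"
    by (rule nn_integral_eq_integral[OF L2_fun_integrable_sq[OF val(1)]]) simp
  also have "(\<integral>x. (val u x)\<^sup>2 \<partial>unit_leb) = (norm u)\<^sup>2"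
    using L2_class_norm[OF val(1), of u] by (simp add: val(2))
  finally show ?thesis .
qed

lemma times_sets_lebesgue:
  fixes A B :: "real set"
  assumes A: "A \<in> sets borel" and B: "B \<in> sets lebesgue"
  shows "A \<times> B \<in> sets (lebesgue :: (real \<times> real) measure)"
proof -
  from B obtain S N N' where 1: "B = S \<union> N" "N \<subseteq> N'" "N' \<in> null_sets lborel" "S \<in> sets lborel"
    by (rule sets_completionE)
  have "A \<times> N' \<in> null_sets (lborel \<Otimes>\<^sub>M lborel)"
    using A 1(3) by (intro lborel.times_in_null_sets2) auto
  then have n: "A \<times> N' \<in> null_sets lborel" unfolding lborel_prod .
  have "A \<times> S \<in> sets (lborel \<Otimes>\<^sub>M lborel)" using A 1(4) by (intro pair_measureI) auto
  then have s: "A \<times> S \<in> sets lborel" unfolding lborel_prod .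
  show ?thesis by (rule sets_completionI[of _ "A \<times> S" "A \<times> N", OF _ _ n s]) (use 1 in auto)
qed

text \<open>Reading off values with \<open>val\<close> gives a Borel function of both variables. For
  each time its square integral over \<omega> is at most M^2, so Tonelli bounds the total by M^2
  times the length of (0,T). The invariance under \<open>restr\<close> makes the indicator of
  \<omega> in \<open>control\<close> harmless.\<close>

lemma control_realisation:
  assumes \<omega>: "\<omega> \<in> sets borel" "\<omega> \<subseteq> {0<..<1}" and E: "E \<in> sets lebesgue" and E': "E' \<in> sets borel" "E' \<subseteq> E" "E' \<subseteq> {0<..<T}"
    and c: "c \<in> borel_measurable borel" "\<And>s. norm (c s) \<le> M" "\<And>s. restr \<omega> (c s) = c s" "\<And>s. s \<notin> E' \<Longrightarrow> c s = 0"
  obtains f where "L2_on (\<omega> \<times> E) f" "control \<omega> E f = c"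
proof -
  define f where "f p = val (c (snd p)) (fst p)" for p :: "real \<times> real"
  have f: "f \<in> borel_measurable borel" unfolding f_def by (rule val_measurable[OF c(1)])
  have "L2_on (\<omega> \<times> E) f"
    unfolding L2_on_def
  proof
    show "f \<in> borel_measurable (lebesgue_on (\<omega> \<times> E))"
      using f by (intro measurable_restrict_space1 measurable_completion) simp
    \<comment> \<open>The Borel set \<open>E'\<close> stands in for the merely Lebesgue measurable
      \<open>E\<close>, so that Tonelli applies to the Borel product. Multiplied with the square of
      \<open>f\<close> both indicators give the same, because \<open>c\<close> vanishes off
      \<open>E'\<close>.\<close>
    define g where "g p = indicator \<omega> (fst p) * indicator E' (snd p) * (f p)\<^sup>2" for p
    have g: "g \<in> borel_measurable (lborel \<Otimes>\<^sub>M lborel)"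
    proof -
      have "(\<lambda>p. indicator \<omega> (fst p) :: real) \<in> borel_measurable (lborel \<Otimes>\<^sub>M lborel)" "(\<lambda>p. indicator E' (snd p) :: real) \<in> borel_measurable (lborel \<Otimes>\<^sub>M lborel)"
        using \<omega> E' by measurable
      moreover have "f \<in> borel_measurable (lborel \<Otimes>\<^sub>M lborel)" unfolding lborel_prod using f by simp
      ultimately show ?thesis unfolding g_def by (intro borel_measurable_times borel_measurable_power)
    qed
    have "(\<integral>\<^sup>+p. ennreal (norm (g p)) \<partial>(lborel \<Otimes>\<^sub>M lborel)) = (\<integral>\<^sup>+s. \<integral>\<^sup>+x. ennreal (norm (g (x, s))) \<partial>lborel \<partial>lborel)"
      using g by (intro lborel_pair.nn_integral_snd[symmetric]) simp
    also have "\<dots> \<le> (\<integral>\<^sup>+s. ennreal (M\<^sup>2) * indicator {0<..<T} s \<partial>lborel)"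
    proof (rule nn_integral_mono)
      fix s :: real
      show "(\<integral>\<^sup>+x. ennreal (norm (g (x, s))) \<partial>lborel) \<le> ennreal (M\<^sup>2) * indicator {0<..<T} s"
      proof (cases "s \<in> E'")
        case True
        then have "(\<integral>\<^sup>+x. ennreal (norm (g (x, s))) \<partial>lborel) = (\<integral>\<^sup>+x. ennreal (indicator \<omega> x * (val (c s) x)\<^sup>2) \<partial>lborel)"
          by (simp add: g_def f_def)
        also have "\<dots> \<le> ennreal ((norm (c s))\<^sup>2)" by (rule nn_integral_val[OF \<omega>(2)])
        also have "\<dots> \<le> ennreal (M\<^sup>2)" using c(2)[of s] by (intro ennreal_leI power_mono) auto
        finally show ?thesis using True E'(3) by (auto simp: indicator_def)
      qed (simp add: g_def)
    qed
    also have "\<dots> < \<infinity>" using emeasure_bounded_finite[of "{0<..<T}"]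
      by (simp add: nn_integral_cmult_indicator ennreal_mult_less_top)
    finally have "integrable (lborel \<Otimes>\<^sub>M lborel) g" using g by (intro integrableI_bounded)
    then have "integrable lebesgue g" using g unfolding lborel_prod by (simp add: integrable_completion)
    moreover have "g = (\<lambda>p. indicat_real (\<omega> \<times> E) p *\<^sub>R (f p)\<^sup>2)"
    proof
      fix p
      show "g p = indicat_real (\<omega> \<times> E) p *\<^sub>R (f p)\<^sup>2"
        using E'(2) c(4)[of "snd p"] by (cases p) (auto simp: g_def f_def indicator_def val_zero)
    qed
    ultimately have "integrable lebesgue (\<lambda>p. indicat_real (\<omega> \<times> E) p *\<^sub>R (f p)\<^sup>2)" by (simp only:)
    then show "integrable (lebesgue_on (\<omega> \<times> E)) (\<lambda>p. (f p)\<^sup>2)"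
      using times_sets_lebesgue[OF \<omega>(1) E] by (simp add: integrable_restrict_space)
  qed
  moreover have "control \<omega> E f = c"
  proof
    fix s
    show "control \<omega> E f s = c s"
    proof (cases "s \<in> E")
      case True
      then have "control \<omega> E f s = L2_class (\<lambda>x. indicat_real \<omega> x * val (c s) x)"
        unfolding control_def f_def by (simp add: indicator_times)
      also have "\<dots> = restr \<omega> (L2_class (val (c s)))" using \<omega>(1) by (intro restr_class[symmetric] val(1)) simp
      also have "\<dots> = c s" by (simp add: val(2) c(3))
      finally show ?thesis .
    next
      case False
      then have "c s = 0" using E'(2) by (intro c(4)) auto
      with False show ?thesis by (simp add: control_def indicator_times L2_class_zero)
    qed
  qed
  ultimately show thesis by (rule that)
qed

text \<open>A Borel part of \<open>E\<close> of full measure takes its place. Its distribution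
  function has derivative 1 at some point of it, and difference quotients to the left that are
  within 1/8 of 1 are the claim.\<close>

lemma lebesgue_density_left:
  fixes E :: "real set"
  assumes E: "E \<in> sets lebesgue" "0 < emeasure lebesgue E" "E \<subseteq> {0<..<T}"
  obtains E' Ts \<delta> where "E' \<in> sets borel" "E' \<subseteq> E" "0 < \<delta>" "0 \<le> Ts - \<delta>" "Ts \<le> T"
    "\<And>s. Ts - \<delta> \<le> s \<Longrightarrow> s < Ts \<Longrightarrow> 7 / 8 * (Ts - s) \<le> measure lebesgue (E' \<inter> {s<..<Ts})"
proof -
  from E(1) obtain S N N' where 1: "E = S \<union> N" "N \<subseteq> N'" "N' \<in> null_sets lborel" "S \<in> sets lborel"
    by (rule sets_completionE)
  then have S: "S \<in> sets lebesgue" "S \<in> sets borel" by auto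
  have bS: "S \<inter> {a..b} \<in> lmeasurable" for a b
    using S by (intro bounded_set_imp_lmeasurable bounded_subset[OF bounded_closed_interval[of a b]]) auto
  have i: "indicat_real S integrable_on {a..b}" for a b
    using bS[of a b] unfolding lmeasurable_iff_integrable_on integrable_restrict_Int[of S, symmetric]
    by (rule integrable_eq) (simp add: indicator_def)
  have int: "integral {a..b} (indicat_real S) = measure lebesgue (S \<inter> {a<..<b})" for a b
  proof -
    have "measure lebesgue (S \<inter> {a<..<b}) = measure lebesgue (S \<inter> {a..b})"
      by (rule measure_negligible_symdiff[OF bS], rule negligible_subset[of "{a, b}"]) auto
    also have "\<dots> = integral UNIV (indicat_real (S \<inter> {a..b}))" using bS by (rule lmeasure_integral_UNIV)
    also have "indicat_real (S \<inter> {a..b}) = (\<lambda>x. if x \<in> {a..b} then indicat_real S x else 0)"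
      by (auto simp: indicator_def)
    also have "integral UNIV \<dots> = integral {a..b} (indicat_real S)" by (rule integral_restrict_UNIV)
    finally show ?thesis by simp
  qed
  have "\<not> (AE x in lebesgue. x \<notin> S)"
  proof
    assume "AE x in lebesgue. x \<notin> S"
    then have "S \<in> null_sets lebesgue" using S by (simp add: AE_iff_null_sets)
    moreover have "N' \<in> null_sets lebesgue" using 1 by (simp add: null_sets_completionI)
    ultimately have "S \<union> N' \<in> null_sets lebesgue" by (rule null_sets.Un)
    moreover have "emeasure lebesgue E \<le> emeasure lebesgue (S \<union> N')"
      using 1 calculation by (intro emeasure_mono) auto
    ultimately show False using E(2) by (simp add: null_sets_def)
  qed
  moreover have "AE x in lebesgue. \<forall>a<x. ((\<lambda>y. integral {a..y} (indicat_real S)) has_real_derivative indicat_real S x) (at x)"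
    by (rule lebesgue_differentiation[OF i])
  ultimately obtain x where x: "x \<in> S" "\<forall>a<x. ((\<lambda>y. integral {a..y} (indicat_real S)) has_real_derivative 1) (at x)"
  proof -
    have "\<exists>x. x \<in> S \<and> (\<forall>a<x. ((\<lambda>y. integral {a..y} (indicat_real S)) has_real_derivative 1) (at x))"
    proof (rule ccontr)
      assume n: "\<not> ?thesis"
      have "AE x in lebesgue. x \<notin> S"
        using \<open>AE x in lebesgue. \<forall>a<x. _ a x\<close> by eventually_elim (use n in auto)
      then show False using \<open>\<not> (AE x in lebesgue. x \<notin> S)\<close> by blast
    qed
    with that show thesis by blast
  qed
  have xT: "0 < x" "x < T" using x(1) 1(1) E(3) by auto
  let ?W = "\<lambda>y. integral {0..y} (indicat_real S)"
  have "(\<lambda>h. (?W (x + h) - ?W x) / h) \<midarrow>0\<rightarrow> 1" using x(2) xT by (simp add: DERIV_def)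
  then obtain d where d: "d > 0" "\<And>h. h \<noteq> 0 \<Longrightarrow> \<bar>h\<bar> < d \<Longrightarrow> \<bar>(?W (x + h) - ?W x) / h - 1\<bar> < 1 / 8"
    using LIM_D[of "\<lambda>h. (?W (x + h) - ?W x) / h" 1 0 "1 / 8"] by auto
  \<comment> \<open>Half of \<open>d\<close> keeps the increment strictly below \<open>d\<close>
    even at the left end, and \<open>x\<close> keeps the interval at nonnegative times.\<close>
  define \<delta> where "\<delta> = min (d / 2) x"
  show thesis
  proof (rule that[of S \<delta> x])
    show "S \<in> sets borel" "S \<subseteq> E" "0 < \<delta>" "0 \<le> x - \<delta>" "x \<le> T" using S 1 d xT by (auto simp: \<delta>_def)
    fix s assume s: "x - \<delta> \<le> s" "s < x"
    have s0: "0 \<le> s" "\<bar>s - x\<bar> < d" using s d(1) by (auto simp: \<delta>_def min_def split: if_splits)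
    have "\<bar>(?W s - ?W x) / (s - x) - 1\<bar> < 1 / 8" using d(2)[of "s - x"] s0 s by simp
    then have "7 / 8 \<le> (?W s - ?W x) / (s - x)" by linarith
    also have "\<dots> = (?W x - ?W s) / (x - s)" using s by (simp add: divide_simps) (simp add: algebra_simps)
    finally have "7 / 8 * (x - s) \<le> ?W x - ?W s" using s by (simp add: pos_le_divide_eq)
    also have "\<dots> = integral {s..x} (indicat_real S)"
      using Henstock_Kurzweil_Integration.integral_combine[OF s0(1) _ i, of x] s by simp
    finally show "7 / 8 * (x - s) \<le> measure lebesgue (S \<inter> {s<..<x})" unfolding int .
  qed
qed

lemma (in degenerate_basis) inner_resolvent_e: "inner (resolvent v) (e k) = inner v (e k) / lam k"
  by (simp add: selfadjoint_resolvent resolvent_e)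

text \<open>The definition of \<open>solution\<close> leaves the semigroup existentially quantified.
  The last clause rests on \<open>semigroup_unique\<close>: every admissible semigroup is the
  diagonal one at nonnegative times, so every solution has the same final value.\<close>

theorem theorem1p2:
  fixes \<alpha> T :: real and \<omega> E :: "real set" and y0 :: L2
  assumes "0 < \<alpha>" and "\<alpha> < 2"
    and "open \<omega>" and "\<omega> \<noteq> {}" and "\<omega> \<subseteq> {0<..<1}"
    and "0 < T"
    and "E \<in> sets lebesgue" and "E \<subseteq> {0<..<T}" and "0 < emeasure lebesgue E"
  shows "\<exists>f. L2_on (\<omega> \<times> E) f \<and>
           (\<exists>y. solution \<alpha> \<omega> E T y0 f y) \<and>
           (\<forall>y. solution \<alpha> \<omega> E T y0 f y \<longrightarrow> y T = 0)"
proof -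
  interpret degenerate \<alpha> by unfold_locales fact+
  obtain e :: "nat \<Rightarrow> L2" and lam nk where e: "hilbert_basis e" "\<And>k. lam k > 0" "filterlim lam at_top sequentially"
    "\<And>k. resolvent (e k) = (1 / lam k) *\<^sub>R e k" "\<And>k x. x \<in> {0<..<1} \<Longrightarrow> lam k * sol (e k) x = nk k * psi (lam k) x"
    "\<And>k. e k = L2_class (\<lambda>x. nk k * psi (lam k) x)"
    by (rule eigenbasis) blast
  interpret degenerate_basis \<alpha> e lam nk
    by (intro degenerate_basis.intro degenerate_basis_axioms.intro e) unfold_locales
  have \<omega>: "\<omega> \<in> sets borel" using assms(3) by simp
  then have \<omega>': "\<omega> \<in> sets lebesgue" by simp
  obtain p where p: "p \<in> \<omega>" using assms(4) by blast
  then obtain r where r: "r > 0" "cball p r \<subseteq> \<omega>" using assms(3) open_contains_cball by blast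
  have ab: "{p - r..p + r} \<subseteq> \<omega>" using r(2) by (simp add: cball_eq_atLeastAtMost)
  then have "p - r \<in> \<omega>" "p + r \<in> \<omega>" using r(1) by auto
  then have "0 < p - r" "p - r < p + r" "p + r < 1" using assms(5) r(1) by auto
  from spectral_inequality[OF this ab \<omega>'] obtain D :: real where D: "D > 0"
    "\<And>\<Lambda> A c. \<Lambda> \<ge> 1 \<Longrightarrow> finite A \<Longrightarrow> (\<And>k. k \<in> A \<Longrightarrow> lam k \<le> \<Lambda>) \<Longrightarrow>
      norm (\<Sum>k\<in>A. c k *\<^sub>R e k) \<le> exp (D * sqrt \<Lambda>) * norm (restr \<omega> (\<Sum>k\<in>A. c k *\<^sub>R e k))"
    by blast
  interpret observed_semigroup e lam "restr \<omega>" D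
    by (intro observed_semigroup.intro observed_semigroup_axioms.intro spectral_semigroup.intro spectral_semigroup_axioms.intro
        e(1-3) bounded_linear_restr[OF \<omega>'] restr_selfadjoint[OF \<omega>'] restr_idem[OF \<omega>'] D)
  obtain E' Ts \<delta> where E': "E' \<in> sets borel" "E' \<subseteq> E" "0 < \<delta>" "0 \<le> Ts - \<delta>" "Ts \<le> T"
    "\<And>s. Ts - \<delta> \<le> s \<Longrightarrow> s < Ts \<Longrightarrow> 7 / 8 * (Ts - s) \<le> measure lebesgue (E' \<inter> {s<..<Ts})"
    by (rule lebesgue_density_left[OF assms(7,9,8)]) blast
  obtain c M where c: "c \<in> borel_measurable borel" "\<And>s. norm (c s) \<le> M" "\<And>s. restr \<omega> (c s) = c s"
    "\<And>s. s \<notin> E' \<Longrightarrow> c s = 0" "semigroup T y0 + duhamel c 0 T = 0"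
    using null_control[OF E'(1,3-6), of y0] by blast
  obtain f where f: "L2_on (\<omega> \<times> E) f" "control \<omega> E f = c"
    using control_realisation[OF \<omega> assms(5,7) E'(1,2) order_trans[OF E'(2) assms(8)] c(1-4)] by blast
  have graph: "{(u, - v) | u v. (u, v) \<in> P_graph \<alpha>} = {(resolvent v, - v) | v. True}" unfolding P_graph_eq by blast
  have int: "set_integrable lebesgue {0..t} (\<lambda>s. semigroup (t - s) (c s))" for t
    by (rule duhamel_integrable[OF c(1,2)]) (auto simp: emeasure_lborel_Icc_eq)
  \<comment> \<open>\<open>solution\<close> integrates over the closed interval and
    \<open>duhamel\<close> over the half-open one; they differ by a null set.\<close>
  have duh: "(LINT s:{0..t}|lebesgue. semigroup (t - s) (c s)) = duhamel c 0 t" for t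
    unfolding duhamel_def set_lebesgue_integral_def
  proof (rule integral_cong_AE)
    show "(\<lambda>s. indicat_real {0..t} s *\<^sub>R semigroup (t - s) (c s)) \<in> borel_measurable lebesgue"
      using int unfolding set_integrable_def by (rule borel_measurable_integrable)
    have "set_integrable lebesgue {0<..t} (\<lambda>s. semigroup (t - s) (c s))"
      by (rule duhamel_integrable[OF c(1,2)]) (auto simp: emeasure_lborel_Ioc_eq)
    then show "(\<lambda>s. indicat_real {0<..t} s *\<^sub>R semigroup (t - s) (c s)) \<in> borel_measurable lebesgue"
      unfolding set_integrable_def by (rule borel_measurable_integrable)
    have "AE s in lebesgue. s \<notin> {0::real}" by (intro AE_not_in) simp
    then show "AE s in lebesgue. indicat_real {0..t} s *\<^sub>R semigroup (t - s) (c s) = indicat_real {0<..t} s *\<^sub>R semigroup (t - s) (c s)"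
      by eventually_elim (auto simp: indicator_def)
  qed
  have "P_semigroup \<alpha> semigroup"
    unfolding P_semigroup_def graph using C0_semigroup generator_semigroup[OF inner_resolvent_e] by simp
  moreover have "continuous_on {0..T} (\<lambda>t. semigroup t y0 + duhamel c 0 t)"
    by (intro continuous_on_add continuous_on_subset[OF continuous_semigroup] continuous_duhamel[OF c(1,2)]) simp
  ultimately have ex: "solution \<alpha> \<omega> E T y0 f (\<lambda>t. semigroup t y0 + duhamel c 0 t)"
    unfolding solution_def f(2) by (intro conjI exI[of _ semigroup] ballI) (simp_all add: int duh)
  have "y T = 0" if "solution \<alpha> \<omega> E T y0 f y" for y
  proof -
    from that obtain S where S: "P_semigroup \<alpha> S"
      "y T = S T y0 + (LINT s:{0..T}|lebesgue. S (T - s) (c s))"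
      using assms(6) unfolding solution_def f(2) by auto
    have eq: "S t u = semigroup t u" if "t \<ge> 0" for t u
      using S(1) unfolding P_semigroup_def graph by (intro semigroup_unique[OF _ _ inner_resolvent_e that]) auto
    have "(LINT s:{0..T}|lebesgue. S (T - s) (c s)) = (LINT s:{0..T}|lebesgue. semigroup (T - s) (c s))"
      by (rule set_lebesgue_integral_cong) (auto simp: eq)
    then show ?thesis using S(2) c(5) assms(6) by (simp add: eq duh)
  qed
  with f(1) ex show ?thesis by blast
qed

end
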